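(* In the setting of the context, assume that the ambient vector field $\mathbf{U}\in\mathbf{V}_0\cap\mathbf{H}^3(\mathcal{O})$ is divergence free. Then any weak solution $(p,\mathbf{u},w)\in L^2(\mathcal{O})\times\mathbf{V}_0\times H_0^2(\Omega)$ of the stationary fluid-structure problem (as defined in the context) is a triple of the form $(c,\mathbf{0},w_c)$, where $c$ is a constant and $w_c\in H_0^2(\Omega)$ solves the boundary value problem $$\Delta^2w=c\ \text{ in }\Omega,\qquad w=\nabla w=0\ \text{ on }\partial\Omega.$$
   Context: **Geometry.** $\mathcal{O}\subset\mathbb{R}^3$ is a bounded convex domain (hence with Lipschitz boundary), with unit outward normal $\mathbf{n}$. $\partial\mathcal{O}=\overline{S}\cup\overline{\Omega}$ with $S\cap\Omega=\emptyset$; $\Omega\subset\{x_3=0\}$ is flat, with Lipschitz boundary, and is identified with a domain in $\mathbb{R}^2$; $S\subset\{x_3\le 0\}$; $\mathbf{n}|_\Omega=(0,0,1)$. Constants: $\nu>0,\lambda\ge 0,\eta>0$. Functions are real-valued. **Notation.** $\mathbf{H}^s(\mathcal{O})=[H^s(\mathcal{O})]^3$; $(\cdot,\cdot)_D$ is the $L^2(D)$ inner product. $\epsilon_{ij}(\mathbf{u})=\frac12(\partial_{x_i}u_j+\partial_{x_j}u_i)$, $\sigma(\mathbf{u})=2\nu\,\epsilon(\mathbf{u})+\lambda\,\mathrm{div}(\mathbf{u})I_3$, $a_{\mathcal{O}}(\mathbf{u},\boldsymbol\psi)=(\sigma(\mathbf{u}),\epsilon(\boldsymbol\psi))_{\mathcal{O}}+\eta(\mathbf{u},\boldsymbol\psi)_{\mathcal{O}}$;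 $\mathbf{U}\cdot\nabla\mathbf{u}=(\mathbf{U}\cdot\nabla)\mathbf{u}$. $$\mathbf{V}_0=\{\mathbf{v}\in\mathbf{H}^1(\mathcal{O}):\mathbf{v}\cdot\mathbf{n}=0\text{ on }\partial\mathcal{O}\},\quad W_{\mathbf{U}}=\{q\in L^2(\mathcal{O}):\mathbf{U}\cdot\nabla q\in L^2(\mathcal{O})\},$$ $$\mathbf{V}_\Omega=\{\mathbf{v}=\mathbf{v}(\beta)\in\mathbf{H}^1(\mathcal{O}):\mathbf{v}\cdot\mathbf{n}=0\text{ on }S,\ \mathbf{v}\cdot\mathbf{n}=\beta\text{ on }\Omega\text{ with }\beta\in H_0^2(\Omega)\}.$$ **Weak stationary solution.** A triple $(p,\mathbf{u},w)\in L^2(\mathcal{O})\times\mathbf{V}_0\times H_0^2(\Omega)$ such that $$(\mathrm{div}\,\mathbf{u},q)_{\mathcal{O}}=\int_{\mathcal{O}}(\mathrm{div}\,\mathbf{U})\,pq\,dx+\int_{\mathcal{O}}(\mathbf{U}\cdot\nabla q)\,p\,dx\quad\text{for all }q\in W_{\mathbf{U}},$$ $$a_{\mathcal{O}}(\mathbf{u},\boldsymbol\psi)-(p,\mathrm{div}\,\boldsymbol\psi)_{\mathcal{O}}=-\int_{\mathcal{O}}(\mathbf{U}\cdot\nabla\mathbf{u})\cdot\boldsymbol\psi\,dx-(\Delta w,\Delta\beta)_\Omega\quad\text{for all }\boldsymbol\psi=\boldsymbol\psi(\beta)\in\mathbf{V}_\Omega .$$ (This is the weak form of: $\mathbf{U}\cdot\nabla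 p+\mathrm{div}\,\mathbf{u}=0$ and $\mathbf{U}\cdot\nabla\mathbf{u}-\mathrm{div}\,\sigma(\mathbf{u})+\eta\mathbf{u}+\nabla p=0$ in $\mathcal{O}$; $(\sigma(\mathbf{u})\mathbf{n}-p\mathbf{n})\cdot\boldsymbol\tau=0$ for tangential $\boldsymbol\tau$, and $\mathbf{u}\cdot\mathbf{n}=0$ on $\partial\mathcal{O}$; $\Delta^2w+[2\nu\partial_{x_3}(\mathbf{u})_3+\lambda\,\mathrm{div}(\mathbf{u})-p]_\Omega=0$ on $\Omega$, $w=\partial w/\partial\nu=0$ on $\partial\Omega$, to which it is equivalent.) *)

theory Defs
  imports "HOL-Analysis.Analysis"
begin

section \<open>Smooth functions and Sobolev spaces\<close>

definition partial :: "'n::finite \<Rightarrow> (real^'n \<Rightarrow> real) \<Rightarrow> real^'n \<Rightarrow> real" where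
  "partial i f x = frechet_derivative f (at x) (axis i 1)"

text \<open>Multi-indices are lists of coordinate directions.\<close>

definition partials :: "'n::finite list \<Rightarrow> (real^'n \<Rightarrow> real) \<Rightarrow> real^'n \<Rightarrow> real" where
  "partials \<alpha> f = foldr partial \<alpha> f"

definition smooth :: "(real^'n::finite \<Rightarrow> real) \<Rightarrow> bool" where
  "smooth f \<longleftrightarrow> (\<forall>\<alpha>. partials \<alpha> f differentiable_on UNIV)"

definition test_functions :: "(real^'n::finite) set \<Rightarrow> (real^'n \<Rightarrow> real) set" where
  "test_functions D = {\<phi>. smooth \<phi> \<and> compact (closure {x. \<phi> x \<noteq> 0}) \<and> closure {x. \<phi> x \<noteq> 0} \<subseteq> D}"

definition L2 :: "'a measure \<Rightarrow> ('a \<Rightarrow> real) set" where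
  "L2 M = {f. f \<in> borel_measurable M \<and> integrable M (\<lambda>x. (f x)\<^sup>2)}"

definition L2_inner ::
  "(real^'n::finite) set \<Rightarrow> (real^'n \<Rightarrow> 'b::real_inner) \<Rightarrow> (real^'n \<Rightarrow> 'b) \<Rightarrow> real" where
  "L2_inner D f g = (\<integral>x. f x \<bullet> g x \<partial>lebesgue_on D)"

definition locally_integrable :: "(real^'n::finite) set \<Rightarrow> (real^'n \<Rightarrow> real) \<Rightarrow> bool" where
  "locally_integrable D f \<longleftrightarrow> (\<forall>K. compact K \<and> K \<subseteq> D \<longrightarrow> integrable (lebesgue_on K) f)"

definition is_wderiv ::
  "(real^'n::finite) set \<Rightarrow> 'n list \<Rightarrow> (real^'n \<Rightarrow> real) \<Rightarrow> (real^'n \<Rightarrow> real) \<Rightarrow> bool" where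
  "is_wderiv D \<alpha> f g \<longleftrightarrow> locally_integrable D f \<and> locally_integrable D g \<and>
     (\<forall>\<phi>\<in>test_functions D.
        (\<integral>x. f x * partials \<alpha> \<phi> x \<partial>lebesgue_on D) = (-1) ^ length \<alpha> * (\<integral>x. g x * \<phi> x \<partial>lebesgue_on D))"

text \<open>Weak derivatives are unique up to null sets of \<open>D\<close> (for open \<open>D\<close>); \<open>wderiv\<close> picks
  a representative.\<close>

definition wderiv :: "(real^'n::finite) set \<Rightarrow> 'n list \<Rightarrow> (real^'n \<Rightarrow> real) \<Rightarrow> real^'n \<Rightarrow> real" where
  "wderiv D \<alpha> f = (SOME g. is_wderiv D \<alpha> f g)"

definition sobolev :: "nat \<Rightarrow> (real^'n::finite) set \<Rightarrow> (real^'n \<Rightarrow> real) set" where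
  "sobolev m D = {f \<in> L2 (lebesgue_on D).
     \<forall>\<alpha>. length \<alpha> \<le> m \<longrightarrow> (\<exists>g \<in> L2 (lebesgue_on D). is_wderiv D \<alpha> f g)}"

definition sobolev_norm :: "nat \<Rightarrow> (real^'n::finite) set \<Rightarrow> (real^'n \<Rightarrow> real) \<Rightarrow> real" where
  "sobolev_norm m D f =
     sqrt (\<Sum>\<alpha>\<in>{\<alpha>. length \<alpha> \<le> m}. \<integral>x. (wderiv D \<alpha> f x)\<^sup>2 \<partial>lebesgue_on D)"

definition vec_sobolev :: "nat \<Rightarrow> (real^'n::finite) set \<Rightarrow> (real^'n \<Rightarrow> real^'n) set" where
  "vec_sobolev m D = {v. \<forall>i. (\<lambda>x. v x $ i) \<in> sobolev m D}"

text \<open>\<open>H\<^sub>0\<^sup>m(D)\<close>: the closure of the test functions in \<open>H\<^sup>m(D)\<close>.\<close>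

definition sobolev0 :: "nat \<Rightarrow> (real^'n::finite) set \<Rightarrow> (real^'n \<Rightarrow> real) set" where
  "sobolev0 m D = {f \<in> sobolev m D. \<exists>\<phi>. (\<forall>k. \<phi> k \<in> test_functions D) \<and>
     (\<lambda>k::nat. sobolev_norm m D (\<lambda>x. \<phi> k x - f x)) \<longlonglongrightarrow> 0}"


section \<open>Surface measure and traces\<close>

text \<open>The \<open>s\<close>-dimensional Hausdorff measure, normalised so as to agree with Lebesgue measure on
  \<open>s\<close>-dimensional planes.  Covers with a member of infinite diameter are excluded explicitly because
  \<open>diameter\<close> is junk on unbounded sets; empty members are singled out for the sake of \<open>s = 0\<close>.\<close>

definition hausdorff_covers :: "real \<Rightarrow> 'a::metric_space set \<Rightarrow> (nat \<Rightarrow> 'a set) set" where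
  "hausdorff_covers \<delta> A = {E. A \<subseteq> (\<Union>i. E i) \<and> (\<forall>i. bounded (E i) \<and> diameter (E i) \<le> \<delta>)}"

definition hausdorff_weight :: "nat \<Rightarrow> 'a::metric_space set \<Rightarrow> ennreal" where
  "hausdorff_weight s E =
     (if E = {} then 0 else ennreal (unit_ball_vol (real s) * (diameter E / 2) ^ s))"

definition hausdorff_outer :: "nat \<Rightarrow> 'a::metric_space set \<Rightarrow> ennreal" where
  "hausdorff_outer s A =
     (SUP \<delta>\<in>{0<..}. INF E\<in>hausdorff_covers \<delta> A. \<Sum>i. hausdorff_weight s (E i))"

definition hausdorff_measure :: "nat \<Rightarrow> 'a::metric_space measure" where
  "hausdorff_measure s = measure_of UNIV (sets borel) (hausdorff_outer s)"

text \<open>\<open>measure_of\<close> yields the zero measure unless its last argument is countably additive, so we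
  check by Caratheodory's criterion that Hausdorff measure really is \<open>hausdorff_outer\<close> on Borel sets.\<close>

definition hausdorff_content :: "nat \<Rightarrow> real \<Rightarrow> 'a::metric_space set \<Rightarrow> ennreal" where
  "hausdorff_content s \<delta> A = (INF E\<in>hausdorff_covers \<delta> A. \<Sum>i. hausdorff_weight s (E i))"

lemma hausdorff_outer_content: "hausdorff_outer s A = (SUP \<delta>\<in>{0<..}. hausdorff_content s \<delta> A)"
  by (simp add: hausdorff_outer_def hausdorff_content_def)

lemma hausdorff_content_mono:
  "A \<subseteq> B \<Longrightarrow> hausdorff_content s \<delta> A \<le> hausdorff_content s \<delta> B"
  unfolding hausdorff_content_def by (rule INF_superset_mono) (auto simp: hausdorff_covers_def)

lemma hausdorff_content_antimono:
  "\<delta> \<le> \<delta>' \<Longrightarrow> hausdorff_content s \<delta>' A \<le> hausdorff_content s \<delta> A"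
  unfolding hausdorff_content_def
  by (rule INF_superset_mono) (auto simp: hausdorff_covers_def intro: order_trans)

lemma hausdorff_content_empty:
  assumes "\<delta> \<ge> 0" shows "hausdorff_content s \<delta> ({} :: 'a::metric_space set) = 0"
proof -
  have "(\<lambda>_. {}) \<in> hausdorff_covers \<delta> ({} :: 'a set)" using assms by (auto simp: hausdorff_covers_def)
  then have "hausdorff_content s \<delta> ({} :: 'a set) \<le> (\<Sum>i::nat. hausdorff_weight s ({}::'a set))"
    unfolding hausdorff_content_def by (rule INF_lower)
  then show ?thesis by (simp add: hausdorff_weight_def)
qed

lemma hausdorff_content_countable_subadditive:
  "hausdorff_content s \<delta> (\<Union>n. A n) \<le> (\<Sum>n. hausdorff_content s \<delta> (A n))"
proof (rule ennreal_le_epsilon)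
  fix e :: real
  assume e: "0 < e" and fin: "(\<Sum>n. hausdorff_content s \<delta> (A n)) < top"
  have "hausdorff_content s \<delta> (A n) < hausdorff_content s \<delta> (A n) + e * (1/2) ^ Suc n" for n
    using fin e by (auto simp add: less_top dest!: ennreal_suminf_lessD)
  then have "\<exists>E\<in>hausdorff_covers \<delta> (A n).
      (\<Sum>i. hausdorff_weight s (E i)) < hausdorff_content s \<delta> (A n) + e * (1/2) ^ Suc n" for n
    by (subst (asm) (1) hausdorff_content_def) (simp add: INF_less_iff)
  then obtain B where B: "\<And>n. B n \<in> hausdorff_covers \<delta> (A n)"
    and Ble: "\<And>n. (\<Sum>i. hausdorff_weight s (B n i)) < hausdorff_content s \<delta> (A n) + e * (1/2) ^ Suc n"
    by metis
  define C where "C = case_prod B \<circ> prod_decode"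
  have sub: "(\<Union>n. A n) \<subseteq> (\<Union>i. C i)"
  proof
    fix x assume "x \<in> (\<Union>n. A n)"
    then obtain n i where "x \<in> B n i" using B by (fastforce simp: hausdorff_covers_def)
    then have "x \<in> C (prod_encode (n, i))" by (simp add: C_def)
    then show "x \<in> (\<Union>i. C i)" by blast
  qed
  have "C \<in> hausdorff_covers \<delta> (\<Union>n. A n)"
    using B sub unfolding hausdorff_covers_def by (auto simp: C_def split_def)
  then have "hausdorff_content s \<delta> (\<Union>n. A n) \<le> (\<Sum>i. hausdorff_weight s (C i))"
    unfolding hausdorff_content_def by (rule INF_lower)
  also have "\<dots> = (\<Sum>n. \<Sum>i. hausdorff_weight s (B n i))"
    using suminf_ennreal_2dimen[of _ "\<lambda>p. hausdorff_weight s (case_prod B p)"]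
    by (simp add: C_def)
  also have "\<dots> \<le> (\<Sum>n. hausdorff_content s \<delta> (A n) + e * (1/2) ^ Suc n)"
    by (intro suminf_le summableI less_imp_le Ble)
  also have "... = (\<Sum>n. hausdorff_content s \<delta> (A n)) + (\<Sum>n. ennreal e * ennreal ((1/2) ^ Suc n))"
    using \<open>0 < e\<close> by (subst suminf_add[symmetric])
      (auto simp del: ennreal_suminf_cmult simp add: ennreal_mult[symmetric])
  also have "\<dots> = (\<Sum>n. hausdorff_content s \<delta> (A n)) + e"
    unfolding ennreal_suminf_cmult
    by (subst suminf_ennreal_eq[OF zero_le_power power_half_series]) auto
  finally show "hausdorff_content s \<delta> (\<Union>n. A n) \<le> (\<Sum>n. hausdorff_content s \<delta> (A n)) + e" .
qed

lemma hausdorff_outer_mono: "A \<subseteq> B \<Longrightarrow> hausdorff_outer s A \<le> hausdorff_outer s B"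
  unfolding hausdorff_outer_content by (intro SUP_mono' hausdorff_content_mono)

lemma hausdorff_outer_empty [simp]: "hausdorff_outer s ({} :: 'a::metric_space set) = 0"
proof -
  have "hausdorff_outer s ({} :: 'a set) \<le> 0"
    unfolding hausdorff_outer_content by (rule SUP_least) (auto simp: hausdorff_content_empty)
  then show ?thesis by simp
qed

lemma hausdorff_outer_countable_subadditive:
  "hausdorff_outer s (\<Union>n. A n) \<le> (\<Sum>n. hausdorff_outer s (A n))"
  unfolding hausdorff_outer_content[of s "\<Union>n. A n"]
proof (rule SUP_least)
  fix \<delta> :: real assume "\<delta> \<in> {0<..}"
  then have "(\<Sum>n. hausdorff_content s \<delta> (A n)) \<le> (\<Sum>n. hausdorff_outer s (A n))"
    unfolding hausdorff_outer_content by (intro suminf_le summableI SUP_upper)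
  then show "hausdorff_content s \<delta> (\<Union>n. A n) \<le> (\<Sum>n. hausdorff_outer s (A n))"
    using hausdorff_content_countable_subadditive order_trans by blast
qed

lemma hausdorff_outer_Un: "hausdorff_outer s (A \<union> B) \<le> hausdorff_outer s A + hausdorff_outer s B"
proof -
  have "(\<Sum>n. hausdorff_outer s (binaryset A B n)) = hausdorff_outer s A + hausdorff_outer s B"
    by (rule suminf_binaryset_eq) simp
  then show ?thesis
    using hausdorff_outer_countable_subadditive[of s "binaryset A B"] by (simp add: UN_binaryset_eq)
qed

lemma hausdorff_outer_metric:
  assumes e: "0 < e" and sep: "\<And>x y. x \<in> A \<Longrightarrow> y \<in> B \<Longrightarrow> e \<le> dist x y"
  shows "hausdorff_outer s A + hausdorff_outer s B \<le> hausdorff_outer s (A \<union> B)"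
proof -
  have small: "hausdorff_content s \<delta> A + hausdorff_content s \<delta> B \<le> hausdorff_content s \<delta> (A \<union> B)"
    if \<delta>: "0 < \<delta>" "\<delta> < e" for \<delta>
    unfolding hausdorff_content_def[of s \<delta> "A \<union> B"]
  proof (rule INF_greatest)
    fix E assume E: "E \<in> hausdorff_covers \<delta> (A \<union> B)"
    then have bd: "bounded (E i)" "diameter (E i) \<le> \<delta>" for i by (auto simp: hausdorff_covers_def)
    have disj: "E i \<inter> A = {} \<or> E i \<inter> B = {}" for i
    proof (rule ccontr)
      assume "\<not> ?thesis"
      then obtain x y where xy: "x \<in> E i" "x \<in> A" "y \<in> E i" "y \<in> B" by blast
      have "dist x y \<le> \<delta>" using diameter_bounded_bound[OF bd(1) xy(1,3)] bd(2)[of i] by linarith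
      with sep[OF xy(2,4)] \<delta> show False by linarith
    qed
    have cov: "(\<lambda>i. E i \<inter> X) \<in> hausdorff_covers \<delta> X" if "X \<subseteq> A \<union> B" for X
      using E that bd diameter_subset[of "E _ \<inter> X" "E _"]
      by (fastforce simp: hausdorff_covers_def intro: bounded_subset order_trans)
    have wmono: "hausdorff_weight s (E i \<inter> X) \<le> hausdorff_weight s (E i)" for i X
    proof -
      have "diameter (E i \<inter> X) \<le> diameter (E i)" by (rule diameter_subset[OF _ bd(1)]) simp
      moreover have "0 \<le> diameter (E i \<inter> X)"
        by (rule diameter_ge_0) (use bd(1)[of i] in \<open>auto intro: bounded_subset\<close>)
      ultimately show ?thesis
        by (auto simp: hausdorff_weight_def intro!: ennreal_leI mult_left_mono power_mono)
    qed
    have w: "hausdorff_weight s (E i \<inter> A) + hausdorff_weight s (E i \<inter> B) \<le> hausdorff_weight s (E i)" for i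
      using disj[of i] wmono[of i A] wmono[of i B] by (auto simp: hausdorff_weight_def[of s "{}"])
    have "hausdorff_content s \<delta> A + hausdorff_content s \<delta> B
        \<le> (\<Sum>i. hausdorff_weight s (E i \<inter> A)) + (\<Sum>i. hausdorff_weight s (E i \<inter> B))"
      unfolding hausdorff_content_def by (intro add_mono INF_lower cov) auto
    also have "\<dots> = (\<Sum>i. hausdorff_weight s (E i \<inter> A) + hausdorff_weight s (E i \<inter> B))"
      by (rule suminf_add) auto
    also have "\<dots> \<le> (\<Sum>i. hausdorff_weight s (E i))"
      by (intro suminf_le summableI w)
    finally show "hausdorff_content s \<delta> A + hausdorff_content s \<delta> B \<le> (\<Sum>i. hausdorff_weight s (E i))" .
  qed
  have two: "hausdorff_content s \<delta>1 A + hausdorff_content s \<delta>2 B \<le> hausdorff_outer s (A \<union> B)"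
    if "\<delta>1 > 0" "\<delta>2 > 0" for \<delta>1 \<delta>2
  proof -
    define \<delta> where "\<delta> = min (min \<delta>1 \<delta>2) (e/2)"
    have d: "0 < \<delta>" "\<delta> < e" "\<delta> \<le> \<delta>1" "\<delta> \<le> \<delta>2" using that e by (auto simp: \<delta>_def)
    have "hausdorff_content s \<delta>1 A + hausdorff_content s \<delta>2 B
        \<le> hausdorff_content s \<delta> A + hausdorff_content s \<delta> B"
      by (intro add_mono hausdorff_content_antimono d)
    also have "\<dots> \<le> hausdorff_content s \<delta> (A \<union> B)" by (rule small[OF d(1,2)])
    also have "\<dots> \<le> hausdorff_outer s (A \<union> B)"
      unfolding hausdorff_outer_content by (rule SUP_upper) (simp add: d)
    finally show ?thesis .
  qed
  have "hausdorff_outer s A + hausdorff_outer s B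
      = (SUP \<delta>1\<in>{0<..}. SUP \<delta>2\<in>{0<..}. hausdorff_content s \<delta>1 A + hausdorff_content s \<delta>2 B)"
    unfolding hausdorff_outer_content
    by (simp add: ennreal_SUP_add_left[symmetric] ennreal_SUP_add_right[symmetric])
  also have "\<dots> \<le> hausdorff_outer s (A \<union> B)"
    by (intro SUP_least two) auto
  finally show ?thesis .
qed

lemma hausdorff_outer_closed:
  fixes C T :: "'a::metric_space set"
  assumes C: "closed C"
  shows "hausdorff_outer s (T \<inter> C) + hausdorff_outer s (T - C) \<le> hausdorff_outer s T"
proof (cases "C = {} \<or> hausdorff_outer s T = top")
  case True
  then show ?thesis by (auto simp: top.extremum_unique)
next
  case False
  then have Cne: "C \<noteq> {}" and fin: "hausdorff_outer s T < top" by (auto simp: less_top)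
  define B where "B k = {x \<in> T. 1 / real (Suc k) \<le> infdist x C}" for k
  define R where "R k = B (Suc k) - B k" for k
  have BT: "B k \<subseteq> T - C" for k
    by (auto simp: B_def)
  have incB: "B j \<subseteq> B k" if "j \<le> k" for j k
  proof -
    have "1 / real (Suc k) \<le> 1 / real (Suc j)" using that by (simp add: frac_le)
    then show ?thesis by (auto simp: B_def)
  qed
  have gap: "0 < 1 / real (Suc j) - 1 / real (Suc (Suc j))" for j
    by (simp add: field_simps add_pos_nonneg)
  have step: "hausdorff_outer s (B j) + hausdorff_outer s (R (Suc j)) \<le> hausdorff_outer s (B (Suc (Suc j)))" for j
  proof -
    have "hausdorff_outer s (B j) + hausdorff_outer s (R (Suc j)) \<le> hausdorff_outer s (B j \<union> R (Suc j))"
    proof (rule hausdorff_outer_metric[OF gap[of j]])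
      fix x y assume "x \<in> B j" "y \<in> R (Suc j)"
      then have "1 / real (Suc j) \<le> infdist x C" "infdist y C < 1 / real (Suc (Suc j))"
        by (auto simp: B_def R_def)
      moreover have "infdist x C \<le> infdist y C + dist x y" by (rule infdist_triangle)
      ultimately show "1 / real (Suc j) - 1 / real (Suc (Suc j)) \<le> dist x y" by linarith
    qed
    also have "\<dots> \<le> hausdorff_outer s (B (Suc (Suc j)))"
      by (rule hausdorff_outer_mono) (use incB[of j "Suc (Suc j)"] in \<open>auto simp: R_def\<close>)
    finally show ?thesis .
  qed
  have sums: "(\<Sum>i<n. hausdorff_outer s (R (2 * i + a + 1))) \<le> hausdorff_outer s (B (2 * n + a))" for n a
  proof (induction n)
    case 0
    show ?case by simp
  next
    case (Suc n)
    have "(\<Sum>i<Suc n. hausdorff_outer s (R (2 * i + a + 1)))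
        \<le> hausdorff_outer s (B (2 * n + a)) + hausdorff_outer s (R (Suc (2 * n + a)))"
      using Suc by (simp add: add_right_mono)
    also have "\<dots> \<le> hausdorff_outer s (B (2 * Suc n + a))"
      using step[of "2 * n + a"] by simp
    finally show ?case .
  qed
  define r where "r k = hausdorff_outer s (R (Suc k))" for k
  have BleT: "hausdorff_outer s (B k) \<le> hausdorff_outer s T" for k
    using BT[of k] by (intro hausdorff_outer_mono) auto
  have split2: "(\<Sum>k<2 * n. r k) = (\<Sum>i<n. r (2 * i)) + (\<Sum>i<n. r (2 * i + 1))" for n
    by (induction n) (auto simp: algebra_simps)
  have partial: "(\<Sum>k<n. r k) \<le> hausdorff_outer s T + hausdorff_outer s T" for n
  proof -
    have "(\<Sum>k<n. r k) \<le> (\<Sum>k<2 * n. r k)" by (rule sum_mono2) auto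
    also have "\<dots> \<le> hausdorff_outer s T + hausdorff_outer s T"
      using order_trans[OF sums[where n = n and a = 0] BleT]
        order_trans[OF sums[where n = n and a = 1] BleT]
      unfolding split2 by (intro add_mono) (simp_all add: r_def)
    finally show ?thesis .
  qed
  have "suminf r \<le> hausdorff_outer s T + hausdorff_outer s T"
    by (intro suminf_le_const summableI partial)
  then have rfin: "suminf r < top"
    using fin by (simp add: le_less_trans)
  show ?thesis
  proof (rule ennreal_le_epsilon)
    fix e :: real assume e: "0 < e"
    have "\<exists>k. suminf r < (\<Sum>i<k. r i) + e"
    proof (rule ccontr)
      assume "\<not> ?thesis"
      then have le: "(\<Sum>i<k. r i) + e \<le> suminf r" for k by (simp add: not_less)
      have "suminf r + e = (SUP k. (\<Sum>i<k. r i) + e)"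
        by (subst suminf_eq_SUP) (simp add: ennreal_SUP_add_left)
      also have "\<dots> \<le> suminf r" by (intro SUP_least le)
      finally show False using rfin e
        using ennreal_add_left_cancel_le[of "suminf r" "ennreal e" 0] by auto
    qed
    then obtain k where k: "suminf r < (\<Sum>i<k. r i) + e" ..
    have "suminf r = (\<Sum>i<k. r i) + (\<Sum>i. r (i + k))"
      using suminf_offset[of r k] by simp
    moreover have "(\<Sum>i<k. r i) < top"
      using rfin sum_le_suminf[of r "{..<k}"] by (simp add: le_less_trans)
    ultimately have tail: "(\<Sum>i. r (i + k)) \<le> e"
      using k by (simp add: ennreal_add_left_cancel_less less_imp_le)
    have cov: "T - C \<subseteq> B (Suc k) \<union> (\<Union>i. R (Suc (i + k)))"
    proof
      fix x assume x: "x \<in> T - C"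
      then have "0 < infdist x C"
        using C Cne by (metis DiffD2 in_closed_iff_infdist_zero infdist_nonneg order_le_less)
      then obtain n where "1 / real (Suc n) < infdist x C" using nat_approx_posE by auto
      then have ex: "\<exists>n. x \<in> B n" using x by (auto simp: B_def intro: less_imp_le)
      define m where "m = (LEAST n. x \<in> B n)"
      have m: "x \<in> B m" "\<And>j. j < m \<Longrightarrow> x \<notin> B j"
        unfolding m_def using ex by (auto intro: LeastI_ex dest: not_less_Least)
      show "x \<in> B (Suc k) \<union> (\<Union>i. R (Suc (i + k)))"
      proof (cases "m \<le> Suc k")
        case True
        then show ?thesis using m(1) incB by blast
      next
        case False
        then obtain i where "m = Suc (Suc (i + k))"
          by (auto simp: not_le less_iff_Suc_add add.commute)
        then have "x \<in> R (Suc (i + k))" using m by (auto simp: R_def)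
        then show ?thesis by blast
      qed
    qed
    have "hausdorff_outer s (T - C) \<le> hausdorff_outer s (B (Suc k) \<union> (\<Union>i. R (Suc (i + k))))"
      by (rule hausdorff_outer_mono[OF cov])
    also have "\<dots> \<le> hausdorff_outer s (B (Suc k)) + hausdorff_outer s (\<Union>i. R (Suc (i + k)))"
      by (rule hausdorff_outer_Un)
    also have "\<dots> \<le> hausdorff_outer s (B (Suc k)) + e"
      using order_trans[OF hausdorff_outer_countable_subadditive[of s "\<lambda>i. R (Suc (i + k))"]] tail
      by (intro add_left_mono) (simp add: r_def)
    finally have "hausdorff_outer s (T \<inter> C) + hausdorff_outer s (T - C)
        \<le> (hausdorff_outer s (T \<inter> C) + hausdorff_outer s (B (Suc k))) + e"
      by (simp add: add_left_mono add.assoc)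
    also have "hausdorff_outer s (T \<inter> C) + hausdorff_outer s (B (Suc k))
        \<le> hausdorff_outer s (T \<inter> C \<union> B (Suc k))"
    proof (rule hausdorff_outer_metric)
      show "0 < 1 / real (Suc (Suc k))" by simp
      fix x y assume "x \<in> T \<inter> C" "y \<in> B (Suc k)"
      then have "1 / real (Suc (Suc k)) \<le> infdist y C" "infdist y C \<le> dist y x"
        by (auto simp: B_def intro: infdist_le)
      then show "1 / real (Suc (Suc k)) \<le> dist x y" by (simp add: dist_commute)
    qed
    also have "\<dots> \<le> hausdorff_outer s T"
      by (rule hausdorff_outer_mono) (use BT[of "Suc k"] in auto)
    finally show "hausdorff_outer s (T \<inter> C) + hausdorff_outer s (T - C) \<le> hausdorff_outer s T + e"
      by (simp add: add_right_mono)
  qed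
qed

lemma emeasure_hausdorff_measure:
  fixes A :: "'a::metric_space set"
  assumes "A \<in> sets borel"
  shows "emeasure (hausdorff_measure s) A = hausdorff_outer s A"
proof -
  let ?f = "hausdorff_outer s :: 'a set \<Rightarrow> ennreal"
  interpret P: sigma_algebra "UNIV :: 'a set" "Pow UNIV" by (rule sigma_algebra_Pow)
  have oms: "outer_measure_space (Pow UNIV) ?f"
    unfolding outer_measure_space_def positive_def increasing_def countably_subadditive_def
    by (auto intro: hausdorff_outer_mono hausdorff_outer_countable_subadditive)
  let ?L = "lambda_system UNIV (Pow UNIV) ?f"
  have L: "measure_space UNIV ?L ?f" by (rule P.caratheodory_lemma[OF oms])
  then have sL: "sigma_algebra UNIV ?L" by (simp add: measure_space_def)
  have "C \<in> ?L" if "closed C" for C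
  proof -
    have "hausdorff_outer s (T \<inter> C) + hausdorff_outer s (T - C) = hausdorff_outer s T" for T
      using hausdorff_outer_closed[OF that, of s T] hausdorff_outer_Un[of s "T \<inter> C" "T - C"]
      by (simp add: antisym Int_Diff_Un)
    then show ?thesis unfolding P.lambda_system_eq by simp
  qed
  then have "sigma_sets UNIV (Collect closed) \<subseteq> ?L"
    by (intro sigma_algebra.sigma_sets_subset[OF sL]) auto
  then have "sets borel \<subseteq> ?L" by (simp add: borel_eq_closed)
  then have "measure_space UNIV (sets borel) ?f"
    using measure_down[OF L] sets.sigma_algebra_axioms[of "borel :: 'a measure"] by auto
  then show ?thesis
    unfolding hausdorff_measure_def
    by (intro emeasure_measure_of_sigma)
       (use assms sets.sigma_algebra_axioms[of "borel :: 'a measure"] in \<open>auto simp: measure_space_def\<close>)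
qed

definition surface :: "(real^'n::finite) set \<Rightarrow> (real^'n) measure" where
  "surface D = restrict_space (hausdorff_measure (CARD('n) - 1)) (frontier D)"

text \<open>\<open>g\<close> is the trace of \<open>f \<in> H\<^sup>1(D)\<close> on the boundary: the image of \<open>f\<close> under the continuous
  extension to \<open>H\<^sup>1(D)\<close> of the restriction map \<open>\<phi> \<mapsto> \<phi>|\<^sub>\<partial>\<^sub>D\<close> into \<open>L\<^sup>2(\<partial>D)\<close>, defined on
  the (for Lipschitz \<open>D\<close> dense) restrictions of smooth functions.\<close>

definition has_trace :: "(real^'n::finite) set \<Rightarrow> (real^'n \<Rightarrow> real) \<Rightarrow> (real^'n \<Rightarrow> real) \<Rightarrow> bool" where
  "has_trace D f g \<longleftrightarrow> f \<in> sobolev 1 D \<and> g \<in> L2 (surface D) \<and>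
     (\<exists>\<phi> :: nat \<Rightarrow> real^'n \<Rightarrow> real. (\<forall>k. smooth (\<phi> k)) \<and>
        (\<lambda>k. sobolev_norm 1 D (\<lambda>x. \<phi> k x - f x)) \<longlonglongrightarrow> 0 \<and>
        (\<lambda>k. \<integral>x. (\<phi> k x - g x)\<^sup>2 \<partial>surface D) \<longlonglongrightarrow> 0)"

text \<open>At almost every boundary point of a convex open set \<open>D\<close>, the outward unit normal is the only
  unit vector that spans an outward supporting half-space; elsewhere the value is arbitrary.\<close>

definition outward_normal :: "(real^'n::finite) set \<Rightarrow> real^'n \<Rightarrow> real^'n" where
  "outward_normal D x = (THE n. norm n = 1 \<and> (\<forall>y\<in>D. n \<bullet> (y - x) \<le> 0))"

text \<open>\<open>v \<cdot> n = b\<close> on the part \<open>\<Gamma>\<close> of the boundary of the convex set \<open>D\<close>, in the sense of traces.\<close>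

definition normal_trace_on ::
  "(real^'n::finite) set \<Rightarrow> (real^'n) set \<Rightarrow> (real^'n \<Rightarrow> real^'n) \<Rightarrow> (real^'n \<Rightarrow> real) \<Rightarrow> bool" where
  "normal_trace_on D \<Gamma> v b \<longleftrightarrow>
     (\<exists>g :: real^'n \<Rightarrow> real^'n. (\<forall>i. has_trace D (\<lambda>x. v x $ i) (\<lambda>x. g x $ i)) \<and>
        (AE x in surface D. x \<in> \<Gamma> \<longrightarrow> g x \<bullet> outward_normal D x = b x))"


section \<open>Geometry\<close>

definition lipschitz_boundary :: "(real^'n::finite) set \<Rightarrow> bool" where
  "lipschitz_boundary D \<longleftrightarrow>
     (\<forall>x\<in>frontier D. \<exists>r>0. \<exists>e. \<exists>h :: real^'n \<Rightarrow> real. \<exists>L. norm e = 1 \<and> L-lipschitz_on UNIV h \<and>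
        D \<inter> ball x r = {y \<in> ball x r. y \<bullet> e > h (y - (y \<bullet> e) *\<^sub>R e)})"

definition lift :: "real^2 \<Rightarrow> real^3" where
  "lift y = vector [y $ 1, y $ 2, 0]"

definition proj :: "real^3 \<Rightarrow> real^2" where
  "proj x = vector [x $ 1, x $ 2]"

definition fluid_structure_geometry :: "(real^3) set \<Rightarrow> (real^3) set \<Rightarrow> (real^2) set \<Rightarrow> bool" where
  "fluid_structure_geometry \<O> S \<Omega> \<longleftrightarrow>
     open \<O> \<and> convex \<O> \<and> bounded \<O> \<and> \<O> \<noteq> {} \<and>
     open \<Omega> \<and> connected \<Omega> \<and> \<Omega> \<noteq> {} \<and> lipschitz_boundary \<Omega> \<and>
     frontier \<O> = closure S \<union> closure (lift ` \<Omega>) \<and> S \<inter> lift ` \<Omega> = {} \<and>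
     S \<subseteq> {x. x $ 3 \<le> 0} \<and>
     (\<forall>x\<in>lift ` \<Omega>. outward_normal \<O> x = vector [0, 0, 1])"


section \<open>The stationary fluid-structure problem\<close>

definition wdiv :: "(real^'n::finite) set \<Rightarrow> (real^'n \<Rightarrow> real^'n) \<Rightarrow> real^'n \<Rightarrow> real" where
  "wdiv D v x = (\<Sum>i\<in>UNIV. wderiv D [i] (\<lambda>y. v y $ i) x)"

definition wlaplacian :: "(real^'n::finite) set \<Rightarrow> (real^'n \<Rightarrow> real) \<Rightarrow> real^'n \<Rightarrow> real" where
  "wlaplacian D f x = (\<Sum>i\<in>UNIV. wderiv D [i, i] f x)"

definition strain :: "(real^'n::finite) set \<Rightarrow> (real^'n \<Rightarrow> real^'n) \<Rightarrow> real^'n \<Rightarrow> real^'n^'n" where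
  "strain D v x =
     (\<chi> i j. (wderiv D [i] (\<lambda>y. v y $ j) x + wderiv D [j] (\<lambda>y. v y $ i) x) / 2)"

definition stress ::
  "real \<Rightarrow> real \<Rightarrow> (real^'n::finite) set \<Rightarrow> (real^'n \<Rightarrow> real^'n) \<Rightarrow> real^'n \<Rightarrow> real^'n^'n" where
  "stress \<nu> lam D v x = (2 * \<nu>) *\<^sub>R strain D v x + (lam * wdiv D v x) *\<^sub>R mat 1"

definition bilinear_a ::
  "real \<Rightarrow> real \<Rightarrow> real \<Rightarrow> (real^'n::finite) set \<Rightarrow>
     (real^'n \<Rightarrow> real^'n) \<Rightarrow> (real^'n \<Rightarrow> real^'n) \<Rightarrow> real" where
  "bilinear_a \<nu> lam \<eta> D v \<psi> = L2_inner D (stress \<nu> lam D v) (strain D \<psi>) + \<eta> * L2_inner D v \<psi>"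

definition convection ::
  "(real^'n::finite) set \<Rightarrow> (real^'n \<Rightarrow> real^'n) \<Rightarrow> (real^'n \<Rightarrow> real^'n) \<Rightarrow> real^'n \<Rightarrow> real^'n" where
  "convection D U v x = (\<chi> j. \<Sum>i\<in>UNIV. U x $ i * wderiv D [i] (\<lambda>y. v y $ j) x)"

text \<open>For \<open>q\<close> merely in \<open>L\<^sup>2\<close>, \<open>U \<cdot> \<nabla>q\<close> is the distribution \<open>\<phi> \<mapsto> -\<integral> q div (\<phi> U)\<close>; \<open>transport\<close> is
  its density if it has one in \<open>L\<^sup>2\<close>.\<close>

definition is_transport ::
  "(real^'n::finite) set \<Rightarrow> (real^'n \<Rightarrow> real^'n) \<Rightarrow> (real^'n \<Rightarrow> real) \<Rightarrow> (real^'n \<Rightarrow> real) \<Rightarrow> bool" where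
  "is_transport D U q r \<longleftrightarrow> r \<in> L2 (lebesgue_on D) \<and>
     (\<forall>\<phi>\<in>test_functions D. (\<integral>x. r x * \<phi> x \<partial>lebesgue_on D) =
        - (\<integral>x. q x * ((\<Sum>i\<in>UNIV. U x $ i * partial i \<phi> x) + wdiv D U x * \<phi> x) \<partial>lebesgue_on D))"

definition transport ::
  "(real^'n::finite) set \<Rightarrow> (real^'n \<Rightarrow> real^'n) \<Rightarrow> (real^'n \<Rightarrow> real) \<Rightarrow> real^'n \<Rightarrow> real" where
  "transport D U q = (SOME r. is_transport D U q r)"

definition W_space :: "(real^'n::finite) set \<Rightarrow> (real^'n \<Rightarrow> real^'n) \<Rightarrow> (real^'n \<Rightarrow> real) set" where
  "W_space D U = {q \<in> L2 (lebesgue_on D). \<exists>r. is_transport D U q r}"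

definition V0 :: "(real^3) set \<Rightarrow> (real^3 \<Rightarrow> real^3) set" where
  "V0 \<O> = {v \<in> vec_sobolev 1 \<O>. normal_trace_on \<O> (frontier \<O>) v (\<lambda>_. 0)}"

text \<open>The fields \<open>v = v(\<beta>)\<close> for a given \<open>\<beta>\<close>; \<open>V\<^sub>\<Omega>\<close> is the union of these sets over
  \<open>\<beta> \<in> H\<^sub>0\<^sup>2(\<Omega>)\<close>.\<close>

definition V_Omega :: "(real^3) set \<Rightarrow> (real^3) set \<Rightarrow> (real^2) set \<Rightarrow> (real^2 \<Rightarrow> real) \<Rightarrow>
    (real^3 \<Rightarrow> real^3) set" where
  "V_Omega \<O> S \<Omega> \<beta> = {v \<in> vec_sobolev 1 \<O>.
     normal_trace_on \<O> S v (\<lambda>_. 0) \<and> normal_trace_on \<O> (lift ` \<Omega>) v (\<lambda>x. \<beta> (proj x))}"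

definition weak_stationary_solution ::
  "(real^3) set \<Rightarrow> (real^3) set \<Rightarrow> (real^2) set \<Rightarrow> real \<Rightarrow> real \<Rightarrow> real \<Rightarrow> (real^3 \<Rightarrow> real^3) \<Rightarrow>
     (real^3 \<Rightarrow> real) \<Rightarrow> (real^3 \<Rightarrow> real^3) \<Rightarrow> (real^2 \<Rightarrow> real) \<Rightarrow> bool" where
  "weak_stationary_solution \<O> S \<Omega> \<nu> lam \<eta> U p u w \<longleftrightarrow>
     p \<in> L2 (lebesgue_on \<O>) \<and> u \<in> V0 \<O> \<and> w \<in> sobolev0 2 \<Omega> \<and>
     (\<forall>q\<in>W_space \<O> U. L2_inner \<O> (wdiv \<O> u) q =
        (\<integral>x. wdiv \<O> U x * p x * q x \<partial>lebesgue_on \<O>) + (\<integral>x. transport \<O> U q x * p x \<partial>lebesgue_on \<O>)) \<and>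
     (\<forall>\<beta>\<in>sobolev0 2 \<Omega>. \<forall>\<psi>\<in>V_Omega \<O> S \<Omega> \<beta>.
        bilinear_a \<nu> lam \<eta> \<O> u \<psi> - L2_inner \<O> p (wdiv \<O> \<psi>) =
        - L2_inner \<O> (convection \<O> U u) \<psi> - L2_inner \<Omega> (wlaplacian \<Omega> w) (wlaplacian \<Omega> \<beta>))"

definition laplacian :: "(real^'n::finite \<Rightarrow> real) \<Rightarrow> real^'n \<Rightarrow> real" where
  "laplacian f x = (\<Sum>i\<in>UNIV. partials [i, i] f x)"

text \<open>\<open>\<Delta>\<^sup>2w = c\<close> in the sense of distributions, \<open>w = \<nabla>w = 0\<close> in the sense of traces.\<close>

definition clamped_plate_solution :: "(real^2) set \<Rightarrow> real \<Rightarrow> (real^2 \<Rightarrow> real) \<Rightarrow> bool" where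
  "clamped_plate_solution \<Omega> c w \<longleftrightarrow>
     (\<forall>\<phi>\<in>test_functions \<Omega>. (\<integral>x. w x * laplacian (laplacian \<phi>) x \<partial>lebesgue_on \<Omega>) =
        (\<integral>x. c * \<phi> x \<partial>lebesgue_on \<Omega>)) \<and>
     has_trace \<Omega> w (\<lambda>_. 0) \<and> (\<forall>i. has_trace \<Omega> (wderiv \<Omega> [i] w) (\<lambda>_. 0))"

end

theory Submission
  imports Defs
begin

text \<open>Testing the mass equation with test functions shows \<open>U \<cdot> \<nabla>p = - div u\<close>, so \<open>p\<close> itself is
  admissible and \<open>(p, div u) = 0\<close>.  As \<open>U\<close> is divergence free and tangential, \<open>(U \<cdot> \<nabla>u, u) = 0\<close>.
  Testing the momentum equation with \<open>u\<close> therefore leaves \<open>a(u, u) = 0\<close>, hence \<open>u = 0\<close>, and the momentum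
  equation becomes \<open>(p, div \<psi>) = (\<Delta>w, \<Delta>\<beta>)\<close>.  With \<open>\<beta> = 0\<close> it makes \<open>p\<close> a constant \<open>c\<close>; with
  \<open>\<beta>\<close> a test function, extended to a field \<open>\<psi>\<close> below the plate, it reads \<open>c \<integral>\<beta> = (\<Delta>w, \<Delta>\<beta>)\<close>.

  The analytic core is that a field \<open>U\<close> with vanishing normal trace satisfies \<open>\<integral>\<zeta> div U + U \<cdot> \<nabla>\<zeta> = 0\<close>
  for all \<open>\<zeta>\<close> of class \<open>C\<^sup>1\<close>.  Instead of the divergence theorem it suffices to bound \<open>\<integral>div F\<close> by a
  multiple of \<open>\<integral>\<bar>F \<cdot> n\<bar>\<close> over the boundary.  To this end \<open>F\<close> is cut off by a function of the gauge of the convex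
  domain, whose gradient is a.e. a multiple of the normal at the radial projection, and thin layers below a piece
  of the boundary are covered by balls, which bounds their volume by their thickness times the Hausdorff
  measure of the piece.\<close>

subsection \<open>Calculus of smooth functions\<close>

text \<open>The normal trace of \<open>U\<close> is known only through smooth fields F_k whose
  boundary values converge in L2 to a field t with t . n = 0. Then |F_k . n| = |(F_k - t) . n| has
  small integral over the boundary, so a bound of the integral of div F_k by the flux passes to the
  limit with any fixed constant. Hence surface measure is never computed exactly: layer volumes need
  only be estimated from above. The gauge suits the cut-off because it is convex, Lipschitz and a
  supremum of linear functionals. Where its partial derivatives exist, the maximising functional is
  unique, and so is the supporting normal at the radial projection, which is what the definite
  description in \<open>outward_normal\<close> asks for. Existence of these derivatives almost
  everywhere and the vanishing of their integrals both come from translation invariance of Lebesgue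
  measure. Default values need care: a non-integrable function has integral 0, and
  \<open>wderiv\<close> and \<open>transport\<close> are arbitrary choices, determined up to null
  sets by the fundamental lemma.\<close>

lemma differentiable_on_UNIV_iff: "f differentiable_on UNIV \<longleftrightarrow> (\<forall>x. f differentiable (at x))"
  by (simp add: differentiable_on_def)

lemma partial_eqI:
  assumes "(f has_derivative f') (at x)"
  shows "partial i f x = f' (axis i 1)"
  using frechet_derivative_at[OF assms] by (simp add: partial_def)

lemma has_derivative_partial:
  fixes f :: "real^'n::finite \<Rightarrow> real"
  assumes "f differentiable (at x)"
  shows "(f has_derivative (\<lambda>h. \<Sum>i\<in>UNIV. partial i f x * h $ i)) (at x)"
proof -
  let ?D = "frechet_derivative f (at x)"
  have D: "(f has_derivative ?D) (at x)" using assms frechet_derivative_works by blast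
  then have lin: "linear ?D" by (simp add: has_derivative_linear)
  have "?D h = (\<Sum>i\<in>UNIV. partial i f x * h $ i)" for h
  proof -
    have "?D h = ?D (\<Sum>i\<in>UNIV. h $ i *s axis i 1)" by (simp add: basis_expansion)
    also have "\<dots> = (\<Sum>i\<in>UNIV. h $ i * ?D (axis i 1))"
      by (simp add: linear_sum[OF lin] scalar_mult_eq_scaleR linear_scale[OF lin])
    finally show ?thesis by (simp add: partial_def mult.commute)
  qed
  then have "?D = (\<lambda>h. \<Sum>i\<in>UNIV. partial i f x * h $ i)" by blast
  with D show ?thesis by simp
qed

lemma partial_const [simp]: "partial i (\<lambda>x. c) = (\<lambda>x. 0)"
  by (rule ext) (rule partial_eqI[where f'="\<lambda>h. 0", simplified], simp)

lemma partial_add: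
  assumes "f differentiable (at x)" "g differentiable (at x)"
  shows "partial i (\<lambda>x. f x + g x) x = partial i f x + partial i g x"
  using partial_eqI[OF has_derivative_add[OF has_derivative_partial[OF assms(1)] has_derivative_partial[OF assms(2)]]]
  by (simp add: axis_def sum.distrib if_distrib sum.delta cong: if_cong)

lemma partial_mult:
  assumes "f differentiable (at x)" "g differentiable (at x)"
  shows "partial i (\<lambda>x. f x * g x) x = f x * partial i g x + partial i f x * g x"
  using partial_eqI[OF has_derivative_mult[OF has_derivative_partial[OF assms(1)] has_derivative_partial[OF assms(2)]]]
  by (simp add: axis_def if_distrib sum.delta cong: if_cong)

lemma partial_component: "partial i (\<lambda>x. x $ j) = (\<lambda>x::real^'n::finite. if i = j then 1 else 0)"
proof
  fix x :: "real^'n"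
  have "((\<lambda>x::real^'n. x $ j) has_derivative (\<lambda>h. h $ j)) (at x)"
    by (intro bounded_linear_imp_has_derivative bounded_linear_vec_nth)
  from partial_eqI[OF this] show "partial i (\<lambda>x. x $ j) x = (if i = j then 1 else 0)"
    by (simp add: axis_def)
qed

lemma partial_compose_real:
  assumes "f differentiable (at x)" "(h has_real_derivative h') (at (f x))"
  shows "partial i (\<lambda>x. h (f x)) x = h' * partial i f x"
    and "(\<lambda>x. h (f x)) differentiable (at x)"
proof -
  have "(h has_derivative (*) h') (at (f x))" using assms(2) by (simp add: has_field_derivative_def)
  from has_derivative_compose[OF has_derivative_partial[OF assms(1)] this]
  have D: "((\<lambda>x. h (f x)) has_derivative (\<lambda>k. h' * (\<Sum>i\<in>UNIV. partial i f x * k $ i))) (at x)" .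
  then show "(\<lambda>x. h (f x)) differentiable (at x)" by (auto simp: differentiable_def)
  show "partial i (\<lambda>x. h (f x)) x = h' * partial i f x"
    using partial_eqI[OF D] by (simp add: axis_def if_distrib sum.delta cong: if_cong)
qed

lemma partial_compose_affine:
  fixes f :: "real^'n::finite \<Rightarrow> real" and L :: "real^'m::finite \<Rightarrow> real^'n"
  assumes "\<And>x. f differentiable (at x)" "linear L"
  shows "partial i (\<lambda>x. f (L x + b)) = (\<lambda>x. \<Sum>j\<in>UNIV. partial j f (L x + b) * L (axis i 1) $ j)"
    and "(\<lambda>x. f (L x + b)) differentiable (at x)"
proof -
  have T: "((\<lambda>x. L x + b) has_derivative L) (at x)" for x
    using linear_imp_has_derivative[OF assms(2)] by (auto intro!: derivative_eq_intros)
  have D: "((\<lambda>x. f (L x + b)) has_derivative (\<lambda>k. \<Sum>j\<in>UNIV. partial j f (L x + b) * L k $ j)) (at x)" for x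
    using has_derivative_compose[OF T has_derivative_partial[OF assms(1)]] .
  show "partial i (\<lambda>x. f (L x + b)) = (\<lambda>x. \<Sum>j\<in>UNIV. partial j f (L x + b) * L (axis i 1) $ j)"
    using partial_eqI[OF D] by blast
  show "(\<lambda>x. f (L x + b)) differentiable (at x)" using D differentiable_def by blast
qed

lemma partials_Nil [simp]: "partials [] f = f"
  and partials_Cons: "partials (i # \<alpha>) f = partial i (partials \<alpha> f)"
  and partials_append: "partials (\<alpha> @ \<beta>) f = partials \<alpha> (partials \<beta> f)"
  by (simp_all add: partials_def)

text \<open>Closure of smooth functions under products and composition needs an induction on the
  order of differentiation, while \<open>smooth\<close> speaks of all multi-indices at once. The
  recursion removes the innermost derivative, to which the product and chain rules apply.\<close>

fun Ck :: "nat \<Rightarrow> (real^'n::finite \<Rightarrow> real) \<Rightarrow> bool" where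
  "Ck 0 f \<longleftrightarrow> f differentiable_on UNIV"
| "Ck (Suc k) f \<longleftrightarrow> f differentiable_on UNIV \<and> (\<forall>i. Ck k (partial i f))"

lemma Ck_iff_partials: "Ck k f \<longleftrightarrow> (\<forall>\<alpha>. length \<alpha> \<le> k \<longrightarrow> partials \<alpha> f differentiable_on UNIV)"
proof (induction k arbitrary: f)
  case (Suc k)
  show ?case
  proof (intro iffI allI impI)
    fix \<alpha> :: "'a list" assume c: "Ck (Suc k) f" and l: "length \<alpha> \<le> Suc k"
    show "partials \<alpha> f differentiable_on UNIV"
    \<comment> \<open>\<open>partials\<close> applies the last letter of the list first, and
      \<open>Ck\<close> removes the innermost derivative, so the list is split at its end.\<close>
    proof (cases \<alpha> rule: rev_cases)
      case (snoc \<beta> i)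
      then show ?thesis using c l by (simp add: Suc partials_append partials_Cons)
    qed (use c in simp)
  next
    assume a: "\<forall>\<alpha>. length \<alpha> \<le> Suc k \<longrightarrow> partials \<alpha> f differentiable_on UNIV"
    have "partials \<alpha> (partial i f) differentiable_on UNIV" if "length \<alpha> \<le> k" for \<alpha> i
      using a[rule_format, of "\<alpha> @ [i]"] that by (simp add: partials_append partials_Cons)
    then show "Ck (Suc k) f" using a[rule_format, of "[]"] by (simp add: Suc)
  qed
qed auto

lemma smooth_iff_Ck: "smooth f \<longleftrightarrow> (\<forall>k. Ck k f)"
  unfolding smooth_def Ck_iff_partials by auto

lemma Ck_differentiable: "Ck k f \<Longrightarrow> f differentiable (at x)"
  by (cases k) (auto simp: differentiable_on_UNIV_iff)

lemma Ck_SucD: "Ck (Suc k) f \<Longrightarrow> Ck k f"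
  by (induction k arbitrary: f) auto

lemma Ck_const [simp]: "Ck k (\<lambda>x. c)"
  by (induction k arbitrary: c) auto

lemma Ck_add: "Ck k f \<Longrightarrow> Ck k g \<Longrightarrow> Ck k (\<lambda>x. f x + g x)"
proof (induction k arbitrary: f g)
  case (Suc k)
  have "partial i (\<lambda>x. f x + g x) = (\<lambda>x. partial i f x + partial i g x)" for i
    by (rule ext, rule partial_add) (use Suc.prems Ck_differentiable in blast)+
  then show ?case using Suc by (auto intro!: differentiable_on_add)
qed (auto intro!: differentiable_on_add)

lemma Ck_mult: "Ck k f \<Longrightarrow> Ck k g \<Longrightarrow> Ck k (\<lambda>x. f x * g x)"
proof (induction k arbitrary: f g)
  case (Suc k)
  have "partial i (\<lambda>x. f x * g x) = (\<lambda>x. f x * partial i g x + partial i f x * g x)" for i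
    by (rule ext, rule partial_mult) (use Suc.prems Ck_differentiable in blast)+
  moreover have "Ck k f" "Ck k g" using Suc.prems Ck_SucD by blast+
  ultimately show ?case using Suc by (auto intro!: differentiable_on_mult Ck_add)
qed (auto intro!: differentiable_on_mult)

lemma Ck_sum: "(\<And>i. i \<in> I \<Longrightarrow> Ck k (f i)) \<Longrightarrow> Ck k (\<lambda>x. \<Sum>i\<in>I. f i x)"
  by (induction I rule: infinite_finite_induct) (auto intro: Ck_add)

lemma Ck_component: "Ck k (\<lambda>x. x $ j)"
proof -
  have "(\<lambda>x. x $ j) differentiable_on UNIV"
    by (auto simp: differentiable_on_UNIV_iff bounded_linear_imp_differentiable bounded_linear_vec_nth)
  then show ?thesis by (cases k) (simp_all add: partial_component)
qed

lemma Ck_compose_affine: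
  fixes f :: "real^'n::finite \<Rightarrow> real" and L :: "real^'m::finite \<Rightarrow> real^'n"
  assumes L: "linear L"
  shows "Ck k f \<Longrightarrow> Ck k (\<lambda>x. f (L x + b))"
proof (induction k arbitrary: f)
  case 0
  then show ?case using partial_compose_affine(2)[OF Ck_differentiable[of 0 f] L]
    by (simp add: differentiable_on_UNIV_iff)
next
  case (Suc k)
  note d = Ck_differentiable[OF Suc.prems]
  show ?case
    using Suc partial_compose_affine(2)[OF d L]
    by (auto simp: partial_compose_affine(1)[OF d L] differentiable_on_UNIV_iff intro!: Ck_sum Ck_mult)
qed

lemma smooth_differentiable: "smooth f \<Longrightarrow> f differentiable (at x)"
  using Ck_differentiable[of 0 f] by (simp add: smooth_iff_Ck)

lemma smooth_partial: "smooth f \<Longrightarrow> smooth (partial i f)"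
  by (simp add: smooth_iff_Ck) (metis Ck.simps(2))

lemma smooth_partials: "smooth f \<Longrightarrow> smooth (partials \<alpha> f)"
  by (induction \<alpha>) (auto simp: partials_Cons intro: smooth_partial)

lemma smooth_continuous_on: "smooth f \<Longrightarrow> continuous_on S f"
  by (meson continuous_at_imp_continuous_on differentiable_imp_continuous_within smooth_differentiable)

lemma smooth_const [simp]: "smooth (\<lambda>x. c)"
  and smooth_add: "smooth f \<Longrightarrow> smooth g \<Longrightarrow> smooth (\<lambda>x. f x + g x)"
  and smooth_mult: "smooth f \<Longrightarrow> smooth g \<Longrightarrow> smooth (\<lambda>x. f x * g x)"
  and smooth_component: "smooth (\<lambda>x. x $ j)"
  by (simp_all add: smooth_iff_Ck Ck_add Ck_mult Ck_component)

lemma smooth_sum: "(\<And>i. i \<in> I \<Longrightarrow> smooth (f i)) \<Longrightarrow> smooth (\<lambda>x. \<Sum>i\<in>I. f i x)"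
  by (simp add: smooth_iff_Ck Ck_sum)

lemma smooth_prod: "(\<And>i. i \<in> I \<Longrightarrow> smooth (f i)) \<Longrightarrow> smooth (\<lambda>x. \<Prod>i\<in>I. f i x)"
  by (induction I rule: infinite_finite_induct) (auto intro: smooth_mult)

lemma smooth_cmult: "smooth f \<Longrightarrow> smooth (\<lambda>x. c * f x)"
  by (intro smooth_mult smooth_const)

lemma smooth_diff: "smooth f \<Longrightarrow> smooth g \<Longrightarrow> smooth (\<lambda>x. f x - g x)"
  using smooth_add[OF _ smooth_cmult[of g "-1"]] by simp

lemma smooth_compose_affine: "linear L \<Longrightarrow> smooth f \<Longrightarrow> smooth (\<lambda>x. f (L x + b))"
  by (simp add: smooth_iff_Ck Ck_compose_affine)

lemma smooth_translate: "smooth f \<Longrightarrow> smooth (\<lambda>x. f (x + b))"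
  using smooth_compose_affine[OF linear_ident] .

lemma partial_translate:
  assumes "smooth f"
  shows "partial i (\<lambda>x. f (x + b)) = (\<lambda>x. partial i f (x + b))"
  using partial_compose_affine(1)[OF smooth_differentiable[OF assms] linear_ident, of i b]
  by (simp add: axis_def if_distrib cong: if_cong)

text \<open>\<open>flat_exp 0\<close> is the classical flat function exp (-1/t). The powers of 1/t
  are included because the derivative of a member is then a linear combination of members, so
  smoothness follows by one induction for all \<open>n\<close>.\<close>

definition flat_exp :: "nat \<Rightarrow> real \<Rightarrow> real" where
  "flat_exp n t = (if t > 0 then (1/t) ^ n * exp (- (1/t)) else 0)"

lemma flat_exp_tendsto_0: "(flat_exp n \<longlongrightarrow> 0) (at 0)"
proof -
  have "((\<lambda>y::real. y ^ n * exp (- y)) \<longlongrightarrow> 0) at_top"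
    using tendsto_power_div_exp_0[of n] by (simp add: exp_minus field_simps)
  then have "((\<lambda>t. inverse t ^ n * exp (- (inverse t))) \<longlongrightarrow> 0) (at_right (0::real))"
    by (rule filterlim_compose) (rule filterlim_inverse_at_top_right)
  then have "(flat_exp n \<longlongrightarrow> 0) (at_right 0)"
    by (rule Lim_transform_eventually)
       (auto simp: flat_exp_def eventually_at_filter inverse_eq_divide)
  moreover have "(flat_exp n \<longlongrightarrow> 0) (at_left 0)"
    by (rule tendsto_eventually) (auto simp: flat_exp_def eventually_at_filter)
  ultimately show ?thesis by (simp add: filterlim_at_split)
qed

lemma flat_exp_has_derivative:
  "(flat_exp n has_real_derivative flat_exp (n + 2) t - n * flat_exp (n + 1) t) (at t)"
proof -
  consider "t > 0" | "t < 0" | "t = 0" by linarith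
  then show ?thesis
  proof cases
    case 1
    have d1: "((\<lambda>t. 1/t) has_real_derivative - ((1/t)^2)) (at t)"
      using 1 by (auto intro!: derivative_eq_intros simp: power2_eq_square)
    have "((\<lambda>t. (1/t) ^ n * exp (- (1/t))) has_real_derivative
        (real n * (1/t)^(n-1) * (- ((1/t)^2))) * exp (-(1/t)) + (1/t)^n * (exp (- (1/t)) * (1/t)^2)) (at t)"
      using 1 by (auto intro!: derivative_eq_intros simp: power2_eq_square)
    moreover have "(real n * (1/t)^(n-1) * (- ((1/t)^2))) * exp (-(1/t)) + (1/t)^n * (exp (- (1/t)) * (1/t)^2)
        = flat_exp (n + 2) t - n * flat_exp (n + 1) t"
      using 1 by (cases n) (auto simp: flat_exp_def power2_eq_square field_simps)
    ultimately have "((\<lambda>t. (1/t) ^ n * exp (- (1/t))) has_real_derivative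
         flat_exp (n + 2) t - n * flat_exp (n + 1) t) (at t)" by simp
    then show ?thesis
      by (rule has_field_derivative_transform_within_open[of _ _ _ "{0<..}"]) (use 1 in \<open>auto simp: flat_exp_def\<close>)
  next
    case 2
    have "((\<lambda>t. 0::real) has_real_derivative 0) (at t)" by simp
    then have "(flat_exp n has_real_derivative 0) (at t)"
      by (rule has_field_derivative_transform_within_open[of _ _ _ "{..<0}"]) (use 2 in \<open>auto simp: flat_exp_def\<close>)
    then show ?thesis using 2 by (simp add: flat_exp_def)
  next
    case 3
    \<comment> \<open>At the origin the difference quotient of \<open>flat_exp n\<close> is exactly
      \<open>flat_exp (n + 1)\<close>, which tends to 0.\<close>
    have "((\<lambda>s. (flat_exp n s - flat_exp n 0) / (s - 0)) \<longlongrightarrow> 0) (at 0)"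
      by (rule Lim_transform_eventually[OF flat_exp_tendsto_0[of "n + 1"]])
         (auto simp: flat_exp_def eventually_at_filter)
    then show ?thesis using 3 by (simp add: flat_exp_def has_field_derivative_iff)
  qed
qed

lemma smooth_flat_exp_compose: "smooth f \<Longrightarrow> smooth (\<lambda>x. flat_exp n (f x))"
proof -
  assume f: "smooth f"
  note d = partial_compose_real[OF smooth_differentiable[OF f] flat_exp_has_derivative]
  have "Ck k (\<lambda>x. flat_exp n (f x))" for k n
  proof (induction k arbitrary: n)
    case (Suc k)
    have "Ck k (\<lambda>x. (flat_exp (n + 2) (f x) + (- real n) * flat_exp (n + 1) (f x)) * partial i f x)" for i
      using f by (intro Ck_mult Ck_add Ck_const Suc) (metis smooth_iff_Ck smooth_partial)
    moreover have "partial i (\<lambda>x. flat_exp n (f x))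
       = (\<lambda>x. (flat_exp (n + 2) (f x) + (- real n) * flat_exp (n + 1) (f x)) * partial i f x)" for i
      by (rule ext) (simp add: d(1))
    ultimately show ?case using d(2) by (simp add: differentiable_on_UNIV_iff)
  qed (use d(2) in \<open>simp add: differentiable_on_UNIV_iff\<close>)
  then show ?thesis by (simp add: smooth_iff_Ck)
qed

lemma flat_exp_0_bounds: "0 \<le> flat_exp 0 t" "flat_exp 0 t \<le> 1"
  by (auto simp: flat_exp_def)

lemma flat_exp_0_pos_iff: "flat_exp 0 t > 0 \<longleftrightarrow> t > 0"
  by (auto simp: flat_exp_def)

text \<open>Since exp (-1/(k t)) tends to 1 for positive t, scaling the argument approximates the
  indicator of a half-line; products of such factors approximate boxes.\<close>

lemma flat_exp_0_scaled_tendsto: "(\<lambda>k. flat_exp 0 (real k * t)) \<longlonglongrightarrow> (if t > 0 then 1 else 0)"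
proof (cases "t > 0")
  case True
  have "(\<lambda>k. exp (- ((1/t) * (1 / real k)))) \<longlonglongrightarrow> exp (- ((1/t) * 0))"
    by (intro tendsto_intros lim_1_over_n)
  then have "(\<lambda>k. flat_exp 0 (real k * t)) \<longlonglongrightarrow> exp (- ((1/t) * 0))"
    by (rule Lim_transform_eventually)
       (use True in \<open>auto simp: flat_exp_def field_simps eventually_sequentially intro!: exI[of _ 1]\<close>)
  then show ?thesis using True by simp
next
  case False
  then have "flat_exp 0 (real k * t) = 0" for k by (simp add: flat_exp_def mult_le_0_iff zero_less_mult_iff)
  then show ?thesis using False by simp
qed

subsection \<open>Test functions\<close>

lemma test_functionsI:
  assumes "smooth \<phi>" "compact K" "K \<subseteq> D" "\<And>x. \<phi> x \<noteq> 0 \<Longrightarrow> x \<in> K"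
  shows "\<phi> \<in> test_functions D"
proof -
  have "closure {x. \<phi> x \<noteq> 0} \<subseteq> K"
    using assms by (intro closure_minimal) (auto simp: compact_imp_closed)
  moreover from this have "compact (closure {x. \<phi> x \<noteq> 0})"
    using bounded_subset[OF compact_imp_bounded[OF assms(2)]] by (simp add: compact_eq_bounded_closed)
  ultimately show ?thesis using assms by (auto simp: test_functions_def)
qed

lemma test_functionsE:
  assumes "\<phi> \<in> test_functions D"
  obtains K where "smooth \<phi>" "compact K" "K \<subseteq> D" "\<And>x. x \<notin> K \<Longrightarrow> \<phi> x = 0"
  using assms closure_subset[of "{x. \<phi> x \<noteq> 0}"] unfolding test_functions_def by blast

lemma test_functions_smooth: "\<phi> \<in> test_functions D \<Longrightarrow> smooth \<phi>"
  by (simp add: test_functions_def)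

lemma test_functions_mono: "D \<subseteq> E \<Longrightarrow> test_functions D \<subseteq> test_functions E"
  by (auto simp: test_functions_def)

lemma test_functions_mult_left:
  assumes "\<phi> \<in> test_functions D" "smooth f" shows "(\<lambda>x. f x * \<phi> x) \<in> test_functions D"
proof -
  obtain K where "smooth \<phi>" "compact K" "K \<subseteq> D" "\<And>x. x \<notin> K \<Longrightarrow> \<phi> x = 0"
    by (rule test_functionsE[OF assms(1)]) (rule that)
  then show ?thesis using assms(2) by (intro test_functionsI[of _ K] smooth_mult) auto
qed

lemma test_functions_add:
  assumes "\<phi> \<in> test_functions D" "\<psi> \<in> test_functions D" shows "(\<lambda>x. \<phi> x + \<psi> x) \<in> test_functions D"
proof -
  obtain K where K: "smooth \<phi>" "compact K" "K \<subseteq> D" "\<And>x. x \<notin> K \<Longrightarrow> \<phi> x = 0"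
    by (rule test_functionsE[OF assms(1)]) (rule that)
  obtain L where L: "smooth \<psi>" "compact L" "L \<subseteq> D" "\<And>x. x \<notin> L \<Longrightarrow> \<psi> x = 0"
    by (rule test_functionsE[OF assms(2)]) (rule that)
  show ?thesis using K L by (intro test_functionsI[of _ "K \<union> L"] smooth_add) force+
qed

lemma test_functions_zero [simp]: "(\<lambda>x. 0) \<in> test_functions D"
  by (rule test_functionsI[of _ "{}"]) auto

lemma test_functions_sum:
  "(\<And>i. i \<in> I \<Longrightarrow> f i \<in> test_functions D) \<Longrightarrow> (\<lambda>x. \<Sum>i\<in>I. f i x) \<in> test_functions D"
  by (induction I rule: infinite_finite_induct) (auto intro: test_functions_add)

lemma partial_zero_outside:
  assumes "closed K" "\<And>x. x \<notin> K \<Longrightarrow> f x = 0" "x \<notin> K"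
  shows "partial i f x = 0"
proof -
  have "((\<lambda>x. 0::real) has_derivative (\<lambda>h. 0)) (at x)" by simp
  then have "(f has_derivative (\<lambda>h. 0)) (at x)"
    by (rule has_derivative_transform_within_open[of _ _ _ _ "-K"]) (use assms in auto)
  from partial_eqI[OF this] show ?thesis by simp
qed

lemma test_functions_partial:
  assumes "\<phi> \<in> test_functions D" shows "partial i \<phi> \<in> test_functions D"
proof -
  obtain K where K: "smooth \<phi>" "compact K" "K \<subseteq> D" "\<And>x. x \<notin> K \<Longrightarrow> \<phi> x = 0"
    by (rule test_functionsE[OF assms(1)]) (rule that)
  have "partial i \<phi> x = 0" if "x \<notin> K" for x
    by (rule partial_zero_outside[OF compact_imp_closed[OF K(2)] _ that]) (rule K(4))
  then show ?thesis
    using K by (intro test_functionsI[of _ K] smooth_partial) auto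
qed

lemma test_functions_partials: "\<phi> \<in> test_functions D \<Longrightarrow> partials \<alpha> \<phi> \<in> test_functions D"
  by (induction \<alpha>) (auto simp: partials_Cons intro: test_functions_partial)

text \<open>Not normalised: only positivity exactly on the ball of radius \<open>r\<close> matters,
  and the mass is divided out in \<open>weak_gradient_zero_imp_constant\<close>.\<close>

definition bump :: "real \<Rightarrow> real^'n::finite \<Rightarrow> real" where
  "bump r x = flat_exp 0 (r\<^sup>2 - x \<bullet> x)"

lemma smooth_bump: "smooth (bump r)"
  unfolding bump_def inner_vec_def
  by (intro smooth_flat_exp_compose smooth_diff smooth_const smooth_sum) (simp add: smooth_mult smooth_component)

lemma bump_pos_iff: "bump r x > 0 \<longleftrightarrow> norm x < \<bar>r\<bar>"
  using abs_le_square_iff[of r "norm x"]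
  by (auto simp: bump_def flat_exp_0_pos_iff power2_norm_eq_inner[symmetric])

lemma bump_bounds: "0 \<le> bump r x" "bump r x \<le> 1"
  by (simp_all add: bump_def flat_exp_0_bounds)

subsection \<open>The fundamental lemma of the calculus of variations\<close>

text \<open>After passing to a Borel representative, the positive and the negative part are
  densities of two measures that agree on boxes. Boxes are an intersection-stable generator, so the
  measures coincide, and densities are unique.\<close>

lemma AE_zero_of_box_integrals_zero:
  fixes f :: "'a::euclidean_space \<Rightarrow> real"
  assumes f: "integrable lebesgue f"
    and box: "\<And>a b. (\<integral>x. indicator (box a b) x * f x \<partial>lebesgue) = 0"
  shows "AE x in lebesgue. f x = 0"
proof -
  obtain g where g[measurable]: "g \<in> borel_measurable lborel" and fg: "AE x in lborel. f x = g x"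
    using completion_ex_borel_measurable_real[of f lborel] f by blast
  have fg': "AE x in lebesgue. f x = g x" using fg by (rule AE_completion)
  have fm[measurable]: "f \<in> borel_measurable lebesgue" using f by auto
  have gm[measurable]: "g \<in> borel_measurable lebesgue" using g by (rule measurable_completion)
  have "integrable lebesgue g"
    using integrable_cong_AE[THEN iffD1, OF fm gm fg' f] .
  then have gi: "integrable lborel g" by (simp add: integrable_completion[OF g])
  have gbox: "(\<integral>x. indicator (box a b) x * g x \<partial>lborel) = 0" for a b
  proof -
    have "(\<integral>x. indicator (box a b) x * g x \<partial>lborel) = (\<integral>x. indicator (box a b) x * g x \<partial>lebesgue)"
      by (rule integral_completion[symmetric]) measurable
    also have "\<dots> = (\<integral>x. indicator (box a b) x * f x \<partial>lebesgue)"
    proof (rule integral_cong_AE)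
      have [measurable]: "box a b \<in> sets lebesgue" by simp
      show "(\<lambda>x. indicator (box a b) x * g x) \<in> borel_measurable lebesgue" by measurable
      show "(\<lambda>x. indicator (box a b) x * f x) \<in> borel_measurable lebesgue" by measurable
    qed (use fg' in auto)
    finally show ?thesis using box by simp
  qed
  have em: "emeasure (density lborel (\<lambda>x. ennreal (h x))) (box a b)
      = ennreal (\<integral>x. indicator (box a b) x * max 0 (h x) \<partial>lborel)"
    if hm[measurable]: "h \<in> borel_measurable lborel" and hi: "integrable lborel h" for h and a b :: 'a
  proof -
    have "emeasure (density lborel (\<lambda>x. ennreal (h x))) (box a b) = (\<integral>\<^sup>+x. ennreal (h x) * indicator (box a b) x \<partial>lborel)"
      by (subst emeasure_density) auto
    also have "\<dots> = (\<integral>\<^sup>+x. ennreal (indicator (box a b) x * max 0 (h x)) \<partial>lborel)"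
      by (rule nn_integral_cong) (auto simp: indicator_def max_def ennreal_neg)
    also have "\<dots> = ennreal (\<integral>x. indicator (box a b) x * max 0 (h x) \<partial>lborel)"
      by (rule nn_integral_eq_integral, rule Bochner_Integration.integrable_bound[OF hi])
         (auto simp: indicator_def)
    finally show ?thesis .
  qed
  have "density lborel (\<lambda>x. ennreal (g x)) = density lborel (\<lambda>x. ennreal (- g x))"
  proof (rule measure_eqI_generator_eq)
    let ?E = "range (\<lambda>(a, b). box a b :: 'a set)"
    show "Int_stable ?E" by (auto simp: Int_stable_def box_Int_box)
    show "?E \<subseteq> Pow UNIV" "sets (density lborel (\<lambda>x. ennreal (g x))) = sigma_sets UNIV ?E"
      "sets (density lborel (\<lambda>x. ennreal (- g x))) = sigma_sets UNIV ?E"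
      by (simp_all add: borel_eq_box)
    let ?A = "\<lambda>n::nat. box (- (real n *\<^sub>R One)) (real n *\<^sub>R One) :: 'a set"
    show "range ?A \<subseteq> ?E" "(\<Union>i. ?A i) = UNIV" unfolding UN_box_eq_UNIV by auto
    show "emeasure (density lborel (\<lambda>x. ennreal (g x))) (?A i) \<noteq> \<infinity>" for i
      using em[OF g gi, of "- (real i *\<^sub>R One)" "real i *\<^sub>R One"] by simp
    fix X assume "X \<in> ?E"
    then obtain a b where X: "X = box a b" by auto
    have i1: "integrable lborel (\<lambda>x. indicator (box a b) x * max 0 (g x))"
      and i2: "integrable lborel (\<lambda>x. indicator (box a b) x * max 0 (- g x))"
      by (rule Bochner_Integration.integrable_bound[OF gi], measurable, auto simp: indicator_def)+
    have "(\<integral>x. indicator (box a b) x * max 0 (g x) \<partial>lborel) - (\<integral>x. indicator (box a b) x * max 0 (- g x) \<partial>lborel)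
       = (\<integral>x. indicator (box a b) x * max 0 (g x) - indicator (box a b) x * max 0 (- g x) \<partial>lborel)"
      using i1 i2 by simp
    also have "\<dots> = (\<integral>x. indicator (box a b) x * g x \<partial>lborel)"
      by (rule Bochner_Integration.integral_cong) (auto simp: indicator_def)
    finally show "emeasure (density lborel (\<lambda>x. ennreal (g x))) X = emeasure (density lborel (\<lambda>x. ennreal (- g x))) X"
      using em[OF g gi, of a b] em[of "\<lambda>x. - g x" a b] gi gbox by (simp add: X)
  qed
  \<comment> \<open>\<open>ennreal\<close> truncates negative numbers to 0, so this equation
    compares the positive with the negative part; at most one of them is nonzero, hence both
    vanish.\<close>
  then have "AE x in lborel. ennreal (g x) = ennreal (- g x)"
    by (intro sigma_finite_measure.density_unique[OF sigma_finite_lborel]) auto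
  then have "AE x in lborel. g x = 0"
  proof eventually_elim
    case (elim x)
    then show ?case by (cases "g x" "0::real" rule: linorder_cases) (auto simp: ennreal_neg ennreal_eq_0_iff dest: sym)
  qed
  with fg have "AE x in lborel. f x = 0" by eventually_elim simp
  then show ?thesis by (rule AE_completion)
qed

text \<open>One factor for each face of the box, vanishing on the far side of it; as k grows the
  product converges pointwise to the indicator of the open box while staying between 0 and
  1.\<close>

definition box_bump :: "real^'n::finite \<Rightarrow> real^'n \<Rightarrow> nat \<Rightarrow> real^'n \<Rightarrow> real" where
  "box_bump a b k x =
     (\<Prod>i\<in>UNIV. flat_exp 0 (real k * (x $ i - a $ i)) * flat_exp 0 (real k * (b $ i - x $ i)))"

lemma box_bump_bounds: "0 \<le> box_bump a b k x" "box_bump a b k x \<le> 1"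
  unfolding box_bump_def
  by (auto intro!: prod_nonneg prod_le_1 mult_nonneg_nonneg mult_le_one simp: flat_exp_0_bounds)

lemma smooth_box_bump: "smooth (box_bump a b k)"
  unfolding box_bump_def
  by (intro smooth_prod smooth_mult smooth_flat_exp_compose smooth_cmult smooth_diff smooth_const smooth_component)

lemma box_bump_outside: "x \<notin> box a b \<Longrightarrow> box_bump a b k x = 0"
proof -
  assume "x \<notin> box a b"
  then obtain i where "\<not> (x $ i - a $ i > 0) \<or> \<not> (b $ i - x $ i > 0)" by (auto simp: mem_box_cart)
  then have "flat_exp 0 (real k * (x $ i - a $ i)) * flat_exp 0 (real k * (b $ i - x $ i)) = 0"
    by (auto simp: flat_exp_def zero_less_mult_iff)
  then show ?thesis unfolding box_bump_def by (intro prod_zero) auto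
qed

lemma box_bump_tendsto: "(\<lambda>k. box_bump a b k x) \<longlonglongrightarrow> indicator (box a b) x"
proof -
  have "(\<lambda>k. box_bump a b k x) \<longlonglongrightarrow>
      (\<Prod>i\<in>UNIV. (if x $ i - a $ i > 0 then 1 else 0) * (if b $ i - x $ i > 0 then 1 else 0))"
    unfolding box_bump_def by (intro tendsto_intros flat_exp_0_scaled_tendsto)
  also have "(\<Prod>i\<in>UNIV. (if x $ i - a $ i > 0 then 1 else 0) * (if b $ i - x $ i > 0 then 1 else (0::real)))
     = indicator (box a b) x"
    by (auto simp: indicator_def mem_box_cart intro!: prod.neutral)
  finally show ?thesis .
qed

lemma box_bump_test:
  assumes "cbox a b \<subseteq> D" shows "box_bump a b k \<in> test_functions D"
  using box_subset_cbox[of a b]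
  by (intro test_functionsI[OF smooth_box_bump compact_cbox assms]) (use box_bump_outside in blast)

lemma smooth_borel_measurable: "smooth f \<Longrightarrow> f \<in> borel_measurable borel"
  by (intro borel_measurable_continuous_onI smooth_continuous_on)

lemma smooth_measurable: "smooth f \<Longrightarrow> f \<in> borel_measurable lebesgue"
  using smooth_borel_measurable[of f] by (intro measurable_completion) simp

lemma smooth_measurable_on: "smooth f \<Longrightarrow> f \<in> borel_measurable (lebesgue_on S)"
  by (intro measurable_restrict_space1 smooth_measurable)

lemma integrable_mult_test:
  assumes D: "D \<in> sets lebesgue" and g: "locally_integrable D g" and \<phi>: "\<phi> \<in> test_functions D"
  shows "integrable (lebesgue_on D) (\<lambda>x. g x * \<phi> x)"
proof -
  obtain K where K: "smooth \<phi>" "compact K" "K \<subseteq> D" "\<And>x. x \<notin> K \<Longrightarrow> \<phi> x = 0"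
    by (rule test_functionsE[OF \<phi>]) (rule that)
  have Ks: "K \<in> sets lebesgue" using K(2) by (simp add: borel_compact)
  have c: "continuous_on UNIV \<phi>" by (rule smooth_continuous_on[OF K(1)])
  then have "compact (\<phi> ` K)" using K(2) by (meson compact_continuous_image continuous_on_subset subset_UNIV)
  then obtain B where B: "\<And>x. x \<in> K \<Longrightarrow> \<bar>\<phi> x\<bar> \<le> B"
    by (force dest!: compact_imp_bounded simp: bounded_iff)
  have cm: "\<phi> \<in> borel_measurable lebesgue" by (rule smooth_measurable[OF K(1)])
  have gi: "integrable (lebesgue_on K) g" using g K by (auto simp: locally_integrable_def)
  have "integrable (lebesgue_on K) (\<lambda>x. g x * \<phi> x)"
  proof (rule Bochner_Integration.integrable_bound)
    show "integrable (lebesgue_on K) (\<lambda>x. B * g x)" using gi by simp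
    show "(\<lambda>x. g x * \<phi> x) \<in> borel_measurable (lebesgue_on K)"
      by (intro borel_measurable_times borel_measurable_integrable[OF gi] measurable_restrict_space1[OF cm])
    show "AE x in lebesgue_on K. norm (g x * \<phi> x) \<le> norm (B * g x)"
    proof (rule AE_I2)
      fix x assume "x \<in> space (lebesgue_on K)"
      then have "\<bar>\<phi> x\<bar> \<le> \<bar>B\<bar>" using B[of x] by auto
      then have "\<bar>g x\<bar> * \<bar>\<phi> x\<bar> \<le> \<bar>g x\<bar> * \<bar>B\<bar>" by (rule mult_left_mono) auto
      then show "norm (g x * \<phi> x) \<le> norm (B * g x)" by (simp add: abs_mult mult.commute)
    qed
  qed
  then have "integrable lebesgue (\<lambda>x. indicator K x *\<^sub>R (g x * \<phi> x))"
    using Ks by (simp add: integrable_restrict_space)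
  moreover have "(\<lambda>x. indicator K x *\<^sub>R (g x * \<phi> x)) = (\<lambda>x. indicator D x *\<^sub>R (g x * \<phi> x))"
    using K(3,4) by (auto simp: indicator_def fun_eq_iff)
  ultimately show ?thesis using D by (simp add: integrable_restrict_space)
qed

lemma AE_lebesgue_on_iff:
  "D \<in> sets lebesgue \<Longrightarrow> (AE x in lebesgue_on D. P x) \<longleftrightarrow> (AE x in lebesgue. x \<in> D \<longrightarrow> P x)"
  by (simp add: AE_restrict_space_iff)

text \<open>Box bumps are test functions, so dominated convergence makes the integral over every box
  inside \<open>D\<close> vanish. This gives the claim on each closed box in \<open>D\<close>, and
  countably many of these exhaust \<open>D\<close>.\<close>

theorem fundamental_lemma:
  assumes D: "open D" and g: "locally_integrable D g"
    and z: "\<And>\<phi>. \<phi> \<in> test_functions D \<Longrightarrow> (\<integral>x. g x * \<phi> x \<partial>lebesgue_on D) = 0"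
  shows "AE x in lebesgue_on D. g x = 0"
proof -
  have Ds: "D \<in> sets lebesgue" using D by (simp add: borel_open)
  have boxz: "(\<integral>x. indicator (box a b) x * g x \<partial>lebesgue) = 0" if ab: "cbox a b \<subseteq> D" for a b
  proof -
    have gi: "integrable lebesgue (\<lambda>x. indicator (cbox a b) x * g x)"
      using g[unfolded locally_integrable_def, rule_format, of "cbox a b"] ab by (simp add: integrable_restrict_space)
    have "(\<lambda>k. \<integral>x. box_bump a b k x * (indicator (cbox a b) x * g x) \<partial>lebesgue)
        \<longlonglongrightarrow> (\<integral>x. indicator (box a b) x * (indicator (cbox a b) x * g x) \<partial>lebesgue)"
    proof (rule integral_dominated_convergence)
      show "integrable lebesgue (\<lambda>x. norm (indicator (cbox a b) x * g x))"
        using gi by (rule integrable_norm)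
      show m: "(\<lambda>x. box_bump a b k x * (indicator (cbox a b) x * g x)) \<in> borel_measurable lebesgue" for k
        by (intro borel_measurable_times smooth_measurable[OF smooth_box_bump] borel_measurable_integrable[OF gi])
      show "(\<lambda>x. indicator (box a b) x * (indicator (cbox a b) x * g x)) \<in> borel_measurable lebesgue"
        by (intro borel_measurable_times borel_measurable_indicator borel_measurable_integrable[OF gi]) simp
      show "AE x in lebesgue. norm (box_bump a b k x * (indicator (cbox a b) x * g x))
          \<le> norm (indicator (cbox a b) x * g x)" for k
        using box_bump_bounds[of a b k] by (auto simp: abs_mult intro!: mult_left_le_one_le)
      show "AE x in lebesgue. (\<lambda>k. box_bump a b k x * (indicator (cbox a b) x * g x))
          \<longlonglongrightarrow> indicator (box a b) x * (indicator (cbox a b) x * g x)"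
        by (intro AE_I2 tendsto_intros box_bump_tendsto)
    qed
    moreover have "(\<integral>x. box_bump a b k x * (indicator (cbox a b) x * g x) \<partial>lebesgue) = 0" for k
    proof -
      have "(\<integral>x. box_bump a b k x * (indicator (cbox a b) x * g x) \<partial>lebesgue)
          = (\<integral>x. indicator D x *\<^sub>R (g x * box_bump a b k x) \<partial>lebesgue)"
        using ab box_subset_cbox[of a b] box_bump_outside[of _ a b k]
        by (intro Bochner_Integration.integral_cong) (auto simp: indicator_def)
      also have "\<dots> = (\<integral>x. g x * box_bump a b k x \<partial>lebesgue_on D)"
        using Ds by (simp add: integral_restrict_space)
      finally show ?thesis using z[OF box_bump_test[OF ab]] by simp
    qed
    ultimately have "(\<integral>x. indicator (box a b) x * (indicator (cbox a b) x * g x) \<partial>lebesgue) = 0"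
      using LIMSEQ_unique[OF _ tendsto_const] by fastforce
    moreover have "(\<lambda>x. indicator (box a b) x * (indicator (cbox a b) x * g x)) = (\<lambda>x. indicator (box a b) x * g x)"
      using box_subset_cbox[of a b] by (auto simp: indicator_def fun_eq_iff)
    ultimately show ?thesis by simp
  qed
  have cb: "AE x in lebesgue. x \<in> cbox a b \<longrightarrow> g x = 0" if ab: "cbox a b \<subseteq> D" for a b
  proof -
    have "AE x in lebesgue. indicator (box a b) x * g x = 0"
    proof (rule AE_zero_of_box_integrals_zero)
      have "integrable lebesgue (\<lambda>x. indicator (cbox a b) x * g x)"
        using g[unfolded locally_integrable_def, rule_format, of "cbox a b"] ab by (simp add: integrable_restrict_space)
      then have "integrable lebesgue (\<lambda>x. indicator (box a b) x *\<^sub>R (indicator (cbox a b) x * g x))"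
        by (rule integrable_mult_indicator[rotated]) simp
      moreover have "(\<lambda>x. indicator (box a b) x *\<^sub>R (indicator (cbox a b) x * g x)) = (\<lambda>x. indicator (box a b) x * g x)"
        using box_subset_cbox[of a b] by (auto simp: indicator_def fun_eq_iff)
      ultimately show "integrable lebesgue (\<lambda>x. indicator (box a b) x * g x)" by simp
      fix c d
      \<comment> \<open>The criterion is applied to \<open>g\<close> cut off to a box, since
        \<open>g\<close> is integrable only locally; its integrals over boxes are integrals of
        \<open>g\<close> over intersections of boxes, again boxes.\<close>
      obtain e f where ef: "box c d \<inter> box a b = box e f" by (auto simp: box_Int_box)
      have "(\<integral>x. indicator (box c d) x * (indicator (box a b) x * g x) \<partial>lebesgue)
          = (\<integral>x. indicator (box e f) x * g x \<partial>lebesgue)"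
        using ef by (intro Bochner_Integration.integral_cong) (auto simp: indicator_def)
      also have "\<dots> = 0"
      proof (cases "box e f = {}")
        case False
        then have "cbox e f \<subseteq> cbox a b"
          using ef box_subset_cbox[of a b] closure_minimal[of "box e f" "cbox a b"] closure_box[OF False] by auto
        then show ?thesis using ab boxz by blast
      qed simp
      finally show "(\<integral>x. indicator (box c d) x * (indicator (box a b) x * g x) \<partial>lebesgue) = 0" .
    qed
    moreover have "AE x in lebesgue. x \<notin> cbox a b - box a b"
      using negligible_frontier_interval[of a b] by (intro AE_not_in) (simp add: negligible_iff_null_sets)
    ultimately show ?thesis by eventually_elim (auto simp: indicator_def)
  qed
  obtain \<D> where \<D>: "countable \<D>" "\<D> \<subseteq> Pow D" "\<And>X. X \<in> \<D> \<Longrightarrow> \<exists>a b. X = cbox a b" "\<Union>\<D> = D"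
    by (rule open_countable_Union_open_cbox[OF D]) (rule that)
  have "AE x in lebesgue. \<forall>X\<in>\<D>. x \<in> X \<longrightarrow> g x = 0"
    using \<D> cb by (subst AE_ball_countable[OF \<D>(1)]) (metis PowD subsetD)
  then have "AE x in lebesgue. x \<in> D \<longrightarrow> g x = 0"
    by eventually_elim (use \<D>(4) in blast)
  then show ?thesis by (simp add: AE_lebesgue_on_iff[OF Ds])
qed

text \<open>Local integrability gives measurability on each compact box only; countably many boxes
  glue it together.\<close>

lemma locally_integrable_measurable:
  assumes D: "open D" and g: "locally_integrable D g"
  shows "g \<in> borel_measurable (lebesgue_on D)"
proof -
  obtain \<D> where \<D>: "countable \<D>" "\<D> \<subseteq> Pow D" "\<And>X. X \<in> \<D> \<Longrightarrow> \<exists>a b. X = cbox a b" "\<Union>\<D> = D"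
    by (rule open_countable_Union_open_cbox[OF D]) (rule that)
  show ?thesis
  proof (rule measurable_piecewise_restrict[OF \<D>(1)])
    fix X assume X: "X \<in> \<D>"
    then have "X \<subseteq> D" using \<D>(2) by blast
    obtain a b where ab: "X = cbox a b" using \<D>(3)[OF X] by blast
    show "X \<inter> space (lebesgue_on D) \<in> sets (lebesgue_on D)"
      using D \<open>X \<subseteq> D\<close> by (auto simp: sets_restrict_space_iff ab borel_open inf.absorb1)
    have "integrable (lebesgue_on X) g" using g \<open>X \<subseteq> D\<close> ab by (auto simp: locally_integrable_def)
    then show "g \<in> borel_measurable (restrict_space (lebesgue_on D) X)"
      using \<open>X \<subseteq> D\<close> D
      by (simp add: restrict_restrict_space borel_open ab inf.absorb2)
  qed (use \<D>(4) in auto)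
qed

lemma locally_integrable_diff:
  "locally_integrable D f \<Longrightarrow> locally_integrable D g \<Longrightarrow> locally_integrable D (\<lambda>x. f x - g x)"
  by (auto simp: locally_integrable_def)

subsection \<open>Square-integrable functions\<close>

lemma L2_mult_integrable:
  assumes "f \<in> L2 M" "g \<in> L2 M" shows "integrable M (\<lambda>x. f x * g x)"
proof (rule Bochner_Integration.integrable_bound)
  show "integrable M (\<lambda>x. (f x)\<^sup>2 + (g x)\<^sup>2)" using assms by (auto simp: L2_def)
  have "\<bar>f x * g x\<bar> \<le> (f x)\<^sup>2 + (g x)\<^sup>2" for x
    using sum_squares_bound[of "\<bar>f x\<bar>" "\<bar>g x\<bar>"] mult_nonneg_nonneg[of "\<bar>f x\<bar>" "\<bar>g x\<bar>"]
    unfolding abs_mult power2_abs by linarith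
  then show "AE x in M. norm (f x * g x) \<le> norm ((f x)\<^sup>2 + (g x)\<^sup>2)" by simp
qed (use assms in \<open>auto simp: L2_def\<close>)

lemma L2_measurable: "f \<in> L2 M \<Longrightarrow> f \<in> borel_measurable M"
  and L2_square_integrable: "f \<in> L2 M \<Longrightarrow> integrable M (\<lambda>x. (f x)\<^sup>2)"
  by (auto simp: L2_def)

lemma L2_cmult: "f \<in> L2 M \<Longrightarrow> (\<lambda>x. c * f x) \<in> L2 M"
  by (auto simp: L2_def power_mult_distrib)

lemma L2_uminus: "f \<in> L2 M \<Longrightarrow> (\<lambda>x. - f x) \<in> L2 M"
  by (auto simp: L2_def)

lemma L2_add: "f \<in> L2 M \<Longrightarrow> g \<in> L2 M \<Longrightarrow> (\<lambda>x. f x + g x) \<in> L2 M"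
  using L2_mult_integrable[of f M g] by (auto simp: L2_def power2_sum mult.assoc)

lemma L2_diff: "f \<in> L2 M \<Longrightarrow> g \<in> L2 M \<Longrightarrow> (\<lambda>x. f x - g x) \<in> L2 M"
  using L2_add[OF _ L2_cmult[of g M "-1"]] by simp

lemma L2_zero [simp]: "(\<lambda>x. 0) \<in> L2 M" by (simp add: L2_def)

lemma L2_sum: "(\<And>i. i \<in> I \<Longrightarrow> f i \<in> L2 M) \<Longrightarrow> (\<lambda>x. \<Sum>i\<in>I. f i x) \<in> L2 M"
  by (induction I rule: infinite_finite_induct) (auto intro: L2_add)

lemma L2_bounded_mult:
  assumes f: "f \<in> L2 M" and a: "a \<in> borel_measurable M" "\<And>x. x \<in> space M \<Longrightarrow> \<bar>a x\<bar> \<le> B"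
  shows "(\<lambda>x. a x * f x) \<in> L2 M"
proof -
  have fm: "f \<in> borel_measurable M" using f by (rule L2_measurable)
  have "integrable M (\<lambda>x. (a x * f x)\<^sup>2)"
  proof (rule Bochner_Integration.integrable_bound)
    show "integrable M (\<lambda>x. B\<^sup>2 * (f x)\<^sup>2)" using f by (simp add: L2_def)
    have "(a x * f x)\<^sup>2 \<le> B\<^sup>2 * (f x)\<^sup>2" if "x \<in> space M" for x
    proof -
      have "(a x)\<^sup>2 \<le> B\<^sup>2" using a(2)[OF that] by (simp add: abs_le_square_iff[symmetric])
      then show ?thesis by (simp add: power_mult_distrib mult_right_mono)
    qed
    then show "AE x in M. norm ((a x * f x)\<^sup>2) \<le> norm (B\<^sup>2 * (f x)\<^sup>2)" by (intro AE_I2) simp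
  qed (use fm a in measurable)
  then show ?thesis using fm a by (simp add: L2_def)
qed

lemma L2_cong_AE:
  assumes "f \<in> L2 M" "g \<in> borel_measurable M" "AE x in M. f x = g x"
  shows "g \<in> L2 M"
proof -
  have "AE x in M. (f x)\<^sup>2 = (g x)\<^sup>2" using assms(3) by eventually_elim simp
  from integrable_cong_AE[THEN iffD1, OF _ _ this] assms show ?thesis
    by (simp add: L2_def)
qed

lemma L2_Cauchy_Schwarz:
  assumes f: "f \<in> L2 M" and g: "g \<in> L2 M"
  shows "(\<integral>x. \<bar>f x * g x\<bar> \<partial>M)\<^sup>2 \<le> (\<integral>x. (f x)\<^sup>2 \<partial>M) * (\<integral>x. (g x)\<^sup>2 \<partial>M)"
proof -
  have [measurable]: "f \<in> borel_measurable M" "g \<in> borel_measurable M" using f g by (auto simp: L2_def)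
  have i: "integrable M (\<lambda>x. \<bar>f x * g x\<bar>)" using L2_mult_integrable[OF f g] by simp
  have "ennreal ((\<integral>x. \<bar>f x * g x\<bar> \<partial>M)\<^sup>2) = (\<integral>\<^sup>+x. ennreal \<bar>f x\<bar> * ennreal \<bar>g x\<bar> \<partial>M)\<^sup>2"
    using nn_integral_eq_integral[OF i] by (simp add: ennreal_power[symmetric] ennreal_mult[symmetric] abs_mult)
  also have "\<dots> \<le> (\<integral>\<^sup>+x. ennreal \<bar>f x\<bar> ^ 2 \<partial>M) * (\<integral>\<^sup>+x. ennreal \<bar>g x\<bar> ^ 2 \<partial>M)"
    by (rule Cauchy_Schwarz_nn_integral) auto
  also have "\<dots> = ennreal ((\<integral>x. (f x)\<^sup>2 \<partial>M) * (\<integral>x. (g x)\<^sup>2 \<partial>M))"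
    using nn_integral_eq_integral[OF L2_square_integrable[OF f]] nn_integral_eq_integral[OF L2_square_integrable[OF g]]
    by (simp add: ennreal_power ennreal_mult)
  finally show ?thesis by (simp add: ennreal_le_iff)
qed

lemma L2_inner_tendsto_0:
  assumes f: "f \<in> L2 M" and g: "\<And>k. g k \<in> L2 M"
    and lim: "(\<lambda>k. \<integral>x. (g k x)\<^sup>2 \<partial>M) \<longlonglongrightarrow> 0"
  shows "(\<lambda>k. \<integral>x. \<bar>f x * g k x\<bar> \<partial>M) \<longlonglongrightarrow> 0"
proof -
  have "(\<lambda>k. sqrt ((\<integral>x. (f x)\<^sup>2 \<partial>M) * (\<integral>x. (g k x)\<^sup>2 \<partial>M))) \<longlonglongrightarrow> sqrt ((\<integral>x. (f x)\<^sup>2 \<partial>M) * 0)"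
    by (intro tendsto_intros lim)
  then have u: "(\<lambda>k. sqrt ((\<integral>x. (f x)\<^sup>2 \<partial>M) * (\<integral>x. (g k x)\<^sup>2 \<partial>M))) \<longlonglongrightarrow> 0" by simp
  have le: "(\<integral>x. \<bar>f x * g k x\<bar> \<partial>M) \<le> sqrt ((\<integral>x. (f x)\<^sup>2 \<partial>M) * (\<integral>x. (g k x)\<^sup>2 \<partial>M))" for k
    by (rule real_le_rsqrt) (rule L2_Cauchy_Schwarz[OF f g])
  have ge: "0 \<le> (\<integral>x. \<bar>f x * g k x\<bar> \<partial>M)" for k by (rule integral_nonneg_AE) simp
  show ?thesis
    by (rule tendsto_sandwich[OF _ _ tendsto_const u]) (use le ge in \<open>simp_all add: always_eventually\<close>)
qed

lemma L2_locally_integrable: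
  assumes f: "f \<in> L2 (lebesgue_on D)" and D: "D \<in> sets lebesgue"
  shows "locally_integrable D f"
  unfolding locally_integrable_def
proof (intro allI impI, elim conjE)
  fix K assume K: "compact K" "K \<subseteq> D"
  have Ks: "K \<in> lmeasurable" using K by (simp add: lmeasurable_compact)
  have eq: "lebesgue_on K = restrict_space (lebesgue_on D) K"
    using K D by (simp add: restrict_restrict_space inf.absorb2 lmeasurable_compact fmeasurableD)
  have KD: "K \<inter> space (lebesgue_on D) \<in> sets (lebesgue_on D)"
    using K D Ks by (auto simp: sets_restrict_space_iff inf.absorb1 fmeasurableD)
  have fm: "f \<in> borel_measurable (lebesgue_on K)"
    unfolding eq using L2_measurable[OF f] by (rule measurable_restrict_space1)
  have "integrable (lebesgue_on D) (\<lambda>x. indicator K x *\<^sub>R (f x)\<^sup>2)"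
    using KD K L2_square_integrable[OF f] by (intro integrable_mult_indicator) (auto simp: inf.absorb1)
  then have i2: "integrable (lebesgue_on K) (\<lambda>x. (f x)\<^sup>2)"
    unfolding eq using KD by (simp add: integrable_restrict_space)
  have i1: "integrable (lebesgue_on K) (\<lambda>x. 1::real)"
    using Ks lmeasurable_iff_integrable[of K] by (simp add: integrable_restrict_space fmeasurableD)
  show "integrable (lebesgue_on K) f"
  proof (rule Bochner_Integration.integrable_bound)
    show "integrable (lebesgue_on K) (\<lambda>x. 1 + (f x)\<^sup>2)" using i1 i2 by simp
    have "\<bar>t\<bar> \<le> 1 + t\<^sup>2" for t :: real
    proof -
      have "2 * \<bar>t\<bar> \<le> 1 + t\<^sup>2" using sum_squares_bound[of 1 "\<bar>t\<bar>"] by simp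
      then show ?thesis by linarith
    qed
    then show "AE x in lebesgue_on K. norm (f x) \<le> norm (1 + (f x)\<^sup>2)" by simp
  qed (rule fm)
qed

subsection \<open>Integration by parts by translation invariance\<close>

lemma lborel_integral_translate:
  fixes f :: "'a::euclidean_space \<Rightarrow> real"
  assumes "f \<in> borel_measurable borel"
  shows "(\<integral>x. f (c + x) \<partial>lborel) = (\<integral>x. f x \<partial>lborel)"
  by (subst (2) lborel_distr_plus[of c, symmetric]) (subst integral_distr, use assms in auto)

text \<open>Difference quotients have integral 0 by translation invariance, and the Lipschitz
  constant dominates them, so the limit may be taken under the integral. Differentiability is
  required only almost everywhere, as is the case for the gauge cut-off.\<close>

lemma integral_directional_derivative_zero:
  fixes f d :: "'a::euclidean_space \<Rightarrow> real"
  assumes L: "L-lipschitz_on UNIV f" and supp: "\<And>x. norm x > R \<Longrightarrow> f x = 0"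
    and d[measurable]: "d \<in> borel_measurable borel"
    and deriv: "AE x in lborel. ((\<lambda>t. f (x + t *\<^sub>R e)) has_real_derivative d x) (at 0)"
  shows "(\<integral>x. d x \<partial>lborel) = 0"
proof -
  have cont: "continuous_on UNIV f" using L by (rule lipschitz_on_continuous_on)
  then have fm[measurable]: "f \<in> borel_measurable borel" by (simp add: borel_measurable_continuous_onI)
  have L0: "L \<ge> 0" using L by (rule lipschitz_on_nonneg)
  have bnd: "\<bar>f (x + h) - f x\<bar> \<le> L * norm h" for x h
    using lipschitz_onD[OF L, of "x + h" x] by (simp add: dist_norm)
  have ind: "integrable lborel (\<lambda>x::'a. C * indicator (cball 0 r) x :: real)" for C and r :: real
    using emeasure_compact_finite[of "cball (0::'a) r"] by (auto intro!: integrable_real_indicator)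
  define s where "s k x = (f (x + (1 / real (Suc k)) *\<^sub>R e) - f x) * real (Suc k)" for k x
  have "bounded (f ` cball 0 R)"
    by (intro compact_imp_bounded compact_continuous_image continuous_on_subset[OF cont]) auto
  then obtain B where B: "\<And>x. x \<in> cball 0 R \<Longrightarrow> \<bar>f x\<bar> \<le> B" by (force simp: bounded_iff)
  have fi: "integrable lborel f"
  proof (rule Bochner_Integration.integrable_bound)
    show "integrable lborel (\<lambda>x::'a. B * indicator (cball 0 R) x :: real)" by (rule ind)
    have "\<bar>f x\<bar> \<le> \<bar>B * indicator (cball 0 R) x\<bar>" for x
      using B[of x] supp[of x] by (cases "x \<in> cball 0 R") auto
    then show "AE x in lborel. norm (f x) \<le> norm (B * indicator (cball 0 R) x :: real)" by simp
  qed simp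
  have si: "(\<integral>x. s k x \<partial>lborel) = 0" for k
  proof -
    let ?c = "(1 / real (Suc k)) *\<^sub>R e"
    have "integrable (distr lborel borel ((+) ?c)) f" using fi by (simp add: lborel_distr_plus)
    then have i: "integrable lborel (\<lambda>x. f (?c + x))" by (simp add: integrable_distr_eq)
    show ?thesis
      using fi i lborel_integral_translate[OF fm, of ?c] by (simp add: s_def add.commute)
  qed
  have "(\<lambda>k. \<integral>x. s k x \<partial>lborel) \<longlonglongrightarrow> (\<integral>x. d x \<partial>lborel)"
  proof (rule integral_dominated_convergence)
    show "s k \<in> borel_measurable lborel" for k unfolding s_def by measurable
    \<comment> \<open>The steps 1/(k+1) are at most 1, so all quotients are supported in the ball
      enlarged by \<open>norm e\<close>.\<close>
    show "integrable lborel (\<lambda>x::'a. (L * norm e) * indicator (cball 0 (R + norm e)) x :: real)" by (rule ind)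
    show "AE x in lborel. (\<lambda>k. s k x) \<longlonglongrightarrow> d x"
      using deriv
    proof eventually_elim
      case (elim x)
      then have lim: "((\<lambda>t. (f (x + t *\<^sub>R e) - f x) / t) \<longlongrightarrow> d x) (at 0)"
        by (simp add: has_field_derivative_iff)
      have "filterlim (\<lambda>k. 1 / real (Suc k)) (at 0) sequentially"
        unfolding filterlim_at using LIMSEQ_Suc[OF lim_1_over_n] by (auto simp: eventually_sequentially)
      from filterlim_compose[OF lim this] show ?case by (simp add: s_def divide_simps) 
    qed
    show "AE x in lborel. norm (s k x) \<le> (L * norm e) * indicator (cball 0 (R + norm e)) x" for k
    proof (rule AE_I2)
      fix x :: 'a
      show "norm (s k x) \<le> (L * norm e) * indicator (cball 0 (R + norm e)) x"
      proof (cases "norm x \<le> R + norm e")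
        case True
        have "\<bar>f (x + (1 / real (Suc k)) *\<^sub>R e) - f x\<bar> * real (Suc k)
            \<le> (L * norm ((1 / real (Suc k)) *\<^sub>R e)) * real (Suc k)"
          by (intro mult_right_mono bnd) auto
        then show ?thesis using True by (simp add: s_def abs_mult)
      next
        case False
        have "norm x \<le> norm (x + (1 / real (Suc k)) *\<^sub>R e) + norm ((1 / real (Suc k)) *\<^sub>R e)"
          using norm_triangle_ineq4[of "x + (1 / real (Suc k)) *\<^sub>R e" "(1 / real (Suc k)) *\<^sub>R e"] by simp
        moreover have "norm ((1 / real (Suc k)) *\<^sub>R e) \<le> norm e"
          using mult_left_mono[of 1 "1 + real k" "norm e"] by (simp add: divide_simps)
        ultimately have "norm (x + (1 / real (Suc k)) *\<^sub>R e) > R" "norm x > R"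
          using False norm_ge_zero[of e] by linarith+
        then show ?thesis using L0 by (simp add: s_def supp)
      qed
    qed
  qed simp
  then show ?thesis using si LIMSEQ_unique[OF _ tendsto_const] by simp
qed

text \<open>One continuous derivative is all that integration by parts asks of a weight. It spares
  higher derivatives of the logarithm that serves as weight in
  \<open>damped_convection_zero\<close>.\<close>

definition C1 :: "(real^'n::finite \<Rightarrow> real) \<Rightarrow> bool" where
  "C1 f \<longleftrightarrow> (\<forall>x. f differentiable (at x)) \<and> (\<forall>i. continuous_on UNIV (partial i f))"

lemma C1_differentiable: "C1 f \<Longrightarrow> f differentiable (at x)"
  and C1_partial_continuous: "C1 f \<Longrightarrow> continuous_on S (partial i f)"
  by (auto simp: C1_def intro: continuous_on_subset[OF _ subset_UNIV])

lemma C1_continuous: "C1 f \<Longrightarrow> continuous_on S f"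
  by (meson C1_differentiable continuous_at_imp_continuous_on differentiable_imp_continuous_within)

lemma smooth_C1: "smooth f \<Longrightarrow> C1 f"
  by (simp add: C1_def smooth_differentiable smooth_continuous_on smooth_partial)

lemma C1_mult: "C1 f \<Longrightarrow> C1 g \<Longrightarrow> C1 (\<lambda>x. f x * g x)"
proof -
  assume fg: "C1 f" "C1 g"
  have "partial i (\<lambda>x. f x * g x) = (\<lambda>x. f x * partial i g x + partial i f x * g x)" for i
    by (rule ext) (simp add: partial_mult fg[THEN C1_differentiable])
  moreover have "continuous_on UNIV (\<lambda>x. f x * partial i g x + partial i f x * g x)" for i
    by (intro continuous_on_add continuous_on_mult) (simp_all add: fg C1_continuous C1_partial_continuous)
  ultimately show ?thesis
    using fg by (simp add: C1_def differentiable_mult)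
qed

lemma C1_lipschitz_on:
  assumes f: "C1 f" and K: "compact K" "convex K"
  obtains L where "L-lipschitz_on K f"
proof -
  have "\<exists>B. \<forall>x\<in>K. \<bar>partial i f x\<bar> \<le> B" for i
    using compact_imp_bounded[OF compact_continuous_image[OF C1_partial_continuous[OF f] K(1), of i]]
    by (force simp: bounded_iff)
  then obtain B where B: "\<And>i x. x \<in> K \<Longrightarrow> \<bar>partial i f x\<bar> \<le> B i" by metis
  define L where "L = (\<Sum>i\<in>UNIV. \<bar>B i\<bar>)"
  have "L-lipschitz_on K f"
  proof (rule bounded_derivative_imp_lipschitz[OF _ K(2)])
    show "(f has_derivative (\<lambda>h. \<Sum>i\<in>UNIV. partial i f x * h $ i)) (at x within K)" for x
      using has_derivative_partial[OF C1_differentiable[OF f]] by (rule has_derivative_at_withinI)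
    show "0 \<le> L" by (simp add: L_def sum_nonneg)
    fix x assume x: "x \<in> K"
    show "onorm (\<lambda>h. \<Sum>i\<in>UNIV. partial i f x * h $ i) \<le> L"
    proof (rule onorm_le)
      fix h
      have "\<bar>\<Sum>i\<in>UNIV. partial i f x * h $ i\<bar> \<le> (\<Sum>i\<in>UNIV. \<bar>partial i f x * h $ i\<bar>)" by (rule sum_abs)
      also have "\<dots> \<le> (\<Sum>i\<in>UNIV. \<bar>B i\<bar> * norm h)"
        unfolding abs_mult
        by (intro sum_mono mult_mono) (auto simp: component_le_norm_cart intro: order_trans[OF B[OF x] abs_ge_self])
      finally show "norm (\<Sum>i\<in>UNIV. partial i f x * h $ i) \<le> L * norm h"
        by (simp add: L_def sum_distrib_right)
    qed
  qed
  then show ?thesis by (rule that)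
qed

text \<open>A segment from the support to a point outside the larger ball crosses the sphere of
  radius \<open>R + 1\<close>, where \<open>f\<close> already vanishes and the given Lipschitz bound
  still applies.\<close>

lemma lipschitz_on_UNIV_of_support:
  fixes f :: "'a::euclidean_space \<Rightarrow> real"
  assumes L: "L-lipschitz_on (cball 0 (R + 1)) f" and z: "\<And>x. norm x > R \<Longrightarrow> f x = 0"
  shows "L-lipschitz_on UNIV f"
proof (rule lipschitz_onI)
  show L0: "0 \<le> L" using L by (rule lipschitz_on_nonneg)
  have main: "dist (f x) (f y) \<le> L * dist x y" if x: "norm x \<le> R" for x y
  proof (cases "norm y \<le> R + 1")
    case True
    then show ?thesis using x by (intro lipschitz_onD[OF L]) auto
  next
    case False
    have "\<exists>s\<in>{0..1}. norm (x + s *\<^sub>R (y - x)) = R + 1"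
      by (rule IVT'[of "\<lambda>s. norm (x + s *\<^sub>R (y - x))" 0 "R + 1" 1, simplified, THEN exE])
         (use x False in \<open>auto intro!: continuous_intros bexI\<close>)
    then obtain s where s: "0 \<le> s" "s \<le> 1" "norm (x + s *\<^sub>R (y - x)) = R + 1" by auto
    let ?z = "x + s *\<^sub>R (y - x)"
    have "dist (f x) (f y) = dist (f x) (f ?z)" using z[of y] z[of ?z] False s by simp
    also have "\<dots> \<le> L * dist x ?z" using s x by (intro lipschitz_onD[OF L]) auto
    also have "dist x ?z \<le> dist x y"
      using s by (simp add: dist_norm norm_minus_commute mult_left_le_one_le)
    finally show ?thesis using L0 by (simp add: mult_left_mono)
  qed
  fix x y
  show "dist (f x) (f y) \<le> L * dist x y"
  proof (cases "norm x \<le> R \<or> norm y \<le> R")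
    case True
    then show ?thesis using main[of x y] main[of y x] by (auto simp: dist_commute)
  next
    case False
    then show ?thesis using L0 z[of x] z[of y] by simp
  qed
qed

lemma partial_has_real_derivative:
  assumes "f differentiable (at x)"
  shows "((\<lambda>t. f (x + t *\<^sub>R axis i 1)) has_real_derivative partial i f x) (at 0)"
proof -
  have "((\<lambda>t. x + t *\<^sub>R axis i 1) has_derivative (\<lambda>t. t *\<^sub>R axis i 1)) (at 0)"
    by (auto intro!: derivative_eq_intros)
  moreover have "(f has_derivative (\<lambda>h. \<Sum>i\<in>UNIV. partial i f x * h $ i)) (at (x + 0 *\<^sub>R axis i 1))"
    using has_derivative_partial[OF assms] by simp
  ultimately have "((\<lambda>t. f (x + t *\<^sub>R axis i 1)) has_derivative
      (\<lambda>t. \<Sum>j\<in>UNIV. partial j f x * (t *\<^sub>R axis i 1) $ j)) (at 0)"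
    by (rule has_derivative_compose)
  moreover have "(\<lambda>t. \<Sum>j\<in>UNIV. partial j f x * (t *\<^sub>R axis i 1) $ j) = (*) (partial i f x)"
    by (simp add: fun_eq_iff axis_def if_distrib cong: if_cong)
  ultimately show ?thesis by (simp add: has_field_derivative_def)
qed

lemma integral_partial_zero:
  assumes f: "C1 f" and z: "\<And>x. norm x > R \<Longrightarrow> f x = 0"
  shows "(\<integral>x. partial i f x \<partial>lebesgue) = 0"
proof -
  obtain L where "L-lipschitz_on (cball 0 (R + 1)) f"
    by (rule C1_lipschitz_on[OF f compact_cball convex_cball])
  then have L: "L-lipschitz_on UNIV f" by (rule lipschitz_on_UNIV_of_support) (rule z)
  have m: "partial i f \<in> borel_measurable borel"
    by (intro borel_measurable_continuous_onI C1_partial_continuous f)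
  have "(\<integral>x. partial i f x \<partial>lborel) = 0"
    by (rule integral_directional_derivative_zero[where e="axis i 1", OF L z m])
       (simp_all add: partial_has_real_derivative C1_differentiable[OF f])
  then show ?thesis using m by (simp add: integral_completion)
qed

lemma test_function_supportE:
  assumes "\<phi> \<in> test_functions D"
  obtains R where "\<And>x. norm x > R \<Longrightarrow> \<phi> x = 0"
proof -
  obtain K where K: "smooth \<phi>" "compact K" "K \<subseteq> D" "\<And>x. x \<notin> K \<Longrightarrow> \<phi> x = 0"
    by (rule test_functionsE[OF assms]) (rule that)
  obtain R where "\<forall>x\<in>K. norm x \<le> R" using compact_imp_bounded[OF K(2)] by (auto simp: bounded_iff)
  then show ?thesis using K(4) by (intro that[of R]) force
qed

lemma integral_mult_test:
  assumes D: "D \<in> sets lebesgue" and \<phi>: "\<phi> \<in> test_functions D"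
  shows "(\<integral>x. g x * \<phi> x \<partial>lebesgue_on D) = (\<integral>x. g x * \<phi> x \<partial>lebesgue)"
proof -
  have "\<phi> x = 0" if "x \<notin> D" for x
    using test_functionsE[OF \<phi>] that by (metis subsetD)
  then have "(\<lambda>x. indicator D x *\<^sub>R (g x * \<phi> x)) = (\<lambda>x. g x * \<phi> x)"
    by (auto simp: indicator_def fun_eq_iff)
  then show ?thesis using D by (simp add: integral_restrict_space)
qed

lemma continuous_locally_integrable:
  fixes f :: "real^'n::finite \<Rightarrow> real"
  assumes "continuous_on UNIV f" shows "locally_integrable D f"
  unfolding locally_integrable_def
proof (intro allI impI, elim conjE)
  fix K :: "(real^'n) set" assume K: "compact K"
  have "f \<in> borel_measurable borel" using assms by (rule borel_measurable_continuous_onI)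
  then have "(\<lambda>x. indicator K x *\<^sub>R f x) \<in> borel_measurable lborel"
    using K by (intro borel_measurable_scaleR borel_measurable_indicator) (simp_all add: borel_compact)
  moreover have "integrable lborel (\<lambda>x. indicator K x *\<^sub>R f x)"
    by (rule borel_integrable_compact[OF K continuous_on_subset[OF assms subset_UNIV]])
  ultimately show "integrable (lebesgue_on K) f"
    using K by (simp add: integrable_restrict_space borel_compact integrable_completion)
qed

lemma integration_by_parts_test:
  fixes f :: "real^'n::finite \<Rightarrow> real"
  assumes f: "C1 f" and \<phi>: "\<phi> \<in> test_functions D" and D: "D \<in> sets lebesgue"
  shows "(\<integral>x. f x * partial i \<phi> x \<partial>lebesgue_on D) = - (\<integral>x. partial i f x * \<phi> x \<partial>lebesgue_on D)"
proof -
  have \<phi>1: "C1 \<phi>" using \<phi> by (intro smooth_C1 test_functions_smooth)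
  obtain R where R: "\<And>x. norm x > R \<Longrightarrow> \<phi> x = 0" by (rule test_function_supportE[OF \<phi>]) (rule that)
  have eq: "partial i (\<lambda>x. f x * \<phi> x) = (\<lambda>x. f x * partial i \<phi> x + partial i f x * \<phi> x)"
    by (rule ext) (simp add: partial_mult C1_differentiable f \<phi>1)
  have \<phi>U: "\<phi> \<in> test_functions UNIV" using \<phi> test_functions_mono[of D UNIV] by auto
  have i1: "integrable lebesgue (\<lambda>x. f x * partial i \<phi> x)"
    using integrable_mult_test[OF _ continuous_locally_integrable test_functions_partial[OF \<phi>U], of f i] f
    by (simp add: C1_continuous lebesgue_on_UNIV_eq)
  have i2: "integrable lebesgue (\<lambda>x. partial i f x * \<phi> x)"
    using integrable_mult_test[OF _ continuous_locally_integrable \<phi>U, of "partial i f"] f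
    by (simp add: C1_partial_continuous lebesgue_on_UNIV_eq)
  have "(\<integral>x. f x * partial i \<phi> x \<partial>lebesgue) + (\<integral>x. partial i f x * \<phi> x \<partial>lebesgue) = 0"
    using integral_partial_zero[OF C1_mult[OF f \<phi>1], of R i] R i1 i2 by (simp add: eq)
  then show ?thesis
    using integral_mult_test[OF D \<phi>] integral_mult_test[OF D test_functions_partial[OF \<phi>]] by simp
qed

subsection \<open>Weak derivatives and Sobolev spaces\<close>

lemma is_wderivD:
  assumes "is_wderiv D \<alpha> f g"
  shows "locally_integrable D f" "locally_integrable D g"
    and "\<phi> \<in> test_functions D \<Longrightarrow> (\<integral>x. f x * partials \<alpha> \<phi> x \<partial>lebesgue_on D)
          = (-1) ^ length \<alpha> * (\<integral>x. g x * \<phi> x \<partial>lebesgue_on D)"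
  using assms by (auto simp: is_wderiv_def)

lemma integral_mult_cong_AE:
  fixes f g h :: "'a \<Rightarrow> real"
  assumes "AE x in M. f x = g x"
    and "f \<in> borel_measurable M" "g \<in> borel_measurable M" "h \<in> borel_measurable M"
  shows "(\<integral>x. f x * h x \<partial>M) = (\<integral>x. g x * h x \<partial>M)"
  by (rule integral_cong_AE) (use assms in auto)

text \<open>Every statement about the chosen representative \<open>wderiv\<close> is reduced to a
  concrete weak derivative through this. Allowing \<open>f\<close> to change on a null set serves
  functions known to vanish only almost everywhere.\<close>

lemma is_wderiv_unique:
  assumes D: "open D" and f: "is_wderiv D \<alpha> f g" and f': "is_wderiv D \<alpha> f' g'"
    and ae: "AE x in lebesgue_on D. f x = f' x"
  shows "AE x in lebesgue_on D. g x = g' x"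
proof -
  have Ds: "D \<in> sets lebesgue" using D by (simp add: borel_open)
  have "AE x in lebesgue_on D. g x - g' x = 0"
  proof (rule fundamental_lemma[OF D])
    show "locally_integrable D (\<lambda>x. g x - g' x)"
      using f f' by (intro locally_integrable_diff) (auto dest: is_wderivD)
    fix \<phi> assume \<phi>: "\<phi> \<in> test_functions D"
    have "(\<integral>x. f x * partials \<alpha> \<phi> x \<partial>lebesgue_on D) = (\<integral>x. f' x * partials \<alpha> \<phi> x \<partial>lebesgue_on D)"
      using f f' \<phi> D
      by (intro integral_mult_cong_AE[OF ae] locally_integrable_measurable smooth_measurable_on smooth_partials)
         (auto dest: is_wderivD test_functions_smooth)
    then have "(\<integral>x. g x * \<phi> x \<partial>lebesgue_on D) = (\<integral>x. g' x * \<phi> x \<partial>lebesgue_on D)"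
      using is_wderivD(3)[OF f \<phi>] is_wderivD(3)[OF f' \<phi>] by simp
    moreover have "integrable (lebesgue_on D) (\<lambda>x. g x * \<phi> x)" "integrable (lebesgue_on D) (\<lambda>x. g' x * \<phi> x)"
      using is_wderivD(2)[OF f] is_wderivD(2)[OF f'] \<phi> Ds by (auto intro: integrable_mult_test)
    ultimately show "(\<integral>x. (g x - g' x) * \<phi> x \<partial>lebesgue_on D) = 0"
      by (simp add: left_diff_distrib)
  qed
  then show ?thesis by simp
qed

lemma wderiv_is_wderiv: "is_wderiv D \<alpha> f g \<Longrightarrow> is_wderiv D \<alpha> f (wderiv D \<alpha> f)"
  unfolding wderiv_def by (rule someI[of "is_wderiv D \<alpha> f"])

lemma wderiv_AE_eq:
  assumes "open D" "is_wderiv D \<alpha> f g"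
  shows "AE x in lebesgue_on D. wderiv D \<alpha> f x = g x"
  by (rule is_wderiv_unique[OF assms(1) wderiv_is_wderiv[OF assms(2)] assms(2)]) simp

lemma is_wderiv_diff:
  assumes D: "D \<in> sets lebesgue" and f: "is_wderiv D \<alpha> f g" and f': "is_wderiv D \<alpha> f' g'"
  shows "is_wderiv D \<alpha> (\<lambda>x. f x - f' x) (\<lambda>x. g x - g' x)"
  unfolding is_wderiv_def
proof (intro conjI ballI)
  fix \<phi> assume \<phi>: "\<phi> \<in> test_functions D"
  note i = integrable_mult_test[OF D]
  show "(\<integral>x. (f x - f' x) * partials \<alpha> \<phi> x \<partial>lebesgue_on D)
      = (-1) ^ length \<alpha> * (\<integral>x. (g x - g' x) * \<phi> x \<partial>lebesgue_on D)"
    using is_wderivD[OF f] is_wderivD[OF f'] \<phi>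
    by (simp add: left_diff_distrib i test_functions_partials right_diff_distrib)
qed (use is_wderivD[OF f] is_wderivD[OF f'] in \<open>auto intro: locally_integrable_diff\<close>)

lemma is_wderiv_Nil: "locally_integrable D f \<Longrightarrow> is_wderiv D [] f f"
  by (simp add: is_wderiv_def)

text \<open>Each integration by parts moves the outermost derivative, so the multi-index is reversed;
  the symmetry of second derivatives is never needed.\<close>

lemma smooth_is_wderiv:
  assumes D: "D \<in> sets lebesgue"
  shows "smooth f \<Longrightarrow> is_wderiv D \<alpha> f (partials (rev \<alpha>) f)"
proof -
  have "(\<integral>x. f x * partials \<alpha> \<phi> x \<partial>lebesgue_on D)
      = (-1) ^ length \<alpha> * (\<integral>x. partials (rev \<alpha>) f x * \<phi> x \<partial>lebesgue_on D)"
    if "smooth f" "\<phi> \<in> test_functions D" for \<phi> and f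
    using that
  proof (induction \<alpha> arbitrary: f)
    case (Cons i \<alpha>)
    have "(\<integral>x. f x * partial i (partials \<alpha> \<phi>) x \<partial>lebesgue_on D)
        = - (\<integral>x. partial i f x * partials \<alpha> \<phi> x \<partial>lebesgue_on D)"
      using Cons.prems by (intro integration_by_parts_test smooth_C1 test_functions_partials D)
    also have "\<dots> = - ((-1) ^ length \<alpha> * (\<integral>x. partials (rev \<alpha>) (partial i f) x * \<phi> x \<partial>lebesgue_on D))"
      using Cons by (simp add: smooth_partial)
    finally show ?case by (simp add: partials_Cons partials_append)
  qed simp
  then show "smooth f \<Longrightarrow> is_wderiv D \<alpha> f (partials (rev \<alpha>) f)"
    by (simp add: is_wderiv_def continuous_locally_integrable smooth_continuous_on smooth_partials)
qed

lemma L2_bounded: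
  assumes "finite_measure M" "f \<in> borel_measurable M" "\<And>x. x \<in> space M \<Longrightarrow> \<bar>f x\<bar> \<le> B"
  shows "f \<in> L2 M"
proof -
  interpret finite_measure M by fact
  have "(\<lambda>x. 1) \<in> L2 M" by (simp add: L2_def)
  from L2_bounded_mult[OF this assms(2,3)] show ?thesis by simp
qed

lemma finite_measure_lebesgue_on:
  assumes "open D" "bounded D" shows "finite_measure (lebesgue_on D)"
proof
  have "D \<in> lmeasurable" using assms by (simp add: bounded_set_imp_lmeasurable borel_open)
  then show "emeasure (lebesgue_on D) (space (lebesgue_on D)) \<noteq> \<infinity>"
    using emeasure_restrict_space[of D lebesgue D] by (simp add: fmeasurable_def less_top del: emeasure_completion)
qed

lemma continuous_bounded_on_closure:
  fixes f :: "real^'n::finite \<Rightarrow> real"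
  assumes "continuous_on UNIV f" "bounded D"
  obtains B where "\<And>x. x \<in> closure D \<Longrightarrow> \<bar>f x\<bar> \<le> B"
proof -
  have "bounded (f ` closure D)"
    using assms by (intro compact_imp_bounded compact_continuous_image continuous_on_subset[OF assms(1)]) auto
  then show ?thesis using that by (force simp: bounded_iff)
qed

lemma continuous_L2:
  fixes f :: "real^'n::finite \<Rightarrow> real"
  assumes f: "continuous_on UNIV f" and D: "open D" "bounded D"
  shows "f \<in> L2 (lebesgue_on D)"
proof -
  obtain B where B: "\<And>x. x \<in> closure D \<Longrightarrow> \<bar>f x\<bar> \<le> B"
    by (rule continuous_bounded_on_closure[OF f D(2)]) (rule that)
  have "f \<in> borel_measurable (lebesgue_on D)"
    using f by (intro measurable_restrict_space1 measurable_completion) (simp add: borel_measurable_continuous_onI)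
  then show ?thesis
    by (rule L2_bounded[OF finite_measure_lebesgue_on[OF D]]) (use B closure_subset in auto)
qed

lemma smooth_L2: "smooth f \<Longrightarrow> open D \<Longrightarrow> bounded D \<Longrightarrow> f \<in> L2 (lebesgue_on D)"
  by (intro continuous_L2 smooth_continuous_on)

lemma smooth_sobolev:
  assumes "smooth f" "open D" "bounded D" shows "f \<in> sobolev m D"
  unfolding sobolev_def
  using assms smooth_is_wderiv[of D f] by (auto intro!: smooth_L2 smooth_partials simp: borel_open)

lemma sobolev_L2: "f \<in> sobolev m D \<Longrightarrow> f \<in> L2 (lebesgue_on D)"
  by (simp add: sobolev_def)

lemma sobolev_wderiv:
  assumes f: "f \<in> sobolev m D" and \<alpha>: "length \<alpha> \<le> m" and D: "open D"
  shows "is_wderiv D \<alpha> f (wderiv D \<alpha> f)" and "wderiv D \<alpha> f \<in> L2 (lebesgue_on D)"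
proof -
  obtain g where g: "g \<in> L2 (lebesgue_on D)" "is_wderiv D \<alpha> f g"
    using f \<alpha> by (auto simp: sobolev_def)
  show w: "is_wderiv D \<alpha> f (wderiv D \<alpha> f)" by (rule wderiv_is_wderiv[OF g(2)])
  have "AE x in lebesgue_on D. g x = wderiv D \<alpha> f x"
    using wderiv_AE_eq[OF D g(2)] by eventually_elim simp
  then show "wderiv D \<alpha> f \<in> L2 (lebesgue_on D)"
    by (rule L2_cong_AE[OF g(1) locally_integrable_measurable[OF D is_wderivD(2)[OF w]]])
qed

lemma sobolev_mono: "f \<in> sobolev m D \<Longrightarrow> k \<le> m \<Longrightarrow> f \<in> sobolev k D"
  by (auto simp: sobolev_def)

lemma sobolevI:
  assumes "\<And>\<alpha>. length \<alpha> \<le> m \<Longrightarrow> is_wderiv D \<alpha> f (g \<alpha>)"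
    and "\<And>\<alpha>. length \<alpha> \<le> m \<Longrightarrow> g \<alpha> \<in> L2 (lebesgue_on D)" "f \<in> L2 (lebesgue_on D)"
  shows "f \<in> sobolev m D"
  using assms by (auto simp: sobolev_def)

lemma finite_multi_indices: "finite {\<alpha> :: 'n::finite list. length \<alpha> \<le> m}"
  using finite_lists_length_le[of "UNIV :: 'n set" m] by simp

text \<open>The left side contains a fresh choice of derivative for the difference; it agrees with
  the difference of the derivatives only almost everywhere, which the integrals do not see.\<close>

lemma sobolev_norm_diff:
  assumes D: "open D" and \<phi>: "smooth \<phi>" and f: "f \<in> sobolev m D"
  shows "sobolev_norm m D (\<lambda>x. \<phi> x - f x) =
    sqrt (\<Sum>\<alpha>\<in>{\<alpha>. length \<alpha> \<le> m}. \<integral>x. (partials (rev \<alpha>) \<phi> x - wderiv D \<alpha> f x)\<^sup>2 \<partial>lebesgue_on D)"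
proof -
  have Ds: "D \<in> sets lebesgue" using D by (simp add: borel_open)
  have "(\<integral>x. (wderiv D \<alpha> (\<lambda>x. \<phi> x - f x) x)\<^sup>2 \<partial>lebesgue_on D)
     = (\<integral>x. (partials (rev \<alpha>) \<phi> x - wderiv D \<alpha> f x)\<^sup>2 \<partial>lebesgue_on D)" if \<alpha>: "length \<alpha> \<le> m" for \<alpha>
  proof (rule integral_cong_AE)
    have w: "is_wderiv D \<alpha> (\<lambda>x. \<phi> x - f x) (\<lambda>x. partials (rev \<alpha>) \<phi> x - wderiv D \<alpha> f x)"
      by (intro is_wderiv_diff Ds smooth_is_wderiv \<phi> sobolev_wderiv[OF f \<alpha> D])
    show "AE x in lebesgue_on D. (wderiv D \<alpha> (\<lambda>x. \<phi> x - f x) x)\<^sup>2 = (partials (rev \<alpha>) \<phi> x - wderiv D \<alpha> f x)\<^sup>2"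
      using wderiv_AE_eq[OF D w] by eventually_elim simp
    have [measurable]: "wderiv D \<alpha> (\<lambda>x. \<phi> x - f x) \<in> borel_measurable (lebesgue_on D)"
      by (rule locally_integrable_measurable[OF D is_wderivD(2)[OF wderiv_is_wderiv[OF w]]])
    show "(\<lambda>x. (wderiv D \<alpha> (\<lambda>x. \<phi> x - f x) x)\<^sup>2) \<in> borel_measurable (lebesgue_on D)" by measurable
    have [measurable]: "(\<lambda>x. partials (rev \<alpha>) \<phi> x - wderiv D \<alpha> f x) \<in> borel_measurable (lebesgue_on D)"
      by (rule locally_integrable_measurable[OF D is_wderivD(2)[OF w]])
    show "(\<lambda>x. (partials (rev \<alpha>) \<phi> x - wderiv D \<alpha> f x)\<^sup>2) \<in> borel_measurable (lebesgue_on D)" by measurable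
  qed
  then show ?thesis by (simp add: sobolev_norm_def)
qed

lemma sobolev_norm_tendsto_0_iff:
  assumes D: "open D" and \<phi>: "\<And>k. smooth (\<phi> k)" and f: "f \<in> sobolev m D"
  shows "(\<lambda>k::nat. sobolev_norm m D (\<lambda>x. \<phi> k x - f x)) \<longlonglongrightarrow> 0 \<longleftrightarrow>
    (\<forall>\<alpha>. length \<alpha> \<le> m \<longrightarrow>
      (\<lambda>k. \<integral>x. (partials (rev \<alpha>) (\<phi> k) x - wderiv D \<alpha> f x)\<^sup>2 \<partial>lebesgue_on D) \<longlonglongrightarrow> 0)"
    (is "?l \<longleftrightarrow> (\<forall>\<alpha>. length \<alpha> \<le> m \<longrightarrow> (?I \<alpha> \<longlonglongrightarrow> 0))")
proof -
  have nn: "0 \<le> ?I \<alpha> k" for \<alpha> k by (rule integral_nonneg_AE) simp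
  let ?S = "\<lambda>k. \<Sum>\<alpha>\<in>{\<alpha>. length \<alpha> \<le> m}. ?I \<alpha> k"
  have "?l \<longleftrightarrow> (\<lambda>k. sqrt (?S k)) \<longlonglongrightarrow> 0" by (simp add: sobolev_norm_diff[OF D \<phi> f])
  also have "\<dots> \<longleftrightarrow> ?S \<longlonglongrightarrow> 0"
  proof
    assume "(\<lambda>k. sqrt (?S k)) \<longlonglongrightarrow> 0"
    then have "(\<lambda>k. (sqrt (?S k))\<^sup>2) \<longlonglongrightarrow> 0\<^sup>2" by (rule tendsto_power)
    then show "?S \<longlonglongrightarrow> 0" using nn by (simp add: sum_nonneg)
  next
    assume "?S \<longlonglongrightarrow> 0"
    then show "(\<lambda>k. sqrt (?S k)) \<longlonglongrightarrow> 0" using tendsto_real_sqrt by fastforce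
  qed
  also have "\<dots> \<longleftrightarrow> (\<forall>\<alpha>. length \<alpha> \<le> m \<longrightarrow> (?I \<alpha> \<longlonglongrightarrow> 0))"
  proof (intro iffI allI impI)
    fix \<alpha> :: "'a list" assume S: "?S \<longlonglongrightarrow> 0" and \<alpha>: "length \<alpha> \<le> m"
    have le: "?I \<alpha> k \<le> ?S k" for k
      by (rule member_le_sum[of \<alpha>]) (use \<alpha> nn finite_multi_indices in auto)
    show "?I \<alpha> \<longlonglongrightarrow> 0"
      by (rule tendsto_sandwich[OF _ _ tendsto_const S]) (use nn le in \<open>simp_all add: always_eventually\<close>)
  next
    assume "\<forall>\<alpha>. length \<alpha> \<le> m \<longrightarrow> (?I \<alpha> \<longlonglongrightarrow> 0)"
    then have "?S \<longlonglongrightarrow> (\<Sum>\<alpha>\<in>{\<alpha> :: 'a list. length \<alpha> \<le> m}. 0)" by (intro tendsto_sum) auto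
    then show "?S \<longlonglongrightarrow> 0" by simp
  qed
  finally show ?thesis .
qed

subsection \<open>Convex functions have directional derivatives almost everywhere\<close>

lemma convex_slope_mono:
  fixes f :: "'a::real_vector \<Rightarrow> real"
  assumes f: "convex_on UNIV f" and st: "0 < s" "s \<le> t"
  shows "(f (x + s *\<^sub>R e) - f x) / s \<le> (f (x + t *\<^sub>R e) - f x) / t"
proof -
  have "f ((1 - s/t) *\<^sub>R x + (s/t) *\<^sub>R (x + t *\<^sub>R e)) \<le> (1 - s/t) * f x + (s/t) * f (x + t *\<^sub>R e)"
    using st by (intro convex_onD[OF f]) auto
  moreover have "(1 - s/t) *\<^sub>R x + (s/t) *\<^sub>R (x + t *\<^sub>R e) = x + s *\<^sub>R e"
  proof -
    have "(1 - s/t) *\<^sub>R x + (s/t) *\<^sub>R (x + t *\<^sub>R e) = x + ((s/t) * t) *\<^sub>R e"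
      unfolding scaleR_add_right scaleR_diff_left scaleR_scaleR by simp
    then show ?thesis using st by simp
  qed
  ultimately have "f (x + s *\<^sub>R e) \<le> (1 - s/t) * f x + (s/t) * f (x + t *\<^sub>R e)" by metis
  then have "f (x + s *\<^sub>R e) - f x \<le> s * ((f (x + t *\<^sub>R e) - f x) / t)"
    by (simp add: left_diff_distrib diff_divide_distrib right_diff_distrib)
  then show ?thesis using st by (simp add: pos_divide_le_eq mult.commute)
qed

lemma convex_slope_left_le_right:
  fixes f :: "'a::real_vector \<Rightarrow> real"
  assumes f: "convex_on UNIV f" and st: "0 < s" "0 < t"
  shows "(f x - f (x - s *\<^sub>R e)) / s \<le> (f (x + t *\<^sub>R e) - f x) / t"
proof -
  define u where "u = s / (s + t)"
  have u: "0 \<le> u" "u \<le> 1" "(s + t) * u = s" "(s + t) * (1 - u) = t"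
    using st by (auto simp: u_def field_simps)
  have "f ((1 - u) *\<^sub>R (x - s *\<^sub>R e) + u *\<^sub>R (x + t *\<^sub>R e)) \<le> (1 - u) * f (x - s *\<^sub>R e) + u * f (x + t *\<^sub>R e)"
    using u by (intro convex_onD[OF f]) auto
  moreover have "(1 - u) *\<^sub>R (x - s *\<^sub>R e) + u *\<^sub>R (x + t *\<^sub>R e) = x + ((s + t) * u - s) *\<^sub>R e"
    by (simp add: algebra_simps)
  ultimately have "f x \<le> (1 - u) * f (x - s *\<^sub>R e) + u * f (x + t *\<^sub>R e)" using u by simp
  then have "(s + t) * f x \<le> (s + t) * ((1 - u) * f (x - s *\<^sub>R e) + u * f (x + t *\<^sub>R e))"
    using st by (intro mult_left_mono) auto
  also have "\<dots> = t * f (x - s *\<^sub>R e) + s * f (x + t *\<^sub>R e)"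
    using u(3,4) by (simp add: distrib_left mult.assoc[symmetric])
  finally have "t * (f x - f (x - s *\<^sub>R e)) \<le> s * (f (x + t *\<^sub>R e) - f x)" by (simp add: algebra_simps)
  then show ?thesis using st by (simp add: field_simps)
qed

text \<open>Difference quotients of a convex function are monotone in the step. Hence the one-sided
  limits along the steps 1/(k+1) enclose the quotients for all small real steps.\<close>

lemma convex_directional_derivative:
  fixes f :: "'a::real_vector \<Rightarrow> real"
  assumes f: "convex_on UNIV f"
    and up: "(\<lambda>k. (f (x + (1 / real (Suc k)) *\<^sub>R e) - f x) * real (Suc k)) \<longlonglongrightarrow> d"
    and lo: "(\<lambda>k. (f x - f (x - (1 / real (Suc k)) *\<^sub>R e)) * real (Suc k)) \<longlonglongrightarrow> d"
  shows "((\<lambda>t. f (x + t *\<^sub>R e)) has_real_derivative d) (at 0)"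
proof -
  define q where "q t = (f (x + t *\<^sub>R e) - f x) / t" for t
  have mono: "q s \<le> q t" if "0 < s" "s \<le> t" for s t
    unfolding q_def by (rule convex_slope_mono[OF f that])
  have mono': "q (-t) \<le> q (-s)" if "0 < s" "s \<le> t" for s t
    using convex_slope_mono[OF f that, of x "- e"] that by (simp add: q_def field_simps)
  have up: "(\<lambda>k. q (1 / real (Suc k))) \<longlonglongrightarrow> d" using up by (simp add: q_def)
  have lo: "(\<lambda>k. q (- (1 / real (Suc k)))) \<longlonglongrightarrow> d"
    using lo by (simp add: q_def minus_divide_left[symmetric] field_simps)
  have small: "eventually (\<lambda>k. 1 / real (Suc k) \<le> t) sequentially" if "t > 0" for t
    using order_tendstoD(2)[OF LIMSEQ_Suc[OF lim_1_over_n] that] by eventually_elim simp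
  have ge: "d \<le> q t" if "t > 0" for t
  proof (rule tendsto_upperbound[OF up])
    show "eventually (\<lambda>k. q (1 / real (Suc k)) \<le> q t) sequentially"
      using small[OF that] by eventually_elim (rule mono, auto)
  qed simp
  have le: "q (-t) \<le> d" if "t > 0" for t
  proof (rule tendsto_lowerbound[OF lo])
    show "eventually (\<lambda>k. q (- t) \<le> q (- (1 / real (Suc k)))) sequentially"
      using small[OF that] by eventually_elim (rule mono', auto)
  qed simp
  have "(q \<longlongrightarrow> d) (at 0)"
  proof (rule tendstoI)
    fix \<epsilon> :: real assume \<epsilon>: "\<epsilon> > 0"
    have "eventually (\<lambda>k. q (1 / real (Suc k)) < d + \<epsilon> \<and> q (- (1 / real (Suc k))) > d - \<epsilon>) sequentially"
      using order_tendstoD(2)[OF up, of "d + \<epsilon>"] order_tendstoD(1)[OF lo, of "d - \<epsilon>"] \<epsilon>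
      by (simp add: eventually_conj)
    then obtain k where k: "q (1 / real (Suc k)) < d + \<epsilon>" "q (- (1 / real (Suc k))) > d - \<epsilon>"
      by (auto simp: eventually_sequentially)
    show "eventually (\<lambda>t. dist (q t) d < \<epsilon>) (at 0)"
      unfolding eventually_at
    proof (intro exI[of _ "1 / real (Suc k)"] conjI ballI impI)
      fix t :: real assume t: "t \<noteq> 0 \<and> dist t 0 < 1 / real (Suc k)"
      show "dist (q t) d < \<epsilon>"
      proof (cases "t > 0")
        case True
        then show ?thesis using mono[of t "1 / real (Suc k)"] ge[of t] k t by (simp add: dist_real_def)
      next
        case False
        then show ?thesis using mono'[of "-t" "1 / real (Suc k)"] le[of "-t"] k t by (simp add: dist_real_def)
      qed
    qed simp
  qed
  then show ?thesis unfolding q_def by (simp add: has_field_derivative_iff)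
qed

text \<open>Instead of slicing into lines: the one-sided derivatives \<open>lo \<le> up\<close> satisfy
  \<open>up x \<le> lo (x + h *\<^sub>R e)\<close>, so by translation they have the same integral against any continuous weight.\<close>

theorem convex_lipschitz_AE_directional_derivative:
  fixes f :: "'a::euclidean_space \<Rightarrow> real"
  assumes f: "convex_on UNIV f" and L: "L-lipschitz_on UNIV f"
  obtains d where "d \<in> borel_measurable borel"
    and "AE x in lborel. ((\<lambda>t. f (x + t *\<^sub>R e)) has_real_derivative d x) (at 0)"
proof -
  have fm[measurable]: "f \<in> borel_measurable borel"
    using lipschitz_on_continuous_on[OF L] by (rule borel_measurable_continuous_onI)
  define up where "up k x = (f (x + (1 / real (Suc k)) *\<^sub>R e) - f x) * real (Suc k)" for k x
  define lo where "lo k x = (f x - f (x - (1 / real (Suc k)) *\<^sub>R e)) * real (Suc k)" for k x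
  have lo_up: "lo k x \<le> up l x" for k l x
    using convex_slope_left_le_right[OF f, of "1 / real (Suc k)" "1 / real (Suc l)" x e]
    by (simp add: up_def lo_def)
  have inv: "1 / real (Suc l) \<le> 1 / real (Suc k)" if "k \<le> l" for k l using that by (simp add: frac_le)
  have dec: "decseq (\<lambda>k. up k x)" for x
    unfolding decseq_def using convex_slope_mono[OF f _ inv, of _ _ x e] by (simp add: up_def)
  have inc: "incseq (\<lambda>k. lo k x)" for x
    unfolding incseq_def
  proof (intro allI impI)
    fix m n :: nat assume "m \<le> n"
    from convex_slope_mono[OF f _ inv[OF this], of x "- e"] show "lo m x \<le> lo n x"
      by (simp add: lo_def left_diff_distrib)
  qed
  define U where "U x = lim (\<lambda>k. up k x)" for x
  define W where "W x = lim (\<lambda>k. lo k x)" for x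
  have [measurable]: "up k \<in> borel_measurable borel" "lo k \<in> borel_measurable borel" for k
    unfolding up_def lo_def by measurable
  have Um[measurable]: "U \<in> borel_measurable borel" and Wm[measurable]: "W \<in> borel_measurable borel"
    unfolding U_def W_def by measurable
  have U: "(\<lambda>k. up k x) \<longlonglongrightarrow> U x" "U x \<le> up k x" for x k
  proof -
    obtain l where l: "(\<lambda>k. up k x) \<longlonglongrightarrow> l" "\<forall>i. l \<le> up i x"
      by (rule decseq_convergent[OF dec, where B="lo 0 x"]) (use lo_up in auto)
    then show "(\<lambda>k. up k x) \<longlonglongrightarrow> U x" "U x \<le> up k x" using limI[OF l(1)] by (auto simp: U_def)
  qed
  have W: "(\<lambda>k. lo k x) \<longlonglongrightarrow> W x" "lo k x \<le> W x" for x k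
  proof -
    obtain l where l: "(\<lambda>k. lo k x) \<longlonglongrightarrow> l" "\<forall>i. lo i x \<le> l"
      by (rule incseq_convergent[OF inc, where B="up 0 x"]) (use lo_up in auto)
    then show "(\<lambda>k. lo k x) \<longlonglongrightarrow> W x" "lo k x \<le> W x" using limI[OF l(1)] by (auto simp: W_def)
  qed
  have WU: "W x \<le> U x" for x
    by (rule LIMSEQ_le[OF W(1) U(1)]) (use lo_up in auto)
  \<comment> \<open>A forward quotient is the backward quotient at the shifted point, so
    \<open>U x \<le> up k x\<close> continues to \<open>lo k\<close> and then to \<open>W\<close> at
    that point.\<close>
  have ulo: "up k x = lo k (x + (1 / real (Suc k)) *\<^sub>R e)" for k x by (simp add: up_def lo_def)
  have bnd: "\<bar>f (x + h) - f x\<bar> \<le> L * norm h" for x h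
    using lipschitz_onD[OF L, of "x + h" x] by (simp add: dist_norm)
  have upB: "\<bar>up k x\<bar> \<le> L * norm e" for k x
  proof -
    have "\<bar>up k x\<bar> \<le> (L * norm ((1 / real (Suc k)) *\<^sub>R e)) * real (Suc k)"
      unfolding up_def abs_mult using lipschitz_on_nonneg[OF L] by (intro mult_mono bnd) auto
    then show ?thesis by simp
  qed
  have loB: "\<bar>lo k x\<bar> \<le> L * norm e" for k x
    using upB[of k "x - (1 / real (Suc k)) *\<^sub>R e"] by (simp add: ulo)
  have UB: "\<bar>U x\<bar> \<le> L * norm e" for x
    by (rule tendsto_upperbound[OF tendsto_rabs[OF U(1)]]) (use upB in auto)
  have WB: "\<bar>W x\<bar> \<le> L * norm e" for x
    by (rule tendsto_upperbound[OF tendsto_rabs[OF W(1)]]) (use loB in auto)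
  have eqR: "AE x in lborel. norm x < r \<longrightarrow> U x = W x" for r :: real
  proof -
    \<comment> \<open>Compact support makes the integrals finite, continuity lets shifts tend to 0,
      and positivity inside the ball turns equality of integrals into equality almost everywhere
      there.\<close>
    define w where "w x = max 0 (r - norm x)" for x :: 'a
    have wm[measurable]: "w \<in> borel_measurable borel" unfolding w_def by measurable
    have w0: "w x \<ge> 0" "\<bar>w x\<bar> \<le> \<bar>r\<bar>" "norm x > \<bar>r\<bar> \<Longrightarrow> w x = 0" for x
      unfolding w_def using norm_ge_zero[of x] by arith+
    have ind: "integrable lborel (\<lambda>x::'a. C * indicator (cball 0 s) x :: real)" for C and s :: real
      using emeasure_compact_finite[of "cball (0::'a) s"] by (auto intro!: integrable_real_indicator)
    have int: "integrable lborel (\<lambda>x. v x * g x)"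
      if [measurable]: "v \<in> borel_measurable borel" "g \<in> borel_measurable borel"
        and v: "\<And>x. \<bar>v x\<bar> \<le> \<bar>r\<bar>" "\<And>x. norm x > s \<Longrightarrow> v x = 0" and g: "\<And>x. \<bar>g x\<bar> \<le> L * norm e"
      for v g :: "'a \<Rightarrow> real" and s
    proof (rule Bochner_Integration.integrable_bound)
      show "integrable lborel (\<lambda>x::'a. (\<bar>r\<bar> * (L * norm e)) * indicator (cball 0 s) x :: real)" by (rule ind)
      have "\<bar>v x * g x\<bar> \<le> \<bar>(\<bar>r\<bar> * (L * norm e)) * indicator (cball 0 s) x\<bar>" for x
        using v[of x] g[of x] lipschitz_on_nonneg[OF L] unfolding abs_mult
        by (cases "norm x \<le> s") (auto intro!: mult_mono)
      then show "AE x in lborel. norm (v x * g x) \<le> norm ((\<bar>r\<bar> * (L * norm e)) * indicator (cball 0 s) x)"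
        by simp
    qed measurable
    have iU: "integrable lborel (\<lambda>x. w x * U x)" by (rule int[OF _ _ w0(2,3) UB]) measurable
    have iW: "integrable lborel (\<lambda>x. w x * W x)" by (rule int[OF _ _ w0(2,3) WB]) measurable
    have step: "(\<integral>x. w x * U x \<partial>lborel) \<le> (\<integral>x. w (x - (1 / real (Suc k)) *\<^sub>R e) * W x \<partial>lborel)" for k
    proof -
      let ?c = "(1 / real (Suc k)) *\<^sub>R e"
      have "(\<integral>x. w x * U x \<partial>lborel) \<le> (\<integral>x. w x * W (?c + x) \<partial>lborel)"
      proof (rule integral_mono[OF iU])
        show "integrable lborel (\<lambda>x. w x * W (?c + x))" by (rule int[OF _ _ w0(2,3) WB]) measurable
        show "w x * U x \<le> w x * W (?c + x)" for x
          using U(2)[of x k] W(2)[of k "?c + x"] w0(1)[of x] ulo[of k x]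
          by (intro mult_left_mono) (auto simp: add.commute)
      qed
      also have "\<dots> = (\<integral>x. w ((?c + x) - ?c) * W (?c + x) \<partial>lborel)" by simp
      \<comment> \<open>The shift is moved from \<open>W\<close>, of which no continuity is known,
        to the continuous weight.\<close>
      also have "\<dots> = (\<integral>x. w (x - ?c) * W x \<partial>lborel)"
        by (rule lborel_integral_translate[where f="\<lambda>x. w (x - ?c) * W x"]) measurable
      finally show ?thesis .
    qed
    have "(\<lambda>k. \<integral>x. w (x - (1 / real (Suc k)) *\<^sub>R e) * W x \<partial>lborel) \<longlonglongrightarrow> (\<integral>x. w x * W x \<partial>lborel)"
    proof (rule integral_dominated_convergence)
      show "integrable lborel (\<lambda>x::'a. (\<bar>r\<bar> * (L * norm e)) * indicator (cball 0 (\<bar>r\<bar> + norm e)) x :: real)"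
        by (rule ind)
      have lim: "(\<lambda>k. x - (1 / real (Suc k)) *\<^sub>R e) \<longlonglongrightarrow> x - 0 *\<^sub>R e" for x
        by (intro tendsto_intros LIMSEQ_Suc[OF lim_1_over_n])
      have "continuous_on UNIV w" unfolding w_def by (intro continuous_intros)
      then have "(\<lambda>k. w (x - (1 / real (Suc k)) *\<^sub>R e)) \<longlonglongrightarrow> w x" for x
        using continuous_on_tendsto_compose[OF _ lim] by fastforce
      then show "AE x in lborel. (\<lambda>k. w (x - (1 / real (Suc k)) *\<^sub>R e) * W x) \<longlonglongrightarrow> w x * W x"
        by (intro AE_I2 tendsto_intros)
      show "AE x in lborel. norm (w (x - (1 / real (Suc k)) *\<^sub>R e) * W x)
           \<le> (\<bar>r\<bar> * (L * norm e)) * indicator (cball 0 (\<bar>r\<bar> + norm e)) x" for k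
      proof (rule AE_I2)
        fix x :: 'a
        let ?c = "(1 / real (Suc k)) *\<^sub>R e"
        have "norm ?c \<le> norm e" using mult_left_mono[of 1 "1 + real k" "norm e"] by (simp add: divide_simps)
        moreover have "norm x \<le> norm (x - ?c) + norm ?c" using norm_triangle_sub[of x ?c] by linarith
        ultimately have "w (x - ?c) = 0" if "norm x > \<bar>r\<bar> + norm e"
          using w0(3)[of "x - ?c"] that by linarith
        then show "norm (w (x - ?c) * W x) \<le> (\<bar>r\<bar> * (L * norm e)) * indicator (cball 0 (\<bar>r\<bar> + norm e)) x"
          using w0(2)[of "x - ?c"] WB[of x] lipschitz_on_nonneg[OF L]
          by (cases "norm x \<le> \<bar>r\<bar> + norm e") (auto simp: abs_mult intro!: mult_mono)
      qed
    qed measurable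
    then have "(\<integral>x. w x * U x \<partial>lborel) \<le> (\<integral>x. w x * W x \<partial>lborel)"
      by (rule tendsto_lowerbound) (use step in auto)
    then have "(\<integral>x. w x * U x - w x * W x \<partial>lborel) \<le> 0" using iU iW by simp
    moreover have nn: "0 \<le> w x * U x - w x * W x" for x
      using mult_left_mono[OF WU w0(1)] by simp
    ultimately have "(\<integral>x. w x * U x - w x * W x \<partial>lborel) = 0"
      by (intro antisym integral_nonneg_AE AE_I2)
    then have "AE x in lborel. w x * U x - w x * W x = 0"
      using iU iW nn by (subst (asm) integral_nonneg_eq_0_iff_AE) auto
    then show ?thesis by eventually_elim (auto simp: w_def max_def split: if_splits)
  qed
  have "AE x in lborel. \<forall>n::nat. norm x < real n \<longrightarrow> U x = W x"
    unfolding AE_all_countable using eqR by blast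
  then have "AE x in lborel. U x = W x"
    by eventually_elim (use reals_Archimedean2 in blast)
  then have "AE x in lborel. ((\<lambda>t. f (x + t *\<^sub>R e)) has_real_derivative U x) (at 0)"
  proof eventually_elim
    case (elim x)
    show ?case
      by (rule convex_directional_derivative[OF f])
         (use U(1)[of x] W(1)[of x] elim in \<open>auto simp: up_def lo_def\<close>)
  qed
  with Um show ?thesis by (rule that)
qed

subsection \<open>The gauge of a convex body\<close>

locale convex_body =
  fixes D :: "(real^'n::finite) set" and a :: "real^'n" and r R :: real
  assumes D: "open D" "convex D" "bounded D"
    and r: "0 < r" "cball a r \<subseteq> D" and R: "\<And>y. y \<in> closure D \<Longrightarrow> norm (y - a) \<le> R"
begin

definition "polar = {n. \<forall>y\<in>D. n \<bullet> (y - a) \<le> 1}"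

text \<open>The Minkowski gauge of \<open>D\<close> seen from \<open>a\<close>, written as the
  support function of the polar body. Convexity and the Lipschitz bound are then immediate, and the
  maximising functionals are multiples of outward normals.\<close>

definition "j x = (SUP n\<in>polar. n \<bullet> (x - a))"

definition "radial x = a + (1 / j x) *\<^sub>R (x - a)"

lemma a_in: "a \<in> D" using r by auto

lemma rR: "r \<le> R" "0 < R"
proof -
  obtain i :: 'n where True by simp
  have "a + r *\<^sub>R axis i 1 \<in> D" using r by (intro subsetD[OF r(2)]) (auto simp: dist_norm)
  then have "norm (a + r *\<^sub>R axis i 1 - a) \<le> R" by (intro R closure_subset[THEN subsetD])
  then show "r \<le> R" "0 < R" using r by auto
qed

lemma polar_norm: "n \<in> polar \<Longrightarrow> norm n \<le> 1 / r"
proof -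
  assume n: "n \<in> polar"
  show ?thesis
  proof (cases "n = 0")
    case False
    have "a + (r / norm n) *\<^sub>R n \<in> D" using r False by (intro subsetD[OF r(2)]) (auto simp: dist_norm)
    then have "n \<bullet> ((r / norm n) *\<^sub>R n) \<le> 1" using n by (force simp: polar_def)
    then have "r * norm n \<le> 1" using False by (simp add: dot_square_norm power2_eq_square)
    then show ?thesis using r by (simp add: field_simps)
  qed (use r in simp)
qed

lemma polar_0: "0 \<in> polar" by (simp add: polar_def)

lemma polar_compact: "compact polar"
proof -
  have "polar = (\<Inter>y\<in>D. {n. n \<bullet> (y - a) \<le> 1})" by (auto simp: polar_def)
  moreover have "closed (\<Inter>y\<in>D. {n. n \<bullet> (y - a) \<le> 1})"
    by (intro closed_INT ballI closed_Collect_le continuous_intros)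
  ultimately have "closed polar" by simp
  moreover have "bounded polar" using polar_norm by (auto simp: bounded_iff)
  ultimately show ?thesis by (simp add: compact_eq_bounded_closed)
qed

lemma j_attained: "\<exists>n\<in>polar. j x = n \<bullet> (x - a)" and j_upper: "n \<in> polar \<Longrightarrow> n \<bullet> (x - a) \<le> j x"
proof -
  have "\<exists>n\<in>polar. \<forall>m\<in>polar. m \<bullet> (x - a) \<le> n \<bullet> (x - a)"
    by (rule continuous_attains_sup[OF polar_compact]) (use polar_0 in \<open>auto intro!: continuous_intros\<close>)
  then obtain n where n: "n \<in> polar" "\<And>m. m \<in> polar \<Longrightarrow> m \<bullet> (x - a) \<le> n \<bullet> (x - a)" by blast
  have "j x = n \<bullet> (x - a)"
    unfolding j_def by (rule cSup_eq_maximum) (use n in auto)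
  then show "\<exists>n\<in>polar. j x = n \<bullet> (x - a)" "n' \<in> polar \<Longrightarrow> n' \<bullet> (x - a) \<le> j x" for n'
    using n by auto
qed

lemma j_nonneg: "0 \<le> j x" using j_upper[OF polar_0, of x] by simp

lemma j_convex: "convex_on UNIV j"
proof (rule convex_onI)
  fix t :: real and x y assume t: "0 < t" "t < 1"
  obtain n where n: "n \<in> polar" "j ((1 - t) *\<^sub>R x + t *\<^sub>R y) = n \<bullet> ((1 - t) *\<^sub>R x + t *\<^sub>R y - a)"
    using j_attained by blast
  have "(1 - t) *\<^sub>R x + t *\<^sub>R y - a = (1 - t) *\<^sub>R (x - a) + t *\<^sub>R (y - a)" by (simp add: algebra_simps)
  then have "j ((1 - t) *\<^sub>R x + t *\<^sub>R y) = (1 - t) * (n \<bullet> (x - a)) + t * (n \<bullet> (y - a))"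
    using n by (simp add: inner_add_right)
  also have "\<dots> \<le> (1 - t) * j x + t * j y"
    using t j_upper[OF n(1)] by (intro add_mono mult_left_mono) auto
  finally show "j ((1 - t) *\<^sub>R x + t *\<^sub>R y) \<le> (1 - t) * j x + t * j y" .
qed simp

lemma j_lipschitz: "(1 / r)-lipschitz_on UNIV j"
proof (rule lipschitz_onI)
  have one: "j x - j y \<le> 1 / r * dist x y" for x y
  proof -
    obtain n where n: "n \<in> polar" "j x = n \<bullet> (x - a)" using j_attained by blast
    have "j x - j y \<le> n \<bullet> (x - a) - n \<bullet> (y - a)" using n j_upper[OF n(1), of y] by simp
    also have "\<dots> = n \<bullet> (x - y)" by (simp add: inner_diff_right)
    also have "\<dots> \<le> norm n * norm (x - y)" by (rule norm_cauchy_schwarz)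
    also have "\<dots> \<le> 1 / r * dist x y" unfolding dist_norm by (intro mult_right_mono polar_norm n) auto
    finally show ?thesis .
  qed
  show "dist (j x) (j y) \<le> 1 / r * dist x y" for x y
    using one[of x y] one[of y x] by (simp add: dist_real_def dist_commute abs_le_iff)
qed (use r in simp)

lemma j_continuous: "continuous_on S j"
  using lipschitz_on_continuous_on[OF j_lipschitz] continuous_on_subset by blast

lemma j_measurable [measurable]: "j \<in> borel_measurable borel"
  by (intro borel_measurable_continuous_onI j_continuous)

lemma j_scale: assumes "0 \<le> t" shows "j (a + t *\<^sub>R v) = t * j (a + v)"
proof (rule antisym)
  obtain n where n: "n \<in> polar" "j (a + t *\<^sub>R v) = n \<bullet> (a + t *\<^sub>R v - a)" using j_attained by blast
  show "j (a + t *\<^sub>R v) \<le> t * j (a + v)"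
    using n(2) mult_left_mono[OF j_upper[OF n(1), of "a + v"] assms] by simp
  obtain m where m: "m \<in> polar" "j (a + v) = m \<bullet> (a + v - a)" using j_attained by blast
  show "t * j (a + v) \<le> j (a + t *\<^sub>R v)" using m(2) j_upper[OF m(1), of "a + t *\<^sub>R v"] by simp
qed

text \<open>By Cauchy-Schwarz the functional in direction \<open>x - a\<close> with norm 1/R belongs
  to the polar body.\<close>

lemma norm_le_j: "norm (x - a) \<le> R * j x"
proof (cases "x = a")
  case True
  then show ?thesis using j_nonneg rR by simp
next
  case False
  let ?n = "(1 / (R * norm (x - a))) *\<^sub>R (x - a)"
  have "?n \<in> polar"
    unfolding polar_def
  proof (intro CollectI ballI)
    fix y assume "y \<in> D"
    then have "norm (y - a) \<le> R" using R closure_subset by blast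
    have "(x - a) \<bullet> (y - a) \<le> norm (x - a) * norm (y - a)" by (rule norm_cauchy_schwarz)
    also have "\<dots> \<le> norm (x - a) * R" using \<open>norm (y - a) \<le> R\<close> by (intro mult_left_mono) auto
    finally show "?n \<bullet> (y - a) \<le> 1"
      unfolding inner_scaleR_left using rR False by (simp add: divide_simps mult.commute)
  qed
  from j_upper[OF this, of x, unfolded inner_scaleR_left] show ?thesis
    using rR False by (simp add: dot_square_norm power2_eq_square field_simps)
qed

lemma j_pos: "x \<noteq> a \<Longrightarrow> 0 < j x"
proof (rule ccontr)
  assume "x \<noteq> a" "\<not> 0 < j x"
  then have "R * j x \<le> 0" "norm (x - a) > 0" using rR by (auto simp: mult_le_0_iff)
  then show False using norm_le_j[of x] by linarith
qed

text \<open>An interior point can be pushed outwards by a factor 1 + \<delta> and stay in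
  \<open>D\<close>, which keeps the gauge away from 1. A point outside is separated from
  \<open>D\<close> by a functional that, rescaled, lies in the polar body and is 1 at that
  point.\<close>

lemma j_less_1_iff: "j x < 1 \<longleftrightarrow> x \<in> D"
proof
  assume x: "x \<in> D"
  obtain e where e: "e > 0" "ball x e \<subseteq> D" using D(1) x by (meson openE)
  \<comment> \<open>The summand 1 keeps the denominator positive at the centre
    \<open>a\<close>.\<close>
  define \<delta> where "\<delta> = e / (2 * (norm (x - a) + 1))"
  have np: "norm (x - a) + 1 > 0" using norm_ge_zero[of "x - a"] by linarith
  have d: "\<delta> > 0" using e np by (simp add: \<delta>_def)
  have "\<delta> * norm (x - a) \<le> e / 2 * 1"
    unfolding \<delta>_def using e np by (simp add: field_simps)
  then have "x + \<delta> *\<^sub>R (x - a) \<in> ball x e" using e d by (simp add: dist_norm)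
  then have xin: "x + \<delta> *\<^sub>R (x - a) \<in> D" using e by blast
  obtain n where n: "n \<in> polar" "j x = n \<bullet> (x - a)" using j_attained by blast
  have "n \<bullet> (x + \<delta> *\<^sub>R (x - a) - a) \<le> 1" using n(1) xin by (auto simp: polar_def)
  moreover have "n \<bullet> (x + \<delta> *\<^sub>R (x - a) - a) = (1 + \<delta>) * j x"
    by (simp add: n(2) inner_add_right inner_diff_right algebra_simps)
  ultimately have *: "(1 + \<delta>) * j x \<le> 1" by simp
  show "j x < 1"
  proof (rule ccontr)
    assume "\<not> j x < 1"
    then have "(1 + \<delta>) * 1 \<le> (1 + \<delta>) * j x" using d by (intro mult_left_mono) auto
    from order_trans[OF this *] d show False by simp
  qed
next
  assume jx: "j x < 1"
  show "x \<in> D"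
  proof (rule ccontr)
    assume "x \<notin> D"
    then obtain n b where n: "n \<noteq> 0" "\<forall>y\<in>D. n \<bullet> y \<le> b" "n \<bullet> x \<ge> b"
      using separating_hyperplane_sets[OF D(2) convex_singleton[of x]] a_in by auto
    have le: "n \<bullet> (y - a) \<le> n \<bullet> (x - a)" if "y \<in> D" for y
      using n that by (force simp: inner_diff_right)
    have "a + (r / norm n) *\<^sub>R n \<in> D" using r n by (intro subsetD[OF r(2)]) (auto simp: dist_norm)
    from le[OF this] have "r * norm n \<le> n \<bullet> (x - a)"
      using n by (simp add: dot_square_norm power2_eq_square)
    then have c: "n \<bullet> (x - a) > 0" using r n by (smt (verit) mult_pos_pos zero_less_norm_iff)
    have "(1 / (n \<bullet> (x - a))) *\<^sub>R n \<in> polar"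
      using le c by (auto simp: polar_def divide_simps)
    from j_upper[OF this, of x] show False using c jx by simp
  qed
qed

lemma frontier_iff: "x \<in> frontier D \<longleftrightarrow> j x = 1"
proof -
  have "closure D \<subseteq> {x. j x \<le> 1}"
  proof (rule closure_minimal)
    show "D \<subseteq> {x. j x \<le> 1}" using j_less_1_iff by (auto intro: less_imp_le)
    show "closed {x. j x \<le> 1}" by (intro closed_Collect_le j_continuous continuous_intros)
  qed
  moreover have "x \<in> closure D" if "j x = 1"
  proof -
    have "(\<lambda>k. a + (1 - 1 / real (Suc k)) *\<^sub>R (x - a)) \<longlonglongrightarrow> a + (1 - 0) *\<^sub>R (x - a)"
      by (intro tendsto_intros LIMSEQ_Suc[OF lim_1_over_n])
    moreover have "a + (1 - 1 / real (Suc k)) *\<^sub>R (x - a) \<in> D" for k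
      using that by (simp add: j_less_1_iff[symmetric] j_scale divide_simps)
    ultimately show ?thesis
      unfolding closure_sequential
      by (intro exI[of _ "\<lambda>k. a + (1 - 1 / real (Suc k)) *\<^sub>R (x - a)"]) simp
  qed
  ultimately show ?thesis
    using D(1) j_less_1_iff[of x] by (auto simp: frontier_def interior_open)
qed

lemma j_radial: "x \<noteq> a \<Longrightarrow> j (radial x) = 1"
  using j_scale[of "1 / j x" "x - a"] j_pos[of x] by (simp add: radial_def)

lemma radial_frontier: "x \<noteq> a \<Longrightarrow> radial x \<in> frontier D"
  by (simp add: frontier_iff j_radial)

lemma polar_normal:
  assumes n: "n \<in> polar" "n \<bullet> (\<theta> - a) = 1"
  shows "n \<noteq> 0" and "\<forall>y\<in>D. (n /\<^sub>R norm n) \<bullet> (y - \<theta>) \<le> 0"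
proof -
  show n0: "n \<noteq> 0" using n by auto
  have "n \<bullet> (y - \<theta>) \<le> 0" if "y \<in> D" for y
  proof -
    have "n \<bullet> (y - \<theta>) = n \<bullet> (y - a) - n \<bullet> (\<theta> - a)" by (simp add: inner_diff_right)
    also have "\<dots> \<le> 0" using n that by (auto simp: polar_def)
    finally show ?thesis .
  qed
  then show "\<forall>y\<in>D. (n /\<^sub>R norm n) \<bullet> (y - \<theta>) \<le> 0" by (simp add: divide_simps)
qed

text \<open>Up to positive scaling, unit vectors supporting \<open>D\<close> at
  \<open>radial x\<close> are the same as elements of the polar body maximising at \<open>x\<close>.
  Uniqueness of the maximiser therefore resolves the definite description in
  \<open>outward_normal\<close>.\<close>

lemma outward_normal_radial:
  assumes x: "x \<noteq> a" and n: "n \<in> polar" "n \<bullet> (x - a) = j x"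
    and uniq: "\<And>m. m \<in> polar \<Longrightarrow> m \<bullet> (x - a) = j x \<Longrightarrow> m = n"
  shows "n \<noteq> 0" "outward_normal D (radial x) = n /\<^sub>R norm n"
proof -
  have jx: "j x > 0" using x by (rule j_pos)
  have n1: "n \<bullet> (radial x - a) = 1" using n jx by (simp add: radial_def)
  show n0: "n \<noteq> 0" using polar_normal[OF n(1) n1] by simp
  show "outward_normal D (radial x) = n /\<^sub>R norm n"
    unfolding outward_normal_def
  proof (rule the_equality)
    show "norm (n /\<^sub>R norm n) = 1 \<and> (\<forall>y\<in>D. (n /\<^sub>R norm n) \<bullet> (y - radial x) \<le> 0)"
      using polar_normal[OF n(1) n1] by simp
  next
    fix m assume m: "norm m = 1 \<and> (\<forall>y\<in>D. m \<bullet> (y - radial x) \<le> 0)"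
    let ?c = "m \<bullet> (radial x - a)"
    have le: "m \<bullet> (y - a) \<le> ?c" if "y \<in> D" for y
      using m that by (force simp: inner_diff_right)
    have "a + r *\<^sub>R m \<in> D" using r m by (intro subsetD[OF r(2)]) (auto simp: dist_norm)
    from le[OF this] m have c: "?c > 0" using r by (simp add: dot_square_norm)
    then have cx: "m \<bullet> (x - a) \<noteq> 0" by (auto simp: radial_def)
    have "(1 / ?c) *\<^sub>R m \<in> polar" using le c by (auto simp: polar_def divide_simps)
    moreover have "((1 / ?c) *\<^sub>R m) \<bullet> (x - a) = j x"
      using cx by (simp add: radial_def)
    ultimately have "n = (1 / ?c) *\<^sub>R m" using uniq by simp
    then show "m = n /\<^sub>R norm n" using c m by simp
  qed
qed

text \<open>The gauge minus a maximising functional is nonnegative and vanishes at \<open>x\<close>,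
  so its derivative along each axis is 0. Partial derivatives suffice; total differentiability does
  not enter.\<close>

lemma gradient_unique:
  assumes g: "\<And>i. ((\<lambda>t. j (x + t *\<^sub>R axis i 1)) has_real_derivative g $ i) (at 0)"
    and n: "n \<in> polar" "n \<bullet> (x - a) = j x"
  shows "n = g"
proof (rule vec_eq_iff[THEN iffD2], rule allI)
  fix i
  have min: "0 \<le> j (x + t *\<^sub>R axis i 1) - (j x + t * n $ i)" for t
    using j_upper[OF n(1), of "x + t *\<^sub>R axis i 1"] n(2)
    by (simp add: inner_add_right inner_diff_right inner_axis)
  have "((\<lambda>t. j (x + t *\<^sub>R axis i 1) - (j x + t * n $ i)) has_real_derivative g $ i - n $ i) (at 0)"
    using g[of i] by (auto intro!: derivative_eq_intros)
  from DERIV_local_min[OF this, of 1] min show "n $ i = g $ i" by simp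
qed

lemma AE_gradient:
  obtains g :: "real^'n \<Rightarrow> real^'n" where "\<And>i. (\<lambda>x. g x $ i) \<in> borel_measurable borel"
    and "AE x in lborel. \<forall>i. ((\<lambda>t. j (x + t *\<^sub>R axis i 1)) has_real_derivative g x $ i) (at 0)"
proof -
  have "\<exists>d. d \<in> borel_measurable borel \<and>
      (AE x in lborel. ((\<lambda>t. j (x + t *\<^sub>R axis i 1)) has_real_derivative d x) (at 0))" for i :: 'n
    by (rule convex_lipschitz_AE_directional_derivative[OF j_convex j_lipschitz, of "axis i 1"]) (intro exI conjI)
  then have "\<exists>d. \<forall>i. d i \<in> borel_measurable borel \<and>
      (AE x in lborel. ((\<lambda>t. j (x + t *\<^sub>R axis i 1)) has_real_derivative d i x) (at 0))"
    by (intro choice allI)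
  then obtain d where d: "\<And>i. d i \<in> borel_measurable borel"
    "\<And>i. AE x in lborel. ((\<lambda>t. j (x + t *\<^sub>R axis i 1)) has_real_derivative d i x) (at 0)" by blast
  show ?thesis
  proof (rule that[of "\<lambda>x. \<chi> i. d i x"])
    show "(\<lambda>x. (\<chi> i. d i x) $ i) \<in> borel_measurable borel" for i using d by simp
    show "AE x in lborel. \<forall>i. ((\<lambda>t. j (x + t *\<^sub>R axis i 1)) has_real_derivative (\<chi> i. d i x) $ i) (at 0)"
      using AE_finite_allI[OF finite_class.finite_UNIV d(2)] by simp
  qed
qed

lemma gradient_outward_normal:
  assumes "\<forall>i. ((\<lambda>t. j (x + t *\<^sub>R axis i 1)) has_real_derivative g $ i) (at 0)" "x \<noteq> a"
  shows "norm g \<le> 1 / r" "g = norm g *\<^sub>R outward_normal D (radial x)"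
    "norm (outward_normal D (radial x)) = 1"
proof -
  obtain n where n: "n \<in> polar" "j x = n \<bullet> (x - a)" using j_attained by blast
  have "m = g" if "m \<in> polar" "m \<bullet> (x - a) = j x" for m
    using gradient_unique[OF _ that] assms(1) by blast
  then have gP: "g \<in> polar" "g \<bullet> (x - a) = j x" and "\<And>m. m \<in> polar \<Longrightarrow> m \<bullet> (x - a) = j x \<Longrightarrow> m = g"
    using n by auto
  from outward_normal_radial[OF assms(2) this] polar_norm[OF gP(1)]
  show "norm g \<le> 1 / r" "g = norm g *\<^sub>R outward_normal D (radial x)"
    "norm (outward_normal D (radial x)) = 1" by auto
qed

end

lemma convex_body_exists:
  fixes D :: "(real^'n::finite) set"
  assumes "open D" "convex D" "bounded D" "D \<noteq> {}"
  obtains a r R where "convex_body D a r R"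
proof -
  obtain a where "a \<in> D" using assms by blast
  obtain r where r: "r > 0" "cball a r \<subseteq> D" using assms(1) \<open>a \<in> D\<close> open_contains_cball by blast
  obtain R where R: "\<forall>y\<in>closure D. norm y \<le> R" 
    using bounded_closure[OF assms(3)] unfolding bounded_iff by blast
  have "norm (y - a) \<le> R + norm a" if "y \<in> closure D" for y
    using norm_triangle_ineq4[of y a] R that by force
  then show ?thesis using that assms r by (auto simp: convex_body_def)
qed

subsection \<open>Surface measure of a convex body\<close>

text \<open>The finite cover is padded with empty sets, whose weight is 0 by definition, to meet the
  sequence format of \<open>hausdorff_covers\<close>.\<close>

lemma hausdorff_content_finite_cover:
  fixes A :: "'a::metric_space set"
  assumes I: "finite I" and A: "A \<subseteq> (\<Union>i\<in>I. E i)" and b: "\<And>i. i \<in> I \<Longrightarrow> bounded (E i)"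
    and d: "\<And>i. i \<in> I \<Longrightarrow> diameter (E i) \<le> d" "d \<le> \<delta>" "0 \<le> \<delta>"
  shows "hausdorff_content s \<delta> A \<le> of_nat (card I) * ennreal (unit_ball_vol (real s) * (d / 2) ^ s)"
proof -
  obtain h where h: "bij_betw h {0..<card I} I" using ex_bij_betw_nat_finite[OF I] by blast
  define E' where "E' i = (if i < card I then E (h i) else {})" for i
  have hI: "h i \<in> I" if "i < card I" for i using h that by (auto simp: bij_betw_def)
  have "E' \<in> hausdorff_covers \<delta> A"
    unfolding hausdorff_covers_def
  proof (intro CollectI conjI allI)
    show "A \<subseteq> (\<Union>i. E' i)"
    proof
      fix x assume "x \<in> A"
      then obtain i where "i \<in> I" "x \<in> E i" using A by blast
      then obtain k where "k < card I" "h k = i" using h by (auto simp: bij_betw_def image_iff) (metis atLeastLessThan_iff imageE)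
      then show "x \<in> (\<Union>i. E' i)" using \<open>x \<in> E i\<close> by (auto simp: E'_def)
    qed
    show "bounded (E' i)" "diameter (E' i) \<le> \<delta>" for i
      using b[OF hI] d(1)[OF hI] d(2,3) by (auto simp: E'_def intro: order_trans)
  qed
  then have "hausdorff_content s \<delta> A \<le> (\<Sum>i. hausdorff_weight s (E' i))"
    unfolding hausdorff_content_def by (rule INF_lower)
  also have "\<dots> = (\<Sum>i<card I. hausdorff_weight s (E' i))"
    by (rule suminf_finite) (auto simp: E'_def hausdorff_weight_def)
  also have "\<dots> \<le> of_nat (card {..<card I}) * ennreal (unit_ball_vol (real s) * (d / 2) ^ s)"
  proof (rule sum_bounded_above)
    fix i assume "i \<in> {..<card I}"
    then have i: "E' i = E (h i)" "h i \<in> I" using hI by (auto simp: E'_def)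
    have "0 \<le> diameter (E (h i))" by (rule diameter_ge_0[OF b[OF i(2)]])
    then show "hausdorff_weight s (E' i) \<le> ennreal (unit_ball_vol (real s) * (d / 2) ^ s)"
      unfolding i(1) hausdorff_weight_def using d(1)[OF i(2)]
      by (auto intro!: ennreal_leI mult_left_mono power_mono)
  qed
  finally show ?thesis by simp
qed

lemma sets_hausdorff_measure: "sets (hausdorff_measure s :: 'a::metric_space measure) = sets borel"
  using sets.sigma_sets_eq[of "borel :: 'a measure"] by (simp add: hausdorff_measure_def)

context convex_body
begin

text \<open>Walking from \<theta> along an outward normal keeps \<theta> the nearest point of the
  closure, and by continuity the walk meets the surface of the cube of half-width
  \<open>M\<close>.\<close>

lemma closest_point_frontier:
  assumes "\<theta> \<in> frontier D" "norm a + R < M"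
  obtains z where "infnorm z = M" "closest_point (closure D) z = \<theta>"
proof -
  obtain n where n: "n \<in> polar" "j \<theta> = n \<bullet> (\<theta> - a)" using j_attained by blast
  have n1: "n \<bullet> (\<theta> - a) = 1" using n assms frontier_iff by simp
  then have n0: "n \<noteq> 0" by auto
  have \<theta>: "\<theta> \<in> closure D" using assms(1) by (simp add: frontier_def)
  have out: "n \<bullet> (y - \<theta>) \<le> 0" if "y \<in> closure D" for y
  proof -
    have "D \<subseteq> {y. n \<bullet> y \<le> n \<bullet> \<theta>}" using n(1) n1 by (auto simp: polar_def inner_diff_right)
    then have "closure D \<subseteq> {y. n \<bullet> y \<le> n \<bullet> \<theta>}" by (rule closure_minimal) (rule closed_halfspace_le)
    then show ?thesis using that by (auto simp: inner_diff_right)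
  qed
  have nb: "norm \<theta> < M"
    using R[OF \<theta>] norm_triangle_ineq[of "\<theta> - a" a] assms(2) by simp
  \<comment> \<open>At the end of this range the displacement has Euclidean norm 2M times the
    dimension, hence sup norm at least 2M; subtracting \<theta>, of norm below \<open>M\<close>,
    leaves at least \<open>M\<close>.\<close>
  have "\<exists>t\<ge>0. t \<le> (M + M) * real CARD('n) / norm n \<and> infnorm (\<theta> + t *\<^sub>R n) = M"
  proof (rule IVT')
    show "infnorm (\<theta> + 0 *\<^sub>R n) \<le> M" using infnorm_le_norm[of \<theta>] nb by simp
    have M: "M > 0" using nb norm_ge_zero[of \<theta>] by linarith
    let ?T = "(M + M) * real CARD('n) / norm n"
    show "0 \<le> ?T" using M by simp
    have "sqrt (real CARD('n)) \<le> real CARD('n)"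
      by (rule real_le_lsqrt) (auto simp: power2_eq_square)
    have T: "?T * norm n = (M + M) * real CARD('n)" using n0 by simp
    have "norm (?T *\<^sub>R n) \<le> real CARD('n) * infnorm (?T *\<^sub>R n)"
    proof -
      have "norm (?T *\<^sub>R n) \<le> (\<Sum>i\<in>UNIV. \<bar>(?T *\<^sub>R n) $ i\<bar>)" by (rule norm_le_l1_cart)
      also have "\<dots> \<le> real CARD('n) * infnorm (?T *\<^sub>R n)"
        by (rule sum_bounded_above) (rule component_le_infnorm_cart)
      finally show ?thesis .
    qed
    moreover have "norm (?T *\<^sub>R n) = (M + M) * real CARD('n)" using T M by simp
    ultimately have "(M + M) * real CARD('n) \<le> infnorm (?T *\<^sub>R n) * real CARD('n)" by (simp add: mult.commute)
    then have "M + M \<le> infnorm (?T *\<^sub>R n)" by (rule mult_right_le_imp_le) simp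
    also have "\<dots> \<le> infnorm (\<theta> + ?T *\<^sub>R n) + infnorm \<theta>"
      using infnorm_triangle[of "\<theta> + ?T *\<^sub>R n" "- \<theta>"] by (simp add: infnorm_neg)
    finally show "M \<le> infnorm (\<theta> + ?T *\<^sub>R n)" using infnorm_le_norm[of \<theta>] nb by linarith
    show "continuous_on {0..?T} (\<lambda>t. infnorm (\<theta> + t *\<^sub>R n))"
      by (intro continuous_intros)
  qed
  then obtain t where t: "t \<ge> 0" "infnorm (\<theta> + t *\<^sub>R n) = M" by blast
  have "\<theta> = closest_point (closure D) (\<theta> + t *\<^sub>R n)"
  proof (rule closest_point_unique)
    show "convex (closure D)" "closed (closure D)" using D by (auto intro: convex_closure)
    show "\<forall>z\<in>closure D. dist (\<theta> + t *\<^sub>R n) \<theta> \<le> dist (\<theta> + t *\<^sub>R n) z"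
    proof
      fix y assume y: "y \<in> closure D"
      have "(norm (t *\<^sub>R n))\<^sup>2 \<le> (norm (t *\<^sub>R n + (\<theta> - y)))\<^sup>2"
      proof -
        have "t *\<^sub>R n \<bullet> (\<theta> - y) \<ge> 0"
          using out[OF y] t(1) by (simp add: inner_diff_right mult_left_mono)
        then show ?thesis unfolding power2_norm_eq_inner
          by (simp add: inner_add_left inner_add_right inner_commute)
      qed
      then have "norm (t *\<^sub>R n) \<le> norm (t *\<^sub>R n + (\<theta> - y))" by (rule power2_le_imp_le) simp
      then show "dist (\<theta> + t *\<^sub>R n) \<theta> \<le> dist (\<theta> + t *\<^sub>R n) y"
        by (simp add: dist_norm algebra_simps)
    qed
  qed (rule \<theta>)
  then show ?thesis using t by (intro that) auto
qed

text \<open>The nearest-point projection maps the surface of a large cube onto the boundary.  If the area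
  were infinite, the integrals in \<open>has_trace\<close> would be junk.\<close>

lemma hausdorff_outer_frontier_finite: "hausdorff_outer (CARD('n) - 1) (frontier D) < \<infinity>"
proof -
  define s where "s = CARD('n) - 1"
  define M where "M = norm a + R + 1"
  have M: "M > 0" using rR norm_ge_zero[of a] unfolding M_def by linarith
  have "\<forall>\<theta>\<in>frontier D. \<exists>z. infnorm z = M \<and> closest_point (closure D) z = \<theta>"
    using closest_point_frontier[of _ M] by (metis M_def less_add_one)
  then obtain z where z: "\<And>\<theta>. \<theta> \<in> frontier D \<Longrightarrow> infnorm (z \<theta>) = M"
    "\<And>\<theta>. \<theta> \<in> frontier D \<Longrightarrow> closest_point (closure D) (z \<theta>) = \<theta>" by metis
  \<comment> \<open>There are at most \<open>2 * CARD('n) * (2 * N + 1) ^ s\<close> pieces of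
    diameter \<open>CARD('n) * M / N\<close>, and (2N+1)/N is at most 3, so the total weight is
    bounded independently of the mesh.\<close>
  define K where "K = real (2 * CARD('n)) * 3 ^ s * (unit_ball_vol (real s) * (real CARD('n) * M / 2) ^ s)"
  have "hausdorff_content s \<delta> (frontier D) \<le> ennreal K" if \<delta>: "\<delta> > 0" for \<delta>
  proof -
    obtain N :: nat where N: "real N > real CARD('n) * M / \<delta>" using reals_Archimedean2 by blast
    have "real CARD('n) * M / \<delta> > 0" using M \<delta> by simp
    then have N0: "N > 0" using N by (cases N) auto
    define \<kappa> where "\<kappa> \<theta> l = \<lfloor>real N * z \<theta> $ l / M\<rfloor>" for \<theta> l
    \<comment> \<open>A frontier point is labelled by the grid cell, of side M/N, that contains its
      preimage on the cube. One coordinate of the preimage is M or -M, so one label is exactly N or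
      -N, while the others take 2N+1 values.\<close>
    define I where "I = (\<Union>i. \<Union>t\<in>{- int N, int N}. \<Pi>\<^sub>E l\<in>(UNIV::'n set). if l = i then {t} else {- int N..int N})"
    define E where "E k = {\<theta>\<in>frontier D. \<kappa> \<theta> = k}" for k
    have fin: "finite (\<Pi>\<^sub>E l\<in>(UNIV::'n set). if l = i then {t} else {- int N..int N})" for i t
      by (rule finite_PiE) auto
    have card1: "card (\<Pi>\<^sub>E l\<in>(UNIV::'n set). if l = i then {t} else {- int N..int N}) = (2 * N + 1) ^ s" for i t
    proof -
      have "card (\<Pi>\<^sub>E l\<in>(UNIV::'n set). if l = i then {t} else {- int N..int N})
          = (\<Prod>l\<in>UNIV. card (if l = i then {t} else {- int N..int N}))"
        by (rule card_PiE) simp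
      also have "\<dots> = (\<Prod>l\<in>UNIV - {i}. card (if l = i then {t} else {- int N..int N}))"
        by (subst prod.remove[of UNIV i]) auto
      also have "\<dots> = (\<Prod>l\<in>UNIV - {i}. 2 * N + 1)"
        by (rule prod.cong) (auto simp: nat_add_distrib nat_mult_distrib)
      also have "\<dots> = (2 * N + 1) ^ s" by (simp add: s_def)
      finally show ?thesis .
    qed
    have cardI: "card I \<le> 2 * CARD('n) * (2 * N + 1) ^ s"
    proof -
      have "card I \<le> (\<Sum>i\<in>(UNIV::'n set). card (\<Union>t\<in>{- int N, int N}. \<Pi>\<^sub>E l\<in>(UNIV::'n set). if l = i then {t} else {- int N..int N}))"
        unfolding I_def by (rule card_UN_le) simp
      also have "\<dots> \<le> (\<Sum>i\<in>(UNIV::'n set). 2 * (2 * N + 1) ^ s)"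
      proof (rule sum_mono)
        fix i :: 'n
        have "card (\<Union>t\<in>{- int N, int N}. \<Pi>\<^sub>E l\<in>(UNIV::'n set). if l = i then {t} else {- int N..int N})
            \<le> (\<Sum>t\<in>{- int N, int N}. card (\<Pi>\<^sub>E l\<in>(UNIV::'n set). if l = i then {t} else {- int N..int N}))"
          by (rule card_UN_le) simp
        also have "\<dots> = card {- int N, int N} * (2 * N + 1) ^ s" by (simp only: card1 sum_constant)  simp
        also have "\<dots> \<le> 2 * (2 * N + 1) ^ s"
          by (intro mult_right_mono) (auto simp: card_insert_if)
        finally show "card (\<Union>t\<in>{- int N, int N}. \<Pi>\<^sub>E l\<in>(UNIV::'n set). if l = i then {t} else {- int N..int N})
            \<le> 2 * (2 * N + 1) ^ s" .
      qed
      finally show ?thesis by simp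
    qed
    have bndz: "\<bar>z \<theta> $ l\<bar> \<le> M" if "\<theta> \<in> frontier D" for \<theta> l
      using component_le_infnorm_cart[of "z \<theta>" l] z(1)[OF that] by simp
    have kI: "\<kappa> \<theta> \<in> I" if \<theta>: "\<theta> \<in> frontier D" for \<theta>
    proof -
      have "infnorm (z \<theta>) \<in> (\<lambda>i. \<bar>z \<theta> \<bullet> i\<bar>) ` Basis"
        unfolding infnorm_Max by (rule Max_in) auto
      then obtain i where i: "\<bar>z \<theta> $ i\<bar> = M"
        using z(1)[OF \<theta>] by (auto simp: Basis_vec_def inner_axis)
      have rng: "\<kappa> \<theta> l \<in> {- int N..int N}" for l
      proof -
        have "real N * z \<theta> $ l / M \<le> real N * M / M" "real N * (- M) / M \<le> real N * z \<theta> $ l / M"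
          using bndz[OF \<theta>, of l] M by (intro divide_right_mono mult_left_mono; simp)+
        then have "real N * z \<theta> $ l / M \<le> real N" "- real N \<le> real N * z \<theta> $ l / M" using M by auto
        then show ?thesis unfolding \<kappa>_def by (auto simp: le_floor_iff floor_le_iff)
      qed
      have "\<kappa> \<theta> i \<in> {- int N, int N}"
      proof (cases "z \<theta> $ i \<ge> 0")
        case True
        then have "z \<theta> $ i = M" using i by simp
        then show ?thesis using M by (simp add: \<kappa>_def)
      next
        case False
        then have "z \<theta> $ i = - M" using i by simp
        then have "\<kappa> \<theta> i = \<lfloor>real_of_int (- int N)\<rfloor>" using M by (simp add: \<kappa>_def)
        then show ?thesis by (simp only: floor_of_int) simp
      qed
      then show ?thesis unfolding I_def using rng by (auto simp: PiE_UNIV_domain Pi_iff)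
    qed
    have dE: "norm (x - y) \<le> real CARD('n) * M / real N" if "x \<in> E k" "y \<in> E k" for x y k
    proof -
      have xy: "x \<in> frontier D" "y \<in> frontier D" "\<kappa> x = \<kappa> y" using that by (auto simp: E_def)
      \<comment> \<open>The nearest-point projection does not increase distances, so pieces inherit
        the diameter of their grid cells.\<close>
      have "norm (x - y) \<le> dist (z x) (z y)"
        using closest_point_lipschitz[of "closure D" "z x" "z y"] z(2)[OF xy(1)] z(2)[OF xy(2)] D(2) a_in closure_subset
        by (auto simp: dist_norm convex_closure)
      also have "\<dots> \<le> (\<Sum>l\<in>UNIV. \<bar>(z x - z y) $ l\<bar>)" unfolding dist_norm by (rule norm_le_l1_cart)
      also have "\<dots> \<le> real CARD('n) * (M / real N)"
      proof (rule sum_bounded_above)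
        fix l
        have "\<lfloor>real N * z x $ l / M\<rfloor> = \<lfloor>real N * z y $ l / M\<rfloor>" using xy(3) by (metis \<kappa>_def)
        then have "\<bar>real N * z x $ l / M - real N * z y $ l / M\<bar> \<le> 1" by linarith
        also have "real N * z x $ l / M - real N * z y $ l / M = (real N / M) * (z x - z y) $ l"
          by (simp add: diff_divide_distrib right_diff_distrib)
        also have "\<bar>(real N / M) * (z x - z y) $ l\<bar> = (real N / M) * \<bar>(z x - z y) $ l\<bar>"
          unfolding abs_mult using M by simp
        finally show "\<bar>(z x - z y) $ l\<bar> \<le> M / real N"
          using M N0 by (simp add: pos_le_divide_eq pos_divide_le_eq mult.commute del: vector_minus_component)
      qed
      finally show ?thesis by simp
    qed
    have bE: "bounded (E k)" for k
      using bounded_subset[OF bounded_closure[OF D(3)], of "E k"] by (auto simp: E_def frontier_def)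
    have "hausdorff_content s \<delta> (frontier D)
        \<le> of_nat (card I) * ennreal (unit_ball_vol (real s) * ((real CARD('n) * M / real N) / 2) ^ s)"
    proof (rule hausdorff_content_finite_cover[where E=E])
      show "finite I" unfolding I_def by (intro finite_UN_I fin) auto
      show "frontier D \<subseteq> (\<Union>i\<in>I. E i)" using kI by (auto simp: E_def)
      show "diameter (E k) \<le> real CARD('n) * M / real N" for k
        using M by (intro diameter_le dE) auto
      show "real CARD('n) * M / real N \<le> \<delta>" using N N0 \<delta> by (simp add: field_simps)
    qed (use bE \<delta> in auto)
    also have "\<dots> \<le> of_nat (2 * CARD('n) * (2 * N + 1) ^ s) * ennreal (unit_ball_vol (real s) * ((real CARD('n) * M / real N) / 2) ^ s)"
      using cardI by (intro mult_right_mono of_nat_mono) auto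
    also have "\<dots> = ennreal (real (2 * CARD('n) * (2 * N + 1) ^ s) * (unit_ball_vol (real s) * ((real CARD('n) * M / real N) / 2) ^ s))"
      by (subst ennreal_mult) (use M in \<open>auto simp: ennreal_of_nat_eq_real_of_nat\<close>)
    also have "\<dots> \<le> ennreal K"
    proof (rule ennreal_leI)
      have "real (2 * CARD('n) * (2 * N + 1) ^ s) * (unit_ball_vol (real s) * ((real CARD('n) * M / real N) / 2) ^ s)
          = real (2 * CARD('n)) * ((2 * real N + 1) / real N) ^ s * (unit_ball_vol (real s) * (real CARD('n) * M / 2) ^ s)"
        by (simp add: power_divide power_mult_distrib add.commute)
      also have "\<dots> \<le> K"
        unfolding K_def using N0 M
        by (intro mult_right_mono mult_left_mono power_mono) (auto simp: field_simps)
      finally show "real (2 * CARD('n) * (2 * N + 1) ^ s) * (unit_ball_vol (real s) * ((real CARD('n) * M / real N) / 2) ^ s) \<le> K" .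
    qed
    finally show ?thesis .
  qed
  then have "hausdorff_outer s (frontier D) \<le> ennreal K"
    unfolding hausdorff_outer_content by (intro SUP_least) auto
  also have "ennreal K < \<infinity>" by simp
  finally show ?thesis unfolding s_def .
qed

lemma sets_surface: "sets (surface D) = sets (restrict_space borel (frontier D))"
  unfolding surface_def by (rule sets_restrict_space_cong) (rule sets_hausdorff_measure)

lemma space_surface: "space (surface D) = frontier D"
  by (simp add: surface_def space_restrict_space hausdorff_measure_def)

lemma emeasure_surface:
  assumes "A \<in> sets borel" "A \<subseteq> frontier D"
  shows "emeasure (surface D) A = hausdorff_outer (CARD('n) - 1) A"
  unfolding surface_def
  by (subst emeasure_restrict_space)
     (use assms in \<open>simp_all add: emeasure_hausdorff_measure, simp_all add: hausdorff_measure_def\<close>)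

lemma finite_measure_surface: "finite_measure (surface D)"
proof
  show "emeasure (surface D) (space (surface D)) \<noteq> \<infinity>"
    using hausdorff_outer_frontier_finite by (simp add: space_surface emeasure_surface)
qed

section \<open>Volume of thin layers below the boundary\<close>

definition "layer \<tau> = {x. 1 - \<tau> < j x \<and> j x < 1}"

text \<open>Volume of balls of radius \<open>(R + 1) * d\<close> in units of \<open>d\<close>; the
  factor 2 absorbs rounding up the number of balls.\<close>

definition "cone_const = 2 * unit_ball_vol (real CARD('n)) * (R + 1) ^ CARD('n)"

text \<open>Converts the plain power of the diameter into \<open>hausdorff_weight\<close>, which
  uses half diameters and the volume of the unit ball in dimension CARD('n) - 1.\<close>

definition "layer_const = cone_const * 2 ^ (CARD('n) - 1) / unit_ball_vol (real (CARD('n) - 1))"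

lemma cone_const_pos: "cone_const > 0" using rR by (simp add: cone_const_def)

lemma layer_const_pos: "layer_const > 0" using cone_const_pos by (simp add: layer_const_def)

text \<open>The points of the layer over a patch of diameter d fill a truncated cone of height about
  \<tau>. Balls of radius \<open>(R + 1) * d\<close> strung along one ray at spacing d cover it:
  about \<tau>/d of them, each of volume of order d to the dimension.\<close>

lemma layer_cover:
  assumes E: "bounded E" "diameter E \<le> d" and d: "0 < d" "d \<le> \<tau>" "\<tau> \<le> 1/2"
  shows "\<exists>B\<in>sets borel. {x \<in> layer \<tau>. radial x \<in> E} \<subseteq> B \<and>
     emeasure lborel B \<le> ennreal (cone_const * \<tau> * d ^ (CARD('n) - 1))"
proof (cases "{x \<in> layer \<tau>. radial x \<in> E} = {}")
  case False
  then obtain x0 where x0: "x0 \<in> layer \<tau>" "radial x0 \<in> E" by blast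
  have ne: "x \<noteq> a" if "x \<in> layer \<tau>" for x
    using that d j_scale[of 0 0] by (auto simp: layer_def)
  define \<theta>0 where "\<theta>0 = radial x0"
  have \<theta>0: "norm (\<theta>0 - a) \<le> R"
    using radial_frontier[OF ne[OF x0(1)]] unfolding \<theta>0_def by (intro R) (auto simp: frontier_def)
  define t where "t l = 1 - \<tau> + real l * d" for l :: nat
  define m where "m = nat \<lceil>\<tau> / d\<rceil>"
  define B where "B = (\<Union>l<m. cball (a + t l *\<^sub>R (\<theta>0 - a)) ((R + 1) * d))"
  have "x \<in> B" if x: "x \<in> layer \<tau>" "radial x \<in> E" for x
  proof -
    have jx: "1 - \<tau> < j x" "j x < 1" using x by (auto simp: layer_def)
    \<comment> \<open>The ball is selected by the level of \<open>x\<close>: \<open>t l\<close> is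
      the largest grid level not above \<open>j x\<close>, so the two differ by at most
      \<open>d\<close>.\<close>
    define l where "l = nat \<lfloor>(j x - (1 - \<tau>)) / d\<rfloor>"
    have q0: "0 \<le> (j x - (1 - \<tau>)) / d" using jx d by simp
    have l: "real l \<le> (j x - (1 - \<tau>)) / d" "(j x - (1 - \<tau>)) / d < real l + 1"
      using q0 unfolding l_def by linarith+
    have "(j x - (1 - \<tau>)) / d < \<tau> / d" using jx d by (intro divide_strict_right_mono) auto
    then have "real l < \<tau> / d" using l by linarith
    then have lm: "l < m" unfolding m_def by linarith
    have jt: "\<bar>j x - t l\<bar> \<le> d"
      using l d by (simp add: t_def pos_le_divide_eq pos_divide_less_eq) (simp add: algebra_simps)
    have "x = a + j x *\<^sub>R (radial x - a)" using jx d by (simp add: radial_def)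
    then have "x - (a + t l *\<^sub>R (\<theta>0 - a)) = j x *\<^sub>R (radial x - \<theta>0) + (j x - t l) *\<^sub>R (\<theta>0 - a)"
      by (simp add: algebra_simps)
    then have "norm (x - (a + t l *\<^sub>R (\<theta>0 - a)))
        \<le> norm (j x *\<^sub>R (radial x - \<theta>0)) + norm ((j x - t l) *\<^sub>R (\<theta>0 - a))"
      using norm_triangle_ineq by metis
    also have "\<dots> = j x * norm (radial x - \<theta>0) + \<bar>j x - t l\<bar> * norm (\<theta>0 - a)"
      using j_nonneg[of x] by simp
    also have "\<dots> \<le> 1 * d + d * R"
    proof (intro add_mono mult_mono)
      show "norm (radial x - \<theta>0) \<le> d"
        using diameter_bounded_bound[OF E(1) x(2) x0(2)] E(2) by (simp add: \<theta>0_def dist_norm)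
    qed (use jx jt \<theta>0 d rR j_nonneg[of x] in auto)
    finally have "norm (x - (a + t l *\<^sub>R (\<theta>0 - a))) \<le> (R + 1) * d" by (simp add: algebra_simps)
    then show ?thesis unfolding B_def using lm by (auto simp: dist_norm norm_minus_commute)
  qed
  moreover have "emeasure lborel B \<le> ennreal (cone_const * \<tau> * d ^ (CARD('n) - 1))"
  proof -
    have "emeasure lborel B \<le> (\<Sum>l<m. emeasure lborel (cball (a + t l *\<^sub>R (\<theta>0 - a)) ((R + 1) * d)))"
      unfolding B_def by (rule emeasure_subadditive_finite) auto
    also have "\<dots> = (\<Sum>l<m. ennreal (unit_ball_vol (real CARD('n)) * ((R + 1) * d) ^ CARD('n)))"
      using rR d by (intro sum.cong) (simp_all add: emeasure_cball)
    also have "\<dots> = of_nat m * ennreal (unit_ball_vol (real CARD('n)) * ((R + 1) * d) ^ CARD('n))" by simp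
    also have "\<dots> = ennreal (real m * (unit_ball_vol (real CARD('n)) * ((R + 1) * d) ^ CARD('n)))"
      by (subst ennreal_mult) (use rR d in \<open>auto simp: ennreal_of_nat_eq_real_of_nat\<close>)
    also have "\<dots> \<le> ennreal ((2 * \<tau> / d) * (unit_ball_vol (real CARD('n)) * ((R + 1) * d) ^ CARD('n)))"
    proof (intro ennreal_leI mult_right_mono)
      \<comment> \<open>Rounding up adds at most 1, and 1 is at most \<tau>/d because d does not
        exceed \<tau>.\<close>
      have "1 \<le> \<tau> / d" using d by simp
      then show "real m \<le> 2 * \<tau> / d" unfolding m_def by linarith
    qed (use rR d in auto)
    also have "(2 * \<tau> / d) * (unit_ball_vol (real CARD('n)) * ((R + 1) * d) ^ CARD('n)) = cone_const * \<tau> * (d ^ CARD('n) / d)"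
      by (simp add: cone_const_def power_mult_distrib)
    also have "d ^ CARD('n) / d = d ^ (CARD('n) - 1)"
      using d by (simp add: power_diff)
    finally show ?thesis .
  qed
  moreover have "B \<in> sets borel" unfolding B_def by auto
  ultimately show ?thesis by blast
qed (auto intro!: bexI[of _ "{}"])

text \<open>A patch may have diameter 0, which \<open>layer_cover\<close> excludes. It is applied
  with positive numbers decreasing to the diameter, and the covers are intersected.\<close>

lemma layer_cover_diameter:
  assumes E: "bounded E" "diameter E < \<tau>" and \<tau>: "\<tau> \<le> 1/2"
  shows "\<exists>B\<in>sets borel. {x \<in> layer \<tau>. radial x \<in> E} \<subseteq> B \<and>
     emeasure lborel B \<le> ennreal (cone_const * \<tau> * diameter E ^ (CARD('n) - 1))"
proof -
  define d where "d k = diameter E + (\<tau> - diameter E) * (1 / real (Suc k))" for k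
  have E0: "0 \<le> diameter E" by (rule diameter_ge_0[OF E(1)])
  have dk: "diameter E \<le> d k" "0 < d k" "d k \<le> \<tau>" for k
  proof -
    have "0 < (\<tau> - diameter E) * (1 / real (Suc k))" using E by simp
    moreover have "(\<tau> - diameter E) * (1 / real (Suc k)) \<le> \<tau> - diameter E"
      using E mult_left_mono[of "1 / real (Suc k)" 1 "\<tau> - diameter E"] by simp
    ultimately show "diameter E \<le> d k" "0 < d k" "d k \<le> \<tau>"
      unfolding d_def using E0 add_left_mono[of "(\<tau> - diameter E) * (1 / real (Suc k))" "\<tau> - diameter E" "diameter E"]
      by auto
  qed
  have "\<exists>B. B \<in> sets borel \<and> {x \<in> layer \<tau>. radial x \<in> E} \<subseteq> B \<and>
     emeasure lborel B \<le> ennreal (cone_const * \<tau> * d k ^ (CARD('n) - 1))" for k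
    using layer_cover[OF E(1) dk \<tau>, of k] by (simp only: Bex_def)
  then have "\<exists>B. \<forall>k. B k \<in> sets borel \<and> {x \<in> layer \<tau>. radial x \<in> E} \<subseteq> B k \<and>
     emeasure lborel (B k) \<le> ennreal (cone_const * \<tau> * d k ^ (CARD('n) - 1))"
    by (intro choice allI)
  then obtain B where B: "\<And>k. B k \<in> sets borel" "\<And>k. {x \<in> layer \<tau>. radial x \<in> E} \<subseteq> B k"
    "\<And>k. emeasure lborel (B k) \<le> ennreal (cone_const * \<tau> * d k ^ (CARD('n) - 1))" by blast
  have lim: "(\<lambda>k. ennreal (cone_const * \<tau> * d k ^ (CARD('n) - 1)))
     \<longlonglongrightarrow> ennreal (cone_const * \<tau> * (diameter E + (\<tau> - diameter E) * 0) ^ (CARD('n) - 1))"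
    unfolding d_def by (intro tendsto_ennrealI tendsto_intros LIMSEQ_Suc[OF lim_1_over_n])
  have "emeasure lborel (\<Inter>k. B k) \<le> ennreal (cone_const * \<tau> * (diameter E + (\<tau> - diameter E) * 0) ^ (CARD('n) - 1))"
  proof (rule tendsto_lowerbound[OF lim])
    show "eventually (\<lambda>k. emeasure lborel (\<Inter>k. B k) \<le> ennreal (cone_const * \<tau> * d k ^ (CARD('n) - 1))) sequentially"
    proof (rule always_eventually, rule allI)
      fix k
      have "emeasure lborel (\<Inter>k. B k) \<le> emeasure lborel (B k)"
        using B(1) by (intro emeasure_mono) auto
      then show "emeasure lborel (\<Inter>k. B k) \<le> ennreal (cone_const * \<tau> * d k ^ (CARD('n) - 1))"
        using B(3)[of k] by (rule order_trans)
    qed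
  qed simp
  moreover have "(\<Inter>k. B k) \<in> sets borel" using B(1) by auto
  ultimately show ?thesis using B(2) by (intro bexI[of _ "\<Inter>k. B k"]) auto
qed

lemma radial_measurable [measurable]: "radial \<in> borel_measurable borel"
  unfolding radial_def by measurable

lemma layer_borel [measurable]: "layer \<tau> \<in> sets borel"
  unfolding layer_def by measurable

lemma layer_measure_le:
  assumes A: "A \<in> sets borel" and \<tau>: "0 < \<tau>" "\<tau> \<le> 1/2"
  shows "emeasure lborel {x \<in> layer \<tau>. radial x \<in> A}
    \<le> ennreal (layer_const * \<tau>) * hausdorff_outer (CARD('n) - 1) A"
proof -
  let ?T = "{x \<in> layer \<tau>. radial x \<in> A}" and ?s = "CARD('n) - 1"
  define c where "c = layer_const * \<tau>"
  have c: "c > 0" using layer_const_pos \<tau> by (simp add: c_def)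
  \<comment> \<open>Scale \<tau>/2 makes the diameters strictly smaller than \<tau>, as
    \<open>layer_cover_diameter\<close> requires.\<close>
  have "ennreal (1 / c) * emeasure lborel ?T \<le> hausdorff_content ?s (\<tau>/2) A"
    unfolding hausdorff_content_def
  proof (rule INF_greatest)
    fix E assume E: "E \<in> hausdorff_covers (\<tau>/2) A"
    have "\<exists>B. B \<in> sets borel \<and> {x \<in> layer \<tau>. radial x \<in> E i} \<subseteq> B \<and>
        emeasure lborel B \<le> ennreal c * hausdorff_weight ?s (E i)" for i
    proof (cases "E i = {}")
      case False
      have b: "bounded (E i)" and "diameter (E i) \<le> \<tau> / 2" using E by (auto simp: hausdorff_covers_def)
      then have d: "diameter (E i) < \<tau>" using \<tau>(1) by linarith
      from layer_cover_diameter[OF b d \<tau>(2)] obtain B where B: "B \<in> sets borel"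
        "{x \<in> layer \<tau>. radial x \<in> E i} \<subseteq> B"
        "emeasure lborel B \<le> ennreal (cone_const * \<tau> * diameter (E i) ^ ?s)" by blast
      have "ennreal c * hausdorff_weight ?s (E i)
          = ennreal (c * (unit_ball_vol (real ?s) * (diameter (E i) / 2) ^ ?s))"
        using False c diameter_ge_0[OF b]
        by (subst ennreal_mult) (auto simp: hausdorff_weight_def)
      also have "c * (unit_ball_vol (real ?s) * (diameter (E i) / 2) ^ ?s) = cone_const * \<tau> * diameter (E i) ^ ?s"
      proof -
        define V where "V = unit_ball_vol (real ?s)"
        have "V > 0" unfolding V_def by (rule unit_ball_vol_pos) simp
        then show ?thesis unfolding c_def layer_const_def V_def[symmetric] by (simp add: power_divide)
      qed
      finally show ?thesis using B by auto
    qed (auto intro!: exI[of _ "{}"])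
    then have "\<exists>B. \<forall>i. B i \<in> sets borel \<and> {x \<in> layer \<tau>. radial x \<in> E i} \<subseteq> B i \<and>
        emeasure lborel (B i) \<le> ennreal c * hausdorff_weight ?s (E i)"
      by (intro choice allI)
    then obtain B where B: "\<And>i. B i \<in> sets borel" "\<And>i. {x \<in> layer \<tau>. radial x \<in> E i} \<subseteq> B i"
      "\<And>i. emeasure lborel (B i) \<le> ennreal c * hausdorff_weight ?s (E i)" by blast
    have "?T \<subseteq> (\<Union>i. B i)" using E B(2) by (fastforce simp: hausdorff_covers_def)
    then have "emeasure lborel ?T \<le> emeasure lborel (\<Union>i. B i)"
      using B(1) by (intro emeasure_mono) auto
    also have "\<dots> \<le> (\<Sum>i. emeasure lborel (B i))"
      using B(1) by (intro emeasure_subadditive_countably) auto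
    also have "\<dots> \<le> (\<Sum>i. ennreal c * hausdorff_weight ?s (E i))"
      by (intro suminf_le summableI B(3))
    also have "\<dots> = ennreal c * (\<Sum>i. hausdorff_weight ?s (E i))" by simp
    finally have "ennreal (1 / c) * emeasure lborel ?T \<le> ennreal (1 / c) * (ennreal c * (\<Sum>i. hausdorff_weight ?s (E i)))"
      by (rule mult_left_mono) simp
    then show "ennreal (1 / c) * emeasure lborel ?T \<le> (\<Sum>i. hausdorff_weight ?s (E i))"
      using c by (simp add: mult.assoc[symmetric] ennreal_mult[symmetric])
  qed
  also have "\<dots> \<le> hausdorff_outer ?s A"
    unfolding hausdorff_outer_content using \<tau> by (intro SUP_upper) auto
  finally have "ennreal c * (ennreal (1 / c) * emeasure lborel ?T) \<le> ennreal c * hausdorff_outer ?s A"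
    by (rule mult_left_mono) simp
  then show ?thesis
    unfolding c_def[symmetric] using c by (simp add: mult.assoc[symmetric] ennreal_mult[symmetric])
qed

end

section \<open>Cut-off profile and integrals over layers\<close>

lemma integral_lebesgue_on_borel:
  fixes f :: "'a::euclidean_space \<Rightarrow> real"
  assumes "f \<in> borel_measurable borel" "D \<in> sets borel"
  shows "(\<integral>x. f x \<partial>lebesgue_on D) = (\<integral>x. indicator D x * f x \<partial>lborel)"
proof -
  have "(\<integral>x. f x \<partial>lebesgue_on D) = (\<integral>x. indicator D x * f x \<partial>lebesgue)"
    using assms by (simp add: integral_restrict_space)
  also have "\<dots> = (\<integral>x. indicator D x * f x \<partial>lborel)"
    using assms by (intro integral_completion) simp
  finally show ?thesis .
qed

text \<open>The primitive of the hat function \<open>spline'\<close> on [0,2]: a once continuously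
  differentiable transition from 0 to 1 whose slope never exceeds 1.\<close>

definition spline :: "real \<Rightarrow> real" where
  "spline t = ((max 0 t)\<^sup>2 - 2 * (max 0 (t - 1))\<^sup>2 + (max 0 (t - 2))\<^sup>2) / 2"

definition spline' :: "real \<Rightarrow> real" where
  "spline' t = max 0 t - 2 * max 0 (t - 1) + max 0 (t - 2)"

lemma spline_le_0: "t \<le> 0 \<Longrightarrow> spline t = 0" "t \<le> 0 \<Longrightarrow> spline' t = 0"
  by (simp_all add: spline_def spline'_def)

lemma spline_ge_2: "t \<ge> 2 \<Longrightarrow> spline t = 1" "t \<ge> 2 \<Longrightarrow> spline' t = 0"
  by (simp_all add: spline_def spline'_def power2_eq_square algebra_simps)

lemma spline'_bounds: "0 \<le> spline' t" "spline' t \<le> 1"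
  unfolding spline'_def by (simp_all add: max_def)

lemma max_square_derivative: "((\<lambda>t::real. (max 0 t)\<^sup>2) has_real_derivative 2 * max 0 t) (at t)"
proof -
  consider "t > 0" | "t < 0" | "t = 0" by linarith
  then show ?thesis
  proof cases
    case 1
    have "((\<lambda>t. t\<^sup>2) has_real_derivative 2 * max 0 t) (at t)"
      using 1 by (auto intro!: derivative_eq_intros)
    then show ?thesis
      by (rule has_field_derivative_transform_within_open[of _ _ _ "{0<..}"]) (use 1 in auto)
  next
    case 2
    have "((\<lambda>t. 0::real) has_real_derivative 2 * max 0 t) (at t)" using 2 by simp
    then show ?thesis
      by (rule has_field_derivative_transform_within_open[of _ _ _ "{..<0}"]) (use 2 in auto)
  next
    case 3
    have "((\<lambda>s::real. (max 0 s)\<^sup>2 / s) \<longlongrightarrow> 0) (at 0)"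
    proof (rule tendsto_0_le[where K=1])
      show "((\<lambda>s::real. s) \<longlongrightarrow> 0) (at 0)" by (rule tendsto_ident_at)
      show "eventually (\<lambda>s::real. norm ((max 0 s)\<^sup>2 / s) \<le> norm s * 1) (at 0)"
        by (rule always_eventually) (auto simp: max_def power2_eq_square)
    qed
    then show ?thesis using 3 by (simp add: has_field_derivative_iff)
  qed
qed

lemma spline_derivative: "(spline has_real_derivative spline' t) (at t)"
proof -
  have shift: "((\<lambda>t. (max 0 (t - c))\<^sup>2) has_real_derivative 2 * max 0 (t - c) * (1 - 0)) (at t)" for c
    by (rule DERIV_chain2[OF max_square_derivative]) (intro derivative_intros)
  show ?thesis
    unfolding spline_def[abs_def] spline'_def
    by (rule DERIV_cong[OF DERIV_cdivide[OF DERIV_add[OF DERIV_diff[OF max_square_derivative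
          DERIV_cmult[OF shift[of 1], of 2]] shift[of 2]], of 2]]) simp
qed

lemma spline_lipschitz: "\<bar>spline s - spline t\<bar> \<le> \<bar>s - t\<bar>"
proof -
  have "norm (spline s - spline t) \<le> 1 * norm (s - t)"
  proof (rule field_differentiable_bound[of UNIV spline spline'])
    show "(spline has_field_derivative spline' z) (at z within UNIV)" for z using spline_derivative by simp
    show "norm (spline' z) \<le> 1" for z using spline'_bounds by simp
  qed auto
  then show ?thesis by simp
qed

lemma spline_bounds: "0 \<le> spline t" "spline t \<le> 1"
proof -
  have mono: "spline s \<le> spline t" if "s \<le> t" for s t
    by (rule DERIV_nonneg_imp_nondecreasing[OF that]) (use spline_derivative spline'_bounds in blast)
  show "0 \<le> spline t" using mono[of "min t 0" t] spline_le_0(1)[of "min t 0"] by simp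
  show "spline t \<le> 1" using mono[of t "max t 2"] spline_ge_2(1)[of "max t 2"] by simp
qed

lemma spline_measurable [measurable]: "spline \<in> borel_measurable borel" "spline' \<in> borel_measurable borel"
  unfolding spline_def[abs_def] spline'_def[abs_def] by measurable

context convex_body
begin

lemma layer_ne: "x \<in> layer \<tau> \<Longrightarrow> \<tau> \<le> 1/2 \<Longrightarrow> x \<noteq> a"
  using j_scale[of 0 0] by (auto simp: layer_def)

lemma radial_measurable_surface:
  assumes "\<tau> \<le> 1/2"
  shows "radial \<in> measurable (restrict_space lborel (layer \<tau>)) (surface D)"
  unfolding surface_def
proof (rule measurable_restrict_space2)
  show "radial \<in> space (restrict_space lborel (layer \<tau>)) \<rightarrow> frontier D"
    using layer_ne[OF _ assms] by (auto simp: space_restrict_space intro: radial_frontier)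
  have "radial \<in> measurable (restrict_space lborel (layer \<tau>)) borel"
    by (intro measurable_restrict_space1) simp
  then show "radial \<in> measurable (restrict_space lborel (layer \<tau>)) (hausdorff_measure (CARD('n) - 1))"
    by (subst measurable_cong_sets[OF refl sets_hausdorff_measure])
qed

text \<open>Stated as an inequality of measures, the volume estimate transfers at once to integrals
  of arbitrary nonnegative functions of the radial projection.\<close>

lemma layer_distr_le:
  assumes \<tau>: "0 < \<tau>" "\<tau> \<le> 1/2"
  shows "distr (restrict_space lborel (layer \<tau>)) (surface D) radial \<le> scale_measure (ennreal (layer_const * \<tau>)) (surface D)"
proof (subst le_measure)
  show "\<forall>A\<in>sets (distr (restrict_space lborel (layer \<tau>)) (surface D) radial).
      emeasure (distr (restrict_space lborel (layer \<tau>)) (surface D) radial) A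
      \<le> emeasure (scale_measure (ennreal (layer_const * \<tau>)) (surface D)) A"
  proof
    fix A assume "A \<in> sets (distr (restrict_space lborel (layer \<tau>)) (surface D) radial)"
    then have As: "A \<in> sets (surface D)" by simp
    then have A: "A \<in> sets borel" "A \<subseteq> frontier D"
      unfolding sets_surface by (auto simp: sets_restrict_space_iff)
    have "emeasure (distr (restrict_space lborel (layer \<tau>)) (surface D) radial) A
        = emeasure (restrict_space lborel (layer \<tau>)) (radial -` A \<inter> space (restrict_space lborel (layer \<tau>)))"
      by (rule emeasure_distr[OF radial_measurable_surface[OF \<tau>(2)] As])
    also have "radial -` A \<inter> space (restrict_space lborel (layer \<tau>)) = {x \<in> layer \<tau>. radial x \<in> A}"
      by (auto simp: space_restrict_space)
    also have "emeasure (restrict_space lborel (layer \<tau>)) {x \<in> layer \<tau>. radial x \<in> A} = emeasure lborel {x \<in> layer \<tau>. radial x \<in> A}"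
      by (rule emeasure_restrict_space) auto
    also have "\<dots> \<le> ennreal (layer_const * \<tau>) * emeasure (surface D) A"
      using layer_measure_le[OF A(1) \<tau>] by (simp add: emeasure_surface[OF A])
    finally show "emeasure (distr (restrict_space lborel (layer \<tau>)) (surface D) radial) A
      \<le> emeasure (scale_measure (ennreal (layer_const * \<tau>)) (surface D)) A" by simp
  qed
qed simp

lemma layer_nn_integral:
  assumes \<tau>: "0 < \<tau>" "\<tau> \<le> 1/2" and f: "f \<in> borel_measurable (surface D)"
  shows "(\<integral>\<^sup>+x. f (radial x) * indicator (layer \<tau>) x \<partial>lborel) \<le> ennreal (layer_const * \<tau>) * (\<integral>\<^sup>+x. f x \<partial>surface D)"
proof -
  let ?N = "distr (restrict_space lborel (layer \<tau>)) (surface D) radial"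
  have "(\<integral>\<^sup>+x. f (radial x) * indicator (layer \<tau>) x \<partial>lborel) = (\<integral>\<^sup>+x. f (radial x) \<partial>restrict_space lborel (layer \<tau>))"
    by (rule nn_integral_restrict_space[symmetric]) simp
  also have "\<dots> = (\<integral>\<^sup>+x. f x \<partial>?N)"
    by (rule nn_integral_distr[symmetric, OF radial_measurable_surface[OF \<tau>(2)]]) (simp add: f)
  also have "\<dots> \<le> (\<integral>\<^sup>+x. f x \<partial>scale_measure (ennreal (layer_const * \<tau>)) (surface D))"
    by (rule nn_integral_mono_measure[OF _ layer_distr_le[OF \<tau>]]) simp
  also have "\<dots> = ennreal (layer_const * \<tau>) * (\<integral>\<^sup>+x. f x \<partial>surface D)"
    by (rule nn_integral_scale_measure[OF f])
  finally show ?thesis .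
qed

text \<open>Conditions known almost everywhere on the surface, such as a vanishing normal component,
  have to be used at radial projections of points inside; the volume estimate maps surface null sets
  to Lebesgue null sets.\<close>

lemma layer_AE:
  assumes \<tau>: "0 < \<tau>" "\<tau> \<le> 1/2" and P: "AE x in surface D. P x"
  shows "AE x in lborel. x \<in> layer \<tau> \<longrightarrow> P (radial x)"
proof -
  obtain N where N: "N \<in> null_sets (surface D)" "{x \<in> space (surface D). \<not> P x} \<subseteq> N"
    using P unfolding eventually_ae_filter by blast
  have Nm: "(\<lambda>x. indicator N x :: ennreal) \<in> borel_measurable (surface D)" using N by auto
  have "(\<integral>\<^sup>+x. indicator N (radial x) * indicator (layer \<tau>) x \<partial>lborel) \<le> ennreal (layer_const * \<tau>) * (\<integral>\<^sup>+x. indicator N x \<partial>surface D)"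
    by (rule layer_nn_integral[OF \<tau> Nm])
  also have "\<dots> = 0" using N(1) by (simp add: null_sets_def)
  finally have z: "(\<integral>\<^sup>+x. indicator N (radial x) * indicator (layer \<tau>) x \<partial>lborel) = 0" by simp
  have "N \<in> sets borel" using N(1) by (auto simp: null_sets_def sets_surface sets_restrict_space_iff)
  then have "(\<lambda>x. indicator N (radial x) * indicator (layer \<tau>) x :: ennreal) \<in> borel_measurable lborel"
    by measurable
  from nn_integral_0_iff_AE[OF this] z
  have "AE x in lborel. indicator N (radial x) * indicator (layer \<tau>) x = (0::ennreal)" by simp
  then show ?thesis
  proof eventually_elim
    case (elim x)
    show ?case
    proof
      assume x: "x \<in> layer \<tau>"
      then have "radial x \<notin> N" using elim by (auto simp: indicator_def split: if_splits)
      moreover have "radial x \<in> space (surface D)"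
        using radial_frontier[OF layer_ne[OF x \<tau>(2)]] by (simp add: space_surface)
      ultimately show "P (radial x)" using N(2) by blast
    qed
  qed
qed

definition "area = measure (surface D) (space (surface D))"

text \<open>\<open>A\<close> is an error uniform over the layer, so it contributes only a multiple
  of \<tau>; \<open>g\<close> carries the genuine boundary quantity and may later have a factor of
  order 1/\<tau>.\<close>

lemma layer_integral_le:
  assumes \<tau>: "0 < \<tau>" "\<tau> \<le> 1/2" and g: "integrable (surface D) g" "\<And>x. 0 \<le> g x" and A: "0 \<le> A"
    and h: "AE x in lborel. \<bar>h x\<bar> \<le> (A + g (radial x)) * indicator (layer \<tau>) x"
  shows "\<bar>\<integral>x. h x \<partial>lborel\<bar> \<le> layer_const * \<tau> * (A * area + (\<integral>x. g x \<partial>surface D))"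
proof (cases "integrable lborel h")
  case True
  interpret finite_measure "surface D" by (rule finite_measure_surface)
  have gm: "g \<in> borel_measurable (surface D)" using g by simp
  have Ig: "integrable (surface D) (\<lambda>x. A + g x)" using g by simp
  have "ennreal (norm (\<integral>x. h x \<partial>lborel)) \<le> (\<integral>\<^sup>+x. norm (h x) \<partial>lborel)"
    by (rule integral_norm_bound_ennreal[OF True])
  also have "\<dots> \<le> (\<integral>\<^sup>+x. ennreal (A + g (radial x)) * indicator (layer \<tau>) x \<partial>lborel)"
  proof (rule nn_integral_mono_AE)
    show "AE x in lborel. ennreal (norm (h x)) \<le> ennreal (A + g (radial x)) * indicator (layer \<tau>) x"
      using h by eventually_elim (auto simp: indicator_def intro!: ennreal_leI split: if_splits)
  qed
  also have "\<dots> \<le> ennreal (layer_const * \<tau>) * (\<integral>\<^sup>+x. ennreal (A + g x) \<partial>surface D)"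
    by (rule layer_nn_integral[OF \<tau>]) (use gm in measurable)
  also have "(\<integral>\<^sup>+x. ennreal (A + g x) \<partial>surface D) = ennreal (\<integral>x. A + g x \<partial>surface D)"
    using A g by (intro nn_integral_eq_integral[OF Ig]) auto
  also have "(\<integral>x. A + g x \<partial>surface D) = A * area + (\<integral>x. g x \<partial>surface D)"
    using g by (simp add: area_def)
  also have "ennreal (layer_const * \<tau>) * ennreal (A * area + (\<integral>x. g x \<partial>surface D))
      = ennreal (layer_const * \<tau> * (A * area + (\<integral>x. g x \<partial>surface D)))"
    by (rule ennreal_mult[symmetric])
       (use layer_const_pos \<tau> A g in \<open>auto simp: area_def intro!: add_nonneg_nonneg integral_nonneg_AE\<close>)
  finally show ?thesis
    by (subst (asm) ennreal_le_iff)
       (use layer_const_pos \<tau> A g in \<open>auto simp: area_def intro!: mult_nonneg_nonneg add_nonneg_nonneg integral_nonneg_AE\<close>)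
next
  \<comment> \<open>A non-integrable \<open>h\<close> has integral 0, and the bound is
    nonnegative.\<close>
  case False
  then show ?thesis
    using layer_const_pos \<tau> A g
    by (auto simp: not_integrable_integral_eq area_def intro!: mult_nonneg_nonneg add_nonneg_nonneg integral_nonneg_AE)
qed

subsection \<open>A one-sided divergence theorem\<close>

text \<open>Equal to 0 outside \<open>D\<close> and to 1 where
  \<open>j x \<le> 1 - 2 * \<epsilon>\<close>; the transition fills
  \<open>layer (2 * \<epsilon>)\<close>.\<close>

definition "cutoff \<epsilon> x = spline ((1 - j x) / \<epsilon>)"

text \<open>Minus the derivative of the cut-off with respect to the value of the gauge, so that the
  gradient of the cut-off is \<open>- cutoff'\<close> times the gradient of
  \<open>j\<close>.\<close>

definition "cutoff' \<epsilon> x = spline' ((1 - j x) / \<epsilon>) / \<epsilon>"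

lemma cutoff_measurable [measurable]:
  "cutoff \<epsilon> \<in> borel_measurable borel" "cutoff' \<epsilon> \<in> borel_measurable borel"
  unfolding cutoff_def[abs_def] cutoff'_def[abs_def] by measurable

lemma cutoff_outside: "\<epsilon> > 0 \<Longrightarrow> x \<notin> D \<Longrightarrow> cutoff \<epsilon> x = 0"
  using j_less_1_iff[of x] by (auto simp: cutoff_def not_less intro!: spline_le_0 divide_nonpos_pos)

lemma cutoff'_outside: "\<epsilon> > 0 \<Longrightarrow> x \<notin> layer (2 * \<epsilon>) \<Longrightarrow> cutoff' \<epsilon> x = 0"
proof -
  assume e: "\<epsilon> > 0" and x: "x \<notin> layer (2 * \<epsilon>)"
  then consider "(1 - j x) / \<epsilon> \<le> 0" | "(1 - j x) / \<epsilon> \<ge> 2"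
    by (auto simp: layer_def divide_le_0_iff pos_le_divide_eq not_less)
  then show ?thesis by cases (auto simp: cutoff'_def spline_le_0 spline_ge_2)
qed

lemma cutoff'_bound: "\<epsilon> > 0 \<Longrightarrow> \<bar>cutoff' \<epsilon> x\<bar> \<le> 1 / \<epsilon>"
  using spline'_bounds[of "(1 - j x) / \<epsilon>"] by (simp add: cutoff'_def divide_right_mono)

lemma cutoff_tendsto: "(\<lambda>k. cutoff (1 / (4 * real (Suc k))) x) \<longlonglongrightarrow> indicator D x"
proof (cases "x \<in> D")
  case True
  then have p: "1 - j x > 0" using j_less_1_iff by simp
  obtain K :: nat where K: "real K > 2 / (1 - j x)" using reals_Archimedean2 by blast
  have "eventually (\<lambda>k. cutoff (1 / (4 * real (Suc k))) x = 1) sequentially"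
    unfolding eventually_sequentially
  proof (intro exI[of _ K] allI impI)
    fix k assume k: "K \<le> k"
    have "real K \<le> real k" using k by simp
    then have "2 / (1 - j x) \<le> 4 * real (Suc k)" using K by simp
    then have "2 \<le> (1 - j x) * (4 * real (Suc k))" using p by (simp add: pos_divide_le_eq mult.commute)
    then show "cutoff (1 / (4 * real (Suc k))) x = 1" by (simp add: cutoff_def spline_ge_2)
  qed
  then show ?thesis using True by (simp add: tendsto_eventually)
qed (simp add: cutoff_outside)

lemma norm_le_closure: "x \<in> closure D \<Longrightarrow> norm x \<le> norm a + R"
  using R[of x] norm_triangle_sub[of x a] by simp

lemma cutoff_lipschitz: "\<epsilon> > 0 \<Longrightarrow> \<bar>cutoff \<epsilon> x - cutoff \<epsilon> y\<bar> \<le> 1 / (r * \<epsilon>) * dist x y"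
proof -
  assume e: "\<epsilon> > 0"
  have "\<bar>cutoff \<epsilon> x - cutoff \<epsilon> y\<bar> \<le> \<bar>(1 - j x) / \<epsilon> - (1 - j y) / \<epsilon>\<bar>"
    unfolding cutoff_def by (rule spline_lipschitz)
  also have "\<dots> = \<bar>j x - j y\<bar> / \<epsilon>" using e by (simp add: diff_divide_distrib[symmetric] abs_minus_commute)
  also have "\<dots> \<le> (1 / r * dist x y) / \<epsilon>"
    using lipschitz_onD[OF j_lipschitz, of x y] e by (intro divide_right_mono) (auto simp: dist_real_def)
  finally show ?thesis by (simp add: mult.commute)
qed

text \<open>The product of \<open>G\<close> with the cut-off is Lipschitz with bounded support, so
  its almost everywhere derivative, given by the product rule, integrates to 0.\<close>

lemma cutoff_partial_integral:
  assumes G: "C1 G" and \<epsilon>: "\<epsilon> > 0"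
    and g: "(\<lambda>x. g x $ i) \<in> borel_measurable borel"
      "AE x in lborel. ((\<lambda>t. j (x + t *\<^sub>R axis i 1)) has_real_derivative g x $ i) (at 0)"
  shows "(\<integral>x. partial i G x * cutoff \<epsilon> x - G x * (cutoff' \<epsilon> x * g x $ i) \<partial>lborel) = 0"
proof -
  let ?R = "norm a + R"
  obtain L where L: "L-lipschitz_on (cball 0 (?R + 1)) G" by (rule C1_lipschitz_on[OF G compact_cball convex_cball])
  obtain B where B: "\<And>x. x \<in> closure (cball 0 (?R + 1)) \<Longrightarrow> \<bar>G x\<bar> \<le> B"
    by (rule continuous_bounded_on_closure[OF C1_continuous[OF G] bounded_cball]) (rule that)
  have B0: "0 \<le> B" using B[of 0] rR by (simp add: order_trans[OF abs_ge_zero])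
  have "(L + B * (1 / (r * \<epsilon>)))-lipschitz_on (cball 0 (?R + 1)) (\<lambda>x. G x * cutoff \<epsilon> x)"
  proof (rule lipschitz_onI)
    show "0 \<le> L + B * (1 / (r * \<epsilon>))" using lipschitz_on_nonneg[OF L] B0 r \<epsilon> by simp
    fix x y :: "real^'n" assume xy: "x \<in> cball 0 (?R + 1)" "y \<in> cball 0 (?R + 1)"
    have "\<bar>G x * cutoff \<epsilon> x - G y * cutoff \<epsilon> y\<bar> = \<bar>(G x - G y) * cutoff \<epsilon> x + G y * (cutoff \<epsilon> x - cutoff \<epsilon> y)\<bar>"
      by (simp add: algebra_simps)
    also have "\<dots> \<le> \<bar>G x - G y\<bar> * \<bar>cutoff \<epsilon> x\<bar> + \<bar>G y\<bar> * \<bar>cutoff \<epsilon> x - cutoff \<epsilon> y\<bar>"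
      unfolding abs_mult[symmetric] by (rule abs_triangle_ineq)
    also have "\<dots> \<le> (L * dist x y) * 1 + B * (1 / (r * \<epsilon>) * dist x y)"
      using lipschitz_onD[OF L xy] B[of y] xy B0 lipschitz_on_nonneg[OF L] spline_bounds[of "(1 - j x) / \<epsilon>"] cutoff_lipschitz[OF \<epsilon>]
      by (intro add_mono mult_mono) (auto simp: dist_real_def cutoff_def)
    finally show "dist (G x * cutoff \<epsilon> x) (G y * cutoff \<epsilon> y) \<le> (L + B * (1 / (r * \<epsilon>))) * dist x y"
      by (simp add: dist_real_def algebra_simps)
  qed
  moreover have out: "G x * cutoff \<epsilon> x = 0" if "norm x > ?R" for x
    using norm_le_closure[of x] closure_subset[of D] that cutoff_outside[OF \<epsilon>, of x] by force
  ultimately have lip: "(L + B * (1 / (r * \<epsilon>)))-lipschitz_on UNIV (\<lambda>x. G x * cutoff \<epsilon> x)"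
    by (rule lipschitz_on_UNIV_of_support)
  have [measurable]: "G \<in> borel_measurable borel" "partial i G \<in> borel_measurable borel"
    using G by (auto intro!: borel_measurable_continuous_onI C1_continuous C1_partial_continuous)
  note [measurable] = g(1)
  show ?thesis
  proof (rule integral_directional_derivative_zero[OF lip out])
    show "(\<lambda>x. partial i G x * cutoff \<epsilon> x - G x * (cutoff' \<epsilon> x * g x $ i)) \<in> borel_measurable borel" by measurable
    show "AE x in lborel. ((\<lambda>t. G (x + t *\<^sub>R axis i 1) * cutoff \<epsilon> (x + t *\<^sub>R axis i 1)) has_real_derivative
        partial i G x * cutoff \<epsilon> x - G x * (cutoff' \<epsilon> x * g x $ i)) (at 0)"
      using g(2)
    proof eventually_elim
      case (elim x)
      have 1: "((\<lambda>t. (1 - j (x + t *\<^sub>R axis i 1)) / \<epsilon>) has_real_derivative (0 - g x $ i) / \<epsilon>) (at 0)"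
        by (rule DERIV_cdivide[OF DERIV_diff[OF DERIV_const elim]])
      have 2: "((\<lambda>t. cutoff \<epsilon> (x + t *\<^sub>R axis i 1)) has_real_derivative
          spline' ((1 - j (x + 0 *\<^sub>R axis i 1)) / \<epsilon>) * ((0 - g x $ i) / \<epsilon>)) (at 0)"
        unfolding cutoff_def by (rule DERIV_chain2[OF spline_derivative 1])
      have "((\<lambda>t. G (x + t *\<^sub>R axis i 1) * cutoff \<epsilon> (x + t *\<^sub>R axis i 1)) has_real_derivative
        partial i G x * cutoff \<epsilon> (x + 0 *\<^sub>R axis i 1) +
        (spline' ((1 - j (x + 0 *\<^sub>R axis i 1)) / \<epsilon>) * ((0 - g x $ i) / \<epsilon>)) * G (x + 0 *\<^sub>R axis i 1)) (at 0)"
        by (rule DERIV_mult[OF partial_has_real_derivative[OF C1_differentiable[OF G]] 2])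
      then show ?case by (simp add: cutoff'_def algebra_simps)
    qed
  qed simp_all
qed

lemma integrable_bounded_on_closure:
  fixes f :: "real^'n \<Rightarrow> real"
  assumes f: "f \<in> borel_measurable lborel"
    and b: "AE x in lborel. \<bar>f x\<bar> \<le> B * indicator (closure D) x"
  shows "integrable lborel f"
proof (rule Bochner_Integration.integrable_bound)
  show "f \<in> borel_measurable lborel" by (rule f)
  have "emeasure lborel (closure D) < \<infinity>"
    using D(3) by (intro emeasure_compact_finite) auto
  then show "integrable lborel (\<lambda>x. B * indicator (closure D) x :: real)"
    by (auto intro!: integrable_real_indicator)
  show "AE x in lborel. norm (f x) \<le> norm (B * indicator (closure D) x)"
    using b by eventually_elim simp
qed

lemma divergence_cutoff:
  assumes G: "\<And>i. C1 (G i)" and \<epsilon>: "0 < \<epsilon>" "\<epsilon> \<le> 1/4"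
    and g: "\<And>i. (\<lambda>x. g x $ i) \<in> borel_measurable borel"
      "AE x in lborel. \<forall>i. ((\<lambda>t. j (x + t *\<^sub>R axis i 1)) has_real_derivative g x $ i) (at 0)"
  shows "(\<integral>x. (\<Sum>i\<in>UNIV. partial i (G i) x) * cutoff \<epsilon> x \<partial>lborel)
    = (\<integral>x. (\<Sum>i\<in>UNIV. G i x * g x $ i) * cutoff' \<epsilon> x \<partial>lborel)"
proof -
  have [measurable]: "G i \<in> borel_measurable borel" "partial i (G i) \<in> borel_measurable borel" for i
    using G by (auto intro!: borel_measurable_continuous_onI C1_continuous C1_partial_continuous)
  note [measurable] = g(1)
  have bd: "\<exists>B. \<forall>x\<in>closure D. \<bar>G i x\<bar> \<le> B \<and> \<bar>partial i (G i) x\<bar> \<le> B" for i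
  proof -
    obtain B1 where B1: "\<And>x. x \<in> closure D \<Longrightarrow> \<bar>G i x\<bar> \<le> B1"
      by (rule continuous_bounded_on_closure[OF C1_continuous[OF G] D(3)]) (rule that)
    obtain B2 where B2: "\<And>x. x \<in> closure D \<Longrightarrow> \<bar>partial i (G i) x\<bar> \<le> B2"
      by (rule continuous_bounded_on_closure[OF C1_partial_continuous[OF G] D(3)]) (rule that)
    show ?thesis using B1 B2 by (intro exI[of _ "max B1 B2"]) (auto simp: le_max_iff_disj)
  qed
  have i1: "integrable lborel (\<lambda>x. partial i (G i) x * cutoff \<epsilon> x)" for i
  proof -
    obtain B where B: "\<forall>x\<in>closure D. \<bar>G i x\<bar> \<le> B \<and> \<bar>partial i (G i) x\<bar> \<le> B" using bd by blast
    show ?thesis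
    proof (rule integrable_bounded_on_closure[where B=B])
      show "AE x in lborel. \<bar>partial i (G i) x * cutoff \<epsilon> x\<bar> \<le> B * indicator (closure D) x"
      proof (rule AE_I2)
        fix x
        show "\<bar>partial i (G i) x * cutoff \<epsilon> x\<bar> \<le> B * indicator (closure D) x"
        proof (cases "x \<in> closure D")
          case True
          have "\<bar>partial i (G i) x\<bar> * \<bar>cutoff \<epsilon> x\<bar> \<le> B * 1"
            using B True spline_bounds by (intro mult_mono) (auto simp: cutoff_def intro: order_trans[OF abs_ge_zero])
          then show ?thesis using True by (simp add: abs_mult)
        next
          case False
          then have "x \<notin> D" using closure_subset by blast
          then show ?thesis using False cutoff_outside[OF \<epsilon>(1)] by simp
        qed
      qed
    qed measurable
  qed
  have i2: "integrable lborel (\<lambda>x. G i x * (cutoff' \<epsilon> x * g x $ i))" for i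
  proof -
    obtain B where B: "\<forall>x\<in>closure D. \<bar>G i x\<bar> \<le> B \<and> \<bar>partial i (G i) x\<bar> \<le> B" using bd by blast
    show ?thesis
    proof (rule integrable_bounded_on_closure[where B="B * (1 / \<epsilon> * (1 / r))"])
      show "AE x in lborel. \<bar>G i x * (cutoff' \<epsilon> x * g x $ i)\<bar> \<le> (B * (1 / \<epsilon> * (1 / r))) * indicator (closure D) x"
        using g(2)
      proof eventually_elim
        case (elim x)
        show ?case
        proof (cases "x \<in> layer (2 * \<epsilon>)")
          case True
          then have xD: "x \<in> closure D" using j_less_1_iff closure_subset by (auto simp: layer_def)
          have "\<bar>g x $ i\<bar> \<le> 1 / r"
            using gradient_outward_normal(1)[OF elim layer_ne[OF True]] \<epsilon> component_le_norm_cart[of "g x" i] by simp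
          then have "\<bar>G i x\<bar> * (\<bar>cutoff' \<epsilon> x\<bar> * \<bar>g x $ i\<bar>) \<le> B * (1 / \<epsilon> * (1 / r))"
            using B xD cutoff'_bound[OF \<epsilon>(1)] r \<epsilon> by (intro mult_mono) (auto intro: order_trans[OF abs_ge_zero])
          then show ?thesis using xD by (simp add: abs_mult)
        next
          case False
          have "0 \<le> B" using B a_in closure_subset[of D] by (meson abs_ge_zero order_trans subsetD)
          then show ?thesis using cutoff'_outside[OF \<epsilon>(1) False] r \<epsilon> by simp
        qed
      qed
    qed measurable
  qed
  have z: "(\<integral>x. partial i (G i) x * cutoff \<epsilon> x \<partial>lborel) = (\<integral>x. G i x * (cutoff' \<epsilon> x * g x $ i) \<partial>lborel)" for i
  proof -
    have "AE x in lborel. ((\<lambda>t. j (x + t *\<^sub>R axis i 1)) has_real_derivative g x $ i) (at 0)"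
      using g(2) by eventually_elim blast
    from cutoff_partial_integral[where i=i and G="G i", OF G \<epsilon>(1) g(1) this] i1[of i] i2[of i] show ?thesis by simp
  qed
  have "(\<integral>x. (\<Sum>i\<in>UNIV. partial i (G i) x) * cutoff \<epsilon> x \<partial>lborel) = (\<Sum>i\<in>UNIV. \<integral>x. partial i (G i) x * cutoff \<epsilon> x \<partial>lborel)"
    unfolding sum_distrib_right by (rule Bochner_Integration.integral_sum) (rule i1)
  also have "\<dots> = (\<Sum>i\<in>UNIV. \<integral>x. G i x * (cutoff' \<epsilon> x * g x $ i) \<partial>lborel)" by (simp add: z)
  also have "\<dots> = (\<integral>x. (\<Sum>i\<in>UNIV. G i x * (cutoff' \<epsilon> x * g x $ i)) \<partial>lborel)"
    by (rule Bochner_Integration.integral_sum[symmetric]) (rule i2)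
  finally show ?thesis by (simp add: sum_distrib_right sum_distrib_left mult.assoc mult.left_commute mult.commute)
qed

end

section \<open>From smooth fields to fields with traces\<close>

lemma L2_integrable:
  assumes "finite_measure M" "f \<in> L2 M" shows "integrable M f"
proof -
  have "(\<lambda>x. 1) \<in> L2 M" using assms(1) by (intro L2_bounded[where B=1]) auto
  from L2_mult_integrable[OF this assms(2)] show ?thesis by simp
qed

lemma L2_inner_tendsto:
  assumes f: "f \<in> L2 M" and g: "\<And>k. g k \<in> L2 M" and h: "h \<in> L2 M"
    and lim: "(\<lambda>k. \<integral>x. (g k x - h x)\<^sup>2 \<partial>M) \<longlonglongrightarrow> 0"
  shows "(\<lambda>k. \<integral>x. f x * g k x \<partial>M) \<longlonglongrightarrow> (\<integral>x. f x * h x \<partial>M)"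
proof (rule LIM_zero_cancel)
  have "(\<lambda>k. \<integral>x. \<bar>f x * (g k x - h x)\<bar> \<partial>M) \<longlonglongrightarrow> 0"
    by (rule L2_inner_tendsto_0[OF f L2_diff[OF g h] lim])
  then show "(\<lambda>k. (\<integral>x. f x * g k x \<partial>M) - (\<integral>x. f x * h x \<partial>M)) \<longlonglongrightarrow> 0"
  proof (rule tendsto_0_le[where K=1], intro always_eventually allI)
    fix k
    have "(\<integral>x. f x * g k x \<partial>M) - (\<integral>x. f x * h x \<partial>M) = (\<integral>x. f x * (g k x - h x) \<partial>M)"
      using L2_mult_integrable[OF f g[of k]] L2_mult_integrable[OF f h] by (simp add: right_diff_distrib)
    also have "norm \<dots> \<le> (\<integral>x. norm (f x * (g k x - h x)) \<partial>M)" by (rule integral_norm_bound)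
    finally show "norm ((\<integral>x. f x * g k x \<partial>M) - (\<integral>x. f x * h x \<partial>M)) \<le> norm (\<integral>x. \<bar>f x * (g k x - h x)\<bar> \<partial>M) * 1"
      by simp
  qed
qed

context convex_body
begin

lemma borel_measurable_surface:
  "f \<in> borel_measurable borel \<Longrightarrow> f \<in> borel_measurable (surface D)"
  using measurable_restrict_space1[of f borel borel "frontier D"]
  by (subst measurable_cong_sets[OF sets_surface refl])

lemma continuous_surface_L2:
  assumes "continuous_on UNIV f" shows "f \<in> L2 (surface D)"
proof -
  obtain B where B: "\<And>x. x \<in> closure D \<Longrightarrow> \<bar>f x\<bar> \<le> B"
    by (rule continuous_bounded_on_closure[OF assms D(3)]) (rule that)
  show ?thesis
    by (rule L2_bounded[OF finite_measure_surface borel_measurable_surface[OF borel_measurable_continuous_onI[OF assms]], where B=B])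
       (use B in \<open>auto simp: space_surface frontier_def\<close>)
qed

lemma layer_radial_dist:
  assumes "x \<in> layer \<tau>" "\<tau> \<le> 1/2" shows "norm (x - radial x) \<le> R * \<tau>"
proof -
  have jx: "1 - \<tau> < j x" "j x < 1" using assms by (auto simp: layer_def)
  have jp: "j x > 0" using j_pos[OF layer_ne[OF assms]] .
  have "x - radial x = (1 - 1 / j x) *\<^sub>R (x - a)" by (simp add: radial_def algebra_simps)
  then have "norm (x - radial x) = (1 / j x - 1) * norm (x - a)"
    using jx jp by (simp add: abs_of_nonpos)
  also have "\<dots> \<le> (1 / j x - 1) * (R * j x)"
    using jx jp by (intro mult_left_mono norm_le_j) auto
  also have "\<dots> = R * (1 - j x)" using jp by (simp add: field_simps)
  also have "\<dots> \<le> R * \<tau>" using rR jx by (intro mult_left_mono) auto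
  finally show ?thesis .
qed

text \<open>The integral of the divergence against the cut-off equals a flux through the layer of
  thickness 2\<epsilon>. The slope 1/\<epsilon> compensates the thickness, the gradient of the gauge
  contributes 1/r, and variation of \<open>F\<close> across the layer contributes an error of order
  \<epsilon>. Letting \<epsilon> tend to 0 leaves the stated constant.\<close>

lemma divergence_bound:
  assumes F: "\<And>i. C1 (F i)" and \<zeta>: "C1 \<zeta>" and Z: "\<And>x. x \<in> closure D \<Longrightarrow> \<bar>\<zeta> x\<bar> \<le> Z"
    and t: "\<And>i. (\<lambda>x. t x $ i) \<in> L2 (surface D)"
    and tn: "AE x in surface D. t x \<bullet> outward_normal D x = 0"
  shows "\<bar>\<integral>x. (\<Sum>i\<in>UNIV. partial i (\<lambda>x. \<zeta> x * F i x) x) \<partial>lebesgue_on D\<bar>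
     \<le> 2 * layer_const * Z / r * (\<Sum>i\<in>UNIV. \<integral>x. \<bar>F i x - t x $ i\<bar> \<partial>surface D)"
proof -
  interpret finite_measure "surface D" by (rule finite_measure_surface)
  define S where "S = (\<Sum>i\<in>UNIV. \<integral>x. \<bar>F i x - t x $ i\<bar> \<partial>surface D)"
  define G where "G i x = \<zeta> x * F i x" for i x
  have G: "C1 (G i)" for i unfolding G_def by (intro C1_mult \<zeta> F)
  have Z0: "0 \<le> Z" using Z[of a] a_in closure_subset[of D] by (meson abs_ge_zero order_trans subsetD)
  obtain g where g: "\<And>i. (\<lambda>x. g x $ i) \<in> borel_measurable borel"
    "AE x in lborel. \<forall>i. ((\<lambda>t. j (x + t *\<^sub>R axis i 1)) has_real_derivative g x $ i) (at 0)"
    by (rule AE_gradient) (rule that)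
  have "\<exists>L. L-lipschitz_on (cball a R) (F i)" for i
    by (rule C1_lipschitz_on[OF F compact_cball convex_cball]) (rule exI)
  then obtain L where L: "\<And>i. (L i)-lipschitz_on (cball a R) (F i)" by metis
  define l where "l = (\<Sum>i\<in>UNIV. L i)"
  have l0: "0 \<le> l" unfolding l_def by (intro sum_nonneg lipschitz_on_nonneg[OF L])
  have Ii: "integrable (surface D) (\<lambda>x. \<bar>F i x - t x $ i\<bar>)" for i
    by (intro integrable_abs L2_integrable[OF finite_measure_surface] L2_diff continuous_surface_L2 C1_continuous F t)
  define q where "q x = (\<Sum>i\<in>UNIV. \<bar>F i x - t x $ i\<bar>)" for x
  have qi: "integrable (surface D) q" unfolding q_def using Ii by (intro Bochner_Integration.integrable_sum) auto
  have q0: "0 \<le> q x" for x unfolding q_def by (intro sum_nonneg) auto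
  have qS: "(\<integral>x. q x \<partial>surface D) = S" unfolding q_def S_def using Ii by (intro Bochner_Integration.integral_sum) auto
  have main: "\<bar>\<integral>x. (\<Sum>i\<in>UNIV. partial i (G i) x) * cutoff \<epsilon> x \<partial>lborel\<bar>
      \<le> layer_const * (2 * \<epsilon>) * (2 * Z * l * R / r * area + Z / (\<epsilon> * r) * S)"
    if \<epsilon>: "0 < \<epsilon>" "\<epsilon> \<le> 1/4" for \<epsilon>
  proof -
    have \<tau>: "0 < 2 * \<epsilon>" "2 * \<epsilon> \<le> 1/2" using \<epsilon> by auto
    have "AE x in lborel. x \<in> layer (2 * \<epsilon>) \<longrightarrow> t (radial x) \<bullet> outward_normal D (radial x) = 0"
      by (rule layer_AE[OF \<tau> tn])
    with g(2) have "AE x in lborel. \<bar>(\<Sum>i\<in>UNIV. G i x * g x $ i) * cutoff' \<epsilon> x\<bar>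
        \<le> (2 * Z * l * R / r + Z / (\<epsilon> * r) * q (radial x)) * indicator (layer (2 * \<epsilon>)) x"
    proof eventually_elim
      case (elim x)
      show ?case
      proof (cases "x \<in> layer (2 * \<epsilon>)")
        case True
        define \<theta> where "\<theta> = radial x"
        define n where "n = outward_normal D \<theta>"
        have xa: "x \<noteq> a" by (rule layer_ne[OF True \<tau>(2)])
        have gn: "norm (g x) \<le> 1 / r" "g x = norm (g x) *\<^sub>R n" "norm n = 1"
          using gradient_outward_normal[OF elim(1) xa] by (auto simp: n_def \<theta>_def)
        have tn0: "t \<theta> \<bullet> n = 0" using elim(2) True by (simp add: n_def \<theta>_def)
        have \<theta>c: "\<theta> \<in> closure D" using radial_frontier[OF xa] by (simp add: \<theta>_def frontier_def)
        have xc: "x \<in> closure D" using True j_less_1_iff closure_subset by (auto simp: layer_def)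
        have ball: "x \<in> cball a R" "\<theta> \<in> cball a R" using R[OF xc] R[OF \<theta>c] by (auto simp: dist_norm norm_minus_commute)
        have ni: "\<bar>n $ i\<bar> \<le> 1" for i using component_le_norm_cart[of n i] gn(3) by simp
        have Fi: "\<bar>F i x - F i \<theta>\<bar> \<le> L i * (R * (2 * \<epsilon>))" for i
        proof -
          have "\<bar>F i x - F i \<theta>\<bar> \<le> L i * dist x \<theta>"
            using lipschitz_onD[OF L ball] by (simp add: dist_real_def)
          also have "\<dots> \<le> L i * (R * (2 * \<epsilon>))"
            using layer_radial_dist[OF True \<tau>(2)] lipschitz_on_nonneg[OF L[of i]]
            by (intro mult_left_mono) (auto simp: dist_norm \<theta>_def)
          finally show ?thesis .
        qed
        \<comment> \<open>Because \<open>t \<theta>\<close> is orthogonal to the normal, it can be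
          subtracted freely. The first summand is small by the Lipschitz bound and the thickness,
          the second depends only on the boundary point.\<close>
        have "(\<Sum>i\<in>UNIV. F i x * n $ i) = (\<Sum>i\<in>UNIV. (F i x - F i \<theta>) * n $ i + (F i \<theta> - t \<theta> $ i) * n $ i)"
          using tn0 by (simp add: inner_vec_def algebra_simps sum.distrib sum_subtractf)
        then have "\<bar>\<Sum>i\<in>UNIV. F i x * n $ i\<bar> \<le> (\<Sum>i\<in>UNIV. \<bar>(F i x - F i \<theta>) * n $ i + (F i \<theta> - t \<theta> $ i) * n $ i\<bar>)"
          by (simp only: sum_abs)
        also have "\<dots> \<le> (\<Sum>i\<in>UNIV. L i * (R * (2 * \<epsilon>)) + \<bar>F i \<theta> - t \<theta> $ i\<bar>)"
        proof (rule sum_mono)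
          fix i
          have "\<bar>(F i x - F i \<theta>) * n $ i\<bar> \<le> \<bar>F i x - F i \<theta>\<bar> * 1"
            unfolding abs_mult by (intro mult_left_mono ni) auto
          moreover have "\<bar>(F i \<theta> - t \<theta> $ i) * n $ i\<bar> \<le> \<bar>F i \<theta> - t \<theta> $ i\<bar> * 1"
            unfolding abs_mult by (intro mult_left_mono ni) auto
          ultimately show "\<bar>(F i x - F i \<theta>) * n $ i + (F i \<theta> - t \<theta> $ i) * n $ i\<bar> \<le> L i * (R * (2 * \<epsilon>)) + \<bar>F i \<theta> - t \<theta> $ i\<bar>"
            using Fi[of i] abs_triangle_ineq[of "(F i x - F i \<theta>) * n $ i" "(F i \<theta> - t \<theta> $ i) * n $ i"]
            by linarith
        qed
        also have "\<dots> = l * (R * (2 * \<epsilon>)) + q \<theta>"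
          by (simp add: sum.distrib l_def q_def sum_distrib_right)
        finally have Fn: "\<bar>\<Sum>i\<in>UNIV. F i x * n $ i\<bar> \<le> l * (R * (2 * \<epsilon>)) + q \<theta>" .
        have "(\<Sum>i\<in>UNIV. G i x * g x $ i) = (\<Sum>i\<in>UNIV. \<zeta> x * norm (g x) * (F i x * n $ i))"
          by (subst gn(2)) (simp add: G_def mult.assoc mult.left_commute)
        also have "\<dots> = \<zeta> x * norm (g x) * (\<Sum>i\<in>UNIV. F i x * n $ i)" by (simp add: sum_distrib_left)
        finally have "\<bar>(\<Sum>i\<in>UNIV. G i x * g x $ i) * cutoff' \<epsilon> x\<bar>
            = (\<bar>\<zeta> x\<bar> * norm (g x)) * \<bar>\<Sum>i\<in>UNIV. F i x * n $ i\<bar> * \<bar>cutoff' \<epsilon> x\<bar>"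
          by (simp add: abs_mult)
        also have "\<dots> \<le> (Z * (1 / r)) * (l * (R * (2 * \<epsilon>)) + q \<theta>) * (1 / \<epsilon>)"
          using Z[OF xc] Z0 gn(1) Fn cutoff'_bound[OF \<epsilon>(1)] r \<epsilon> l0 rR q0[of \<theta>]
          by (intro mult_mono) (auto intro!: mult_nonneg_nonneg add_nonneg_nonneg)
        also have "\<dots> = 2 * Z * l * R / r + Z / (\<epsilon> * r) * q \<theta>"
          using \<epsilon> r by (simp add: field_simps)
        finally show ?thesis using True by (simp add: \<theta>_def)
      next
        case False
        then show ?thesis using cutoff'_outside[OF \<epsilon>(1)] by simp
      qed
    qed
    from layer_integral_le[OF \<tau> _ _ _ this]
    have "\<bar>\<integral>x. (\<Sum>i\<in>UNIV. G i x * g x $ i) * cutoff' \<epsilon> x \<partial>lborel\<bar>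
        \<le> layer_const * (2 * \<epsilon>) * (2 * Z * l * R / r * area + (\<integral>x. Z / (\<epsilon> * r) * q x \<partial>surface D))"
      using qi q0 Z0 l0 rR r \<epsilon> by simp
    then show ?thesis by (simp add: divergence_cutoff[OF G \<epsilon> g] qS)
  qed
  \<comment> \<open>These stay below 1/4, so the layers of thickness 2\<epsilon> avoid the centre,
    where the radial projection degenerates.\<close>
  let ?e = "\<lambda>k. 1 / (4 * real (Suc k))"
  have borel: "(\<lambda>x. \<Sum>i\<in>UNIV. partial i (G i) x) \<in> borel_measurable borel"
    by (intro borel_measurable_sum borel_measurable_continuous_onI C1_partial_continuous G)
  have lim1: "(\<lambda>k. \<integral>x. (\<Sum>i\<in>UNIV. partial i (G i) x) * cutoff (?e k) x \<partial>lborel)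
      \<longlonglongrightarrow> (\<integral>x. (\<Sum>i\<in>UNIV. partial i (G i) x) * indicator D x \<partial>lborel)"
  proof -
    obtain B where B: "\<And>x. x \<in> closure D \<Longrightarrow> \<bar>\<Sum>i\<in>UNIV. partial i (G i) x\<bar> \<le> B"
      by (rule continuous_bounded_on_closure[OF _ D(3), of "\<lambda>x. \<Sum>i\<in>UNIV. partial i (G i) x"])
         (intro continuous_on_sum C1_partial_continuous G, rule that)
    show ?thesis
    proof (rule integral_dominated_convergence)
      show "integrable lborel (\<lambda>x. B * indicator (closure D) x)"
        using emeasure_compact_finite[of "closure D"] D(3) by (auto intro!: integrable_real_indicator)
      show "(\<lambda>x. (\<Sum>i\<in>UNIV. partial i (G i) x) * indicator D x) \<in> borel_measurable lborel"
        using borel D(1) by (intro borel_measurable_times borel_measurable_indicator) auto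
      show "(\<lambda>x. (\<Sum>i\<in>UNIV. partial i (G i) x) * cutoff (?e k) x) \<in> borel_measurable lborel" for k
        using borel cutoff_measurable(1) by (intro borel_measurable_times) auto
      show "AE x in lborel. (\<lambda>k. (\<Sum>i\<in>UNIV. partial i (G i) x) * cutoff (?e k) x)
          \<longlonglongrightarrow> (\<Sum>i\<in>UNIV. partial i (G i) x) * indicator D x"
        by (intro AE_I2 tendsto_mult tendsto_const cutoff_tendsto)
      show "AE x in lborel. norm ((\<Sum>i\<in>UNIV. partial i (G i) x) * cutoff (?e k) x) \<le> B * indicator (closure D) x" for k
      proof (rule AE_I2)
        fix x
        show "norm ((\<Sum>i\<in>UNIV. partial i (G i) x) * cutoff (?e k) x) \<le> B * indicator (closure D) x"
        proof (cases "x \<in> closure D")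
          case True
          have "\<bar>\<Sum>i\<in>UNIV. partial i (G i) x\<bar> * \<bar>cutoff (?e k) x\<bar> \<le> B * 1"
            using B[OF True] spline_bounds by (intro mult_mono) (auto simp: cutoff_def intro: order_trans[OF abs_ge_zero])
          then show ?thesis using True by (simp add: abs_mult)
        next
          case False
          then have "x \<notin> D" using closure_subset by blast
          then show ?thesis using False cutoff_outside[of "?e k" x] by simp
        qed
      qed
    qed
  qed
  have "(\<lambda>k. layer_const * (2 * ?e k) * (2 * Z * l * R / r * area + Z / (?e k * r) * S))
      \<longlonglongrightarrow> 2 * layer_const * Z / r * S"
  proof -
    \<comment> \<open>The thickness cancels the 1/\<epsilon> in front of the boundary integral; what
      remains besides it is of order \<epsilon>.\<close>
    have eq: "layer_const * (2 * e) * (Q + Z / (e * r) * S) = 2 * layer_const * Z / r * S + layer_const * Q * 2 * e"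
      if "e \<noteq> 0" for e Q using that r by (simp add: field_simps)
    have "(\<lambda>k. (1 / 4) * (1 / real (Suc k))) \<longlonglongrightarrow> (1 / 4) * 0"
      by (intro tendsto_intros LIMSEQ_Suc[OF lim_1_over_n])
    then have "?e \<longlonglongrightarrow> 0" by simp
    then have "(\<lambda>k. 2 * layer_const * Z / r * S + layer_const * (2 * Z * l * R / r * area) * 2 * ?e k)
        \<longlonglongrightarrow> 2 * layer_const * Z / r * S + layer_const * (2 * Z * l * R / r * area) * 2 * 0"
      by (intro tendsto_intros)
    then show ?thesis by (subst eq) simp_all
  qed
  with tendsto_rabs[OF lim1]
  have "\<bar>\<integral>x. (\<Sum>i\<in>UNIV. partial i (G i) x) * indicator D x \<partial>lborel\<bar> \<le> 2 * layer_const * Z / r * S"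
  proof (rule LIMSEQ_le)
    have e: "0 < ?e k" "?e k \<le> 1 / 4" for k by (simp_all add: field_simps)
    show "\<exists>N. \<forall>k\<ge>N. \<bar>\<integral>x. (\<Sum>i\<in>UNIV. partial i (G i) x) * cutoff (?e k) x \<partial>lborel\<bar>
        \<le> layer_const * (2 * ?e k) * (2 * Z * l * R / r * area + Z / (?e k * r) * S)"
      using main[OF e] by blast
  qed
  moreover have "(\<integral>x. (\<Sum>i\<in>UNIV. partial i (G i) x) * indicator D x \<partial>lborel) = (\<integral>x. (\<Sum>i\<in>UNIV. partial i (G i) x) \<partial>lebesgue_on D)"
    using integral_lebesgue_on_borel[OF borel, of D] D(1) by (simp add: mult.commute)
  ultimately show ?thesis unfolding S_def G_def by simp
qed

text \<open>Smooth approximants of \<open>V\<close> converge in H1 inside and in L2 on the boundary.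
  The left side is the limit of their integrals, and \<open>divergence_bound\<close> controls these
  by the distance of the boundary values to \<open>t\<close>, which tends to 0.\<close>

lemma integral_normal_trace_zero:
  fixes V t :: "real^'n \<Rightarrow> real^'n"
  assumes tr: "\<And>i. has_trace D (\<lambda>x. V x $ i) (\<lambda>x. t x $ i)"
    and tn: "AE x in surface D. t x \<bullet> outward_normal D x = 0"
    and \<zeta>: "C1 \<zeta>"
  shows "(\<Sum>i\<in>UNIV. \<integral>x. \<zeta> x * wderiv D [i] (\<lambda>x. V x $ i) x \<partial>lebesgue_on D)
    + (\<Sum>i\<in>UNIV. \<integral>x. partial i \<zeta> x * V x $ i \<partial>lebesgue_on D) = 0"
proof -
  have Vi: "(\<lambda>x. V x $ i) \<in> sobolev 1 D" and ti: "(\<lambda>x. t x $ i) \<in> L2 (surface D)" for i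
    using tr[of i] by (auto simp: has_trace_def)
  have "\<exists>\<phi>. \<forall>i. (\<forall>k. smooth (\<phi> i k)) \<and> (\<lambda>k::nat. sobolev_norm 1 D (\<lambda>x. \<phi> i k x - V x $ i)) \<longlonglongrightarrow> 0 \<and>
        (\<lambda>k. \<integral>x. (\<phi> i k x - t x $ i)\<^sup>2 \<partial>surface D) \<longlonglongrightarrow> 0"
    using tr by (intro choice allI) (simp add: has_trace_def)
  then obtain \<phi> where \<phi>: "\<And>i k. smooth (\<phi> i k)"
    and H1: "\<And>i. (\<lambda>k::nat. sobolev_norm 1 D (\<lambda>x. \<phi> i k x - V x $ i)) \<longlonglongrightarrow> 0"
    and S: "\<And>i. (\<lambda>k. \<integral>x. (\<phi> i k x - t x $ i)\<^sup>2 \<partial>surface D) \<longlonglongrightarrow> 0" by blast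
  note lim = sobolev_norm_tendsto_0_iff[OF D(1) \<phi> Vi, THEN iffD1, OF H1, rule_format]
  have nil: "AE x in lebesgue_on D. wderiv D [] (\<lambda>x. V x $ i) x = V x $ i" for i
    by (rule wderiv_AE_eq[OF D(1) is_wderiv_Nil[OF L2_locally_integrable[OF sobolev_L2[OF Vi]]]])
       (use D(1) in \<open>simp add: borel_open\<close>)
  have lim0: "(\<lambda>k. \<integral>x. (\<phi> i k x - V x $ i)\<^sup>2 \<partial>lebesgue_on D) \<longlonglongrightarrow> 0" for i
  proof -
    have [measurable]: "(\<lambda>x. V x $ i) \<in> borel_measurable (lebesgue_on D)"
      "wderiv D [] (\<lambda>x. V x $ i) \<in> borel_measurable (lebesgue_on D)"
      by (auto intro!: L2_measurable sobolev_L2[OF Vi] sobolev_wderiv(2)[OF Vi _ D(1)])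
    have [measurable]: "\<phi> i k \<in> borel_measurable (lebesgue_on D)" for k by (rule smooth_measurable_on[OF \<phi>])
    have "(\<integral>x. (\<phi> i k x - wderiv D [] (\<lambda>x. V x $ i) x)\<^sup>2 \<partial>lebesgue_on D)
        = (\<integral>x. (\<phi> i k x - V x $ i)\<^sup>2 \<partial>lebesgue_on D)" for k
    proof (rule integral_cong_AE)
      show "AE x in lebesgue_on D. (\<phi> i k x - wderiv D [] (\<lambda>x. V x $ i) x)\<^sup>2 = (\<phi> i k x - V x $ i)\<^sup>2"
        using nil[of i] by eventually_elim simp
    qed measurable
    then show ?thesis using lim[of "[]" i] by simp
  qed
  have lim1: "(\<lambda>k. \<integral>x. (partial i (\<phi> i k) x - wderiv D [i] (\<lambda>x. V x $ i) x)\<^sup>2 \<partial>lebesgue_on D) \<longlonglongrightarrow> 0" for i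
    using lim[of "[i]" i] by (simp add: partials_Cons)
  have \<zeta>2: "\<zeta> \<in> L2 (lebesgue_on D)" "partial i \<zeta> \<in> L2 (lebesgue_on D)" for i
    using \<zeta> D by (auto intro!: continuous_L2 C1_continuous C1_partial_continuous)
  have p2: "\<phi> i k \<in> L2 (lebesgue_on D)" "partial i (\<phi> i k) \<in> L2 (lebesgue_on D)" for i k
    using \<phi> D by (auto intro!: smooth_L2 smooth_partial)
  have V2: "(\<lambda>x. V x $ i) \<in> L2 (lebesgue_on D)" "wderiv D [i] (\<lambda>x. V x $ i) \<in> L2 (lebesgue_on D)" for i
    by (auto intro!: sobolev_L2[OF Vi] sobolev_wderiv(2)[OF Vi _ D(1)])
  let ?I = "\<lambda>k. (\<Sum>i\<in>UNIV. \<integral>x. \<zeta> x * partial i (\<phi> i k) x \<partial>lebesgue_on D) + (\<Sum>i\<in>UNIV. \<integral>x. partial i \<zeta> x * \<phi> i k x \<partial>lebesgue_on D)"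
  have conv: "?I \<longlonglongrightarrow> (\<Sum>i\<in>UNIV. \<integral>x. \<zeta> x * wderiv D [i] (\<lambda>x. V x $ i) x \<partial>lebesgue_on D)
    + (\<Sum>i\<in>UNIV. \<integral>x. partial i \<zeta> x * V x $ i \<partial>lebesgue_on D)"
    by (intro tendsto_add tendsto_sum L2_inner_tendsto \<zeta>2 p2 V2 lim0 lim1)
  obtain Z where Z: "\<And>x. x \<in> closure D \<Longrightarrow> \<bar>\<zeta> x\<bar> \<le> Z"
    by (rule continuous_bounded_on_closure[OF C1_continuous[OF \<zeta>] D(3)]) (rule that)
  let ?S = "\<lambda>k. 2 * layer_const * Z / r * (\<Sum>i\<in>UNIV. \<integral>x. \<bar>\<phi> i k x - t x $ i\<bar> \<partial>surface D)"
  have "(\<lambda>k. \<integral>x. \<bar>1 * (\<phi> i k x - t x $ i)\<bar> \<partial>surface D) \<longlonglongrightarrow> 0" for i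
    by (rule L2_inner_tendsto_0[OF continuous_surface_L2[OF continuous_on_const]
          L2_diff[OF continuous_surface_L2[OF smooth_continuous_on[OF \<phi>]] ti] S])
  then have "?S \<longlonglongrightarrow> 2 * layer_const * Z / r * (\<Sum>i\<in>(UNIV::'n set). 0)"
    by (intro tendsto_mult tendsto_const tendsto_sum) simp
  then have S0: "?S \<longlonglongrightarrow> 0" by simp
  have "\<bar>?I k\<bar> \<le> ?S k" for k
  proof -
    have i1: "integrable (lebesgue_on D) (\<lambda>x. \<zeta> x * partial i (\<phi> i k) x)" for i by (rule L2_mult_integrable[OF \<zeta>2(1) p2(2)])
    have i2: "integrable (lebesgue_on D) (\<lambda>x. partial i \<zeta> x * \<phi> i k x)" for i by (rule L2_mult_integrable[OF \<zeta>2(2) p2(1)])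
    have "partial i (\<lambda>x. \<zeta> x * \<phi> i k x) = (\<lambda>x. \<zeta> x * partial i (\<phi> i k) x + partial i \<zeta> x * \<phi> i k x)" for i
      by (rule ext) (simp add: partial_mult C1_differentiable[OF \<zeta>] smooth_differentiable[OF \<phi>])
    then have "(\<integral>x. (\<Sum>i\<in>UNIV. partial i (\<lambda>x. \<zeta> x * \<phi> i k x) x) \<partial>lebesgue_on D) = ?I k"
      using i1 i2 by (simp add: Bochner_Integration.integral_sum sum.distrib)
    then show ?thesis
      using divergence_bound[where F="\<lambda>i. \<phi> i k", OF smooth_C1[OF \<phi>] \<zeta> Z ti tn] by simp
  qed
  then have "(\<lambda>k. \<bar>?I k\<bar>) \<longlonglongrightarrow> 0"
    by (intro tendsto_sandwich[OF _ _ tendsto_const S0] always_eventually allI) simp_all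
  then have "?I \<longlonglongrightarrow> 0" by (rule tendsto_rabs_zero_cancel)
  then show ?thesis using LIMSEQ_unique[OF conv] by simp
qed

end

subsection \<open>The convection term\<close>

text \<open>The limit is split: with bounded coefficients the change of \<open>b\<close> is
  controlled by Cauchy-Schwarz, and with \<open>b'\<close> fixed the pointwise change of the
  coefficients by dominated convergence.\<close>

lemma tendsto_integral_bounded_coefficient:
  fixes b :: "nat \<Rightarrow> 'a \<Rightarrow> real"
  assumes h: "h \<in> L2 M"
    and a: "\<And>k. a k \<in> borel_measurable M" "\<And>k x. \<bar>a k x\<bar> \<le> B" "\<And>x. \<bar>a' x\<bar> \<le> B" "a' \<in> borel_measurable M"
    and lim: "AE x in M. (\<lambda>k. a k x) \<longlonglongrightarrow> a' x"
    and b: "\<And>k. b k \<in> L2 M" "b' \<in> L2 M" "(\<lambda>k. \<integral>x. (b k x - b' x)\<^sup>2 \<partial>M) \<longlonglongrightarrow> 0"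
  shows "(\<lambda>k. \<integral>x. h x * (a k x * b k x) \<partial>M) \<longlonglongrightarrow> (\<integral>x. h x * (a' x * b' x) \<partial>M)"
proof -
  have ab: "(\<lambda>x. a k x * f x) \<in> L2 M" if "f \<in> L2 M" for k f
    by (rule L2_bounded_mult[OF that a(1)]) (rule a(2))
  have I: "integrable M (\<lambda>x. h x * (a k x * f x))" if "f \<in> L2 M" for k f
    by (rule L2_mult_integrable[OF h ab[OF that]])
  have "(\<lambda>k. \<integral>x. \<bar>h x * (b k x - b' x)\<bar> \<partial>M) \<longlonglongrightarrow> 0"
    by (rule L2_inner_tendsto_0[OF h L2_diff[OF b(1,2)] b(3)])
  then have "(\<lambda>k. B * (\<integral>x. \<bar>h x * (b k x - b' x)\<bar> \<partial>M)) \<longlonglongrightarrow> 0" by (rule tendsto_mult_right_zero)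
  then have "(\<lambda>k. (\<integral>x. h x * (a k x * b k x) \<partial>M) - (\<integral>x. h x * (a k x * b' x) \<partial>M)) \<longlonglongrightarrow> 0"
  proof (rule tendsto_0_le[where K=1], intro always_eventually allI)
    fix k
    have i: "integrable M (\<lambda>x. B * \<bar>h x * (b k x - b' x)\<bar>)"
      using L2_mult_integrable[OF h L2_diff[OF b(1,2)]] by simp
    have "(\<integral>x. h x * (a k x * b k x) \<partial>M) - (\<integral>x. h x * (a k x * b' x) \<partial>M) = (\<integral>x. h x * (a k x * (b k x - b' x)) \<partial>M)"
      using I[OF b(1)] I[OF b(2)] by (simp add: right_diff_distrib)
    also have "norm \<dots> \<le> (\<integral>x. norm (h x * (a k x * (b k x - b' x))) \<partial>M)" by (rule integral_norm_bound)
    also have "\<dots> \<le> (\<integral>x. B * \<bar>h x * (b k x - b' x)\<bar> \<partial>M)"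
    proof (rule integral_mono[OF _ i])
      show "integrable M (\<lambda>x. norm (h x * (a k x * (b k x - b' x))))"
        by (intro integrable_norm I L2_diff b)
      fix x
      have "\<bar>a k x\<bar> * \<bar>h x * (b k x - b' x)\<bar> \<le> B * \<bar>h x * (b k x - b' x)\<bar>"
        by (intro mult_right_mono a(2)) simp
      then show "norm (h x * (a k x * (b k x - b' x))) \<le> B * \<bar>h x * (b k x - b' x)\<bar>"
        by (simp add: abs_mult mult_ac)
    qed
    finally show "norm ((\<integral>x. h x * (a k x * b k x) \<partial>M) - (\<integral>x. h x * (a k x * b' x) \<partial>M))
        \<le> norm (B * (\<integral>x. \<bar>h x * (b k x - b' x)\<bar> \<partial>M)) * 1"
      by (simp add: order_trans[OF _ abs_ge_self])
  qed
  moreover have "(\<lambda>k. \<integral>x. h x * (a k x * b' x) \<partial>M) \<longlonglongrightarrow> (\<integral>x. h x * (a' x * b' x) \<partial>M)"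
  proof (rule integral_dominated_convergence)
    show "integrable M (\<lambda>x. B * \<bar>h x * b' x\<bar>)" using L2_mult_integrable[OF h b(2)] by simp
    show "AE x in M. (\<lambda>k. h x * (a k x * b' x)) \<longlonglongrightarrow> h x * (a' x * b' x)"
      using lim by eventually_elim (intro tendsto_intros)
    show "AE x in M. norm (h x * (a k x * b' x)) \<le> B * \<bar>h x * b' x\<bar>" for k
    proof (rule AE_I2)
      fix x
      have "\<bar>a k x\<bar> * \<bar>h x * b' x\<bar> \<le> B * \<bar>h x * b' x\<bar>" by (intro mult_right_mono a(2)) simp
      then show "norm (h x * (a k x * b' x)) \<le> B * \<bar>h x * b' x\<bar>" by (simp add: abs_mult mult_ac)
    qed
    show "(\<lambda>x. h x * (a k x * b' x)) \<in> borel_measurable M" for k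
      by (intro borel_measurable_integrable I b)
    show "(\<lambda>x. h x * (a' x * b' x)) \<in> borel_measurable M"
      by (intro borel_measurable_times L2_measurable[OF h] a(4) L2_measurable[OF b(2)])
  qed
  ultimately have "(\<lambda>k. ((\<integral>x. h x * (a k x * b k x) \<partial>M) - (\<integral>x. h x * (a k x * b' x) \<partial>M)) + (\<integral>x. h x * (a k x * b' x) \<partial>M))
      \<longlonglongrightarrow> 0 + (\<integral>x. h x * (a' x * b' x) \<partial>M)"
    by (rule tendsto_add)
  then show ?thesis by simp
qed

lemma borel_measurable_vecI:
  fixes u :: "'a \<Rightarrow> real^'n::finite"
  assumes "\<And>i. (\<lambda>x. u x $ i) \<in> borel_measurable M" shows "u \<in> borel_measurable M"
  using assms by (subst borel_measurable_euclidean_space) (auto simp: Basis_vec_def inner_axis)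

lemma wdiv_L2:
  assumes "\<And>i. (\<lambda>x. U x $ i) \<in> sobolev 1 D" "open D" shows "wdiv D U \<in> L2 (lebesgue_on D)"
  unfolding wdiv_def[abs_def] by (intro L2_sum sobolev_wderiv(2)[OF assms(1) _ assms(2)]) auto

context convex_body
begin

lemma integral_divergence_free:
  fixes U t :: "real^'n \<Rightarrow> real^'n"
  assumes tr: "\<And>i. has_trace D (\<lambda>x. U x $ i) (\<lambda>x. t x $ i)"
    and tn: "AE x in surface D. t x \<bullet> outward_normal D x = 0"
    and div0: "AE x in lebesgue_on D. wdiv D U x = 0" and \<zeta>: "C1 \<zeta>"
  shows "(\<Sum>i\<in>UNIV. \<integral>x. U x $ i * partial i \<zeta> x \<partial>lebesgue_on D) = 0"
proof -
  have Ui: "(\<lambda>x. U x $ i) \<in> sobolev 1 D" for i using tr[of i] by (simp add: has_trace_def)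
  have "integrable (lebesgue_on D) (\<lambda>x. \<zeta> x * wderiv D [i] (\<lambda>x. U x $ i) x)" for i
    using \<zeta> D by (intro L2_mult_integrable continuous_L2 C1_continuous sobolev_wderiv(2)[OF Ui]) auto
  then have "(\<Sum>i\<in>UNIV. \<integral>x. \<zeta> x * wderiv D [i] (\<lambda>x. U x $ i) x \<partial>lebesgue_on D) = (\<integral>x. \<zeta> x * wdiv D U x \<partial>lebesgue_on D)"
    by (simp add: wdiv_def sum_distrib_left Bochner_Integration.integral_sum)
  also have "\<dots> = 0"
    by (rule integral_eq_zero_AE) (use div0 in \<open>eventually_elim, simp\<close>)
  finally show ?thesis
    using integral_normal_trace_zero[OF tr tn \<zeta>] by (simp add: mult.commute)
qed

text \<open>\<open>U \<cdot> \<nabla>u \<cdot> u\<close> need not be integrable a priori, so it is tested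
  with the damped field \<open>u / (1 + \<bar>u\<bar>\<^sup>2 / M)\<close>, the gradient of a function of \<open>u\<close>.\<close>

lemma damped_convection_zero:
  fixes U t u :: "real^'n \<Rightarrow> real^'n"
  assumes tr: "\<And>i. has_trace D (\<lambda>x. U x $ i) (\<lambda>x. t x $ i)"
    and tn: "AE x in surface D. t x \<bullet> outward_normal D x = 0"
    and div0: "AE x in lebesgue_on D. wdiv D U x = 0"
    and tru: "\<And>i. has_trace D (\<lambda>x. u x $ i) (\<lambda>x. s x $ i)" and M: "1 \<le> M"
  shows "(\<Sum>i\<in>UNIV. \<Sum>l\<in>UNIV. \<integral>x. U x $ i * (u x $ l / (1 + (u x \<bullet> u x) / M) * wderiv D [i] (\<lambda>x. u x $ l) x) \<partial>lebesgue_on D) = 0"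
proof -
  have Ui: "(\<lambda>x. U x $ i) \<in> sobolev 1 D" for i using tr[of i] by (simp add: has_trace_def)
  have ui: "(\<lambda>x. u x $ i) \<in> sobolev 1 D" for i using tru[of i] by (simp add: has_trace_def)
  have "\<exists>\<phi>. \<forall>i. (\<forall>k. smooth (\<phi> i k)) \<and> (\<lambda>k::nat. sobolev_norm 1 D (\<lambda>x. \<phi> i k x - u x $ i)) \<longlonglongrightarrow> 0"
    using tru by (intro choice allI) (auto simp: has_trace_def)
  then obtain \<phi> where \<phi>: "\<And>i k. smooth (\<phi> i k)"
    and H1: "\<And>i. (\<lambda>k::nat. sobolev_norm 1 D (\<lambda>x. \<phi> i k x - u x $ i)) \<longlonglongrightarrow> 0" by blast
  note lim = sobolev_norm_tendsto_0_iff[OF D(1) \<phi> ui, THEN iffD1, OF H1, rule_format]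
  have lim1: "(\<lambda>k. \<integral>x. (partial i (\<phi> l k) x - wderiv D [i] (\<lambda>x. u x $ l) x)\<^sup>2 \<partial>lebesgue_on D) \<longlonglongrightarrow> 0" for i l
    using lim[of "[i]" l] by (simp add: partials_Cons)
  have nil: "AE x in lebesgue_on D. wderiv D [] (\<lambda>x. u x $ i) x = u x $ i" for i
    by (rule wderiv_AE_eq[OF D(1) is_wderiv_Nil[OF L2_locally_integrable[OF sobolev_L2[OF ui]]]])
       (use D(1) in \<open>simp add: borel_open\<close>)
  have p2: "\<phi> i k \<in> L2 (lebesgue_on D)" "partial l (\<phi> i k) \<in> L2 (lebesgue_on D)" for i k l
    using \<phi> D by (auto intro!: smooth_L2 smooth_partial)
  let ?w = "\<lambda>i. wderiv D [] (\<lambda>x. u x $ i)"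
  define Q where "Q k x = (\<Sum>i\<in>UNIV. (\<phi> i k x - ?w i x)\<^sup>2)" for k x
  have Q2: "integrable (lebesgue_on D) (\<lambda>x. (\<phi> i k x - ?w i x)\<^sup>2)" for i k
    by (intro L2_square_integrable L2_diff p2 sobolev_wderiv(2)[OF ui _ D(1)]) simp
  have Qi: "integrable (lebesgue_on D) (Q k)" for k
    unfolding Q_def using Q2 by (intro Bochner_Integration.integrable_sum) auto
  have "(\<integral>x. norm (Q k x) \<partial>lebesgue_on D) = (\<Sum>i\<in>UNIV. \<integral>x. (\<phi> i k x - ?w i x)\<^sup>2 \<partial>lebesgue_on D)" for k
  proof -
    have "(\<lambda>x. norm (Q k x)) = Q k" by (auto simp: Q_def fun_eq_iff sum_nonneg)
    then show ?thesis unfolding Q_def using Q2 by (simp add: Bochner_Integration.integral_sum)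
  qed
  moreover have "(\<lambda>k. \<Sum>i\<in>UNIV. \<integral>x. (\<phi> i k x - ?w i x)\<^sup>2 \<partial>lebesgue_on D) \<longlonglongrightarrow> (\<Sum>i\<in>(UNIV::'n set). 0)"
    using lim[of "[]"] by (intro tendsto_sum) simp
  ultimately have "(\<lambda>k. \<integral>x. norm (Q k x) \<partial>lebesgue_on D) \<longlonglongrightarrow> 0" by simp
  \<comment> \<open>Summing the squared errors of all components first yields one subsequence along
    which every component converges almost everywhere.\<close>
  from tendsto_L1_AE_subseq[OF Qi this] obtain m where m: "strict_mono m"
    "AE x in lebesgue_on D. (\<lambda>k. Q (m k) x) \<longlonglongrightarrow> 0" by blast
  have nil': "AE x in lebesgue_on D. \<forall>i. ?w i x = u x $ i"
    using AE_finite_allI[OF finite_class.finite_UNIV nil] by simp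
  have pt: "AE x in lebesgue_on D. \<forall>i. (\<lambda>k. \<phi> i (m k) x) \<longlonglongrightarrow> u x $ i"
    using m(2) nil'
  proof eventually_elim
    case (elim x)
    show ?case
    proof
      fix i
      have "(\<lambda>k. (\<phi> i (m k) x - ?w i x)\<^sup>2) \<longlonglongrightarrow> 0"
      proof (rule tendsto_sandwich[OF _ _ tendsto_const elim(1)])
        show "eventually (\<lambda>k. (\<phi> i (m k) x - ?w i x)\<^sup>2 \<le> Q (m k) x) sequentially"
          unfolding Q_def by (intro always_eventually allI member_le_sum) auto
      qed simp
      then have "(\<lambda>k. sqrt ((\<phi> i (m k) x - ?w i x)\<^sup>2)) \<longlonglongrightarrow> sqrt 0" by (rule tendsto_real_sqrt)
      then have "(\<lambda>k. \<phi> i (m k) x - ?w i x) \<longlonglongrightarrow> 0" by (simp add: tendsto_rabs_zero_iff)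
      then show "(\<lambda>k. \<phi> i (m k) x) \<longlonglongrightarrow> u x $ i" using elim(2) by (simp add: LIM_zero_iff)
    qed
  qed
  define c where "c v l = v $ l / (1 + (v \<bullet> v) / M)" for v :: "real^'n" and l
  have den: "0 < 1 + (v \<bullet> v) / M" for v :: "real^'n" using M by (simp add: add_pos_nonneg)
  \<comment> \<open>From |s| \<le> 1 + s^2 and 1 \<le> M, each component is at most M + |v|^2, which
    is M times the denominator.\<close>
  have cB: "\<bar>c v l\<bar> \<le> M" for v l
  proof -
    have "(v $ l)\<^sup>2 \<le> v \<bullet> v"
      using component_le_norm_cart[of v l] by (simp add: power2_norm_eq_inner[symmetric] abs_le_square_iff[symmetric])
    moreover have "\<bar>v $ l\<bar> \<le> 1 + (v $ l)\<^sup>2"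
      using sum_squares_bound[of 1 "\<bar>v $ l\<bar>"] abs_ge_zero[of "v $ l"] unfolding power2_abs by simp
    ultimately have "\<bar>v $ l\<bar> \<le> M + v \<bullet> v" using M by linarith
    also have "\<dots> = M * (1 + (v \<bullet> v) / M)" using M by (simp add: field_simps)
    finally show ?thesis using den[of v] by (simp add: c_def abs_divide pos_divide_le_eq)
  qed
  have cc: "continuous_on UNIV (\<lambda>v. c v l)" for l
  proof -
    have "1 + (v \<bullet> v) / M \<noteq> 0" for v :: "real^'n" using den[of v] by linarith
    then show ?thesis unfolding c_def by (intro continuous_intros) (use M in auto)
  qed
  define \<Phi> where "\<Phi> k x = (\<chi> l. \<phi> l k x)" for k x
  \<comment> \<open>(M/2) ln (1 + |v|^2/M) is a potential of the damped field \<open>c\<close>, so U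
    . \<nabla>\<zeta> is the damped convection term of the approximant and integrates to 0 against a
    divergence-free tangential field.\<close>
  define \<zeta> where "\<zeta> k x = (M / 2) * ln (1 + (\<Phi> k x \<bullet> \<Phi> k x) / M)" for k x
  have \<zeta>p: "partial i (\<zeta> k) x = (\<Sum>l\<in>UNIV. c (\<Phi> k x) l * partial i (\<phi> l k) x)"
    and \<zeta>d: "\<zeta> k differentiable (at x)" for i k x
  proof -
    let ?f = "\<lambda>x. \<Sum>l\<in>UNIV. \<phi> l k x * \<phi> l k x"
    have f: "smooth ?f" by (intro smooth_sum smooth_mult \<phi>)
    have fe: "?f x = \<Phi> k x \<bullet> \<Phi> k x" for x by (simp add: \<Phi>_def inner_vec_def)
    have h: "((\<lambda>s. (M / 2) * ln (1 + s / M)) has_real_derivative (M / 2) * (1 / (1 + ?f x / M) * (1 / M))) (at (?f x))"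
    proof -
      have 1: "((\<lambda>s. 1 + s / M) has_real_derivative (0 + 1 / M)) (at (?f x))"
        by (intro DERIV_add DERIV_const DERIV_cdivide DERIV_ident)
      have "0 < 1 + ?f x / M" using den[of "\<Phi> k x"] by (simp only: fe)
      from DERIV_cmult[OF DERIV_chain2[OF DERIV_ln_divide[OF this] 1], of "M / 2"] show ?thesis by simp
    qed
    have \<zeta>f: "\<zeta> k = (\<lambda>x. (M / 2) * ln (1 + ?f x / M))" by (simp add: \<zeta>_def fe fun_eq_iff)
    note pc = partial_compose_real[OF smooth_differentiable[OF f] h]
    show "\<zeta> k differentiable (at x)" unfolding \<zeta>f by (rule pc(2))
    have pf: "partial i ?f x = (\<Sum>l\<in>UNIV. 2 * (\<phi> l k x * partial i (\<phi> l k) x))"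
    proof -
      have "((\<lambda>x. \<Sum>l\<in>UNIV. \<phi> l k x * \<phi> l k x) has_derivative
          (\<lambda>h. \<Sum>l\<in>UNIV. \<phi> l k x * (\<Sum>i\<in>UNIV. partial i (\<phi> l k) x * h $ i) + (\<Sum>i\<in>UNIV. partial i (\<phi> l k) x * h $ i) * \<phi> l k x)) (at x)"
        by (intro has_derivative_sum has_derivative_mult has_derivative_partial smooth_differentiable \<phi>)
      from partial_eqI[OF this, of i] show ?thesis
        by (simp add: axis_def if_distrib mult.commute cong: if_cong)
    qed
    have "partial i (\<zeta> k) x = (M / 2) * (1 / (1 + ?f x / M) * (1 / M)) * partial i ?f x"
      unfolding \<zeta>f by (rule pc(1))
    also have "\<dots> = (\<Sum>l\<in>UNIV. c (\<Phi> k x) l * partial i (\<phi> l k) x)"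
      unfolding pf unfolding fe sum_distrib_left
    proof (intro sum.cong refl)
      fix l
      have "M / 2 * (1 / N * (1 / M)) * (2 * (v * w)) = v / N * w" for N v w :: real using M by simp
      moreover have "\<Phi> k x $ l = \<phi> l k x" by (simp add: \<Phi>_def)
      ultimately show "M / 2 * (1 / (1 + (\<Phi> k x \<bullet> \<Phi> k x) / M) * (1 / M)) * (2 * (\<phi> l k x * partial i (\<phi> l k) x))
          = c (\<Phi> k x) l * partial i (\<phi> l k) x"
        by (simp only: c_def)
    qed
    finally show "partial i (\<zeta> k) x = (\<Sum>l\<in>UNIV. c (\<Phi> k x) l * partial i (\<phi> l k) x)" .
  qed
  have \<Phi>c: "continuous_on UNIV (\<Phi> k)" for k
    unfolding \<Phi>_def by (intro continuous_on_vec_lambda smooth_continuous_on \<phi>)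
  have c\<Phi>: "continuous_on UNIV (\<lambda>x. c (\<Phi> k x) l)" for k l
    by (rule continuous_on_compose2[OF cc \<Phi>c]) simp
  have \<zeta>1: "C1 (\<zeta> k)" for k
    unfolding C1_def \<zeta>p[abs_def]
    by (intro conjI allI \<zeta>d continuous_on_sum continuous_on_mult c\<Phi> smooth_continuous_on[OF smooth_partial[OF \<phi>]])
  have um: "u \<in> borel_measurable (lebesgue_on D)"
    by (intro borel_measurable_vecI L2_measurable sobolev_L2[OF ui])
  have cm: "(\<lambda>x. c (u x) l) \<in> borel_measurable (lebesgue_on D)" for l
    by (rule borel_measurable_continuous_on[OF cc um])
  have cl: "AE x in lebesgue_on D. (\<lambda>k. c (\<Phi> (m k) x) l) \<longlonglongrightarrow> c (u x) l" for l
    using pt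
  proof eventually_elim
    case (elim x)
    then have "(\<lambda>k. \<Phi> (m k) x) \<longlonglongrightarrow> (\<chi> l. u x $ l)" unfolding \<Phi>_def by (intro tendsto_vec_lambda) simp
    then show ?case using continuous_on_tendsto_compose[OF cc, of _ "u x"] by simp
  qed
  have wu: "wderiv D [i] (\<lambda>x. u x $ l) \<in> L2 (lebesgue_on D)" for i l
    by (rule sobolev_wderiv(2)[OF ui _ D(1)]) simp
  have cm\<Phi>: "(\<lambda>x. c (\<Phi> k x) l) \<in> borel_measurable (lebesgue_on D)" for k l
    using borel_measurable_continuous_onI[OF c\<Phi>] by (intro measurable_restrict_space1 measurable_completion) simp
  have "(\<lambda>k. \<Sum>i\<in>UNIV. \<Sum>l\<in>UNIV. \<integral>x. U x $ i * (c (\<Phi> (m k) x) l * partial i (\<phi> l (m k)) x) \<partial>lebesgue_on D)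
      \<longlonglongrightarrow> (\<Sum>i\<in>UNIV. \<Sum>l\<in>UNIV. \<integral>x. U x $ i * (c (u x) l * wderiv D [i] (\<lambda>x. u x $ l) x) \<partial>lebesgue_on D)"
    by (intro tendsto_sum tendsto_integral_bounded_coefficient[where B=M] sobolev_L2[OF Ui] cm\<Phi> cB cm cl p2 wu
          LIMSEQ_subseq_LIMSEQ[OF lim1 m(1), unfolded comp_def])
  moreover have "(\<Sum>i\<in>UNIV. \<Sum>l\<in>UNIV. \<integral>x. U x $ i * (c (\<Phi> k x) l * partial i (\<phi> l k) x) \<partial>lebesgue_on D) = 0" for k
  proof -
    have I: "integrable (lebesgue_on D) (\<lambda>x. U x $ i * (c (\<Phi> k x) l * partial i (\<phi> l k) x))" for i l
      by (rule L2_mult_integrable[OF sobolev_L2[OF Ui] L2_bounded_mult[OF p2(2) cm\<Phi>]]) (rule cB)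
    have "(\<Sum>i\<in>UNIV. \<integral>x. U x $ i * partial i (\<zeta> k) x \<partial>lebesgue_on D) = 0"
      by (rule integral_divergence_free[OF tr tn div0 \<zeta>1])
    then show ?thesis
      unfolding \<zeta>p sum_distrib_left using I by (simp add: Bochner_Integration.integral_sum)
  qed
  ultimately have "(\<Sum>i\<in>UNIV. \<Sum>l\<in>UNIV. \<integral>x. U x $ i * (c (u x) l * wderiv D [i] (\<lambda>x. u x $ l) x) \<partial>lebesgue_on D) = 0"
    by (simp add: LIMSEQ_const_iff)
  then show ?thesis by (simp add: c_def)
qed

text \<open>If the integrand is integrable, the damping factors with M = k + 1 lie between 0 and 1
  and tend to 1, so dominated convergence removes them. Otherwise \<open>L2_inner\<close> is 0 by
  the convention for non-integrable functions.\<close>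

lemma convection_orthogonal:
  fixes U t u :: "real^'n \<Rightarrow> real^'n"
  assumes tr: "\<And>i. has_trace D (\<lambda>x. U x $ i) (\<lambda>x. t x $ i)"
    and tn: "AE x in surface D. t x \<bullet> outward_normal D x = 0"
    and div0: "AE x in lebesgue_on D. wdiv D U x = 0"
    and tru: "\<And>i. has_trace D (\<lambda>x. u x $ i) (\<lambda>x. s x $ i)"
  shows "L2_inner D (convection D U u) u = 0"
proof (cases "integrable (lebesgue_on D) (\<lambda>x. convection D U u x \<bullet> u x)")
  case False
  then show ?thesis by (simp add: L2_inner_def not_integrable_integral_eq)
next
  case True
  define f where "f x = convection D U u x \<bullet> u x" for x
  define c where "c k x = 1 / (1 + (u x \<bullet> u x) / real (Suc k))" for k x
  have Ui: "(\<lambda>x. U x $ i) \<in> L2 (lebesgue_on D)" for i using tr[of i] by (auto simp: has_trace_def intro: sobolev_L2)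
  have ui: "(\<lambda>x. u x $ i) \<in> sobolev 1 D" for i using tru[of i] by (simp add: has_trace_def)
  have um: "u \<in> borel_measurable (lebesgue_on D)"
    by (intro borel_measurable_vecI L2_measurable sobolev_L2[OF ui])
  have fi: "integrable (lebesgue_on D) f" using True by (simp add: f_def[abs_def])
  have c01: "0 \<le> c k x" "c k x \<le> 1" for k x
    unfolding c_def by (auto simp: divide_le_eq_1 add_pos_nonneg)
  have cm: "c k \<in> borel_measurable (lebesgue_on D)" for k unfolding c_def using um by measurable
  have fz: "(\<integral>x. c k x * f x \<partial>lebesgue_on D) = 0" for k
  proof -
    define W where "W i l x = U x $ i * (u x $ l / (1 + (u x \<bullet> u x) / real (Suc k)) * wderiv D [i] (\<lambda>x. u x $ l) x)" for i l x
    have e: "c k x * f x = (\<Sum>i\<in>UNIV. \<Sum>l\<in>UNIV. W i l x)" for x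
      unfolding f_def convection_def inner_vec_def
      by (subst sum.swap) (simp add: W_def c_def sum_distrib_left sum_distrib_right mult_ac)
    have cb: "\<bar>u x $ l / (1 + (u x \<bullet> u x) / real (Suc k))\<bar> \<le> real (Suc k)" for x l
    proof -
      have "(u x $ l)\<^sup>2 \<le> u x \<bullet> u x"
        using component_le_norm_cart[of "u x" l] by (simp add: power2_norm_eq_inner[symmetric] abs_le_square_iff[symmetric])
      moreover have "\<bar>u x $ l\<bar> \<le> 1 + (u x $ l)\<^sup>2"
        using sum_squares_bound[of 1 "\<bar>u x $ l\<bar>"] abs_ge_zero[of "u x $ l"] unfolding power2_abs by simp
      ultimately have "\<bar>u x $ l\<bar> \<le> real (Suc k) + u x \<bullet> u x" by simp
      also have "\<dots> = real (Suc k) * (1 + (u x \<bullet> u x) / real (Suc k))" by (simp add: field_simps)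
      finally show ?thesis by (simp add: abs_divide pos_divide_le_eq add_pos_nonneg)
    qed
    have I: "integrable (lebesgue_on D) (W i l)" for i l
      unfolding W_def[abs_def]
    proof (intro L2_mult_integrable[OF Ui] L2_bounded_mult[OF sobolev_wderiv(2)[OF ui _ D(1)] _ cb])
      note [measurable] = um L2_measurable[OF sobolev_L2[OF ui]]
      show "(\<lambda>x. u x $ l / (1 + (u x \<bullet> u x) / real (Suc k))) \<in> borel_measurable (lebesgue_on D)" by measurable
    qed simp
    have "(\<Sum>i\<in>UNIV. \<Sum>l\<in>UNIV. \<integral>x. W i l x \<partial>lebesgue_on D) = 0"
      unfolding W_def by (rule damped_convection_zero[OF tr tn div0 tru]) simp
    then show ?thesis unfolding e using I by (simp add: Bochner_Integration.integral_sum)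
  qed
  have "(\<lambda>k. \<integral>x. c k x * f x \<partial>lebesgue_on D) \<longlonglongrightarrow> (\<integral>x. f x \<partial>lebesgue_on D)"
  proof (rule integral_dominated_convergence)
    show "integrable (lebesgue_on D) (\<lambda>x. norm (f x))" using fi by simp
    show "AE x in lebesgue_on D. (\<lambda>k. c k x * f x) \<longlonglongrightarrow> f x"
    proof (rule AE_I2)
      fix x
      have "(\<lambda>k. 1 / (1 + (u x \<bullet> u x) * (1 / real (Suc k))) * f x) \<longlonglongrightarrow> 1 / (1 + (u x \<bullet> u x) * 0) * f x"
        by (intro tendsto_intros LIMSEQ_Suc[OF lim_1_over_n]) simp
      then show "(\<lambda>k. c k x * f x) \<longlonglongrightarrow> f x" by (simp add: c_def)
    qed
    show "AE x in lebesgue_on D. norm (c k x * f x) \<le> norm (f x)" for k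
      using c01[of k] by (intro AE_I2) (simp add: abs_mult mult_left_le_one_le)
  qed (use fi cm in auto)
  then have "(\<integral>x. f x \<partial>lebesgue_on D) = 0" unfolding fz by (simp add: LIMSEQ_const_iff)
  then show ?thesis by (simp add: L2_inner_def f_def)
qed

end

subsection \<open>Transport and the energy identity\<close>

lemma is_transportD:
  assumes "is_transport D U q r" "\<phi> \<in> test_functions D"
  shows "(\<integral>x. r x * \<phi> x \<partial>lebesgue_on D) =
    - (\<integral>x. q x * ((\<Sum>i\<in>UNIV. U x $ i * partial i \<phi> x) + wdiv D U x * \<phi> x) \<partial>lebesgue_on D)"
  using assms unfolding is_transport_def by blast

lemma transport_unique:
  assumes D: "open D" and r: "is_transport D U q r" "is_transport D U q r'"
  shows "AE x in lebesgue_on D. r x = r' x"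
proof -
  have Ds: "D \<in> sets lebesgue" using D by (simp add: borel_open)
  have L: "r \<in> L2 (lebesgue_on D)" "r' \<in> L2 (lebesgue_on D)" using r by (auto simp: is_transport_def)
  note l = L2_locally_integrable[OF L(1) Ds] L2_locally_integrable[OF L(2) Ds]
  have "AE x in lebesgue_on D. r x - r' x = 0"
  proof (rule fundamental_lemma[OF D locally_integrable_diff[OF l]])
    fix \<phi> assume \<phi>: "\<phi> \<in> test_functions D"
    have "(\<integral>x. r x * \<phi> x \<partial>lebesgue_on D) = (\<integral>x. r' x * \<phi> x \<partial>lebesgue_on D)"
      by (simp only: is_transportD[OF r(1) \<phi>] is_transportD[OF r(2) \<phi>])
    then show "(\<integral>x. (r x - r' x) * \<phi> x \<partial>lebesgue_on D) = 0"
      using integrable_mult_test[OF Ds l(1) \<phi>] integrable_mult_test[OF Ds l(2) \<phi>] by (simp add: left_diff_distrib)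
  qed
  then show ?thesis by simp
qed

lemma transport_AE_eq: "open D \<Longrightarrow> is_transport D U q r \<Longrightarrow> AE x in lebesgue_on D. transport D U q x = r x"
  unfolding transport_def by (rule transport_unique[OF _ someI[of "is_transport D U q"]])

lemma transport_L2: "is_transport D U q r \<Longrightarrow> transport D U q \<in> L2 (lebesgue_on D)"
  unfolding transport_def using someI[of "is_transport D U q"] by (simp add: is_transport_def)

text \<open>For smooth \<phi> the distribution is the classical expression: test the weak
  derivatives of \<open>U\<close> with the product \<phi>\<psi> and expand it by the product
  rule.\<close>

lemma test_function_is_transport:
  assumes D: "open D" "bounded D" and U: "\<And>i. (\<lambda>x. U x $ i) \<in> sobolev 1 D" and \<phi>: "\<phi> \<in> test_functions D"
  shows "is_transport D U \<phi> (\<lambda>x. \<Sum>i\<in>UNIV. U x $ i * partial i \<phi> x)"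
  unfolding is_transport_def
proof (intro conjI ballI)
  have Ds: "D \<in> sets lebesgue" using D by (simp add: borel_open)
  have sm: "smooth \<phi>" by (rule test_functions_smooth[OF \<phi>])
  have b: "(\<lambda>x. f x * g x) \<in> L2 (lebesgue_on D)" if f: "f \<in> L2 (lebesgue_on D)" and g: "smooth g" for f g
  proof -
    obtain B where B: "\<And>x. x \<in> closure D \<Longrightarrow> \<bar>g x\<bar> \<le> B"
      by (rule continuous_bounded_on_closure[OF smooth_continuous_on[OF g] D(2)]) (rule that)
    have "(\<lambda>x. g x * f x) \<in> L2 (lebesgue_on D)"
      by (rule L2_bounded_mult[OF f smooth_measurable_on[OF g], where B=B]) (use B closure_subset in auto)
    then show ?thesis by (simp add: mult.commute)
  qed
  show "(\<lambda>x. \<Sum>i\<in>UNIV. U x $ i * partial i \<phi> x) \<in> L2 (lebesgue_on D)"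
    by (intro L2_sum b sobolev_L2[OF U] smooth_partial sm)
  fix \<psi> assume \<psi>: "\<psi> \<in> test_functions D"
  have sp: "smooth \<psi>" by (rule test_functions_smooth[OF \<psi>])
  have \<phi>\<psi>: "(\<lambda>x. \<phi> x * \<psi> x) \<in> test_functions D" by (rule test_functions_mult_left[OF \<psi> sm])
  let ?w = "\<lambda>i. wderiv D [i] (\<lambda>x. U x $ i)"
  note li = L2_locally_integrable[OF sobolev_L2[OF U] Ds]
  have w: "is_wderiv D [i] (\<lambda>x. U x $ i) (?w i)" for i by (rule sobolev_wderiv(1)[OF U _ D(1)]) simp
  have i1: "integrable (lebesgue_on D) (\<lambda>x. U x $ i * (partial i \<phi> x * \<psi> x))" for i
    by (rule integrable_mult_test[OF Ds li test_functions_mult_left[OF \<psi> smooth_partial[OF sm]]])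
  have i2: "integrable (lebesgue_on D) (\<lambda>x. U x $ i * (\<phi> x * partial i \<psi> x))" for i
    by (rule integrable_mult_test[OF Ds li test_functions_mult_left[OF test_functions_partial[OF \<psi>] sm]])
  have i3: "integrable (lebesgue_on D) (\<lambda>x. ?w i x * (\<phi> x * \<psi> x))" for i
    by (rule integrable_mult_test[OF Ds is_wderivD(2)[OF w] \<phi>\<psi>])
  have "partial i (\<lambda>x. \<phi> x * \<psi> x) = (\<lambda>x. \<phi> x * partial i \<psi> x + partial i \<phi> x * \<psi> x)" for i
    by (rule ext) (simp add: partial_mult smooth_differentiable sm sp)
  then have eq: "(\<integral>x. U x $ i * (partial i \<phi> x * \<psi> x) \<partial>lebesgue_on D)
      = - (\<integral>x. U x $ i * (\<phi> x * partial i \<psi> x) \<partial>lebesgue_on D) - (\<integral>x. ?w i x * (\<phi> x * \<psi> x) \<partial>lebesgue_on D)" for i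
    using is_wderivD(3)[OF w \<phi>\<psi>, of i] i1[of i] i2[of i] by (simp add: partials_Cons distrib_left)
  have "(\<integral>x. (\<Sum>i\<in>UNIV. U x $ i * partial i \<phi> x) * \<psi> x \<partial>lebesgue_on D)
      = (\<Sum>i\<in>UNIV. \<integral>x. U x $ i * (partial i \<phi> x * \<psi> x) \<partial>lebesgue_on D)"
    using i1 by (simp add: sum_distrib_right mult.assoc Bochner_Integration.integral_sum)
  also have "\<dots> = - (\<Sum>i\<in>UNIV. (\<integral>x. U x $ i * (\<phi> x * partial i \<psi> x) \<partial>lebesgue_on D) + (\<integral>x. ?w i x * (\<phi> x * \<psi> x) \<partial>lebesgue_on D))"
    by (simp add: eq sum_negf[symmetric])
  also have "\<dots> = - (\<integral>x. (\<Sum>i\<in>UNIV. U x $ i * (\<phi> x * partial i \<psi> x) + ?w i x * (\<phi> x * \<psi> x)) \<partial>lebesgue_on D)"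
    using i2 i3 by (simp add: Bochner_Integration.integral_sum)
  also have "(\<lambda>x. \<Sum>i\<in>UNIV. U x $ i * (\<phi> x * partial i \<psi> x) + ?w i x * (\<phi> x * \<psi> x))
      = (\<lambda>x. \<phi> x * ((\<Sum>i\<in>UNIV. U x $ i * partial i \<psi> x) + wdiv D U x * \<psi> x))"
    by (simp add: fun_eq_iff wdiv_def sum.distrib sum_distrib_left sum_distrib_right mult_ac distrib_left)
  finally show "(\<integral>x. (\<Sum>i\<in>UNIV. U x $ i * partial i \<phi> x) * \<psi> x \<partial>lebesgue_on D)
      = - (\<integral>x. \<phi> x * ((\<Sum>i\<in>UNIV. U x $ i * partial i \<psi> x) + wdiv D U x * \<psi> x) \<partial>lebesgue_on D)" .
qed

text \<open>Testing with test functions shows that \<open>p\<close> itself is admissible, with \<open>U \<cdot> \<nabla>p = - div u\<close>;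
  testing with \<open>p\<close> then gives \<open>(div u, p) = - (div u, p)\<close>.\<close>

lemma pressure_divergence_orthogonal:
  assumes D: "open D" "bounded D" and U: "\<And>i. (\<lambda>x. U x $ i) \<in> sobolev 1 D"
    and u: "\<And>i. (\<lambda>x. u x $ i) \<in> sobolev 1 D"
    and div0: "AE x in lebesgue_on D. wdiv D U x = 0" and p: "p \<in> L2 (lebesgue_on D)"
    and eq: "\<forall>q\<in>W_space D U. L2_inner D (wdiv D u) q =
        (\<integral>x. wdiv D U x * p x * q x \<partial>lebesgue_on D) + (\<integral>x. transport D U q x * p x \<partial>lebesgue_on D)"
  shows "L2_inner D p (wdiv D u) = 0"
proof -
  have Ds: "D \<in> sets lebesgue" using D by (simp add: borel_open)
  have du: "wdiv D u \<in> L2 (lebesgue_on D)" by (rule wdiv_L2[OF u D(1)])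
  have "(\<integral>x. wdiv D U x * p x * q x \<partial>lebesgue_on D) = 0" for q
    by (rule integral_eq_zero_AE) (use div0 in \<open>eventually_elim, simp\<close>)
  then have eq': "L2_inner D (wdiv D u) q = (\<integral>x. transport D U q x * p x \<partial>lebesgue_on D)"
    if "q \<in> W_space D U" for q
    using eq that by simp
  have tp: "is_transport D U p (\<lambda>x. - wdiv D u x)"
    unfolding is_transport_def
  proof (intro conjI ballI)
    show "(\<lambda>x. - wdiv D u x) \<in> L2 (lebesgue_on D)" by (rule L2_uminus[OF du])
    fix \<phi> assume \<phi>: "\<phi> \<in> test_functions D"
    note t = test_function_is_transport[OF D U \<phi>]
    have \<phi>W: "\<phi> \<in> W_space D U"
      using t smooth_L2[OF test_functions_smooth[OF \<phi>] D] by (auto simp: W_space_def)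
    have m: "(\<lambda>x. U x $ i) \<in> borel_measurable (lebesgue_on D)" "partial i \<phi> \<in> borel_measurable (lebesgue_on D)"
      "\<phi> \<in> borel_measurable (lebesgue_on D)" for i
      by (rule L2_measurable[OF sobolev_L2[OF U]])
         (intro smooth_measurable_on smooth_partial test_functions_smooth[OF \<phi>])+
    note [measurable] = m L2_measurable[OF p] L2_measurable[OF wdiv_L2[OF U D(1)]] L2_measurable[OF transport_L2[OF t]]
    have "(\<integral>x. wdiv D u x * \<phi> x \<partial>lebesgue_on D) = (\<integral>x. transport D U \<phi> x * p x \<partial>lebesgue_on D)"
      using eq'[OF \<phi>W] by (simp add: L2_inner_def)
    also have "\<dots> = (\<integral>x. p x * ((\<Sum>i\<in>UNIV. U x $ i * partial i \<phi> x) + wdiv D U x * \<phi> x) \<partial>lebesgue_on D)"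
    proof (rule integral_cong_AE)
      show "AE x in lebesgue_on D. transport D U \<phi> x * p x = p x * ((\<Sum>i\<in>UNIV. U x $ i * partial i \<phi> x) + wdiv D U x * \<phi> x)"
        using transport_AE_eq[OF D(1) t] div0 by eventually_elim simp
    qed measurable
    finally show "(\<integral>x. - wdiv D u x * \<phi> x \<partial>lebesgue_on D)
        = - (\<integral>x. p x * ((\<Sum>i\<in>UNIV. U x $ i * partial i \<phi> x) + wdiv D U x * \<phi> x) \<partial>lebesgue_on D)" by simp
  qed
  then have pW: "p \<in> W_space D U" using p by (auto simp: W_space_def)
  have "(\<integral>x. transport D U p x * p x \<partial>lebesgue_on D) = (\<integral>x. - wdiv D u x * p x \<partial>lebesgue_on D)"
    by (rule integral_mult_cong_AE[OF transport_AE_eq[OF D(1) tp]])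
       (auto intro!: L2_measurable L2_uminus du p transport_L2[OF tp])
  with eq'[OF pW] have "(\<integral>x. wdiv D u x * p x \<partial>lebesgue_on D) = 0" by (simp add: L2_inner_def)
  then show ?thesis by (simp add: L2_inner_def mult.commute)
qed

text \<open>The pairing of stress and strain is 2\<nu> times a square plus \<open>lam\<close> times
  a square, hence nonnegative; positive \<eta> then forces the integral of |u|^2 to vanish.\<close>

lemma bilinear_a_zero_imp:
  assumes "\<nu> > 0" "lam \<ge> 0" "\<eta> > 0" and u: "\<And>i. (\<lambda>x. u x $ i) \<in> L2 (lebesgue_on D)"
    and z: "bilinear_a \<nu> lam \<eta> D u u = 0"
  shows "AE x in lebesgue_on D. u x = 0"
proof -
  have tr: "mat 1 \<bullet> strain D u x = wdiv D u x" for x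
  proof -
    have "mat 1 \<bullet> strain D u x = (\<Sum>i\<in>UNIV. \<Sum>l\<in>UNIV. if i = l then strain D u x $ i $ l else 0)"
      unfolding inner_vec_def by (intro sum.cong refl) (simp add: mat_def)
    then show ?thesis by (simp add: strain_def wdiv_def)
  qed
  have "stress \<nu> lam D u x \<bullet> strain D u x = (2 * \<nu>) * (strain D u x \<bullet> strain D u x) + lam * (wdiv D u x)\<^sup>2" for x
    by (simp add: stress_def inner_add_left tr power2_eq_square)
  then have "0 \<le> L2_inner D (stress \<nu> lam D u) (strain D u)"
    unfolding L2_inner_def using assms by (intro integral_nonneg_AE AE_I2) simp
  moreover have nn: "0 \<le> L2_inner D u u" unfolding L2_inner_def by (intro integral_nonneg_AE AE_I2) simp
  ultimately have "\<eta> * L2_inner D u u = 0"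
    using z[unfolded bilinear_a_def] mult_nonneg_nonneg[of \<eta> "L2_inner D u u"] assms(3) by linarith
  then have 0: "(\<integral>x. u x \<bullet> u x \<partial>lebesgue_on D) = 0" using assms(3) by (simp add: L2_inner_def)
  have i: "integrable (lebesgue_on D) (\<lambda>x. u x \<bullet> u x)"
    unfolding inner_vec_def using L2_mult_integrable[OF u u] by simp
  have "AE x in lebesgue_on D. u x \<bullet> u x = 0"
    using integral_nonneg_eq_0_iff_AE[OF i] 0 by simp
  then show ?thesis by eventually_elim simp
qed

subsection \<open>Functions with vanishing weak gradient\<close>

text \<open>Fubini and translation arguments run on the Borel measure \<open>lborel\<close> over the
  whole space. \<open>P\<close> extends \<open>p\<close> by 0 and is Borel, with the same
  pairings.\<close>

lemma borel_representative:
  assumes D: "D \<in> sets lebesgue" and p: "integrable (lebesgue_on D) p"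
  obtains P :: "'a::euclidean_space \<Rightarrow> real" where "integrable lborel P"
    and "\<And>f. f \<in> borel_measurable borel \<Longrightarrow> (\<integral>x. p x * f x \<partial>lebesgue_on D) = (\<integral>x. P x * f x \<partial>lborel)"
proof -
  let ?q = "\<lambda>x. indicator D x * p x"
  have q: "integrable lebesgue ?q" using p D by (simp add: integrable_restrict_space)
  obtain P where P[measurable]: "P \<in> borel_measurable lborel" and ae: "AE x in lborel. ?q x = P x"
    using completion_ex_borel_measurable_real[of ?q lborel] q by blast
  have ae': "AE x in lebesgue. ?q x = P x" using ae by (rule AE_completion)
  have Pl: "P \<in> borel_measurable lebesgue" by (rule measurable_completion) measurable
  have "integrable lebesgue P"
    using integrable_cong_AE[THEN iffD1, OF borel_measurable_integrable[OF q] Pl ae' q] .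
  then have Pi: "integrable lborel P" by (simp add: integrable_completion)
  have "(\<integral>x. p x * f x \<partial>lebesgue_on D) = (\<integral>x. P x * f x \<partial>lborel)" if f[measurable]: "f \<in> borel_measurable borel" for f
  proof -
    have fl: "f \<in> borel_measurable lebesgue" by (rule measurable_completion) (use f in simp)
    have "(\<integral>x. p x * f x \<partial>lebesgue_on D) = (\<integral>x. ?q x * f x \<partial>lebesgue)"
      using D by (simp add: integral_restrict_space mult.assoc)
    also have "\<dots> = (\<integral>x. P x * f x \<partial>lebesgue)"
      by (rule integral_mult_cong_AE[OF ae' borel_measurable_integrable[OF q] Pl fl])
    also have "\<dots> = (\<integral>x. P x * f x \<partial>lborel)" by (rule integral_completion) measurable
    finally show ?thesis .
  qed
  with Pi show ?thesis by (rule that)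
qed

lemma test_function_lipschitz:
  assumes "\<phi> \<in> test_functions D" obtains L where "L-lipschitz_on UNIV \<phi>"
proof -
  obtain R where R: "\<And>x. norm x > R \<Longrightarrow> \<phi> x = 0" by (rule test_function_supportE[OF assms]) (rule that)
  obtain L where "L-lipschitz_on (cball 0 (R + 1)) \<phi>"
    by (rule C1_lipschitz_on[OF smooth_C1[OF test_functions_smooth[OF assms]] compact_cball convex_cball])
  then have "L-lipschitz_on UNIV \<phi>" by (rule lipschitz_on_UNIV_of_support) (rule R)
  then show ?thesis by (rule that)
qed

lemma test_function_bounded:
  assumes "\<phi> \<in> test_functions D" obtains B where "\<And>x. \<bar>\<phi> x\<bar> \<le> B" "0 \<le> B"
proof -
  obtain K where K: "smooth \<phi>" "compact K" "K \<subseteq> D" "\<And>x. x \<notin> K \<Longrightarrow> \<phi> x = 0"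
    by (rule test_functionsE[OF assms]) (rule that)
  obtain B where B: "\<And>x. x \<in> closure K \<Longrightarrow> \<bar>\<phi> x\<bar> \<le> B"
    by (rule continuous_bounded_on_closure[OF smooth_continuous_on[OF K(1)] compact_imp_bounded[OF K(2)]]) (rule that)
  have "\<bar>\<phi> x\<bar> \<le> max B 0" for x
    using B[of x] K(4)[of x] closure_subset[of K] by (cases "x \<in> K") (auto simp: le_max_iff_disj)
  then show ?thesis by (rule that) simp
qed

lemma test_function_integrable:
  assumes "\<phi> \<in> test_functions D" shows "integrable lborel \<phi>"
proof -
  have "\<phi> \<in> test_functions UNIV" using assms test_functions_mono[of D UNIV] by auto
  from integrable_mult_test[OF _ continuous_locally_integrable this, of "\<lambda>x. 1"]
  have "integrable lebesgue \<phi>" by (simp add: lebesgue_on_UNIV_eq)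
  then show ?thesis
    using smooth_borel_measurable[OF test_functions_smooth[OF assms]] by (simp add: integrable_completion)
qed

lemma integrable_mult_bounded:
  fixes P f :: "'a \<Rightarrow> real"
  assumes "integrable M P" "f \<in> borel_measurable M" "\<And>x. \<bar>f x\<bar> \<le> B"
  shows "integrable M (\<lambda>x. P x * f x)"
proof (rule Bochner_Integration.integrable_bound)
  show "integrable M (\<lambda>x. B * P x)" using assms(1) by simp
  show "AE x in M. norm (P x * f x) \<le> norm (B * P x)"
  proof (rule AE_I2)
    fix x
    have "\<bar>P x\<bar> * \<bar>f x\<bar> \<le> \<bar>P x\<bar> * \<bar>B\<bar>"
      by (intro mult_left_mono order_trans[OF assms(3) abs_ge_self]) simp
    then show "norm (P x * f x) \<le> norm (B * P x)" by (simp add: abs_mult mult.commute)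
  qed
qed (use assms in auto)

lemma directional_derivative_smooth:
  assumes "smooth \<rho>"
  shows "((\<lambda>s. \<rho> (z + s *\<^sub>R v)) has_real_derivative (\<Sum>i\<in>UNIV. partial i \<rho> (z + t *\<^sub>R v) * v $ i)) (at t)"
proof -
  have "((\<lambda>s. z + s *\<^sub>R v) has_derivative (\<lambda>s. s *\<^sub>R v)) (at t)" by (auto intro!: derivative_eq_intros)
  from has_derivative_compose[OF this has_derivative_partial[OF smooth_differentiable[OF assms]]]
  have "((\<lambda>s. \<rho> (z + s *\<^sub>R v)) has_derivative (\<lambda>s. \<Sum>i\<in>UNIV. partial i \<rho> (z + t *\<^sub>R v) * (s *\<^sub>R v) $ i)) (at t)" .
  moreover have "(\<lambda>s. \<Sum>i\<in>UNIV. partial i \<rho> (z + t *\<^sub>R v) * (s *\<^sub>R v) $ i) = (*) (\<Sum>i\<in>UNIV. partial i \<rho> (z + t *\<^sub>R v) * v $ i)"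
    by (simp add: fun_eq_iff sum_distrib_left sum_distrib_right mult_ac)
  ultimately show ?thesis by (simp add: has_field_derivative_def)
qed

text \<open>The Lipschitz constant of \<rho> bounds all difference quotients, so \<bar>P\<bar> times
  a constant dominates. No regularity of \<open>P\<close> is used beyond integrability.\<close>

lemma convolution_derivative:
  fixes P \<rho> :: "real^'n::finite \<Rightarrow> real"
  assumes P: "integrable lborel P" and \<rho>: "\<rho> \<in> test_functions UNIV"
  shows "((\<lambda>t. \<integral>y. P y * \<rho> (y + b + t *\<^sub>R v) \<partial>lborel) has_real_derivative
    (\<integral>y. P y * (\<Sum>i\<in>UNIV. partial i \<rho> (y + b + t *\<^sub>R v) * v $ i) \<partial>lborel)) (at t)"
  unfolding has_field_derivative_iff tendsto_at_iff_sequentially comp_def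
proof (intro allI impI)
  fix X :: "nat \<Rightarrow> real" assume X: "\<forall>k. X k \<in> UNIV - {t}" "X \<longlonglongrightarrow> t"
  have sm: "smooth \<rho>" by (rule test_functions_smooth[OF \<rho>])
  have [measurable]: "\<rho> \<in> borel_measurable borel" "partial i \<rho> \<in> borel_measurable borel" for i
    by (intro smooth_borel_measurable smooth_partial sm)+
  have [measurable]: "P \<in> borel_measurable borel" using P by auto
  obtain L where L: "L-lipschitz_on UNIV \<rho>" by (rule test_function_lipschitz[OF \<rho>])
  obtain B where B: "\<And>x. \<bar>\<rho> x\<bar> \<le> B" "0 \<le> B" by (rule test_function_bounded[OF \<rho>]) (rule that)
  have I: "integrable lborel (\<lambda>y. P y * \<rho> (y + c))" for c
    by (rule integrable_mult_bounded[OF P _ B(1)]) measurable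
  define q where "q k y = P y * ((\<rho> (y + b + X k *\<^sub>R v) - \<rho> (y + b + t *\<^sub>R v)) / (X k - t))" for k y
  have qe: "((\<integral>y. P y * \<rho> (y + b + X k *\<^sub>R v) \<partial>lborel) - (\<integral>y. P y * \<rho> (y + b + t *\<^sub>R v) \<partial>lborel)) / (X k - t)
      = (\<integral>y. q k y \<partial>lborel)" for k
  proof -
    have "(\<integral>y. q k y \<partial>lborel) = (\<integral>y. (P y * \<rho> (y + (b + X k *\<^sub>R v)) - P y * \<rho> (y + (b + t *\<^sub>R v))) / (X k - t) \<partial>lborel)"
      by (simp add: q_def right_diff_distrib add.assoc)
    also have "\<dots> = ((\<integral>y. P y * \<rho> (y + (b + X k *\<^sub>R v)) \<partial>lborel) - (\<integral>y. P y * \<rho> (y + (b + t *\<^sub>R v)) \<partial>lborel)) / (X k - t)"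
      by (subst integral_divide_zero, subst Bochner_Integration.integral_diff[OF I I]) simp
    finally show ?thesis by (simp add: add.assoc)
  qed
  have "(\<lambda>k. \<integral>y. q k y \<partial>lborel) \<longlonglongrightarrow> (\<integral>y. P y * (\<Sum>i\<in>UNIV. partial i \<rho> (y + b + t *\<^sub>R v) * v $ i) \<partial>lborel)"
  proof (rule integral_dominated_convergence)
    show "integrable lborel (\<lambda>y. (L * norm v) * \<bar>P y\<bar>)" using P by simp
    show "AE y in lborel. (\<lambda>k. q k y) \<longlonglongrightarrow> P y * (\<Sum>i\<in>UNIV. partial i \<rho> (y + b + t *\<^sub>R v) * v $ i)"
    proof (rule AE_I2)
      fix y
      have "((\<lambda>s. (\<rho> (y + b + s *\<^sub>R v) - \<rho> (y + b + t *\<^sub>R v)) / (s - t)) \<longlongrightarrow> (\<Sum>i\<in>UNIV. partial i \<rho> (y + b + t *\<^sub>R v) * v $ i)) (at t)"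
        using directional_derivative_smooth[OF sm, of "y + b" v t] by (simp add: has_field_derivative_iff)
      then have "(\<lambda>k. (\<rho> (y + b + X k *\<^sub>R v) - \<rho> (y + b + t *\<^sub>R v)) / (X k - t)) \<longlonglongrightarrow> (\<Sum>i\<in>UNIV. partial i \<rho> (y + b + t *\<^sub>R v) * v $ i)"
        using X unfolding tendsto_at_iff_sequentially comp_def by blast
      then show "(\<lambda>k. q k y) \<longlonglongrightarrow> P y * (\<Sum>i\<in>UNIV. partial i \<rho> (y + b + t *\<^sub>R v) * v $ i)"
        unfolding q_def by (rule tendsto_mult_left)
    qed
    show "AE y in lborel. norm (q k y) \<le> (L * norm v) * \<bar>P y\<bar>" for k
    proof (rule AE_I2)
      fix y
      have "\<bar>\<rho> (y + b + X k *\<^sub>R v) - \<rho> (y + b + t *\<^sub>R v)\<bar> \<le> L * dist (y + b + X k *\<^sub>R v) (y + b + t *\<^sub>R v)"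
        using lipschitz_onD[OF L UNIV_I UNIV_I, of "y + b + X k *\<^sub>R v" "y + b + t *\<^sub>R v"] by (simp only: dist_real_def)
      also have "dist (y + b + X k *\<^sub>R v) (y + b + t *\<^sub>R v) = \<bar>X k - t\<bar> * norm v"
        by (simp add: dist_norm scaleR_diff_left[symmetric])
      finally have "\<bar>\<rho> (y + b + X k *\<^sub>R v) - \<rho> (y + b + t *\<^sub>R v)\<bar> / \<bar>X k - t\<bar> \<le> L * norm v"
        using X(1)[rule_format, of k] by (simp add: pos_divide_le_eq mult_ac)
      then have "\<bar>P y\<bar> * (\<bar>\<rho> (y + b + X k *\<^sub>R v) - \<rho> (y + b + t *\<^sub>R v)\<bar> / \<bar>X k - t\<bar>) \<le> \<bar>P y\<bar> * (L * norm v)"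
        by (rule mult_left_mono) simp
      then show "norm (q k y) \<le> (L * norm v) * \<bar>P y\<bar>"
        unfolding q_def real_norm_def abs_mult abs_divide by (simp only: mult.commute[of "\<bar>P y\<bar>"])
    qed
    show "q k \<in> borel_measurable lborel" for k unfolding q_def by measurable
  qed measurable
  then show "(\<lambda>k. ((\<integral>y. P y * \<rho> (y + b + X k *\<^sub>R v) \<partial>lborel) - (\<integral>y. P y * \<rho> (y + b + t *\<^sub>R v) \<partial>lborel)) / (X k - t))
      \<longlonglongrightarrow> (\<integral>y. P y * (\<Sum>i\<in>UNIV. partial i \<rho> (y + b + t *\<^sub>R v) * v $ i) \<partial>lborel)"
    by (simp add: qe)
qed

lemma bump_test: "cball x \<epsilon> \<subseteq> D \<Longrightarrow> \<epsilon> > 0 \<Longrightarrow> (\<lambda>y. bump \<epsilon> (y + - x)) \<in> test_functions D"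
proof (rule test_functionsI[OF smooth_translate[OF smooth_bump] compact_cball])
  fix y assume "\<epsilon> > 0" "bump \<epsilon> (y + - x) \<noteq> 0"
  then have "norm (y + - x) < \<epsilon>" using bump_pos_iff[of \<epsilon> "y + - x"] bump_bounds(1)[of \<epsilon> "y + - x"] by simp
  then show "y \<in> cball x \<epsilon>" by (simp add: dist_norm norm_minus_commute)
qed

lemma bump_integral_pos:
  assumes "\<epsilon> > 0" shows "0 < (\<integral>x. bump \<epsilon> x \<partial>lborel)"
proof -
  have i: "integrable lborel (bump \<epsilon> :: real^'a \<Rightarrow> real)"
    using test_function_integrable[OF bump_test[OF subset_UNIV assms, of 0]] by simp
  have nn: "0 \<le> (\<integral>x. bump \<epsilon> (x::real^'a) \<partial>lborel)" using bump_bounds by (intro integral_nonneg_AE AE_I2) auto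
  have "(\<integral>x. bump \<epsilon> (x::real^'a) \<partial>lborel) \<noteq> 0"
  proof
    assume "(\<integral>x. bump \<epsilon> (x::real^'a) \<partial>lborel) = 0"
    then have "AE x in (lborel :: (real^'a) measure). bump \<epsilon> x = 0"
      using integral_nonneg_eq_0_iff_AE[OF i AE_I2[OF bump_bounds(1)]] by simp
    then have "AE x in (lborel :: (real^'a) measure). x \<notin> ball 0 \<epsilon>"
      by eventually_elim (use bump_pos_iff[of \<epsilon>] assms in \<open>force simp: dist_norm\<close>)
    then have "ball (0::real^'a) \<epsilon> \<in> null_sets lborel" by (subst AE_iff_null_sets) auto
    then show False
      using open_not_negligible[of "ball (0::real^'a) \<epsilon>"] assms
      by (simp add: negligible_iff_null_sets null_sets_completionI)
  qed
  with nn show ?thesis by simp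
qed

text \<open>Slide the bump along the segment from x to x'. By convexity its support never leaves
  \<open>D\<close>, so the derivative of the pairing is a combination of pairings with derivatives
  of test functions and vanishes.\<close>

lemma convolution_constant:
  fixes P :: "real^'n::finite \<Rightarrow> real"
  assumes D: "convex D" and P: "integrable lborel P"
    and z: "\<And>i \<phi>. \<phi> \<in> test_functions D \<Longrightarrow> (\<integral>x. P x * partial i \<phi> x \<partial>lborel) = 0"
    and \<epsilon>: "\<epsilon> > 0" and x: "cball x \<epsilon> \<subseteq> D" "cball x' \<epsilon> \<subseteq> D"
  shows "(\<integral>y. P y * bump \<epsilon> (y + - x) \<partial>lborel) = (\<integral>y. P y * bump \<epsilon> (y + - x') \<partial>lborel)"
proof -
  let ?v = "x - x'"
  let ?h = "\<lambda>t. \<integral>y. P y * bump \<epsilon> (y + - x + t *\<^sub>R ?v) \<partial>lborel"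
  have \<rho>: "(bump \<epsilon> :: real^'n \<Rightarrow> real) \<in> test_functions UNIV" using bump_test[OF subset_UNIV \<epsilon>, of 0] by simp
  have Bint: "integrable lborel (\<lambda>y. P y * \<phi> y)" if \<phi>: "\<phi> \<in> test_functions D" for \<phi>
  proof -
    obtain B where B: "\<And>x. \<bar>\<phi> x\<bar> \<le> B" "0 \<le> B" by (rule test_function_bounded[OF \<phi>]) (rule that)
    show ?thesis
      by (rule integrable_mult_bounded[OF P _ B(1)])
         (use smooth_borel_measurable[OF test_functions_smooth[OF \<phi>]] in simp)
  qed
  have d: "(?h has_real_derivative 0) (at t)" if t: "0 < t" "t < 1" for t
  proof -
    define c where "c = x - t *\<^sub>R ?v"
    have c: "cball c \<epsilon> \<subseteq> D"
    proof
      fix y assume y: "y \<in> cball c \<epsilon>"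
      define e where "e = y - c"
      have "norm e \<le> \<epsilon>" using y by (simp add: e_def dist_norm norm_minus_commute)
      then have "x + e \<in> D" "x' + e \<in> D" using x by (auto simp: dist_norm)
      then have "(1 - t) *\<^sub>R (x + e) + t *\<^sub>R (x' + e) \<in> D" using D t by (intro convexD_alt) auto
      also have "(1 - t) *\<^sub>R (x + e) + t *\<^sub>R (x' + e) = y" by (simp add: e_def c_def algebra_simps)
      finally show "y \<in> D" .
    qed
    let ?\<phi> = "\<lambda>y. bump \<epsilon> (y + - c)"
    have \<phi>: "?\<phi> \<in> test_functions D" by (rule bump_test[OF c \<epsilon>])
    have shift: "y + - x + t *\<^sub>R ?v = y + - c" for y by (simp add: c_def)
    have "(\<integral>y. P y * (\<Sum>i\<in>UNIV. partial i (bump \<epsilon>) (y + - x + t *\<^sub>R ?v) * ?v $ i) \<partial>lborel)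
        = (\<integral>y. (\<Sum>i\<in>UNIV. (P y * partial i ?\<phi> y) * ?v $ i) \<partial>lborel)"
      unfolding shift partial_translate[OF smooth_bump] by (simp add: sum_distrib_left mult.assoc)
    also have "\<dots> = (\<Sum>i\<in>UNIV. (\<integral>y. P y * partial i ?\<phi> y \<partial>lborel) * ?v $ i)"
      using Bint[OF test_functions_partial[OF \<phi>]] by (subst Bochner_Integration.integral_sum) auto
    also have "\<dots> = 0" using z[OF \<phi>] by simp
    finally show ?thesis using convolution_derivative[OF P \<rho>, of "- x" ?v t] by simp
  qed
  have "continuous_on {0..1} ?h"
    by (intro continuous_at_imp_continuous_on ballI DERIV_isCont) (rule convolution_derivative[OF P \<rho>])
  from DERIV_isconst_end[OF zero_less_one this d] have "?h 1 = ?h 0" by simp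
  then show ?thesis by simp
qed

text \<open>Fubini transfers the mollification from \<open>P\<close> to \<phi>. There it changes
  \<phi> by at most L\<epsilon> times the mass of the bump, since only points at distance at most
  \<epsilon> are averaged.\<close>

lemma mollified_integral_bound:
  fixes P \<phi> :: "real^'n::finite \<Rightarrow> real"
  assumes P: "integrable lborel P" and \<phi>: "\<phi> \<in> test_functions D" and L: "L-lipschitz_on UNIV \<phi>" and \<epsilon>: "\<epsilon> > 0"
  shows "\<bar>(\<integral>x. \<phi> x * (\<integral>y. P y * bump \<epsilon> (y + - x) \<partial>lborel) \<partial>lborel) - (\<integral>x. bump \<epsilon> (x::real^'n) \<partial>lborel) * (\<integral>y. P y * \<phi> y \<partial>lborel)\<bar>
    \<le> L * \<epsilon> * (\<integral>x. bump \<epsilon> (x::real^'n) \<partial>lborel) * (\<integral>y. \<bar>P y\<bar> \<partial>lborel)"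
proof -
  let ?m = "\<integral>x. bump \<epsilon> (x::real^'n) \<partial>lborel"
  have [measurable]: "P \<in> borel_measurable borel" using P by auto
  have [measurable]: "\<phi> \<in> borel_measurable borel" by (rule smooth_borel_measurable[OF test_functions_smooth[OF \<phi>]])
  have [measurable]: "(bump \<epsilon> :: real^'n \<Rightarrow> real) \<in> borel_measurable borel" by (rule smooth_borel_measurable[OF smooth_bump])
  have \<phi>i: "integrable lborel \<phi>" by (rule test_function_integrable[OF \<phi>])
  have bi: "integrable lborel (bump \<epsilon> :: real^'n \<Rightarrow> real)"
    using test_function_integrable[OF bump_test[OF subset_UNIV \<epsilon>, of 0]] by simp
  obtain B where B: "\<And>x. \<bar>\<phi> x\<bar> \<le> B" "0 \<le> B" by (rule test_function_bounded[OF \<phi>]) (rule that)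
  have sym: "bump \<epsilon> (y + - x) = bump \<epsilon> (- y + x)" for x y :: "real^'n"
    by (simp add: bump_def inner_diff_left inner_diff_right inner_commute algebra_simps)
  have bt: "integrable lborel (\<lambda>x. bump \<epsilon> (y + - x))" "(\<integral>x. bump \<epsilon> (y + - x) \<partial>lborel) = ?m" for y :: "real^'n"
  proof -
    have "integrable (distr lborel borel ((+) (- y))) (bump \<epsilon> :: real^'n \<Rightarrow> real)" using bi by (simp only: lborel_distr_plus)
    then show "integrable lborel (\<lambda>x. bump \<epsilon> (y + - x))" unfolding sym by (subst (asm) integrable_distr_eq) auto
    show "(\<integral>x. bump \<epsilon> (y + - x) \<partial>lborel) = ?m" unfolding sym by (rule lborel_integral_translate) measurable
  qed
  have m0: "0 \<le> ?m" using bump_bounds by (intro integral_nonneg_AE AE_I2) auto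
  define F where "F x y = \<phi> x * (P y * bump \<epsilon> (y + - x))" for x y
  have Fm[measurable]: "(\<lambda>(x, y). F x y) \<in> borel_measurable (lborel \<Otimes>\<^sub>M lborel)"
    unfolding F_def split_beta' by measurable
  have Fb: "\<bar>F x y\<bar> \<le> \<bar>\<phi> x\<bar> * \<bar>P y\<bar>" for x y
  proof -
    have "\<bar>F x y\<bar> = \<bar>\<phi> x\<bar> * \<bar>P y\<bar> * bump \<epsilon> (y + - x)" using bump_bounds(1)[of \<epsilon> "y + - x"] by (simp add: F_def abs_mult)
    also have "\<dots> \<le> \<bar>\<phi> x\<bar> * \<bar>P y\<bar> * 1" by (intro mult_left_mono bump_bounds) auto
    finally show ?thesis by simp
  qed
  have Fy: "integrable lborel (\<lambda>y. F x y)" for x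
    by (rule Bochner_Integration.integrable_bound[where f="\<lambda>y. \<phi> x * P y"])
       (use P Fb[of x] in \<open>auto simp: abs_mult F_def\<close>)
  have "integrable (lborel \<Otimes>\<^sub>M lborel) (\<lambda>(x, y). F x y)"
  proof (rule lborel_pair.Fubini_integrable[OF Fm])
    show "AE x in lborel. integrable lborel (\<lambda>y. case (x, y) of (x, y) \<Rightarrow> F x y)" using Fy by simp
    show "integrable lborel (\<lambda>x. \<integral>y. norm (case (x, y) of (x, y) \<Rightarrow> F x y) \<partial>lborel)"
    proof (rule Bochner_Integration.integrable_bound)
      show "integrable lborel (\<lambda>x. \<bar>\<phi> x\<bar> * (\<integral>y. \<bar>P y\<bar> \<partial>lborel))" using \<phi>i by simp
      show "(\<lambda>x. \<integral>y. norm (case (x, y) of (x, y) \<Rightarrow> F x y) \<partial>lborel) \<in> borel_measurable lborel"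
        by measurable
      show "AE x in lborel. norm (\<integral>y. norm (case (x, y) of (x, y) \<Rightarrow> F x y) \<partial>lborel) \<le> norm (\<bar>\<phi> x\<bar> * (\<integral>y. \<bar>P y\<bar> \<partial>lborel))"
      proof (rule AE_I2)
        fix x
        have "(\<integral>y. norm (F x y) \<partial>lborel) \<le> (\<integral>y. \<bar>\<phi> x\<bar> * \<bar>P y\<bar> \<partial>lborel)"
          using Fb Fy[of x] P by (intro integral_mono) auto
        then have "(\<integral>y. norm (F x y) \<partial>lborel) \<le> \<bar>\<phi> x\<bar> * (\<integral>y. \<bar>P y\<bar> \<partial>lborel)" by simp
        moreover have "0 \<le> (\<integral>y. norm (F x y) \<partial>lborel)" by (intro integral_nonneg_AE AE_I2) simp
        ultimately show "norm (\<integral>y. norm (case (x, y) of (x, y) \<Rightarrow> F x y) \<partial>lborel) \<le> norm (\<bar>\<phi> x\<bar> * (\<integral>y. \<bar>P y\<bar> \<partial>lborel))"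
          by simp
      qed
    qed
  qed
  then have "(\<integral>x. (\<integral>y. F x y \<partial>lborel) \<partial>lborel) = (\<integral>y. (\<integral>x. F x y \<partial>lborel) \<partial>lborel)"
    and Gi: "integrable lborel (\<lambda>y. \<integral>x. F x y \<partial>lborel)"
    by (rule lborel_pair.Fubini_integral[symmetric], rule lborel_pair.integrable_snd)
  then have swap: "(\<integral>x. \<phi> x * (\<integral>y. P y * bump \<epsilon> (y + - x) \<partial>lborel) \<partial>lborel) = (\<integral>y. (\<integral>x. F x y \<partial>lborel) \<partial>lborel)"
    by (simp add: F_def)
  have P\<phi>: "integrable lborel (\<lambda>y. P y * \<phi> y)"
    by (rule integrable_mult_bounded[OF P _ B(1)]) measurable
  have inner: "\<bar>(\<integral>x. F x y \<partial>lborel) - ?m * (P y * \<phi> y)\<bar> \<le> L * \<epsilon> * ?m * \<bar>P y\<bar>" for y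
  proof -
    have i1: "integrable lborel (\<lambda>x. \<phi> x * bump \<epsilon> (y + - x))"
      by (rule Bochner_Integration.integrable_bound[where f="\<lambda>x. B * bump \<epsilon> (y + - x)"])
         (use bt(1) B bump_bounds in \<open>auto simp: abs_mult intro!: mult_right_mono AE_I2\<close>)
    have i2: "integrable lborel (\<lambda>x. (\<phi> x - \<phi> y) * bump \<epsilon> (y + - x))"
      using i1 bt(1)[of y] by (simp add: left_diff_distrib)
    have "(\<integral>x. F x y \<partial>lborel) = (\<integral>x. P y * (\<phi> x * bump \<epsilon> (y + - x)) \<partial>lborel)"
      by (simp add: F_def mult_ac)
    also have "\<dots> = P y * (\<integral>x. \<phi> x * bump \<epsilon> (y + - x) \<partial>lborel)" by simp
    finally have "(\<integral>x. F x y \<partial>lborel) - ?m * (P y * \<phi> y)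
        = P y * ((\<integral>x. \<phi> x * bump \<epsilon> (y + - x) \<partial>lborel) - (\<integral>x. \<phi> y * bump \<epsilon> (y + - x) \<partial>lborel))"
      using bt(2)[of y] by (simp add: algebra_simps)
    also have "(\<integral>x. \<phi> x * bump \<epsilon> (y + - x) \<partial>lborel) - (\<integral>x. \<phi> y * bump \<epsilon> (y + - x) \<partial>lborel)
        = (\<integral>x. (\<phi> x - \<phi> y) * bump \<epsilon> (y + - x) \<partial>lborel)"
      using i1 bt(1)[of y] by (simp add: left_diff_distrib)
    finally have eq: "\<bar>(\<integral>x. F x y \<partial>lborel) - ?m * (P y * \<phi> y)\<bar> = \<bar>P y\<bar> * \<bar>\<integral>x. (\<phi> x - \<phi> y) * bump \<epsilon> (y + - x) \<partial>lborel\<bar>"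
      by (simp add: abs_mult)
    have "\<bar>\<integral>x. (\<phi> x - \<phi> y) * bump \<epsilon> (y + - x) \<partial>lborel\<bar> \<le> (\<integral>x. norm ((\<phi> x - \<phi> y) * bump \<epsilon> (y + - x)) \<partial>lborel)"
      using integral_norm_bound[of lborel "\<lambda>x. (\<phi> x - \<phi> y) * bump \<epsilon> (y + - x)"] by simp
    also have "\<dots> \<le> (\<integral>x. L * \<epsilon> * bump \<epsilon> (y + - x) \<partial>lborel)"
    proof (rule integral_mono)
      show "integrable lborel (\<lambda>x. norm ((\<phi> x - \<phi> y) * bump \<epsilon> (y + - x)))" using i2 by (rule integrable_norm)
      show "integrable lborel (\<lambda>x. L * \<epsilon> * bump \<epsilon> (y + - x))" using bt(1)[of y] by simp
      fix x
      show "norm ((\<phi> x - \<phi> y) * bump \<epsilon> (y + - x)) \<le> L * \<epsilon> * bump \<epsilon> (y + - x)"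
      proof (cases "bump \<epsilon> (y + - x) = 0")
        case False
        then have b: "0 < bump \<epsilon> (y + - x)" using bump_bounds(1)[of \<epsilon> "y + - x"] by simp
        then have "dist x y \<le> \<epsilon>" using \<epsilon> by (simp add: bump_pos_iff dist_norm norm_minus_commute)
        then have "\<bar>\<phi> x - \<phi> y\<bar> \<le> L * \<epsilon>"
          using lipschitz_onD[OF L, of x y] mult_left_mono[of "dist x y" \<epsilon> L] lipschitz_on_nonneg[OF L]
          by (simp add: dist_real_def)
        then show ?thesis using b by (simp add: abs_mult mult_right_mono)
      qed simp
    qed
    also have "\<dots> = L * \<epsilon> * ?m" using bt(2)[of y] by simp
    finally have "\<bar>P y\<bar> * \<bar>\<integral>x. (\<phi> x - \<phi> y) * bump \<epsilon> (y + - x) \<partial>lborel\<bar> \<le> \<bar>P y\<bar> * (L * \<epsilon> * ?m)"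
      by (rule mult_left_mono) simp
    then show ?thesis unfolding eq by (simp only: mult.commute[of "\<bar>P y\<bar>"])
  qed
  have "(\<integral>y. (\<integral>x. F x y \<partial>lborel) \<partial>lborel) - ?m * (\<integral>y. P y * \<phi> y \<partial>lborel)
      = (\<integral>y. (\<integral>x. F x y \<partial>lborel) - ?m * (P y * \<phi> y) \<partial>lborel)"
    using Gi P\<phi> by simp
  also have "\<bar>\<dots>\<bar> \<le> (\<integral>y. \<bar>(\<integral>x. F x y \<partial>lborel) - ?m * (P y * \<phi> y)\<bar> \<partial>lborel)"
    using integral_norm_bound[of lborel "\<lambda>y. (\<integral>x. F x y \<partial>lborel) - ?m * (P y * \<phi> y)"] by simp
  also have "\<dots> \<le> (\<integral>y. L * \<epsilon> * ?m * \<bar>P y\<bar> \<partial>lborel)"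
    using Gi P\<phi> P by (intro integral_mono inner integrable_abs Bochner_Integration.integrable_diff) auto
  finally show ?thesis using swap by simp
qed

text \<open>On the support of a test function all small mollifications of \<open>p\<close> are
  constant, with value independent of the point. So the pairing of \<open>p\<close> with \<phi> is
  the limit of these constants times the integral of \<phi>.\<close>

theorem weak_gradient_zero_imp_constant:
  fixes p :: "real^'n::finite \<Rightarrow> real"
  assumes D: "open D" "convex D" "D \<noteq> {}" and p: "integrable (lebesgue_on D) p" "locally_integrable D p"
    and z: "\<And>i \<phi>. \<phi> \<in> test_functions D \<Longrightarrow> (\<integral>x. p x * partial i \<phi> x \<partial>lebesgue_on D) = 0"
  shows "\<exists>c. AE x in lebesgue_on D. p x = c"
proof -
  have Ds: "D \<in> sets lebesgue" using D by (simp add: borel_open)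
  obtain P where P: "integrable lborel P"
    and pP: "\<And>f. f \<in> borel_measurable borel \<Longrightarrow> (\<integral>x. p x * f x \<partial>lebesgue_on D) = (\<integral>x. P x * f x \<partial>lborel)"
    by (rule borel_representative[OF Ds p(1)]) (rule that)
  have zP: "(\<integral>x. P x * partial i \<phi> x \<partial>lborel) = 0" if "\<phi> \<in> test_functions D" for i \<phi>
    using z[OF that] pP[OF smooth_borel_measurable[OF smooth_partial[OF test_functions_smooth[OF that]]]] by simp
  obtain x0 where "x0 \<in> D" using D by blast
  then obtain r where r: "r > 0" "cball x0 r \<subseteq> D" using D(1) open_contains_cball by blast
  let ?m = "\<lambda>\<epsilon>. \<integral>x. bump \<epsilon> (x::real^'n) \<partial>lborel"
  let ?C = "\<lambda>\<epsilon>. \<integral>y. P y * bump \<epsilon> (y + - x0) \<partial>lborel"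
  let ?e = "\<lambda>k. 1 / real (Suc k)"
  have lim: "(\<lambda>k. ?C (?e k) / ?m (?e k) * (\<integral>x. \<phi> x \<partial>lborel)) \<longlonglongrightarrow> (\<integral>y. P y * \<phi> y \<partial>lborel)"
    if \<phi>: "\<phi> \<in> test_functions D" for \<phi>
  proof -
    obtain K where K: "smooth \<phi>" "compact K" "K \<subseteq> D" "\<And>x. x \<notin> K \<Longrightarrow> \<phi> x = 0"
      by (rule test_functionsE[OF \<phi>]) (rule that)
    obtain e0 where e0: "e0 > 0" "(\<Union>x\<in>K. cball x e0) \<subseteq> D"
      using compact_subset_open_imp_cball_epsilon_subset[OF K(2) D(1) K(3)] by blast
    obtain L where L: "L-lipschitz_on UNIV \<phi>" by (rule test_function_lipschitz[OF \<phi>])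
    have bound: "\<bar>?C \<epsilon> / ?m \<epsilon> * (\<integral>x. \<phi> x \<partial>lborel) - (\<integral>y. P y * \<phi> y \<partial>lborel)\<bar> \<le> L * \<epsilon> * (\<integral>y. \<bar>P y\<bar> \<partial>lborel)"
      if \<epsilon>: "\<epsilon> > 0" "\<epsilon> \<le> e0" "\<epsilon> \<le> r" for \<epsilon>
    proof -
      have m: "0 < ?m \<epsilon>" by (rule bump_integral_pos[OF \<epsilon>(1)])
      have fe: "\<phi> x * (\<integral>y. P y * bump \<epsilon> (y + - x) \<partial>lborel) = ?C \<epsilon> * \<phi> x" for x
      proof (cases "x \<in> K")
        case True
        then have "cball x \<epsilon> \<subseteq> D" "cball x0 \<epsilon> \<subseteq> D" using e0 \<epsilon> r by (force simp: subset_iff)+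
        from convolution_constant[OF D(2) P zP \<epsilon>(1) this] show ?thesis by simp
      qed (simp add: K(4))
      have "\<bar>?C \<epsilon> * (\<integral>x. \<phi> x \<partial>lborel) - ?m \<epsilon> * (\<integral>y. P y * \<phi> y \<partial>lborel)\<bar>
          \<le> L * \<epsilon> * ?m \<epsilon> * (\<integral>y. \<bar>P y\<bar> \<partial>lborel)"
        using mollified_integral_bound[OF P \<phi> L \<epsilon>(1), unfolded fe integral_mult_right_zero] .
      moreover have "?C \<epsilon> / ?m \<epsilon> * (\<integral>x. \<phi> x \<partial>lborel) - (\<integral>y. P y * \<phi> y \<partial>lborel)
          = (?C \<epsilon> * (\<integral>x. \<phi> x \<partial>lborel) - ?m \<epsilon> * (\<integral>y. P y * \<phi> y \<partial>lborel)) / ?m \<epsilon>"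
        using m by (simp add: diff_divide_distrib)
      ultimately show ?thesis using m by (simp add: abs_divide pos_divide_le_eq mult_ac)
    qed
    have e_lim: "?e \<longlonglongrightarrow> 0" by (rule LIMSEQ_Suc[OF lim_1_over_n])
    have "(\<lambda>k. L * ?e k * (\<integral>y. \<bar>P y\<bar> \<partial>lborel)) \<longlonglongrightarrow> L * 0 * (\<integral>y. \<bar>P y\<bar> \<partial>lborel)"
      by (intro tendsto_intros e_lim)
    then have "(\<lambda>k. L * ?e k * (\<integral>y. \<bar>P y\<bar> \<partial>lborel)) \<longlonglongrightarrow> 0" by simp
    moreover have "eventually (\<lambda>k. norm (?C (?e k) / ?m (?e k) * (\<integral>x. \<phi> x \<partial>lborel) - (\<integral>y. P y * \<phi> y \<partial>lborel))
        \<le> norm (L * ?e k * (\<integral>y. \<bar>P y\<bar> \<partial>lborel)) * 1) sequentially"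
      using order_tendstoD(2)[OF e_lim e0(1)] order_tendstoD(2)[OF e_lim r(1)]
    proof eventually_elim
      case (elim k)
      have "\<bar>?C (?e k) / ?m (?e k) * (\<integral>x. \<phi> x \<partial>lborel) - (\<integral>y. P y * \<phi> y \<partial>lborel)\<bar> \<le> L * ?e k * (\<integral>y. \<bar>P y\<bar> \<partial>lborel)"
        by (rule bound) (use elim in auto)
      then show ?case unfolding real_norm_def mult_1_right by (rule order_trans[OF _ abs_ge_self])
    qed
    ultimately have "(\<lambda>k. ?C (?e k) / ?m (?e k) * (\<integral>x. \<phi> x \<partial>lborel) - (\<integral>y. P y * \<phi> y \<partial>lborel)) \<longlonglongrightarrow> 0"
      by (rule tendsto_0_le)
    then show ?thesis by (rule LIM_zero_cancel)
  qed
  \<comment> \<open>A single test function with nonzero integral shows that the normalised constants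
    converge, and identifies their limit.\<close>
  define \<phi>0 where "\<phi>0 y = bump r (y + - x0)" for y
  have \<phi>0: "\<phi>0 \<in> test_functions D" unfolding \<phi>0_def[abs_def] by (rule bump_test[OF r(2,1)])
  have "(\<integral>x. \<phi>0 x \<partial>lborel) = ?m r"
    unfolding \<phi>0_def using lborel_integral_translate[OF smooth_borel_measurable[OF smooth_bump], of r "- x0"]
    by (simp add: add.commute)
  then have I0: "(\<integral>x. \<phi>0 x \<partial>lborel) \<noteq> 0" using bump_integral_pos[OF r(1), where 'a='n] by simp
  define c where "c = (\<integral>y. P y * \<phi>0 y \<partial>lborel) / (\<integral>x. \<phi>0 x \<partial>lborel)"
  have "(\<lambda>k. ?C (?e k) / ?m (?e k) * (\<integral>x. \<phi>0 x \<partial>lborel) / (\<integral>x. \<phi>0 x \<partial>lborel)) \<longlonglongrightarrow> c"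
    unfolding c_def by (intro tendsto_divide lim[OF \<phi>0] tendsto_const I0)
  then have cl: "(\<lambda>k. ?C (?e k) / ?m (?e k)) \<longlonglongrightarrow> c" using I0 by simp
  have "AE x in lebesgue_on D. p x - c = 0"
  proof (rule fundamental_lemma[OF D(1)])
    have lc: "locally_integrable D (\<lambda>x. c)" by (rule continuous_locally_integrable) simp
    show "locally_integrable D (\<lambda>x. p x - c)" by (rule locally_integrable_diff[OF p(2) lc])
    fix \<phi> assume \<phi>: "\<phi> \<in> test_functions D"
    have fm: "\<phi> \<in> borel_measurable borel" by (rule smooth_borel_measurable[OF test_functions_smooth[OF \<phi>]])
    have "(\<integral>y. P y * \<phi> y \<partial>lborel) = c * (\<integral>x. \<phi> x \<partial>lborel)"
      by (rule LIMSEQ_unique[OF lim[OF \<phi>]]) (intro tendsto_intros cl)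
    moreover have "(\<integral>x. c * \<phi> x \<partial>lebesgue_on D) = c * (\<integral>x. \<phi> x \<partial>lborel)"
      using integral_mult_test[OF Ds \<phi>, of "\<lambda>x. c"] fm by (simp add: integral_completion)
    ultimately show "(\<integral>x. (p x - c) * \<phi> x \<partial>lebesgue_on D) = 0"
      using integrable_mult_test[OF Ds p(2) \<phi>] integrable_mult_test[OF Ds lc \<phi>] pP[OF fm]
      by (auto simp: left_diff_distrib)
  qed
  then show ?thesis by (intro exI[of _ c]) simp
qed

subsection \<open>Traces of functions in $H_0^2$\<close>

text \<open>\<open>partials (i # \<alpha>)\<close> applies \<open>partial i\<close> last, so both
  hypotheses can be tested with the same pair: \<open>f\<close> with the test function
  \<open>partials \<alpha> \<phi>\<close>, and then \<open>h\<close> with \<phi>.\<close>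

lemma is_wderiv_wderiv:
  assumes f: "is_wderiv D [i] f g" and h: "is_wderiv D (i # \<alpha>) f h"
  shows "is_wderiv D \<alpha> g h"
  unfolding is_wderiv_def
proof (intro conjI ballI)
  fix \<phi> assume \<phi>: "\<phi> \<in> test_functions D"
  show "(\<integral>x. g x * partials \<alpha> \<phi> x \<partial>lebesgue_on D) = (-1) ^ length \<alpha> * (\<integral>x. h x * \<phi> x \<partial>lebesgue_on D)"
    using is_wderivD(3)[OF f test_functions_partials[OF \<phi>], of \<alpha>] is_wderivD(3)[OF h \<phi>] by (simp add: partials_Cons)
qed (use is_wderivD[OF f] is_wderivD[OF h] in auto)

lemma test_functions_frontier: "open D \<Longrightarrow> \<phi> \<in> test_functions D \<Longrightarrow> x \<in> frontier D \<Longrightarrow> \<phi> x = 0"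
  by (metis DiffD2 frontier_def interior_open subsetD test_functionsE)

text \<open>The approximating test functions vanish on the frontier, so they also serve as the
  approximants demanded by \<open>has_trace\<close>, with boundary error exactly 0.\<close>

lemma has_trace_zero_of_test_functions:
  assumes D: "open D" and f: "f \<in> sobolev 1 D" and \<phi>: "\<And>k. \<phi> k \<in> test_functions D"
    and lim: "(\<lambda>k::nat. sobolev_norm 1 D (\<lambda>x. \<phi> k x - f x)) \<longlonglongrightarrow> 0"
  shows "has_trace D f (\<lambda>_. 0)"
  unfolding has_trace_def
proof (intro conjI exI[of _ \<phi>] allI)
  have "(\<integral>x. (\<phi> k x - 0)\<^sup>2 \<partial>surface D) = 0" for k
  proof (rule integral_eq_zero_AE, rule AE_I2)
    fix x assume "x \<in> space (surface D)"
    then have "x \<in> frontier D" by (simp add: surface_def space_restrict_space)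
    then show "(\<phi> k x - 0)\<^sup>2 = 0" using test_functions_frontier[OF D \<phi>] by simp
  qed
  then show "(\<lambda>k. \<integral>x. (\<phi> k x - 0)\<^sup>2 \<partial>surface D) \<longlonglongrightarrow> 0" by simp
qed (use f lim \<phi> in \<open>auto intro: test_functions_smooth\<close>)

text \<open>If test functions approximate \<open>w\<close> in H2, their partial derivatives are
  again test functions and approximate the derivatives of \<open>w\<close> in H1.\<close>

lemma sobolev0_traces:
  assumes D: "open D" and w: "w \<in> sobolev0 2 D"
  shows "has_trace D w (\<lambda>_. 0)" "has_trace D (wderiv D [i] w) (\<lambda>_. 0)"
proof -
  have w2: "w \<in> sobolev 2 D" using w by (simp add: sobolev0_def)
  then have w1: "w \<in> sobolev 1 D" by (rule sobolev_mono) simp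
  obtain \<phi> where \<phi>: "\<And>k. \<phi> k \<in> test_functions D"
    and N: "(\<lambda>k::nat. sobolev_norm 2 D (\<lambda>x. \<phi> k x - w x)) \<longlonglongrightarrow> 0"
    using w by (auto simp: sobolev0_def)
  have sm: "smooth (\<phi> k)" for k by (rule test_functions_smooth[OF \<phi>])
  note lim = sobolev_norm_tendsto_0_iff[OF D sm w2, THEN iffD1, OF N, rule_format]
  have "(\<lambda>k. sobolev_norm 1 D (\<lambda>x. \<phi> k x - w x)) \<longlonglongrightarrow> 0"
    unfolding sobolev_norm_tendsto_0_iff[OF D sm w1] using lim by simp
  then show "has_trace D w (\<lambda>_. 0)" by (rule has_trace_zero_of_test_functions[OF D w1 \<phi>])
  let ?w = "wderiv D [i] w"
  have wd: "is_wderiv D \<alpha> ?w (wderiv D (i # \<alpha>) w)" if "length \<alpha> \<le> 1" for \<alpha>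
    using that by (intro is_wderiv_wderiv[OF sobolev_wderiv(1)[OF w2 _ D] sobolev_wderiv(1)[OF w2 _ D]]) auto
  have wi: "?w \<in> sobolev 1 D"
    by (rule sobolevI[OF wd]) (auto intro!: sobolev_wderiv(2)[OF w2 _ D])
  have smi: "smooth (partial i (\<phi> k))" for k by (rule smooth_partial[OF sm])
  have "(\<lambda>k. sobolev_norm 1 D (\<lambda>x. partial i (\<phi> k) x - ?w x)) \<longlonglongrightarrow> 0"
    unfolding sobolev_norm_tendsto_0_iff[OF D smi wi]
  proof (intro allI impI)
    fix \<alpha> :: "'a list" assume \<alpha>: "length \<alpha> \<le> 1"
    have ae: "AE x in lebesgue_on D. wderiv D \<alpha> ?w x = wderiv D (i # \<alpha>) w x"
      by (rule wderiv_AE_eq[OF D wd[OF \<alpha>]])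
    have "(\<integral>x. (partials (rev \<alpha>) (partial i (\<phi> k)) x - wderiv D \<alpha> ?w x)\<^sup>2 \<partial>lebesgue_on D)
        = (\<integral>x. (partials (rev (i # \<alpha>)) (\<phi> k) x - wderiv D (i # \<alpha>) w x)\<^sup>2 \<partial>lebesgue_on D)" for k
    proof (rule integral_cong_AE)
      have m: "wderiv D \<alpha> ?w \<in> borel_measurable (lebesgue_on D)" "wderiv D (i # \<alpha>) w \<in> borel_measurable (lebesgue_on D)"
        using \<alpha> by (auto intro!: L2_measurable sobolev_wderiv(2)[OF w2 _ D] sobolev_wderiv(2)[OF wi _ D])
      have p: "partials (rev \<alpha>) (partial i (\<phi> k)) \<in> borel_measurable (lebesgue_on D)"
        by (intro smooth_measurable_on smooth_partials smi)
      show "AE x in lebesgue_on D. (partials (rev \<alpha>) (partial i (\<phi> k)) x - wderiv D \<alpha> ?w x)\<^sup>2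
          = (partials (rev (i # \<alpha>)) (\<phi> k) x - wderiv D (i # \<alpha>) w x)\<^sup>2"
        using ae by eventually_elim (simp add: partials_append partials_Cons)
      show "(\<lambda>x. (partials (rev \<alpha>) (partial i (\<phi> k)) x - wderiv D \<alpha> ?w x)\<^sup>2) \<in> borel_measurable (lebesgue_on D)"
        using m p by measurable
      show "(\<lambda>x. (partials (rev (i # \<alpha>)) (\<phi> k) x - wderiv D (i # \<alpha>) w x)\<^sup>2) \<in> borel_measurable (lebesgue_on D)"
        using m p by (simp add: partials_append partials_Cons)
    qed
    then show "(\<lambda>k. \<integral>x. (partials (rev \<alpha>) (partial i (\<phi> k)) x - wderiv D \<alpha> ?w x)\<^sup>2 \<partial>lebesgue_on D) \<longlonglongrightarrow> 0"
      using lim[of "i # \<alpha>"] \<alpha> by simp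
  qed
  then show "has_trace D ?w (\<lambda>_. 0)"
    by (rule has_trace_zero_of_test_functions[OF D wi test_functions_partial[OF \<phi>]])
qed

section \<open>Admissible test functions and the weak bilaplacian\<close>

lemma sobolev_norm_zero:
  assumes D: "open D" "bounded D" shows "sobolev_norm m D (\<lambda>x. 0) = 0"
proof -
  have Ds: "D \<in> sets lebesgue" using D by (simp add: borel_open)
  have z: "smooth (\<lambda>x. 0)" by simp
  have "(\<integral>x. (partials (rev \<alpha>) (\<lambda>x. 0) x - wderiv D \<alpha> (\<lambda>x. 0) x)\<^sup>2 \<partial>lebesgue_on D) = 0" for \<alpha>
    by (rule integral_eq_zero_AE)
       (use wderiv_AE_eq[OF D(1) smooth_is_wderiv[OF Ds z, of \<alpha>]] in \<open>eventually_elim, simp\<close>)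
  then show ?thesis using sobolev_norm_diff[OF D(1) z smooth_sobolev[OF z D], of m] by simp
qed

lemma test_functions_sobolev0:
  assumes D: "open D" "bounded D" and \<phi>: "\<phi> \<in> test_functions D" shows "\<phi> \<in> sobolev0 m D"
proof -
  have "smooth \<phi>" by (rule test_functions_smooth[OF \<phi>])
  then show ?thesis
    using \<phi> smooth_sobolev[OF _ D] sobolev_norm_zero[OF D]
    by (auto simp: sobolev0_def intro!: exI[of _ "\<lambda>_. \<phi>"])
qed

lemma wdiv_smooth:
  assumes D: "open D" and v: "\<And>i. smooth (\<lambda>x. v x $ i)"
  shows "AE x in lebesgue_on D. wdiv D v x = (\<Sum>i\<in>UNIV. partial i (\<lambda>x. v x $ i) x)"
proof -
  have Ds: "D \<in> sets lebesgue" using D by (simp add: borel_open)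
  have "AE x in lebesgue_on D. wderiv D [i] (\<lambda>x. v x $ i) x = partial i (\<lambda>x. v x $ i) x" for i
    using wderiv_AE_eq[OF D smooth_is_wderiv[OF Ds v[of i], where \<alpha>="[i]"]] by (simp add: partials_Cons)
  then have "AE x in lebesgue_on D. \<forall>i\<in>UNIV. wderiv D [i] (\<lambda>x. v x $ i) x = partial i (\<lambda>x. v x $ i) x"
    by (intro AE_finite_allI) auto
  then show ?thesis by eventually_elim (simp add: wdiv_def)
qed

lemma (in convex_body) smooth_has_trace: "smooth f \<Longrightarrow> has_trace D f f"
  unfolding has_trace_def
  by (auto intro!: exI[of _ "\<lambda>_. f"] smooth_sobolev continuous_surface_L2 smooth_continuous_on
      simp: sobolev_norm_zero D)

lemma bilaplacian_weak:
  assumes D: "open D" and w: "w \<in> sobolev 2 D" and \<phi>: "\<phi> \<in> test_functions D"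
  shows "(\<integral>x. w x * laplacian (laplacian \<phi>) x \<partial>lebesgue_on D) = L2_inner D (wlaplacian D w) (wlaplacian D \<phi>)"
proof -
  have Ds: "D \<in> sets lebesgue" using D by (simp add: borel_open)
  have w2: "is_wderiv D [i, i] w (wderiv D [i, i] w)" "wderiv D [i, i] w \<in> L2 (lebesgue_on D)" for i
    by (auto intro!: sobolev_wderiv[OF w _ D])
  have lap: "laplacian f = (\<lambda>x. \<Sum>i\<in>UNIV. partials [i, i] f x)" for f :: "real^'a \<Rightarrow> real"
    by (simp add: laplacian_def fun_eq_iff)
  have t: "laplacian \<phi> \<in> test_functions D"
    unfolding lap by (intro test_functions_sum test_functions_partials \<phi>)
  have lw: "locally_integrable D w" by (rule is_wderivD(1)[OF w2(1)])
  have "(\<integral>x. w x * laplacian (laplacian \<phi>) x \<partial>lebesgue_on D)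
      = (\<Sum>i\<in>UNIV. \<integral>x. w x * partials [i, i] (laplacian \<phi>) x \<partial>lebesgue_on D)"
    by (simp only: lap[of "laplacian \<phi>"] sum_distrib_left)
       (rule Bochner_Integration.integral_sum, rule integrable_mult_test[OF Ds lw test_functions_partials[OF t]])
  also have "\<dots> = (\<Sum>i\<in>UNIV. \<integral>x. wderiv D [i, i] w x * laplacian \<phi> x \<partial>lebesgue_on D)"
    using is_wderivD(3)[OF w2(1) t] by simp
  also have "\<dots> = (\<integral>x. wlaplacian D w x * laplacian \<phi> x \<partial>lebesgue_on D)"
    unfolding wlaplacian_def sum_distrib_right
    by (rule Bochner_Integration.integral_sum[symmetric], rule integrable_mult_test[OF Ds is_wderivD(2)[OF w2(1)] t])
  also have "\<dots> = (\<integral>x. wlaplacian D w x * wlaplacian D \<phi> x \<partial>lebesgue_on D)"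
  proof (rule integral_cong_AE)
    have wp: "is_wderiv D [i, i] \<phi> (partials [i, i] \<phi>)" for i
      using smooth_is_wderiv[OF Ds test_functions_smooth[OF \<phi>], of "[i, i]"] by simp
    have m: "wlaplacian D w \<in> borel_measurable (lebesgue_on D)"
      unfolding wlaplacian_def[abs_def] by (intro borel_measurable_sum L2_measurable w2(2))
    have m': "wlaplacian D \<phi> \<in> borel_measurable (lebesgue_on D)"
      unfolding wlaplacian_def[abs_def]
      by (intro borel_measurable_sum locally_integrable_measurable[OF D] is_wderivD(2)[OF wderiv_is_wderiv[OF wp]])
    show "(\<lambda>x. wlaplacian D w x * laplacian \<phi> x) \<in> borel_measurable (lebesgue_on D)"
      by (intro borel_measurable_times m smooth_measurable_on test_functions_smooth[OF t])
    show "(\<lambda>x. wlaplacian D w x * wlaplacian D \<phi> x) \<in> borel_measurable (lebesgue_on D)"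
      by (intro borel_measurable_times m m')
    have "AE x in lebesgue_on D. \<forall>i\<in>UNIV. wderiv D [i, i] \<phi> x = partials [i, i] \<phi> x"
      using wderiv_AE_eq[OF D wp] by (intro AE_finite_allI) auto
    then show "AE x in lebesgue_on D. wlaplacian D w x * laplacian \<phi> x = wlaplacian D w x * wlaplacian D \<phi> x"
      by eventually_elim (simp add: wlaplacian_def lap)
  qed
  finally show ?thesis by (simp add: L2_inner_def)
qed

subsection \<open>The geometry near the plate\<close>

lemma lift_nth [simp]: "lift y $ 1 = y $ 1" "lift y $ 2 = y $ 2" "lift y $ 3 = 0"
  by (simp_all add: lift_def)

lemma proj_nth [simp]: "proj x $ 1 = x $ 1" "proj x $ 2 = x $ 2"
  by (simp_all add: proj_def vector_def)

lemma proj_lift [simp]: "proj (lift y) = y"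
  by (simp add: vec_eq_iff forall_2)

lemma linear_proj: "linear proj"
  by (rule linearI) (simp_all add: vec_eq_iff forall_2)

lemma linear_lift: "linear lift"
  by (rule linearI) (simp_all add: vec_eq_iff forall_3)

lemma geometry_lift_closure: "fluid_structure_geometry \<O> S \<Omega> \<Longrightarrow> lift ` \<Omega> \<subseteq> closure \<O>"
  using closure_subset[of "lift ` \<Omega>"] unfolding fluid_structure_geometry_def frontier_def by blast

text \<open>The hypothesis on \<open>outward_normal\<close> says something about the domain only
  once the definite description is known to denote. At a plate point every supporting vector is
  vertical, because the plate is open in its plane, and a domain point off the plane fixes the sign.
  So the unit normal is unique and the domain lies below.\<close>

lemma geometry_below:
  assumes g: "fluid_structure_geometry \<O> S \<Omega>" and z: "z \<in> \<O>"
  shows "z $ 3 < 0"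
proof -
  have O: "open \<O>" "convex \<O>" "bounded \<O>" "\<O> \<noteq> {}" and \<Omega>: "open \<Omega>" "\<Omega> \<noteq> {}"
    and fr: "frontier \<O> = closure S \<union> closure (lift ` \<Omega>)"
    and nrm: "\<And>x. x \<in> lift ` \<Omega> \<Longrightarrow> outward_normal \<O> x = vector [0, 0, 1]"
    using g by (auto simp: fluid_structure_geometry_def)
  obtain y where y: "y \<in> \<Omega>" using \<Omega> by blast
  then obtain r where r: "r > 0" "cball y r \<subseteq> \<Omega>" using \<Omega>(1) open_contains_cball by blast
  let ?x = "lift y"
  have xf: "?x \<in> frontier \<O>" using y closure_subset[of "lift ` \<Omega>"] unfolding fr by blast
  have up: "\<exists>z\<in>\<O>. z $ 3 \<noteq> 0"
  proof -
    obtain z e where ze: "z \<in> \<O>" "e > 0" "cball z e \<subseteq> \<O>" using O open_contains_cball by blast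
    then have "z + e *\<^sub>R axis 3 1 \<in> \<O>" by (intro subsetD[OF ze(3)]) (auto simp: dist_norm)
    moreover have "(z + e *\<^sub>R axis 3 1) $ 3 = z $ 3 + e" by (simp add: axis_def)
    ultimately show ?thesis using ze by (cases "z $ 3 = 0") force+
  qed
  have vert: "m $ 1 = 0 \<and> m $ 2 = 0" if m: "\<forall>z\<in>\<O>. m \<bullet> (z - ?x) \<le> 0" for m
  proof -
    have "\<O> \<subseteq> {z. m \<bullet> z \<le> m \<bullet> ?x}" using m by (auto simp: inner_diff_right)
    then have "closure \<O> \<subseteq> {z. m \<bullet> z \<le> m \<bullet> ?x}" by (rule closure_minimal) (rule closed_halfspace_le)
    then have le: "m \<bullet> (lift y' - ?x) \<le> 0" if "y' \<in> \<Omega>" for y'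
      using geometry_lift_closure[OF g] that by (auto simp: inner_diff_right)
    \<comment> \<open>Both signs of the horizontal step stay in the plate, so the two inequalities
      force the horizontal components of \<open>m\<close> to vanish.\<close>
    have "m \<bullet> lift (t *\<^sub>R axis i 1) \<le> 0" if "\<bar>t\<bar> = r" for t and i :: 2
    proof -
      have "y + t *\<^sub>R axis i 1 \<in> \<Omega>" using that r by (intro subsetD[OF r(2)]) (auto simp: dist_norm)
      from le[OF this] show ?thesis by (simp add: linear_add[OF linear_lift])
    qed
    from this[of r] this[of "- r"] have "m \<bullet> lift (axis i 1) = 0" for i :: 2
      using r by (simp add: linear_scale[OF linear_lift] linear_neg[OF linear_lift] mult_le_0_iff zero_le_mult_iff)
        (metis antisym)
    from this[of 1] this[of 2] show ?thesis by (simp add: inner_vec_def sum_3 axis_def)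
  qed
  have inner: "m \<bullet> (z - ?x) = m $ 3 * z $ 3" if "m $ 1 = 0 \<and> m $ 2 = 0" for m z :: "real^3"
    using that by (simp add: inner_vec_def sum_3)
  have n3: "\<bar>m $ 3\<bar> = 1" if "norm m = 1" "m $ 1 = 0 \<and> m $ 2 = 0" for m :: "real^3"
    using that by (simp add: norm_eq_sqrt_inner inner_vec_def sum_3)
  let ?P = "\<lambda>n. norm n = 1 \<and> (\<forall>z\<in>\<O>. n \<bullet> (z - ?x) \<le> 0)"
  have "\<exists>!n. ?P n"
  proof (rule ex_ex1I)
    obtain a r' R where "convex_body \<O> a r' R" using convex_body_exists[OF O] .
    then interpret convex_body \<O> a r' R .
    obtain n where n: "n \<in> polar" "j ?x = n \<bullet> (?x - a)" using j_attained by blast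
    have "n \<bullet> (?x - a) = 1" using n xf frontier_iff by simp
    from polar_normal[OF n(1) this] show "\<exists>n. ?P n" by (intro exI[of _ "n /\<^sub>R norm n"]) simp
  next
    fix m n assume m: "?P m" and n: "?P n"
    have v: "m $ 1 = 0 \<and> m $ 2 = 0" "n $ 1 = 0 \<and> n $ 2 = 0" using vert m n by auto
    have a1: "\<bar>m $ 3\<bar> = 1" "\<bar>n $ 3\<bar> = 1" using n3 m n v by auto
    obtain z where z: "z \<in> \<O>" "z $ 3 \<noteq> 0" using up by blast
    have "m $ 3 * z $ 3 \<le> 0" "n $ 3 * z $ 3 \<le> 0" using m n z inner[OF v(1)] inner[OF v(2)] by metis+
    then have "m $ 3 = n $ 3" using a1 z(2) by (auto simp: abs_if mult_le_0_iff split: if_splits)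
    then show "m = n" using v by (simp add: vec_eq_iff forall_3)
  qed
  then have "?P (outward_normal \<O> ?x)" unfolding outward_normal_def by (rule theI')
  then have P: "\<forall>z\<in>\<O>. (vector [0, 0, 1] :: real^3) \<bullet> (z - ?x) \<le> 0" using nrm[of ?x] y by simp
  have le0: "z $ 3 \<le> 0" if "z \<in> \<O>" for z
    using P that inner[of "vector [0, 0, 1]" z] by auto
  obtain e where e: "e > 0" "cball z e \<subseteq> \<O>" using O z open_contains_cball by blast
  then have "z + e *\<^sub>R axis 3 1 \<in> \<O>" by (intro subsetD[OF e(2)]) (auto simp: dist_norm)
  from le0[OF this] show ?thesis using e by (simp add: axis_def)
qed

text \<open>A point slightly below \<open>K\<close> lies on a segment from a nearby plate point to a
  fixed interior point \<open>z\<close>; by convexity the open end of such a segment is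
  interior.\<close>

lemma geometry_prism:
  assumes g: "fluid_structure_geometry \<O> S \<Omega>" and K: "compact K" "K \<subseteq> \<Omega>"
  obtains \<delta> where "\<delta> > 0" "\<And>x. proj x \<in> K \<Longrightarrow> - \<delta> < x $ 3 \<Longrightarrow> x $ 3 < 0 \<Longrightarrow> x \<in> \<O>"
proof -
  have O: "open \<O>" "convex \<O>" "\<O> \<noteq> {}" and \<Omega>: "open \<Omega>"
    using g by (auto simp: fluid_structure_geometry_def)
  obtain z where z: "z \<in> \<O>" using O by blast
  define h where "h = - (z $ 3)"
  have h: "h > 0" using geometry_below[OF g z] by (simp add: h_def)
  obtain e where e: "e > 0" "(\<Union>y\<in>K. cball y e) \<subseteq> \<Omega>"
    using compact_subset_open_imp_cball_epsilon_subset[OF K(1) \<Omega> K(2)] by blast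
  obtain B where B: "\<forall>y\<in>K. norm y \<le> B" using compact_imp_bounded[OF K(1)] by (auto simp: bounded_iff)
  define \<rho> where "\<rho> = \<bar>B\<bar> + norm (proj z) + 1"
  have \<rho>: "\<rho> > 0" unfolding \<rho>_def using norm_ge_zero[of "proj z"] by linarith
  \<comment> \<open>With t the depth relative to \<open>z\<close>, the plate point \<open>y\<close>
    is off by t/(1-t) times a distance of at most \<rho>. The bound 1/2 on t makes this at most
    2t\<rho>, and the second bound keeps it below \<open>e\<close>.\<close>
  define \<delta> where "\<delta> = h * min (1 / 2) (e / (2 * \<rho>))"
  show ?thesis
  proof (rule that)
    show "\<delta> > 0" using h e \<rho> by (simp add: \<delta>_def)
    fix x assume x: "proj x \<in> K" "- \<delta> < x $ 3" "x $ 3 < 0"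
    define t where "t = - (x $ 3) / h"
    have "- (x $ 3) < h * min (1 / 2) (e / (2 * \<rho>))" using x by (simp add: \<delta>_def)
    moreover have "- (x $ 3) = h * t" using h by (simp add: t_def)
    ultimately have "t < min (1 / 2) (e / (2 * \<rho>))" using h mult_less_cancel_left_pos[OF h] by metis
    then have t: "0 < t" "t < 1 / 2" "t * (2 * \<rho>) < e" using x h \<rho> by (auto simp: t_def pos_less_divide_eq divide_neg_pos)
    define y where "y = (1 / (1 - t)) *\<^sub>R (proj x - t *\<^sub>R proj z)"
    have "y - proj x = (t / (1 - t)) *\<^sub>R (proj x - proj z)"
    proof -
      have ty: "(1 - t) *\<^sub>R y = proj x - t *\<^sub>R proj z" using t by (simp add: y_def)
      have "(1 - t) *\<^sub>R (y - proj x) = t *\<^sub>R (proj x - proj z)"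
        unfolding scaleR_diff_right[of "1 - t"] ty by (simp add: algebra_simps)
      then have "(1 / (1 - t)) *\<^sub>R ((1 - t) *\<^sub>R (y - proj x)) = (1 / (1 - t)) *\<^sub>R (t *\<^sub>R (proj x - proj z))" by simp
      then show ?thesis using t by simp
    qed
    then have "norm (y - proj x) = (t / (1 - t)) * norm (proj x - proj z)" using t by simp
    also have "\<dots> \<le> (t / (1 / 2)) * \<rho>"
    proof (intro mult_mono divide_left_mono)
      show "norm (proj x - proj z) \<le> \<rho>"
        using norm_triangle_ineq4[of "proj x" "proj z"] B x(1) unfolding \<rho>_def by force
    qed (use t \<rho> in auto)
    also have "\<dots> \<le> e" using t by (simp add: mult_ac)
    finally have "y \<in> cball (proj x) e" by (simp add: dist_norm norm_minus_commute)
    then have "y \<in> \<Omega>" using e x by blast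
    then have yc: "lift y \<in> closure \<O>" using geometry_lift_closure[OF g] by blast
    have "lift y - t *\<^sub>R (lift y - z) \<in> interior \<O>"
      by (rule mem_interior_closure_convex_shrink[OF O(2) _ yc]) (use z O t in \<open>auto simp: interior_open\<close>)
    moreover have "lift y - t *\<^sub>R (lift y - z) = x"
    proof -
      have "(1 - t) *\<^sub>R y = proj x - t *\<^sub>R proj z" using t by (simp add: y_def)
      then have "((1 - t) *\<^sub>R y) $ 1 = x $ 1 - t * z $ 1" "((1 - t) *\<^sub>R y) $ 2 = x $ 2 - t * z $ 2" by simp_all
      moreover have "t * z $ 3 = x $ 3" using h by (simp add: t_def h_def)
      ultimately show ?thesis by (simp add: vec_eq_iff forall_3 algebra_simps)
    qed
    ultimately show "x \<in> \<O>" using O(1) by (simp add: interior_open)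
  qed
qed

section \<open>Lebesgue measure in space as a product of plate and height\<close>

lemma prod_Basis_vec: "(\<Prod>b\<in>Basis. (v :: real^'n::finite) \<bullet> b) = (\<Prod>i\<in>UNIV. v $ i)"
proof -
  have "(Basis :: (real^'n) set) = range (\<lambda>i. axis i 1)" by (auto simp: Basis_vec_def)
  moreover have "inj (\<lambda>i::'n. axis i (1::real))" by (auto simp: inj_def axis_eq_axis)
  ultimately have "(\<Prod>b\<in>Basis. v \<bullet> b) = (\<Prod>i\<in>UNIV. v \<bullet> axis i 1)"
    using prod.reindex[of "\<lambda>i::'n. axis i (1::real)" UNIV "(\<bullet>) v"] by simp
  then show ?thesis by (simp add: inner_axis)
qed

lemma proj_measurable [measurable]: "proj \<in> borel_measurable borel"
  by (intro borel_measurable_continuous_onI linear_continuous_on linear_conv_bounded_linear[THEN iffD1] linear_proj)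

text \<open>In these coordinates an open box is a planar box times an interval, so the two measures
  agree on boxes. This opens the way to Fubini for integrands that separate into plate and height
  variables.\<close>

lemma lborel_real3_eq:
  "lborel = distr (lborel \<Otimes>\<^sub>M lborel) borel (\<lambda>(y :: real^2, s :: real). lift y + s *\<^sub>R axis 3 1)"
proof (rule lborel_eqI)
  let ?f = "\<lambda>(y :: real^2, s :: real). lift y + s *\<^sub>R axis 3 1"
  have lm: "continuous_on UNIV lift"
    by (intro linear_continuous_on linear_conv_bounded_linear[THEN iffD1] linear_lift)
  have "continuous_on UNIV ?f"
    unfolding split_beta' by (intro continuous_intros continuous_on_compose2[OF lm]) auto
  then have fm: "?f \<in> measurable (lborel \<Otimes>\<^sub>M lborel) borel"
    using borel_measurable_continuous_onI[of ?f] by (simp add: lborel_prod)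
  fix l u :: "real^3" assume lu: "\<And>b. b \<in> Basis \<Longrightarrow> l \<bullet> b \<le> u \<bullet> b"
  have lu': "l $ i \<le> u $ i" for i
  proof -
    have "axis i 1 \<in> (Basis :: (real^3) set)" by (auto simp: Basis_vec_def)
    from lu[OF this] show ?thesis by (simp add: inner_axis)
  qed
  have "?f -` box l u \<inter> space (lborel \<Otimes>\<^sub>M lborel) = box (proj l) (proj u) \<times> box (l $ 3) (u $ 3)"
    by (auto simp: mem_box_cart forall_3 forall_2 space_pair_measure axis_def box_real)
  then have "emeasure (distr (lborel \<Otimes>\<^sub>M lborel) borel ?f) (box l u)
      = emeasure (lborel \<Otimes>\<^sub>M lborel) (box (proj l) (proj u) \<times> box (l $ 3) (u $ 3))"
    by (subst emeasure_distr[OF fm]) auto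
  also have "\<dots> = emeasure lborel (box (proj l) (proj u)) * emeasure lborel (box (l $ 3) (u $ 3))"
    by (rule lborel.emeasure_pair_measure_Times) auto
  also have "emeasure lborel (box (proj l) (proj u)) = ennreal (\<Prod>i\<in>UNIV. (proj u - proj l) $ i)"
  proof -
    have "proj l $ i \<le> proj u $ i" for i using exhaust_2[of i] lu'[of 1] lu'[of 2] by auto
    then have "proj l \<bullet> b \<le> proj u \<bullet> b" if "b \<in> Basis" for b
      using that by (auto simp: Basis_vec_def inner_axis)
    from emeasure_lborel_box[OF this] show ?thesis by (simp only: prod_Basis_vec)
  qed
  also have "emeasure lborel (box (l $ 3) (u $ 3)) = ennreal (u $ 3 - l $ 3)"
    unfolding box_real by (rule emeasure_lborel_Ioo) (rule lu')
  also have "ennreal (\<Prod>i\<in>UNIV. (proj u - proj l) $ i) * ennreal (u $ 3 - l $ 3) = ennreal (\<Prod>b\<in>Basis. (u - l) \<bullet> b)"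
  proof -
    have "(\<Prod>i\<in>UNIV. (proj u - proj l) $ i) = (u $ 1 - l $ 1) * (u $ 2 - l $ 2)"
      unfolding UNIV_2 by simp
    moreover have "(\<Prod>b\<in>Basis. (u - l) \<bullet> b) = (u $ 1 - l $ 1) * (u $ 2 - l $ 2) * (u $ 3 - l $ 3)"
      unfolding prod_Basis_vec UNIV_3 by (simp add: mult.assoc)
    moreover have "0 \<le> (u $ 1 - l $ 1) * (u $ 2 - l $ 2)" using lu' by simp
    ultimately show ?thesis using lu'[of 3] by (simp only: ennreal_mult diff_ge_0_iff_ge)
  qed
  finally show "emeasure (distr (lborel \<Otimes>\<^sub>M lborel) borel ?f) (box l u) = ennreal (\<Prod>b\<in>Basis. (u - l) \<bullet> b)" .
qed simp

lemma integral_real3_product: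
  fixes \<phi> :: "real^2 \<Rightarrow> real" and c :: "real \<Rightarrow> real"
  assumes \<phi>: "integrable lborel \<phi>" and c: "integrable lborel c"
  shows "(\<integral>x. \<phi> (proj x) * c (x $ 3) \<partial>lborel) = (\<integral>y. \<phi> y \<partial>lborel) * (\<integral>s. c s \<partial>lborel)"
proof -
  have [measurable]: "\<phi> \<in> borel_measurable borel" "c \<in> borel_measurable borel" using \<phi> c by auto
  let ?f = "\<lambda>(y :: real^2, s :: real). lift y + s *\<^sub>R axis 3 1"
  have lm: "continuous_on UNIV lift"
    by (intro linear_continuous_on linear_conv_bounded_linear[THEN iffD1] linear_lift)
  have "continuous_on UNIV ?f"
    unfolding split_beta' by (intro continuous_intros continuous_on_compose2[OF lm]) auto
  then have fm: "?f \<in> measurable (lborel \<Otimes>\<^sub>M lborel) borel"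
    using borel_measurable_continuous_onI[of ?f] by (simp add: lborel_prod)
  have pf: "proj (lift y + s *\<^sub>R axis 3 1) = y" "(lift y + s *\<^sub>R axis 3 1) $ 3 = s" for y and s :: real
    by (simp_all add: vec_eq_iff forall_2 axis_def)
  have "(\<integral>x. \<phi> (proj x) * c (x $ 3) \<partial>lborel) = (\<integral>z. \<phi> (proj (?f z)) * c (?f z $ 3) \<partial>(lborel \<Otimes>\<^sub>M lborel))"
    by (subst lborel_real3_eq, subst integral_distr[OF fm]) (auto simp: split_beta')
  also have "\<dots> = (\<integral>z. (case z of (y, s) \<Rightarrow> \<phi> y * c s) \<partial>(lborel \<Otimes>\<^sub>M lborel))"
    by (simp add: split_beta' pf)
  also have "\<dots> = (\<integral>y. (\<integral>s. \<phi> y * c s \<partial>lborel) \<partial>lborel)"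
  proof -
    have "integrable (lborel \<Otimes>\<^sub>M lborel) (\<lambda>z. case z of (y, s) \<Rightarrow> \<phi> y * c s)"
    proof (rule lborel_pair.Fubini_integrable)
      show "integrable lborel (\<lambda>y. \<integral>s. norm (case (y, s) of (y, s) \<Rightarrow> \<phi> y * c s) \<partial>lborel)"
        using \<phi> by (simp add: abs_mult)
      show "AE y in lborel. integrable lborel (\<lambda>s. case (y, s) of (y, s) \<Rightarrow> \<phi> y * c s)" using c by simp
    qed measurable
    from lborel_pair.integral_fst'[OF this] show ?thesis by simp
  qed
  finally show ?thesis by simp
qed

subsection \<open>Extending plate displacements to the fluid domain\<close>

lemma proj_bounded: "bounded X \<Longrightarrow> bounded (proj ` X)"
  by (rule bounded_linear_image) (simp_all add: linear_conv_bounded_linear[symmetric] linear_proj)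

lemma geometry_bounded_plate:
  assumes "fluid_structure_geometry \<O> S \<Omega>" shows "bounded \<Omega>"
proof -
  have "bounded (closure \<O>)" using assms by (auto simp: fluid_structure_geometry_def)
  then have "bounded (proj ` (lift ` \<Omega>))"
    by (intro proj_bounded bounded_subset[OF _ geometry_lift_closure[OF assms]])
  then show ?thesis by (simp add: image_image)
qed

text \<open>The field \<open>(0, 0, \<phi> (x\<^sub>1, x\<^sub>2) \<kappa> (x\<^sub>3))\<close>, with a bump \<open>\<kappa>\<close> so narrow that the support meets
  \<open>\<O>\<close> only in a prism below the plate.\<close>

lemma plate_extension:
  assumes g: "fluid_structure_geometry \<O> S \<Omega>" and \<phi>: "\<phi> \<in> test_functions \<Omega>"
  obtains \<psi> where "\<psi> \<in> V_Omega \<O> S \<Omega> \<phi>"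
    and "(\<integral>x. wdiv \<O> \<psi> x \<partial>lebesgue_on \<O>) = (\<integral>y. \<phi> y \<partial>lebesgue_on \<Omega>)"
proof -
  have O: "open \<O>" "convex \<O>" "bounded \<O>" "\<O> \<noteq> {}" and \<Omega>: "open \<Omega>"
    and fr: "frontier \<O> = closure S \<union> closure (lift ` \<Omega>)" and dis: "S \<inter> lift ` \<Omega> = {}"
    and nrm: "\<And>x. x \<in> lift ` \<Omega> \<Longrightarrow> outward_normal \<O> x = vector [0, 0, 1]"
    using g by (auto simp: fluid_structure_geometry_def)
  have Os: "\<O> \<in> sets borel" using O by simp
  have \<Omega>s: "\<Omega> \<in> sets lebesgue" using \<Omega> by (simp add: borel_open)
  obtain a r R where cb: "convex_body \<O> a r R" using convex_body_exists[OF O] .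
  obtain K where K: "smooth \<phi>" "compact K" "K \<subseteq> \<Omega>" "\<And>x. x \<notin> K \<Longrightarrow> \<phi> x = 0"
    by (rule test_functionsE[OF \<phi>]) (rule that)
  obtain \<delta> where \<delta>: "\<delta> > 0" "\<And>x. proj x \<in> K \<Longrightarrow> - \<delta> < x $ 3 \<Longrightarrow> x $ 3 < 0 \<Longrightarrow> x \<in> \<O>"
    by (rule geometry_prism[OF g K(2,3)]) (rule that)
  \<comment> \<open>Normalises \<kappa> to height 1 at the plate, so that the normal trace there is
    exactly \<phi>.\<close>
  define C where "C = 1 / flat_exp 0 (\<delta>\<^sup>2)"
  have C: "C * flat_exp 0 (\<delta>\<^sup>2) = 1" using flat_exp_0_pos_iff[of "\<delta>\<^sup>2"] \<delta>(1) by (simp add: C_def)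
  define \<kappa> where "\<kappa> s = C * flat_exp 0 (\<delta>\<^sup>2 - s * s)" for s
  define \<kappa>' where "\<kappa>' s = C * (flat_exp 2 (\<delta>\<^sup>2 - s * s) * (- 2 * s))" for s
  have d\<kappa>: "(\<kappa> has_real_derivative \<kappa>' s) (at s)" for s
  proof -
    have 1: "((\<lambda>s. \<delta>\<^sup>2 - s * s) has_real_derivative (- 2 * s)) (at s)" by (auto intro!: derivative_eq_intros)
    have 2: "(flat_exp 0 has_real_derivative flat_exp 2 t) (at t)" for t
      using flat_exp_has_derivative[of 0 t] by (simp add: numeral_2_eq_2)
    show ?thesis unfolding \<kappa>_def[abs_def] \<kappa>'_def by (rule DERIV_cmult[OF DERIV_chain2[OF 2 1]])
  qed
  have c\<kappa>: "continuous_on UNIV \<kappa>'"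
  proof -
    have "continuous_on UNIV (flat_exp 2)"
      by (intro continuous_at_imp_continuous_on ballI DERIV_isCont) (rule flat_exp_has_derivative)
    then have "continuous_on UNIV (\<lambda>s. flat_exp 2 (\<delta>\<^sup>2 - s * s))"
      by (rule continuous_on_compose2) (intro continuous_intros, simp)
    then show ?thesis unfolding \<kappa>'_def[abs_def] by (intro continuous_on_mult continuous_on_const continuous_on_id)
  qed
  have out: "\<delta>\<^sup>2 - s * s \<le> 0" if "\<bar>s\<bar> \<ge> \<delta>" for s
    using abs_le_square_iff[of \<delta> s] that \<delta>(1) by (simp add: power2_eq_square)
  have \<kappa>0: "\<kappa> s = 0" "\<kappa>' s = 0" if "\<bar>s\<bar> \<ge> \<delta>" for s
    using out[OF that] by (simp_all add: \<kappa>_def \<kappa>'_def flat_exp_def)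
  have \<kappa>1: "\<kappa> 0 = 1" "\<kappa>' 0 = 0" using C by (simp_all add: \<kappa>_def \<kappa>'_def)
  define f where "f x = \<phi> (proj x) * \<kappa> (x $ 3)" for x
  have s1: "smooth (\<lambda>x. \<phi> (proj x))" using smooth_compose_affine[OF linear_proj K(1), of 0] by simp
  have s2: "smooth (\<lambda>x. \<kappa> (x $ 3))"
    unfolding \<kappa>_def by (intro smooth_cmult smooth_flat_exp_compose smooth_diff smooth_const smooth_mult smooth_component)
  have sf: "smooth f" unfolding f_def[abs_def] by (rule smooth_mult[OF s1 s2])
  define \<psi> where "\<psi> x = (vector [0, 0, f x] :: real^3)" for x
  have \<psi>c: "(\<lambda>x. \<psi> x $ 1) = (\<lambda>x. 0)" "(\<lambda>x. \<psi> x $ 2) = (\<lambda>x. 0)" "(\<lambda>x. \<psi> x $ 3) = f"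
    by (simp_all add: \<psi>_def fun_eq_iff)
  have s\<psi>: "smooth (\<lambda>x. \<psi> x $ i)" for i
    using exhaust_3[of i] sf by (auto simp: \<psi>c)
  \<comment> \<open>A frontier point where \<open>f\<close> is nonzero projects into
    \<open>K\<close>, lies less than \<delta> from the plane and not above it. Strictly below it
    would be inside the domain, so it is a plate point.\<close>
  have f0: "f x = 0" if x: "x \<in> frontier \<O>" "x \<notin> lift ` \<Omega>" for x
  proof (rule ccontr)
    assume "f x \<noteq> 0"
    then have pK: "proj x \<in> K" and "\<not> \<delta> \<le> \<bar>x $ 3\<bar>" using K(4) \<kappa>0(1)[of "x $ 3"] by (auto simp: f_def)
    then have \<kappa>x: "\<bar>x $ 3\<bar> < \<delta>" by simp
    have "\<O> \<subseteq> {x. x $ 3 \<le> 0}" using geometry_below[OF g] by (auto intro: less_imp_le)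
    then have "closure \<O> \<subseteq> {x. x $ 3 \<le> 0}"
      by (rule closure_minimal) (intro closed_Collect_le continuous_intros)
    then have le: "x $ 3 \<le> 0" using x(1) by (auto simp: frontier_def)
    have "x \<notin> \<O>" using x(1) O(1) by (simp add: frontier_def interior_open)
    then have "x $ 3 = 0" using \<delta>(2)[OF pK] le \<kappa>x by force
    then have "x = lift (proj x)" by (simp add: vec_eq_iff forall_3)
    then show False using x(2) pK K(3) by blast
  qed
  have tr: "has_trace \<O> (\<lambda>x. \<psi> x $ i) (\<lambda>x. \<psi> x $ i)" for i
    by (rule convex_body.smooth_has_trace[OF cb s\<psi>])
  have "\<psi> \<in> V_Omega \<O> S \<Omega> \<phi>"
    unfolding V_Omega_def vec_sobolev_def normal_trace_on_def
  proof (intro CollectI conjI allI exI[of _ \<psi>] AE_I2 impI)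
    show "(\<lambda>x. \<psi> x $ i) \<in> sobolev 1 \<O>" for i by (rule smooth_sobolev[OF s\<psi> O(1,3)])
    show "has_trace \<O> (\<lambda>x. \<psi> x $ i) (\<lambda>x. \<psi> x $ i)" "has_trace \<O> (\<lambda>x. \<psi> x $ i) (\<lambda>x. \<psi> x $ i)" for i by (rule tr)+
  next
    fix x assume "x \<in> space (surface \<O>)" "x \<in> S"
    then have "f x = 0" using dis by (intro f0) (auto simp: convex_body.space_surface[OF cb])
    then show "\<psi> x \<bullet> outward_normal \<O> x = 0" by (simp add: \<psi>_def inner_vec_def sum_3)
  next
    fix x assume x: "x \<in> lift ` \<Omega>"
    then have "x $ 3 = 0" by auto
    then show "\<psi> x \<bullet> outward_normal \<O> x = \<phi> (proj x)"
      using nrm[OF x] \<kappa>1 by (simp add: \<psi>_def inner_vec_def sum_3 f_def)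
  qed
  moreover have "(\<integral>x. wdiv \<O> \<psi> x \<partial>lebesgue_on \<O>) = (\<integral>y. \<phi> y \<partial>lebesgue_on \<Omega>)"
  proof -
    have p3: "partial 3 f x = \<phi> (proj x) * \<kappa>' (x $ 3)" for x
    proof -
      have "partial 3 (\<lambda>x. \<phi> (proj x)) x = 0"
        using partial_compose_affine(1)[OF smooth_differentiable[OF K(1)] linear_proj, of 3 0]
        by (simp add: sum_2 axis_def)
      moreover have "partial 3 (\<lambda>x. \<kappa> (x $ 3)) x = \<kappa>' (x $ 3) * partial 3 (\<lambda>x. x $ 3) x"
        by (rule partial_compose_real(1)[OF smooth_differentiable[OF smooth_component] d\<kappa>])
      ultimately show ?thesis
        unfolding f_def using partial_mult[OF smooth_differentiable[OF s1] smooth_differentiable[OF s2], of 3 x]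
        by (simp add: partial_component)
    qed
    have "AE x in lebesgue_on \<O>. wdiv \<O> \<psi> x = partial 3 f x"
      using wdiv_smooth[OF O(1), of \<psi>, OF s\<psi>] by eventually_elim (simp add: sum_3 \<psi>c)
    then have "(\<integral>x. wdiv \<O> \<psi> x \<partial>lebesgue_on \<O>) = (\<integral>x. partial 3 f x \<partial>lebesgue_on \<O>)"
      by (intro integral_cong_AE L2_measurable wdiv_L2 smooth_measurable_on smooth_partial sf smooth_sobolev[OF s\<psi>] O)
    also have "\<dots> = (\<integral>x. indicator \<O> x * partial 3 f x \<partial>lborel)"
      by (rule integral_lebesgue_on_borel[OF smooth_borel_measurable[OF smooth_partial[OF sf]] Os])
    also have "\<dots> = (\<integral>x. \<phi> (proj x) * (\<kappa>' (x $ 3) * indicator {- \<delta>..0} (x $ 3)) \<partial>lborel)"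
    proof (rule Bochner_Integration.integral_cong[OF refl])
      fix x :: "real^3"
      \<comment> \<open>The prism property replaces the domain by a product region: below
        \<open>K\<close> the strip of depth \<delta> lies inside, and elsewhere in the domain the
        integrand vanishes. The two end heights are harmless since \<kappa>' is 0 there.\<close>
      show "indicator \<O> x * partial 3 f x = \<phi> (proj x) * (\<kappa>' (x $ 3) * indicator {- \<delta>..0} (x $ 3))"
      proof (cases "x \<in> \<O>")
        case True
        then have "x $ 3 < 0" by (rule geometry_below[OF g])
        then show ?thesis using True \<kappa>0(2)[of "x $ 3"] by (auto simp: p3 indicator_def not_le)
      next
        case False
        have "\<phi> (proj x) = 0 \<or> \<kappa>' (x $ 3) * indicator {- \<delta>..0} (x $ 3) = (0::real)"
        proof (cases "proj x \<in> K")
          case True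
          then have "x $ 3 \<le> - \<delta> \<or> 0 \<le> x $ 3" using \<delta>(2)[OF True] False by force
          then show ?thesis using \<kappa>0(2)[of "x $ 3"] \<kappa>1(2) by (cases "x $ 3 = 0") (auto simp: indicator_def)
        qed (simp add: K(4))
        then show ?thesis using False by auto
      qed
    qed
    also have "\<dots> = (\<integral>y. \<phi> y \<partial>lborel) * (\<integral>s. \<kappa>' s * indicator {- \<delta>..0} s \<partial>lborel)"
    proof (rule integral_real3_product)
      show "integrable lborel \<phi>" by (rule test_function_integrable[OF \<phi>])
      from borel_integrable_compact[of "{- \<delta>..0}" \<kappa>', OF _ continuous_on_subset[OF c\<kappa> subset_UNIV]]
      show "integrable lborel (\<lambda>s. \<kappa>' s * indicator {- \<delta>..0} s)" by (simp add: mult.commute)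
    qed
    \<comment> \<open>\<kappa> rises from 0 at the bottom of the prism to 1 at the plate, so the
      vertical integral is 1 and only the integral of \<phi> survives.\<close>
    also have "(\<integral>s. \<kappa>' s * indicator {- \<delta>..0} s \<partial>lborel) = \<kappa> 0 - \<kappa> (- \<delta>)"
    proof (rule integral_FTC_Icc_real)
      show "isCont \<kappa>' s" for s using c\<kappa> by (simp add: continuous_on_eq_continuous_at)
    qed (use \<delta>(1) d\<kappa> in auto)
    also have "\<kappa> 0 - \<kappa> (- \<delta>) = 1" using \<kappa>1(1) \<kappa>0(1)[of "- \<delta>"] \<delta>(1) by simp
    also have "(\<integral>y. \<phi> y \<partial>lborel) * 1 = (\<integral>y. \<phi> y \<partial>lebesgue_on \<Omega>)"
      using integral_mult_test[OF \<Omega>s \<phi>, of "\<lambda>_. 1"] smooth_borel_measurable[OF K(1)]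
      by (simp add: integral_completion)
    finally show ?thesis .
  qed
  ultimately show ?thesis by (rule that)
qed

lemma wderiv_AE_zero:
  assumes D: "open D" and f: "f \<in> sobolev m D" "length \<alpha> \<le> m" and z: "AE x in lebesgue_on D. f x = 0"
  shows "AE x in lebesgue_on D. wderiv D \<alpha> f x = 0"
proof -
  have "is_wderiv D \<alpha> (\<lambda>x. 0) (partials (rev \<alpha>) (\<lambda>x. 0))"
    by (rule smooth_is_wderiv) (use D in \<open>simp_all add: borel_open\<close>)
  moreover have "partials \<beta> (\<lambda>x. 0 :: real) = (\<lambda>x. 0)" for \<beta> :: "'a list"
    by (induction \<beta>) (simp_all add: partials_Cons)
  ultimately have "is_wderiv D \<alpha> (\<lambda>x. 0) (\<lambda>x. 0)" by simp
  from is_wderiv_unique[OF D sobolev_wderiv(1)[OF f D] this z] show ?thesis .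
qed

lemma test_field_in_V_Omega:
  assumes O: "open \<O>" "convex \<O>" "bounded \<O>" "\<O> \<noteq> {}" and sub: "S \<subseteq> frontier \<O>"
    and \<phi>: "\<phi> \<in> test_functions \<O>"
  shows "(\<lambda>x. \<phi> x *\<^sub>R axis i 1) \<in> V_Omega \<O> S \<Omega> (\<lambda>_. 0)"
proof -
  obtain a r R where cb: "convex_body \<O> a r R" using convex_body_exists[OF O] .
  let ?\<psi> = "\<lambda>x. \<phi> x *\<^sub>R axis i 1 :: real^3"
  have s: "smooth (\<lambda>x. ?\<psi> x $ l)" for l
    using test_functions_smooth[OF \<phi>] by (simp add: axis_def)
  have 0: "?\<psi> x \<bullet> outward_normal \<O> x = 0" if "x \<in> space (surface \<O>)" for x
    using that test_functions_frontier[OF O(1) \<phi>] by (simp add: convex_body.space_surface[OF cb])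
  show ?thesis
    unfolding V_Omega_def vec_sobolev_def normal_trace_on_def
    by (intro CollectI conjI allI exI[of _ ?\<psi>] AE_I2 impI smooth_sobolev[OF s O(1,3)]
        convex_body.smooth_has_trace[OF cb s] 0)
qed

section \<open>Rigidity of weak stationary solutions\<close>

theorem lemma6p2:
  fixes \<O> S :: "(real^3) set" and \<Omega> :: "(real^2) set" and \<nu> lam \<eta> :: real
    and U u :: "real^3 \<Rightarrow> real^3" and p :: "real^3 \<Rightarrow> real" and w :: "real^2 \<Rightarrow> real"
  assumes "fluid_structure_geometry \<O> S \<Omega>"
    and "\<nu> > 0" and "lam \<ge> 0" and "\<eta> > 0"
    and "U \<in> V0 \<O> \<inter> vec_sobolev 3 \<O>"
    and "AE x in lebesgue_on \<O>. wdiv \<O> U x = 0"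
    and "weak_stationary_solution \<O> S \<Omega> \<nu> lam \<eta> U p u w"
  shows "\<exists>c. (AE x in lebesgue_on \<O>. p x = c) \<and> (AE x in lebesgue_on \<O>. u x = 0) \<and>
           w \<in> sobolev0 2 \<Omega> \<and> clamped_plate_solution \<Omega> c w"
proof -
  have O: "open \<O>" "convex \<O>" "bounded \<O>" "\<O> \<noteq> {}" and \<Omega>: "open \<Omega>"
    and fr: "frontier \<O> = closure S \<union> closure (lift ` \<Omega>)"
    using assms(1) by (auto simp: fluid_structure_geometry_def)
  have Os: "\<O> \<in> sets lebesgue" using O by (simp add: borel_open)
  have \<Omega>b: "bounded \<Omega>" by (rule geometry_bounded_plate[OF assms(1)])
  have sub: "S \<subseteq> frontier \<O>" "lift ` \<Omega> \<subseteq> frontier \<O>"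
    using closure_subset[of S] closure_subset[of "lift ` \<Omega>"] by (auto simp: fr)
  obtain a r R where cb: "convex_body \<O> a r R" using convex_body_exists[OF O] .
  have UV: "U \<in> V0 \<O>" using assms(5) by simp
  note sol = assms(7)[unfolded weak_stationary_solution_def]
  have p: "p \<in> L2 (lebesgue_on \<O>)" and uV: "u \<in> V0 \<O>" and w0: "w \<in> sobolev0 2 \<Omega>"
    and mass: "\<forall>q\<in>W_space \<O> U. L2_inner \<O> (wdiv \<O> u) q =
        (\<integral>x. wdiv \<O> U x * p x * q x \<partial>lebesgue_on \<O>) + (\<integral>x. transport \<O> U q x * p x \<partial>lebesgue_on \<O>)"
    and momentum: "\<And>\<beta> \<psi>. \<beta> \<in> sobolev0 2 \<Omega> \<Longrightarrow> \<psi> \<in> V_Omega \<O> S \<Omega> \<beta> \<Longrightarrow>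
        bilinear_a \<nu> lam \<eta> \<O> u \<psi> - L2_inner \<O> p (wdiv \<O> \<psi>) =
        - L2_inner \<O> (convection \<O> U u) \<psi> - L2_inner \<Omega> (wlaplacian \<Omega> w) (wlaplacian \<Omega> \<beta>)"
    using sol by blast+
  have w2: "w \<in> sobolev 2 \<Omega>" using w0 by (simp add: sobolev0_def)
  have pi: "integrable (lebesgue_on \<O>) p" by (rule L2_integrable[OF finite_measure_lebesgue_on[OF O(1,3)] p])
  have Ui: "(\<lambda>x. U x $ i) \<in> sobolev 1 \<O>" and ui: "(\<lambda>x. u x $ i) \<in> sobolev 1 \<O>" for i
    using UV uV by (simp_all add: V0_def vec_sobolev_def)
  obtain t where t: "\<And>i. has_trace \<O> (\<lambda>x. U x $ i) (\<lambda>x. t x $ i)"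
    and tn: "AE x in surface \<O>. x \<in> frontier \<O> \<longrightarrow> t x \<bullet> outward_normal \<O> x = 0"
    using UV by (auto simp: V0_def normal_trace_on_def)
  obtain s where s: "\<And>i. has_trace \<O> (\<lambda>x. u x $ i) (\<lambda>x. s x $ i)"
    and sn: "AE x in surface \<O>. x \<in> frontier \<O> \<longrightarrow> s x \<bullet> outward_normal \<O> x = 0"
    using uV by (auto simp: V0_def normal_trace_on_def)
  have "AE x in surface \<O>. x \<in> frontier \<O>"
    by (rule AE_I2) (simp add: convex_body.space_surface[OF cb])
  with tn have tn': "AE x in surface \<O>. t x \<bullet> outward_normal \<O> x = 0" by eventually_elim blast
  have zero: "(\<lambda>_. 0) \<in> sobolev0 2 \<Omega>" by (rule test_functions_sobolev0[OF \<Omega> \<Omega>b test_functions_zero])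
  \<comment> \<open>The normal trace of \<open>u\<close> vanishes on the whole frontier, hence on
    \<open>S\<close> and on the plate, so \<open>u\<close> is an admissible test field with
    displacement 0.\<close>
  have uVO: "u \<in> V_Omega \<O> S \<Omega> (\<lambda>_. 0)"
    unfolding V_Omega_def vec_sobolev_def normal_trace_on_def
  proof (intro CollectI conjI allI exI[of _ s] ui s)
    show "AE x in surface \<O>. x \<in> S \<longrightarrow> s x \<bullet> outward_normal \<O> x = 0"
      "AE x in surface \<O>. x \<in> lift ` \<Omega> \<longrightarrow> s x \<bullet> outward_normal \<O> x = 0"
      using sn by (eventually_elim, use sub in blast)+
  qed
  \<comment> \<open>\<open>wlaplacian\<close> of the zero function is built from chosen
    representatives, so it is known to vanish only almost everywhere.\<close>
  have plate0: "L2_inner \<Omega> f (wlaplacian \<Omega> (\<lambda>_. 0)) = 0" for f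
  proof -
    have z: "(\<lambda>_. 0) \<in> sobolev 2 \<Omega>" using zero by (simp add: sobolev0_def)
    have "AE x in lebesgue_on \<Omega>. \<forall>i\<in>UNIV. wderiv \<Omega> [i, i] (\<lambda>_. 0) x = 0"
      using wderiv_AE_zero[OF \<Omega> z] by (intro AE_finite_allI) simp_all
    then have "AE x in lebesgue_on \<Omega>. f x \<bullet> wlaplacian \<Omega> (\<lambda>_. 0) x = 0"
      by eventually_elim (simp add: wlaplacian_def)
    then show ?thesis unfolding L2_inner_def by (rule integral_eq_zero_AE)
  qed
  have "bilinear_a \<nu> lam \<eta> \<O> u u = 0"
    using momentum[OF zero uVO] plate0[of "wlaplacian \<Omega> w"]
      convex_body.convection_orthogonal[OF cb t tn' assms(6) s]
      pressure_divergence_orthogonal[OF O(1,3) Ui ui assms(6) p mass] by simp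
  then have u0: "AE x in lebesgue_on \<O>. u x = 0"
    by (rule bilinear_a_zero_imp[OF assms(2-4) sobolev_L2[OF ui]])
  have "AE x in lebesgue_on \<O>. wderiv \<O> [i] (\<lambda>x. u x $ l) x = 0" for i l
  proof (rule wderiv_AE_zero[OF O(1) ui])
    show "AE x in lebesgue_on \<O>. u x $ l = 0" using u0 by eventually_elim simp
  qed simp
  then have "AE x in lebesgue_on \<O>. \<forall>l\<in>UNIV. \<forall>i\<in>UNIV. wderiv \<O> [i] (\<lambda>x. u x $ l) x = 0"
    by (intro AE_finite_allI) auto
  then have du: "AE x in lebesgue_on \<O>. \<forall>l i. wderiv \<O> [i] (\<lambda>x. u x $ l) x = 0" by simp
  have pressure: "L2_inner \<O> p (wdiv \<O> \<psi>) = L2_inner \<Omega> (wlaplacian \<Omega> w) (wlaplacian \<Omega> \<beta>)"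
    if "\<beta> \<in> sobolev0 2 \<Omega>" "\<psi> \<in> V_Omega \<O> S \<Omega> \<beta>" for \<beta> \<psi>
  proof -
    have "L2_inner \<O> (stress \<nu> lam \<O> u) (strain \<O> \<psi>) = 0" unfolding L2_inner_def
    proof (rule integral_eq_zero_AE)
      show "AE x in lebesgue_on \<O>. stress \<nu> lam \<O> u x \<bullet> strain \<O> \<psi> x = 0"
        using du
      proof eventually_elim
        case (elim x)
        then have "strain \<O> u x = 0" "wdiv \<O> u x = 0"
          by (simp_all add: strain_def wdiv_def vec_eq_iff)
        then show ?case by (simp add: stress_def)
      qed
    qed
    moreover have "L2_inner \<O> u \<psi> = 0" unfolding L2_inner_def
      by (rule integral_eq_zero_AE) (use u0 in \<open>eventually_elim, simp\<close>)
    moreover have "L2_inner \<O> (convection \<O> U u) \<psi> = 0" unfolding L2_inner_def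
    proof (rule integral_eq_zero_AE)
      show "AE x in lebesgue_on \<O>. convection \<O> U u x \<bullet> \<psi> x = 0"
        using du by eventually_elim (simp add: convection_def inner_vec_def)
    qed
    ultimately show ?thesis using momentum[OF that] by (simp add: bilinear_a_def)
  qed
  have "\<exists>c. AE x in lebesgue_on \<O>. p x = c"
  proof (rule weak_gradient_zero_imp_constant[OF O(1,2,4) pi L2_locally_integrable[OF p Os]])
    fix i and \<phi> :: "real^3 \<Rightarrow> real" assume \<phi>: "\<phi> \<in> test_functions \<O>"
    let ?\<psi> = "\<lambda>x. \<phi> x *\<^sub>R axis i 1 :: real^3"
    have c: "(\<lambda>x. ?\<psi> x $ l) = (if l = i then \<phi> else (\<lambda>x. 0))" for l by (auto simp: axis_def)
    have s: "smooth (\<lambda>x. ?\<psi> x $ l)" for l unfolding c using test_functions_smooth[OF \<phi>] by simp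
    have ae: "AE x in lebesgue_on \<O>. wdiv \<O> ?\<psi> x = partial i \<phi> x"
      using wdiv_smooth[OF O(1), of ?\<psi>, OF s]
      by eventually_elim (simp only: c if_distrib[of "\<lambda>f. partial _ f _"] partial_const, simp)
    have "0 = (\<integral>x. p x * wdiv \<O> ?\<psi> x \<partial>lebesgue_on \<O>)"
      using pressure[OF zero test_field_in_V_Omega[OF O sub(1) \<phi>]] plate0[of "wlaplacian \<Omega> w"]
      by (simp add: L2_inner_def)
    also have "\<dots> = (\<integral>x. p x * partial i \<phi> x \<partial>lebesgue_on \<O>)"
    proof (rule integral_cong_AE)
      show "AE x in lebesgue_on \<O>. p x * wdiv \<O> ?\<psi> x = p x * partial i \<phi> x" using ae by eventually_elim simp
    qed (intro borel_measurable_times L2_measurable[OF p] L2_measurable[OF wdiv_L2] smooth_sobolev[OF s O(1,3)] O(1)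
        smooth_measurable_on smooth_partial test_functions_smooth[OF \<phi>])+
    finally show "(\<integral>x. p x * partial i \<phi> x \<partial>lebesgue_on \<O>) = 0" by simp
  qed
  then obtain c where c: "AE x in lebesgue_on \<O>. p x = c" by blast
  have "(\<integral>x. w x * laplacian (laplacian \<phi>) x \<partial>lebesgue_on \<Omega>) = (\<integral>x. c * \<phi> x \<partial>lebesgue_on \<Omega>)"
    if \<phi>: "\<phi> \<in> test_functions \<Omega>" for \<phi>
  proof -
    obtain \<psi> where \<psi>: "\<psi> \<in> V_Omega \<O> S \<Omega> \<phi>"
      and div: "(\<integral>x. wdiv \<O> \<psi> x \<partial>lebesgue_on \<O>) = (\<integral>y. \<phi> y \<partial>lebesgue_on \<Omega>)"
      by (rule plate_extension[OF assms(1) \<phi>]) (rule that)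
    have d: "wdiv \<O> \<psi> \<in> L2 (lebesgue_on \<O>)"
      using \<psi> by (intro wdiv_L2 O) (simp add: V_Omega_def vec_sobolev_def)
    have "(\<integral>x. w x * laplacian (laplacian \<phi>) x \<partial>lebesgue_on \<Omega>) = L2_inner \<O> p (wdiv \<O> \<psi>)"
      using bilaplacian_weak[OF \<Omega> w2 \<phi>] pressure[OF test_functions_sobolev0[OF \<Omega> \<Omega>b \<phi>] \<psi>] by simp
    \<comment> \<open>With \<open>p\<close> constant, only the total divergence of the extension
      matters, and that equals the integral of \<phi> over the plate whatever the shape of the
      domain further down.\<close>
    also have "\<dots> = (\<integral>x. c * wdiv \<O> \<psi> x \<partial>lebesgue_on \<O>)"
      using integral_mult_cong_AE[OF c L2_measurable[OF p] borel_measurable_const L2_measurable[OF d]]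
      by (simp add: L2_inner_def)
    finally show ?thesis using div by simp
  qed
  then have "clamped_plate_solution \<Omega> c w"
    unfolding clamped_plate_solution_def using sobolev0_traces[OF \<Omega> w0] by blast
  then show ?thesis using c u0 w0 by blast
qed

end
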